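(* Let $u$ be the solution of $-\operatorname{div}(A\nabla u)+cu=f$ in $\Omega$, $u=0$ on $\partial\Omega$, with $u\in H^3(\Omega)$, and let $u_h\in U_h$ satisfy $a_h(u_h,\Pi_h^*v_h)=(f,\Pi_h^*v_h)$ for all $v_h\in U_h$, where $T_h$ is a regular rectangular partition. Then, for $h$ sufficiently small, $$\|\Pi_hu-u_h\|_1\le Ch^2\|u\|_3,$$ with $C$ independent of $h$ and $u$.
   Context: $\Omega\subset\mathbb{R}^2$ is an open rectangle. $A=(a_{ij})_{2\times2}\in[W^{1,\infty}(\Omega)]^{2\times2}$ satisfies $C_1\xi^T\xi\le\xi^TA\xi\le C_2\xi^T\xi$ for all $\xi\in\mathbb{R}^2$ on $\Omega$, with constants $C_1,C_2>0$; $c\in L^\infty(\Omega)$, $c\ge0$. $T_h$ is a conforming partition of $\overline\Omega$ into closed rectangles with sides parallel to the axes; $h_K$ is the diameter of $K$, $h=\max_Kh_K$, $\rho_K$ the diameter of the largest ball in $K$; regular means $h_K/\rho_K\le\gamma$ for all $K$ with fixed $\gamma$. $N_h$ is the set of nodes. The dual partition $T_h^*$ is obtained by connecting the center of each element to the midpoints of its edges; the control volume $K_P^*$ of a node $P$ is the union of the resulting sub-rectangles having $P$ as a vertex. $U_h=\{v\in C^0(\overline\Omega): v|_K\in Q_1(K)\ \forall K,\ v|_{\partial\Omega}=0\}$ ($Q_1$ = bilinear polynomials). $\Pi_h^*v=\sum_{P\in N_h}v(P)\chi_P$, $\chi_P$ the characteristic function of $K_P^*$. $\Pi_hu$ is the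 piecewise bilinear nodal interpolant of $u$. For $w\in H^1(\Omega)$ (with traces of $A\nabla w$ defined) and $z$ piecewise constant on $T_h^*$ vanishing on control volumes of boundary nodes, $a_h(w,z)=\sum_{K_P^*\in T_h^*}\big(-\int_{\partial K_P^*}n\cdot(A\nabla w)z\,ds+\int_{K_P^*}cwz\big)$, $n$ the outward unit normal; $(f,z)=\int_\Omega fz$. $\|\cdot\|_m$ is the $H^m(\Omega)$ norm. *)

theory Defs
  imports "HOL-Analysis.Analysis"
begin

definition pdir :: "bool \<Rightarrow> (real \<times> real \<Rightarrow> real) \<Rightarrow> real \<times> real \<Rightarrow> real" where
  "pdir d g p = (if d then deriv (\<lambda>t. g (t, snd p)) (fst p)
                      else deriv (\<lambda>t. g (fst p, t)) (snd p))"

definition pdir_exists :: "bool \<Rightarrow> (real \<times> real \<Rightarrow> real) \<Rightarrow> real \<times> real \<Rightarrow> bool" where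
  "pdir_exists d g p = (if d then (\<lambda>t. g (t, snd p)) differentiable (at (fst p))
                             else (\<lambda>t. g (fst p, t)) differentiable (at (snd p)))"

fun iter_pd :: "bool list \<Rightarrow> (real \<times> real \<Rightarrow> real) \<Rightarrow> real \<times> real \<Rightarrow> real" where
  "iter_pd [] g = g"
| "iter_pd (d # ds) g = pdir d (iter_pd ds g)"

definition smooth2 :: "(real \<times> real \<Rightarrow> real) \<Rightarrow> bool" where
  "smooth2 g = (\<forall>ds. continuous_on UNIV (iter_pd ds g) \<and>
                     (\<forall>d p. pdir_exists d (iter_pd ds g) p))"

definition Dcl :: "nat \<times> nat \<Rightarrow> (real \<times> real \<Rightarrow> real) \<Rightarrow> real \<times> real \<Rightarrow> real" where
  "Dcl \<alpha> g = iter_pd (replicate (fst \<alpha>) True @ replicate (snd \<alpha>) False) g"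

definition test_fun :: "(real \<times> real) set \<Rightarrow> (real \<times> real \<Rightarrow> real) \<Rightarrow> bool" where
  "test_fun \<Omega> \<phi> = (smooth2 \<phi> \<and> compact (closure {x. \<phi> x \<noteq> 0}) \<and> closure {x. \<phi> x \<noteq> 0} \<subseteq> \<Omega>)"

definition loc_integrable :: "(real \<times> real) set \<Rightarrow> (real \<times> real \<Rightarrow> real) \<Rightarrow> bool" where
  "loc_integrable \<Omega> f = (\<forall>K. compact K \<and> K \<subseteq> \<Omega> \<longrightarrow> set_integrable lborel K f)"

definition L2 :: "(real \<times> real) set \<Rightarrow> (real \<times> real \<Rightarrow> real) \<Rightarrow> bool" where
  "L2 \<Omega> f = (set_borel_measurable lborel \<Omega> f \<and> set_integrable lborel \<Omega> (\<lambda>x. (f x)\<^sup>2))"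

definition Linf :: "(real \<times> real) set \<Rightarrow> (real \<times> real \<Rightarrow> real) \<Rightarrow> bool" where
  "Linf \<Omega> f = (set_borel_measurable lborel \<Omega> f \<and> (\<exists>M. AE x in lborel. x \<in> \<Omega> \<longrightarrow> \<bar>f x\<bar> \<le> M))"

definition weak_deriv :: "(real \<times> real) set \<Rightarrow> nat \<times> nat \<Rightarrow> (real \<times> real \<Rightarrow> real) \<Rightarrow> (real \<times> real \<Rightarrow> real) \<Rightarrow> bool" where
  "weak_deriv \<Omega> \<alpha> f g = (loc_integrable \<Omega> f \<and> loc_integrable \<Omega> g \<and>
     (\<forall>\<phi>. test_fun \<Omega> \<phi> \<longrightarrow>
        (LINT x:\<Omega>|lborel. f x * Dcl \<alpha> \<phi> x) = (-1) ^ (fst \<alpha> + snd \<alpha>) * (LINT x:\<Omega>|lborel. g x * \<phi> x)))"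

definition H :: "nat \<Rightarrow> (real \<times> real) set \<Rightarrow> (real \<times> real \<Rightarrow> real) \<Rightarrow> bool" where
  "H m \<Omega> f = (\<forall>i j. i + j \<le> m \<longrightarrow> (\<exists>g. weak_deriv \<Omega> (i, j) f g \<and> L2 \<Omega> g))"

definition W1inf :: "(real \<times> real) set \<Rightarrow> (real \<times> real \<Rightarrow> real) \<Rightarrow> bool" where
  "W1inf \<Omega> f = (\<forall>i j. i + j \<le> 1 \<longrightarrow> (\<exists>g. weak_deriv \<Omega> (i, j) f g \<and> Linf \<Omega> g))"

(* a choice of the weak derivative D^\<alpha> f (unique a.e.) *)
definition wd :: "(real \<times> real) set \<Rightarrow> nat \<times> nat \<Rightarrow> (real \<times> real \<Rightarrow> real) \<Rightarrow> real \<times> real \<Rightarrow> real" where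
  "wd \<Omega> \<alpha> f = (SOME g. weak_deriv \<Omega> \<alpha> f g \<and> L2 \<Omega> g)"

definition Hnorm :: "nat \<Rightarrow> (real \<times> real) set \<Rightarrow> (real \<times> real \<Rightarrow> real) \<Rightarrow> real" where
  "Hnorm m \<Omega> f = sqrt (\<Sum>i\<le>m. \<Sum>j\<le>m - i. LINT x:\<Omega>|lborel. (wd \<Omega> (i, j) f x)\<^sup>2)"

(* A conforming partition of the closed rectangle [a1,b1]x[a2,b2] into closed axis-parallel
   rectangles is a tensor-product grid  xs 0 < ... < xs nx,  ys 0 < ... < ys ny. *)
definition valid_mesh :: "real \<Rightarrow> real \<Rightarrow> real \<Rightarrow> real \<Rightarrow> (nat \<Rightarrow> real) \<Rightarrow> nat \<Rightarrow> (nat \<Rightarrow> real) \<Rightarrow> nat \<Rightarrow> bool" where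
  "valid_mesh a1 b1 a2 b2 xs nx ys ny =
     (1 \<le> nx \<and> 1 \<le> ny \<and> xs 0 = a1 \<and> xs nx = b1 \<and> ys 0 = a2 \<and> ys ny = b2 \<and>
      (\<forall>i<nx. xs i < xs (Suc i)) \<and> (\<forall>j<ny. ys j < ys (Suc j)))"

definition elem :: "(nat \<Rightarrow> real) \<Rightarrow> (nat \<Rightarrow> real) \<Rightarrow> nat \<Rightarrow> nat \<Rightarrow> (real \<times> real) set" where
  "elem xs ys i j = {xs i .. xs (Suc i)} \<times> {ys j .. ys (Suc j)}"

definition hK :: "(nat \<Rightarrow> real) \<Rightarrow> (nat \<Rightarrow> real) \<Rightarrow> nat \<Rightarrow> nat \<Rightarrow> real" where
  "hK xs ys i j = sqrt ((xs (Suc i) - xs i)\<^sup>2 + (ys (Suc j) - ys j)\<^sup>2)"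

(* \<rho>_K: diameter of the largest ball contained in K *)
definition rhoK :: "(nat \<Rightarrow> real) \<Rightarrow> (nat \<Rightarrow> real) \<Rightarrow> nat \<Rightarrow> nat \<Rightarrow> real" where
  "rhoK xs ys i j = min (xs (Suc i) - xs i) (ys (Suc j) - ys j)"

definition mesh_size :: "(nat \<Rightarrow> real) \<Rightarrow> nat \<Rightarrow> (nat \<Rightarrow> real) \<Rightarrow> nat \<Rightarrow> real" where
  "mesh_size xs nx ys ny = Max {hK xs ys i j | i j. i < nx \<and> j < ny}"

definition regular_mesh :: "real \<Rightarrow> (nat \<Rightarrow> real) \<Rightarrow> nat \<Rightarrow> (nat \<Rightarrow> real) \<Rightarrow> nat \<Rightarrow> bool" where
  "regular_mesh \<gamma> xs nx ys ny = (\<forall>i<nx. \<forall>j<ny. hK xs ys i j / rhoK xs ys i j \<le> \<gamma>)"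

definition node_idx :: "nat \<Rightarrow> nat \<Rightarrow> (nat \<times> nat) set" where
  "node_idx nx ny = {..nx} \<times> {..ny}"

definition node :: "(nat \<Rightarrow> real) \<Rightarrow> (nat \<Rightarrow> real) \<Rightarrow> nat \<times> nat \<Rightarrow> real \<times> real" where
  "node xs ys P = (xs (fst P), ys (snd P))"

(* K_P^* for P = (xs i, ys j): union of the sub-rectangles (center of element, midpoints of
   edges, P) having P as a vertex; this is the rectangle [lo i, hi i] x [lo j, hi j] *)
definition lo :: "(nat \<Rightarrow> real) \<Rightarrow> nat \<Rightarrow> real" where
  "lo xs i = (if i = 0 then xs 0 else (xs (i - 1) + xs i) / 2)"

definition hi :: "(nat \<Rightarrow> real) \<Rightarrow> nat \<Rightarrow> nat \<Rightarrow> real" where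
  "hi xs n i = (if i = n then xs n else (xs i + xs (Suc i)) / 2)"

definition ctrl_vol :: "(nat \<Rightarrow> real) \<Rightarrow> nat \<Rightarrow> (nat \<Rightarrow> real) \<Rightarrow> nat \<Rightarrow> nat \<times> nat \<Rightarrow> (real \<times> real) set" where
  "ctrl_vol xs nx ys ny P = {lo xs (fst P) .. hi xs nx (fst P)} \<times> {lo ys (snd P) .. hi ys ny (snd P)}"

definition Pistar :: "(nat \<Rightarrow> real) \<Rightarrow> nat \<Rightarrow> (nat \<Rightarrow> real) \<Rightarrow> nat \<Rightarrow> (real \<times> real \<Rightarrow> real) \<Rightarrow> real \<times> real \<Rightarrow> real" where
  "Pistar xs nx ys ny v x = (\<Sum>P\<in>node_idx nx ny. v (node xs ys P) * indicator (ctrl_vol xs nx ys ny P) x)"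

definition Q1_on :: "(real \<times> real) set \<Rightarrow> (real \<times> real \<Rightarrow> real) \<Rightarrow> bool" where
  "Q1_on K v = (\<exists>c0 c1 c2 c3. \<forall>p\<in>K. v p = c0 + c1 * fst p + c2 * snd p + c3 * fst p * snd p)"

definition Uh :: "real \<Rightarrow> real \<Rightarrow> real \<Rightarrow> real \<Rightarrow> (nat \<Rightarrow> real) \<Rightarrow> nat \<Rightarrow> (nat \<Rightarrow> real) \<Rightarrow> nat \<Rightarrow> (real \<times> real \<Rightarrow> real) set" where
  "Uh a1 b1 a2 b2 xs nx ys ny =
     {v. continuous_on (cbox (a1, a2) (b1, b2)) v \<and>
         (\<forall>i<nx. \<forall>j<ny. Q1_on (elem xs ys i j) v) \<and>
         (\<forall>p\<in>frontier (box (a1, a2) (b1, b2)). v p = 0)}"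

definition hat :: "(nat \<Rightarrow> real) \<Rightarrow> nat \<Rightarrow> nat \<Rightarrow> real \<Rightarrow> real" where
  "hat xs n i t =
     (if 0 < i \<and> xs (i - 1) \<le> t \<and> t \<le> xs i then (t - xs (i - 1)) / (xs i - xs (i - 1))
      else if i < n \<and> xs i \<le> t \<and> t \<le> xs (Suc i) then (xs (Suc i) - t) / (xs (Suc i) - xs i)
      else 0)"

definition Pih :: "(nat \<Rightarrow> real) \<Rightarrow> nat \<Rightarrow> (nat \<Rightarrow> real) \<Rightarrow> nat \<Rightarrow> (real \<times> real \<Rightarrow> real) \<Rightarrow> real \<times> real \<Rightarrow> real" where
  "Pih xs nx ys ny u p =
     (\<Sum>P\<in>node_idx nx ny. u (node xs ys P) * hat xs nx (fst P) (fst p) * hat ys ny (snd P) (snd p))"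

definition grad :: "(real \<times> real \<Rightarrow> real) \<Rightarrow> real \<times> real \<Rightarrow> real^2" where
  "grad w p = vector [pdir True w p, pdir False w p]"

(* - \<integral>_{\<partial>R} n \<cdot> (A \<nabla> w) ds  for the rectangle R = [l1,r1] x [l2,r2] *)
definition neg_flux :: "(real \<times> real \<Rightarrow> real^2^2) \<Rightarrow> (real \<times> real \<Rightarrow> real) \<Rightarrow> real \<Rightarrow> real \<Rightarrow> real \<Rightarrow> real \<Rightarrow> real" where
  "neg_flux A w l1 r1 l2 r2 =
     - ( integral {l2..r2} (\<lambda>y. (A (r1, y) *v grad w (r1, y)) $ 1)
       - integral {l2..r2} (\<lambda>y. (A (l1, y) *v grad w (l1, y)) $ 1)
       + integral {l1..r1} (\<lambda>x. (A (x, r2) *v grad w (x, r2)) $ 2)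
       - integral {l1..r1} (\<lambda>x. (A (x, l2) *v grad w (x, l2)) $ 2))"

(* a_h(w,z) = \<Sum>_P ( - \<integral>_{\<partial>K_P^*} n\<cdot>(A\<nabla>w) z ds + \<integral>_{K_P^*} c w z ),
   z piecewise constant on the dual partition; its (constant) value on K_P^* is z(P). *)
definition ah :: "(real \<times> real \<Rightarrow> real^2^2) \<Rightarrow> (real \<times> real \<Rightarrow> real) \<Rightarrow> (nat \<Rightarrow> real) \<Rightarrow> nat \<Rightarrow> (nat \<Rightarrow> real) \<Rightarrow> nat \<Rightarrow>
                  (real \<times> real \<Rightarrow> real) \<Rightarrow> (real \<times> real \<Rightarrow> real) \<Rightarrow> real" where
  "ah A c xs nx ys ny w z =
     (\<Sum>P\<in>node_idx nx ny.
        neg_flux A w (lo xs (fst P)) (hi xs nx (fst P)) (lo ys (snd P)) (hi ys ny (snd P)) * z (node xs ys P)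
        + (LINT x:ctrl_vol xs nx ys ny P|lborel. c x * w x * z x))"

end

theory Submission
  imports Defs "HOL-Computational_Algebra.Polynomial"
begin

text \<open>For a function of \<open>U\<^sub>h\<close> the form \<open>a\<^sub>h(v, \<Pi>\<^sub>h\<^sup>*v)\<close> is, cell by cell, a perturbation of relative size \<open>h\<close> of a positive
  definite quadratic form in the four nodal differences. For small \<open>h\<close> it therefore dominates the energy, the sum of
  all squared nodal differences, which by a discrete Poincare inequality dominates the \<open>H\<^sup>1\<close> norm.
  By the divergence theorem on control volumes \<open>u\<close> satisfies the scheme exactly, so for \<open>e = \<Pi>\<^sub>hu - u\<^sub>h\<close> the number
  \<open>a\<^sub>h(e, \<Pi>\<^sub>h\<^sup>*e)\<close> is a sum of flux errors of the interpolant over pieces of dual edges. On half a dual edge this error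
  is only of first order, but its leading part has opposite signs on the two halves, and after a summation by parts along
  a row of cells only third derivatives remain.
  All local estimates are first proved in the \<open>L\<^sup>1\<close> norm for smooth functions. They pass to \<open>u\<close> by dilating and
  mollifying it: the masses of the derivatives on cells and on thin strips converge, which also gives a continuous
  gradient of \<open>u\<close> up to the boundary, so that neither traces nor embedding theorems are needed.\<close>

subsection \<open>Smooth functions of one variable\<close>

text \<open>The first-order term cancels because the mesh is a tensor grid: neighbouring cells of a
  row have the same height, so the interpolation defects on their common vertical side coincide and
  differencing leaves only the variation of the defect inside each cell. The same structure makes
  every width comparable with every height, on which the discrete Poincare inequality rests. The
  contraction towards the centre keeps the support of the mollifier inside the domain even for
  boundary points, in place of an extension operator. L1 masses suit this because Tonelli bounds the
  mass of a mollified derivative by an integral that converges; an upper bound is enough, since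
  masses occur only on the larger side of the estimates. Of the two powers of \<open>h\<close> in
  the flux part one comes from the local estimates, the other from the square root of the cell area
  when L1 masses are bounded by L2 norms. Vertical and horizontal dual edges share one argument,
  because meshes, cell functionals and the locale \<open>approx\<close> are stable under exchange of
  the coordinates.\<close>

fun diffn :: "nat => (real => real) => bool" where
  "diffn 0 f = True"
| "diffn (Suc n) f = (\<exists>f'. (\<forall>x. (f has_real_derivative f' x) (at x)) \<and> diffn n f')"

text \<open>\<open>diffn\<close> speaks of derivatives through witnesses, so closure under sums,
  products and affine substitution goes by induction with the function generalised;
  \<open>smooth1_deriv\<close> then returns to \<open>deriv\<close>.\<close>

definition smooth1 :: "(real => real) => bool" where
  "smooth1 f = (\<forall>n. diffn n f)"

lemma diffn_mono: "diffn (Suc n) f ==> diffn n f"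
proof (induction n arbitrary: f)
  case (Suc n)
  then show ?case by (metis diffn.simps(2))
qed simp

lemma diffn_add: "diffn n f ==> diffn n g ==> diffn n (%x. f x + g x)"
proof (induction n arbitrary: f g)
  case (Suc n)
  from Suc.prems obtain f' g' where
    "!!x. (f has_real_derivative f' x) (at x)" "diffn n f'"
    "!!x. (g has_real_derivative g' x) (at x)" "diffn n g'" by auto
  then show ?case using Suc.IH[of f' g']
    by (auto intro!: exI[of _ "%x. f' x + g' x"] DERIV_add)
qed simp

lemma diffn_mult: "diffn n f ==> diffn n g ==> diffn n (%x. f x * g x)"
proof (induction n arbitrary: f g)
  case (Suc n)
  from Suc.prems obtain f' g' where *:
    "!!x. (f has_real_derivative f' x) (at x)" "diffn n f'"
    "!!x. (g has_real_derivative g' x) (at x)" "diffn n g'" by auto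
  have "diffn n (%x. f' x * g x + g' x * f x)"
    using Suc.IH[of f' g] Suc.IH[of g' f] * Suc.prems diffn_mono
    by (intro diffn_add) (auto simp: diffn_mono)
  then show ?case using *
    by (auto intro!: exI[of _ "%x. f' x * g x + g' x * f x"] DERIV_mult)
qed simp

lemma diffn_affine: "diffn n f ==> diffn n (%x. c * f (a * x + b))"
proof (induction n arbitrary: f c)
  case (Suc n)
  from Suc.prems obtain f' where *:
    "!!x. (f has_real_derivative f' x) (at x)" "diffn n f'" by auto
  have "((%x. c * f (a * x + b)) has_real_derivative (c * a) * f' (a * x + b)) (at x)" for x
    by (rule derivative_eq_intros DERIV_chain2[OF *(1)] refl)+ simp
  then show ?case using Suc.IH[OF *(2), of "c * a"]
    by (auto intro!: exI[of _ "%x. c * a * f' (a * x + b)"])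
qed simp

lemma smooth1_has_deriv:
  assumes "smooth1 f" shows "(f has_real_derivative deriv f x) (at x)"
proof -
  have "diffn (Suc 0) f" using assms unfolding smooth1_def by blast
  then show ?thesis using DERIV_imp_deriv by (metis diffn.simps(2))
qed

lemma smooth1_deriv: "smooth1 f ==> smooth1 (deriv f)"
  unfolding smooth1_def
proof
  fix n assume "\<forall>n. diffn n f"
  then have "diffn (Suc n) f" by blast
  then obtain f' where f': "\<forall>x. (f has_real_derivative f' x) (at x)" "diffn n f'" by auto
  moreover have "deriv f = f'" using f' DERIV_imp_deriv by blast
  ultimately show "diffn n (deriv f)" by simp
qed

lemma smooth1_funpow: "smooth1 f ==> smooth1 ((deriv ^^ k) f)"
  by (induction k) (auto intro: smooth1_deriv)

lemma smooth1_funpow_deriv: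
  assumes "smooth1 f" shows "((deriv ^^ k) f has_real_derivative (deriv ^^ Suc k) f x) (at x)"
  using smooth1_has_deriv[OF smooth1_funpow[OF assms]] by simp

lemma smooth1_cont: "smooth1 f ==> continuous_on A f"
  by (meson DERIV_isCont continuous_at_imp_continuous_on smooth1_has_deriv)

lemma smooth1_affine: "smooth1 f ==> smooth1 (%x. c * f (a * x + b))"
  unfolding smooth1_def using diffn_affine by blast

lemma smooth1_diff: "smooth1 f ==> smooth1 g ==> smooth1 (%x. f x - g x)"
  using smooth1_affine[of g "-1" 1 0] diffn_add[of _ f "%x. - g x"] unfolding smooth1_def by simp

lemma funpow_deriv_affine:
  assumes "smooth1 f"
  shows "(deriv ^^ k) (%x. c * f (a * x + b)) = (%x. c * a ^ k * (deriv ^^ k) f (a * x + b))"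
proof (induction k)
  case (Suc k)
  have "((%x. c * a ^ k * (deriv ^^ k) f (a * x + b)) has_real_derivative
      c * a ^ Suc k * (deriv ^^ Suc k) f (a * x + b)) (at x)" for x
    by (rule derivative_eq_intros DERIV_chain2[OF smooth1_funpow_deriv[OF assms]] refl)+ simp
  then have "deriv (%x. c * a ^ k * (deriv ^^ k) f (a * x + b)) = (%x. c * a ^ Suc k * (deriv ^^ Suc k) f (a * x + b))"
    using DERIV_imp_deriv by blast
  then show ?case using Suc by simp
qed simp

section \<open>A smooth bump, its primitive and the mollifier\<close>

definition flat :: "real poly => real => real" where
  "flat P x = (if x > 0 then poly P (1 / x) * exp (- (1 / x)) else 0)"

lemma poly_exp_tendsto_0: "((%t. poly P t * exp (- t)) \<longlongrightarrow> 0) at_top" for P :: "real poly"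
proof -
  have "((%t. \<Sum>i\<le>degree P. coeff P i * (t ^ i / exp t)) \<longlongrightarrow> (\<Sum>i\<le>degree P. coeff P i * 0)) at_top"
    by (intro tendsto_sum tendsto_mult tendsto_const tendsto_power_div_exp_0)
  then show ?thesis
    by (simp add: poly_altdef exp_minus divide_inverse sum_distrib_right mult.assoc)
qed

text \<open>With t = 1/x, differentiating P(t) exp(-t) gives t^2 (P - P')(t) exp(-t). The family
  \<open>flat\<close> is thus closed under differentiation, which yields all derivatives at
  once.\<close>

lemma flat_deriv: "(flat P has_real_derivative flat (monom 1 2 * (P - pderiv P)) x) (at x)"
proof -
  consider "x > 0" | "x < 0" | "x = 0" by linarith
  then show ?thesis
  proof cases
    case 1
    have "((%x. poly P (1 / x) * exp (- (1 / x))) has_real_derivative flat (monom 1 2 * (P - pderiv P)) x) (at x)"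
      using 1 by (auto intro!: derivative_eq_intros DERIV_chain2[OF poly_DERIV]
          simp: flat_def poly_monom field_simps power2_eq_square)
    then show ?thesis
      by (rule has_field_derivative_transform_within_open[where S="{0<..}"])
        (use 1 in \<open>auto simp: flat_def\<close>)
  next
    case 2
    have "((%x. 0) has_real_derivative flat (monom 1 2 * (P - pderiv P)) x) (at x)"
      using 2 by (auto simp: flat_def)
    then show ?thesis
      by (rule has_field_derivative_transform_within_open[where S="{..<0}"])
        (use 2 in \<open>auto simp: flat_def\<close>)
  next
    case 3
    \<comment> \<open>The right difference quotient at 0 is t P(t) exp(-t) with t = 1/h; the factor
      \<open>monom 1 1\<close> is the division by h.\<close>
    have "((%h. poly (monom 1 1 * P) (1/h) * exp (- (1/h))) \<longlongrightarrow> 0) (at_right 0)"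
      using filterlim_compose[OF poly_exp_tendsto_0[of "monom 1 1 * P"] filterlim_inverse_at_top_right]
      by (simp add: inverse_eq_divide)
    then have r: "((%h. flat P h / h) \<longlongrightarrow> 0) (at_right 0)"
      by (rule Lim_transform_eventually)
        (auto simp: flat_def eventually_at_filter poly_monom)
    have l: "((%h. flat P h / h) \<longlongrightarrow> 0) (at_left 0)"
      by (rule tendsto_eventually) (auto simp: flat_def eventually_at_filter)
    have "((%h. flat P h / h) \<longlongrightarrow> 0) (at 0)"
      using l r filterlim_split_at by blast
    then have "((%h. (flat P (0 + h) - flat P 0) / h) \<longlongrightarrow> 0) (at 0)"
      by (simp add: flat_def)
    then show ?thesis using 3 by (simp add: DERIV_def flat_def)
  qed
qed

lemma smooth1_flat: "smooth1 (flat P)"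
proof -
  have "diffn n (flat P)" for n
    by (induction n arbitrary: P) (use flat_deriv in auto)
  then show ?thesis by (simp add: smooth1_def)
qed

definition bump :: "real => real" where
  "bump t = flat 1 (1 + t) * flat 1 (1 - t)"

lemma smooth1_bump: "smooth1 bump"
proof -
  have "smooth1 (%t. 1 * flat 1 (1 * t + 1))" "smooth1 (%t. 1 * flat 1 ((-1) * t + 1))"
    by (intro smooth1_affine smooth1_flat)+
  then have "!!n. diffn n (%t. (1 * flat 1 (1 * t + 1)) * (1 * flat 1 ((-1) * t + 1)))"
    unfolding smooth1_def using diffn_mult by blast
  then show ?thesis unfolding smooth1_def bump_def[abs_def] by (simp add: add.commute)
qed

lemma bump_nonneg: "bump t >= 0" by (auto simp: bump_def flat_def)
lemma bump_pos: "\<bar>t\<bar> < 1 ==> bump t > 0" by (auto simp: bump_def flat_def)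
lemma bump_eq_0: "\<bar>t\<bar> >= 1 ==> bump t = 0" by (auto simp: bump_def flat_def)

definition bump_mass :: real where "bump_mass = integral {-1..1} bump"

text \<open>The primitive of the normalised bump, a smooth transition from 0 at -1 to 1 at 1.
  Differences of its dilates serve as cut-offs, and later as integrals of the mollifying
  kernel.\<close>

definition step :: "real => real" where
  "step t = (if t <= -1 then 0 else integral {-1..t} bump / bump_mass)"

lemma bump_integrable: "bump integrable_on {a..b}"
  using smooth1_cont[OF smooth1_bump] integrable_continuous_real by blast

lemma bump_mass_pos: "bump_mass > 0"
proof -
  have "integral {-1..1} bump \<noteq> 0"
  proof
    assume "integral {-1..1} bump = 0"
    then have "(bump has_integral 0) (cbox (-1) 1)"
      using bump_integrable[of "-1" 1] by (simp add: has_integral_iff)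
    then have "bump 0 = 0"
      by (rule has_integral_0_cbox_imp_0[rotated 2])
        (auto intro: smooth1_cont[OF smooth1_bump] simp: bump_nonneg)
    then show False using bump_pos[of 0] by simp
  qed
  moreover have "integral {-1..1} bump >= 0"
    by (intro integral_nonneg bump_integrable) (simp add: bump_nonneg)
  ultimately show ?thesis by (simp add: bump_mass_def)
qed

lemma step_left: "t <= -1 ==> step t = 0" by (simp add: step_def)

lemma step_right: assumes "t >= 1" shows "step t = 1"
proof -
  have "integral {-1..1} bump + integral {1..t} bump = integral {-1..t} bump"
    by (rule Henstock_Kurzweil_Integration.integral_combine) (use assms bump_integrable in auto)
  moreover have "integral {1..t} bump = 0"
    using integral_cong[of "{1..t}" bump "%x. 0"] by (simp add: bump_eq_0)
  ultimately show ?thesis using assms bump_mass_pos by (simp add: step_def bump_mass_def)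
qed

lemma step_deriv_bump: "(step has_real_derivative bump t / bump_mass) (at t)"
proof -
  \<comment> \<open>A lower end of integration to the left of both -1 and t removes the case
    distinction in \<open>step\<close>, so that the fundamental theorem applies at an interior
    point.\<close>
  have eq: "step x = integral {-1 - \<bar>t\<bar> - 1..x} bump / bump_mass" if "x >= -1 - \<bar>t\<bar> - 1" for x
  proof (cases "x <= -1")
    case True
    then have "integral {-1 - \<bar>t\<bar> - 1..x} bump = 0"
      using integral_cong[of "{-1 - \<bar>t\<bar> - 1..x}" bump "%x. 0"] by (simp add: bump_eq_0)
    then show ?thesis using True by (simp add: step_def)
  next
    case False
    have "integral {-1 - \<bar>t\<bar> - 1..-1} bump + integral {-1..x} bump = integral {-1 - \<bar>t\<bar> - 1..x} bump"
      by (rule Henstock_Kurzweil_Integration.integral_combine) (use False bump_integrable in auto)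
    moreover have "integral {-1 - \<bar>t\<bar> - 1..-1} bump = 0"
      using integral_cong[of "{-1 - \<bar>t\<bar> - 1..-1}" bump "%x. 0"] by (simp add: bump_eq_0)
    ultimately show ?thesis using False by (simp add: step_def)
  qed
  have "((%x. integral {-1 - \<bar>t\<bar> - 1..x} bump) has_real_derivative bump t) (at t within {-1 - \<bar>t\<bar> - 1..\<bar>t\<bar>+1})"
    by (rule integral_has_real_derivative) (auto intro: smooth1_cont[OF smooth1_bump])
  then have "((%x. integral {-1 - \<bar>t\<bar> - 1..x} bump) has_real_derivative bump t) (at t)"
    by (subst (asm) at_within_interior) auto
  then have "((%x. integral {-1 - \<bar>t\<bar> - 1..x} bump / bump_mass) has_real_derivative bump t / bump_mass) (at t)"
    by (rule DERIV_cdivide)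
  then show ?thesis
    by (rule has_field_derivative_transform_within_open[where S="{-1 - \<bar>t\<bar> - 1<..}"])
      (auto simp: eq)
qed

lemma smooth1_step: "smooth1 step"
  unfolding smooth1_def
proof
  fix n
  have "diffn n (%t. (1 / bump_mass) * bump (1 * t + 0))"
    using smooth1_affine[OF smooth1_bump] unfolding smooth1_def by blast
  then have "diffn (Suc n) step"
    using step_deriv_bump by (auto intro!: exI[of _ "%t. bump t / bump_mass"])
  then show "diffn n step" by (rule diffn_mono)
qed

definition moll :: "real => real" where "moll = deriv step"

lemma smooth1_moll: "smooth1 moll"
  unfolding moll_def by (rule smooth1_deriv[OF smooth1_step])

lemma step_deriv: "(step has_real_derivative moll t) (at t)"
  unfolding moll_def by (rule smooth1_has_deriv[OF smooth1_step])

lemma moll_eq: "moll t = bump t / bump_mass"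
  using step_deriv step_deriv_bump DERIV_unique by blast

lemma moll_nonneg: "moll t >= 0"
  using bump_nonneg bump_mass_pos by (simp add: moll_eq)

lemma moll_eq_0: "\<bar>t\<bar> >= 1 ==> moll t = 0" by (simp add: moll_eq bump_eq_0)

lemma step_mono: "s <= t ==> step s <= step t"
  using DERIV_nonneg_imp_nondecreasing[of s t step] step_deriv moll_nonneg by blast

lemma step_ge0: "0 <= step t"
  using step_mono[of "min t (-1)" t] step_left[of "min t (-1)"] by simp

lemma step_le1: "step t <= 1"
  using step_mono[of t "max t 1"] step_right[of "max t 1"] by simp

subsection \<open>Tensor products as test functions\<close>

text \<open>Only tensor products are ever inserted into weak identities. For them every word of
  partial derivatives splits into one-variable derivatives, so \<open>smooth2\<close> reduces to
  \<open>smooth1\<close>.\<close>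

lemma iter_pd_tensor:
  assumes "smooth1 f" "smooth1 g"
  shows "iter_pd ds (%p. f (fst p) * g (snd p)) =
    (%p. (deriv ^^ length (filter (%d. d) ds)) f (fst p) * (deriv ^^ length (filter Not ds)) g (snd p))"
proof (induction ds)
  case (Cons d ds)
  let ?F = "(deriv ^^ length (filter (%d. d) ds)) f" and ?G = "(deriv ^^ length (filter Not ds)) g"
  have F: "smooth1 ?F" and G: "smooth1 ?G" using assms smooth1_funpow by auto
  have "deriv (%t. ?F t * c) x = deriv ?F x * c" for c x
    by (intro DERIV_imp_deriv DERIV_cmult_right smooth1_has_deriv F)
  moreover have "deriv (%t. c * ?G t) x = c * deriv ?G x" for c x
    by (intro DERIV_imp_deriv DERIV_cmult smooth1_has_deriv G)
  ultimately show ?case using Cons by (auto simp: pdir_def fun_eq_iff)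
qed simp

lemma smooth2_tensor:
  assumes "smooth1 f" "smooth1 g"
  shows "smooth2 (%p. f (fst p) * g (snd p))"
  unfolding smooth2_def iter_pd_tensor[OF assms]
proof (intro allI conjI)
  fix ds d p
  let ?F = "(deriv ^^ length (filter (%d. d) ds)) f" and ?G = "(deriv ^^ length (filter Not ds)) g"
  have F: "smooth1 ?F" and G: "smooth1 ?G" using assms smooth1_funpow by auto
  have FC: "continuous_on UNIV ?F" and GC: "continuous_on UNIV ?G"
    using smooth1_cont F G by auto
  show "continuous_on UNIV (%p. ?F (fst p) * ?G (snd p))"
    by (intro continuous_intros continuous_on_compose2[OF FC] continuous_on_compose2[OF GC]) auto
  show "pdir_exists d (%p. ?F (fst p) * ?G (snd p)) p"
    using DERIV_cmult_right[OF smooth1_has_deriv[OF F]] DERIV_cmult[OF smooth1_has_deriv[OF G]]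
    unfolding pdir_exists_def real_differentiable_def fst_conv snd_conv
    by (cases d) (simp only: if_True if_False, blast)+
qed

lemma test_fun_tensor:
  assumes "smooth1 f" "smooth1 g"
    and "!!x. x \<notin> {l1..r1} ==> f x = 0" "!!y. y \<notin> {l2..r2} ==> g y = 0"
    and "{l1..r1} \<times> {l2..r2} \<subseteq> \<Omega>"
  shows "test_fun \<Omega> (%p. f (fst p) * g (snd p))"
proof -
  have *: "closure {x. f (fst x) * g (snd x) \<noteq> 0} \<subseteq> {l1..r1} \<times> {l2..r2}"
    by (rule closure_minimal) (use assms(3,4) in \<open>auto intro: closed_Times, fastforce+\<close>)
  have "compact ({l1..r1} \<times> {l2..r2})" by (intro compact_Times) auto
  then have "compact (closure {x. f (fst x) * g (snd x) \<noteq> 0})"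
    using * compact_closure by (meson bounded_subset compact_imp_bounded closure_subset subset_trans)
  then show ?thesis using * assms smooth2_tensor unfolding test_fun_def by auto
qed

lemma Dcl_tensor:
  assumes "smooth1 f" "smooth1 g"
  shows "Dcl (i, j) (%p. f (fst p) * g (snd p)) = (%p. (deriv ^^ i) f (fst p) * (deriv ^^ j) g (snd p))"
  unfolding Dcl_def iter_pd_tensor[OF assms] by simp

subsection \<open>Cut-off functions\<close>

text \<open>As \<open>e\<close> tends to 0 this approximates the indicator of [l, r], while its
  derivative \<open>cut'\<close> approximates the difference of the point masses at l and r.
  Products of two cut-offs therefore turn a weak divergence into fluxes through the sides of a
  rectangle.\<close>

definition cut :: "real => real => real => real => real" where
  "cut e l r x = step ((x - l) / e) - step ((x - r) / e)"

definition cut' :: "real => real => real => real => real" where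
  "cut' e l r x = moll ((x - l) / e) / e - moll ((x - r) / e) / e"

lemma smooth1_cut: "smooth1 (cut e l r)"
proof -
  have "smooth1 (%x. 1 * step ((1/e) * x + (- l / e)))" "smooth1 (%x. 1 * step ((1/e) * x + (- r / e)))"
    by (intro smooth1_affine smooth1_step)+
  from smooth1_diff[OF this] show ?thesis
    by (simp add: cut_def[abs_def] diff_divide_distrib)
qed

lemma step_affine_deriv:
  "((%x. step ((x - l) / e)) has_real_derivative moll ((x - l) / e) / e) (at x within S)"
proof -
  have "((%x. (x - l) / e) has_real_derivative 1 / e) (at x within S)"
    by (rule DERIV_cdivide) (auto intro!: derivative_eq_intros)
  from DERIV_chain2[OF step_deriv this] show ?thesis by simp
qed

lemma deriv_cut: "deriv (cut e l r) = cut' e l r"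
proof
  fix x
  have "(cut e l r has_real_derivative cut' e l r x) (at x)"
    unfolding cut_def[abs_def] cut'_def
    by (intro DERIV_diff step_affine_deriv)
  then show "deriv (cut e l r) x = cut' e l r x" by (rule DERIV_imp_deriv)
qed

lemma cut_cont: "continuous_on A (cut e l r)" and cut'_cont: "continuous_on A (cut' e l r)"
  using smooth1_cont smooth1_cut smooth1_deriv deriv_cut by metis+

lemma cut_cont_comp: "continuous_on A f ==> continuous_on A (%p. cut e l r (f p))"
  by (rule continuous_on_compose2[OF cut_cont[of UNIV]]) auto

lemma cut'_cont_comp: "continuous_on A f ==> continuous_on A (%p. cut' e l r (f p))"
  by (rule continuous_on_compose2[OF cut'_cont[of UNIV]]) auto

lemma cut_bounds: assumes "e > 0" "l <= r" shows "0 <= cut e l r x" "cut e l r x <= 1"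
  using step_mono[of "(x - r) / e" "(x - l) / e"] step_ge0[of "(x-r)/e"] step_le1[of "(x-l)/e"] assms
  by (auto simp: cut_def divide_right_mono)

lemma cut_support: assumes "e > 0" "l <= r" "x \<notin> {l - e..r + e}" shows "cut e l r x = 0" "cut' e l r x = 0"
proof -
  have "x < l - e \<or> x > r + e" using assms by auto
  then have *: "(x - l)/e <= -1 \<and> (x - r)/e <= -1 \<or> (x - l)/e >= 1 \<and> (x - r)/e >= 1"
    using assms by (auto simp: field_simps)
  then show "cut e l r x = 0" by (auto simp: cut_def step_left step_right)
  have "\<bar>(x - l)/e\<bar> >= 1" "\<bar>(x - r)/e\<bar> >= 1" using * by linarith+
  then show "cut' e l r x = 0" unfolding cut'_def by (simp only: moll_eq_0)
qed

lemma filterlim_divide_null: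
  fixes e :: "nat => real"
  assumes "!!n. e n > 0" "e \<longlonglongrightarrow> 0" "d \<longlonglongrightarrow> D" "D > 0"
  shows "filterlim (%n. d n / e n) at_top sequentially"
proof -
  have "filterlim (%n. inverse (e n)) at_top sequentially"
    using assms by (intro filterlim_inverse_at_top) auto
  then show ?thesis
    using filterlim_tendsto_pos_mult_at_top[OF assms(3,4)] by (simp add: divide_inverse)
qed

lemma step_tendsto_1:
  assumes "!!n. e n > 0" "e \<longlonglongrightarrow> 0" "d \<longlonglongrightarrow> D" "D > 0"
  shows "(%n. step (d n / e n)) \<longlonglongrightarrow> 1"
proof -
  have "eventually (%n. d n / e n >= 1) sequentially"
    using filterlim_divide_null[OF assms] unfolding filterlim_at_top by blast
  then show ?thesis by (intro tendsto_eventually) (auto elim: eventually_mono simp: step_right)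
qed

lemma step_tendsto_0:
  assumes "!!n. e n > 0" "e \<longlonglongrightarrow> 0" "d \<longlonglongrightarrow> D" "D < 0"
  shows "(%n. step (d n / e n)) \<longlonglongrightarrow> 0"
proof -
  have "filterlim (%n. - d n / e n) at_top sequentially"
    by (rule filterlim_divide_null[OF assms(1,2) tendsto_minus[OF assms(3)]]) (use assms(4) in simp)
  then have "eventually (%n. 1 <= - d n / e n) sequentially"
    unfolding filterlim_at_top by blast
  then have "eventually (%n. d n / e n <= - 1) sequentially"
    by (rule eventually_mono) simp
  then show ?thesis by (intro tendsto_eventually) (auto elim: eventually_mono simp: step_left)
qed

lemma cut_tendsto:
  assumes "!!n. e n > 0" "e \<longlonglongrightarrow> 0" "x \<noteq> l" "x \<noteq> r" "l <= r"
  shows "(%n. cut (e n) l r x) \<longlonglongrightarrow> indicator {l..r} x"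
proof -
  consider "x < l" | "l < x" "x < r" | "x > r" using assms by linarith
  then show ?thesis unfolding cut_def
  proof cases
    case 1 
    have "(%n. step ((x - l) / e n) - step ((x - r) / e n)) \<longlonglongrightarrow> 0 - 0"
      by (intro tendsto_diff step_tendsto_0 assms tendsto_const) (use 1 assms in auto)
    then show "(%n. step ((x - l) / e n) - step ((x - r) / e n)) \<longlonglongrightarrow> indicator {l..r} x" using 1 by simp
  next
    case 2
    have "(%n. step ((x - l) / e n) - step ((x - r) / e n)) \<longlonglongrightarrow> 1 - 0"
      by (intro tendsto_diff step_tendsto_0 step_tendsto_1 assms tendsto_const) (use 2 assms in auto)
    then show "(%n. step ((x - l) / e n) - step ((x - r) / e n)) \<longlonglongrightarrow> indicator {l..r} x" using 2 by simp
  next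
    case 3 
    have "(%n. step ((x - l) / e n) - step ((x - r) / e n)) \<longlonglongrightarrow> 1 - 1"
      by (intro tendsto_diff step_tendsto_1 assms tendsto_const) (use 3 assms in auto)
    then show "(%n. step ((x - l) / e n) - step ((x - r) / e n)) \<longlonglongrightarrow> indicator {l..r} x" using 3 by simp
  qed
qed

section \<open>Averages against an approximate identity\<close>

lemma moll_mass:
  assumes "e > 0" "a <= l - e" "l + e <= b"
  shows "((%x. moll ((x - l) / e) / e) has_integral 1) {a..b}"
proof -
  have "((%x. moll ((x - l) / e) / e) has_integral step ((b - l) / e) - step ((a - l) / e)) {a..b}"
    by (intro fundamental_theorem_of_calculus) (use assms step_affine_deriv in \<open>auto simp: has_real_derivative_iff_has_vector_derivative[symmetric]\<close>)
  moreover have "step ((b - l) / e) = 1" "step ((a - l) / e) = 0"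
    by (rule step_right step_left; use assms in \<open>simp add: field_simps\<close>)+
  ultimately show ?thesis by simp
qed

lemma moll_cont: "continuous_on A (%x. moll ((x - l) / e) / e)"
proof -
  have "smooth1 (%x. (1/e) * moll ((1/e) * x + (- l / e)))"
    by (intro smooth1_affine smooth1_moll)
  from smooth1_cont[OF this] show ?thesis by (simp add: diff_divide_distrib)
qed

text \<open>The averaging argument shared by the one-dimensional kernel (\<open>moll_bound\<close>)
  and the tensor kernel (\<open>V00_average\<close>): integrate f - c against the weight, whose mass
  is 1.\<close>

lemma weighted_average_bound:
  fixes f \<rho> :: "'a::euclidean_space => real"
  assumes "(\<rho> has_integral 1) S" "!!x. x \<in> S ==> \<rho> x >= 0" "(%x. f x * \<rho> x) integrable_on S"
    and "!!x. x \<in> S ==> \<rho> x \<noteq> 0 ==> \<bar>f x - c\<bar> <= d"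
  shows "\<bar>integral S (%x. f x * \<rho> x) - c\<bar> <= d"
proof -
  have 1: "((%x. c * \<rho> x) has_integral c * 1) S" "((%x. d * \<rho> x) has_integral d * 1) S"
    using assms(1) by (intro has_integral_mult_right; simp)+
  have 2: "((%x. f x * \<rho> x - c * \<rho> x) has_integral integral S (%x. f x * \<rho> x) - c) S"
    using has_integral_diff[OF integrable_integral[OF assms(3)] 1(1)] by simp
  have "norm (f x * \<rho> x - c * \<rho> x) <= d * \<rho> x" if "x \<in> S" for x
    using assms(2)[OF that] assms(4)[OF that]
    by (cases "\<rho> x = 0") (auto simp: left_diff_distrib[symmetric] abs_mult mult_right_mono)
  then have "norm (integral S (%x. f x * \<rho> x - c * \<rho> x)) <= integral S (%x. d * \<rho> x)"
    using 1 2 by (intro integral_norm_bound_integral) (auto simp: has_integral_iff)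
  then show ?thesis using 1 2 by (auto simp: has_integral_iff)
qed

lemma moll_bound:
  assumes "continuous_on {a..b} f" "e > 0" "a <= l - e" "l + e <= b"
    "!!x. x \<in> {a..b} ==> \<bar>x - l\<bar> <= e ==> \<bar>f x - c\<bar> <= d"
  shows "\<bar>integral {a..b} (%x. f x * (moll ((x - l) / e) / e)) - c\<bar> <= d"
proof (rule weighted_average_bound)
  show "((%x. moll ((x - l) / e) / e) has_integral 1) {a..b}" using moll_mass assms by auto
  show "(%x. f x * (moll ((x - l) / e) / e)) integrable_on {a..b}"
    by (intro integrable_continuous_real continuous_on_mult moll_cont assms)
  show "moll ((x - l) / e) / e >= 0" for x using moll_nonneg \<open>e > 0\<close> by simp
  show "\<bar>f x - c\<bar> <= d" if "x \<in> {a..b}" "moll ((x - l) / e) / e \<noteq> 0" for x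
  proof (rule assms(5)[OF that(1)])
    have "\<not> \<bar>(x - l)/e\<bar> >= 1" using that moll_eq_0 by auto
    then show "\<bar>x - l\<bar> <= e" using \<open>e > 0\<close> by (simp add: field_simps)
  qed
qed

lemma moll_tendsto:
  assumes "continuous_on {a..b} f" "!!n. e n > 0" "e \<longlonglongrightarrow> 0" "!!n. a <= l - e n" "!!n. l + e n <= b"
  shows "(%n. integral {a..b} (%x. f x * (moll ((x - l) / e n) / e n))) \<longlonglongrightarrow> f l"
proof (rule LIMSEQ_I)
  fix r :: real assume "r > 0"
  have "l \<in> {a..b}" using assms(2,4,5)[of 0] by auto
  then obtain d where d: "d > 0" "!!x. x \<in> {a..b} ==> dist x l < d ==> dist (f x) (f l) < r/2"
    using assms(1) \<open>r > 0\<close> unfolding continuous_on_iff by (metis half_gt_zero)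
  have "eventually (%n. e n < d) sequentially"
    using assms(3) d(1) by (rule order_tendstoD)
  then obtain N where N: "!!n. n >= N ==> e n < d" by (auto simp: eventually_sequentially)
  have le: "\<bar>integral {a..b} (%x. f x * (moll ((x - l) / e n) / e n)) - f l\<bar> <= r/2" if "n >= N" for n
    by (rule moll_bound) (use assms d N[OF that] in \<open>auto simp: dist_real_def less_imp_le\<close>)
  show "\<exists>N. \<forall>n\<ge>N. norm (integral {a..b} (%x. f x * (moll ((x - l) / e n) / e n)) - f l) < r"
  proof (intro exI allI impI)
    fix n assume "N <= n"
    then show "norm (integral {a..b} (%x. f x * (moll ((x - l) / e n) / e n)) - f l) < r"
      using le[of n] \<open>r > 0\<close> unfolding real_norm_def by linarith
  qed
qed

subsection \<open>Integrals over rectangles\<close>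

lemma cbox_Pair_real: "cbox (a, c) (b, d) = {a..b} \<times> {c..d}" for a b c d :: real
  by (simp add: cbox_Pair_eq)

lemma LINT_cbox_HK:
  fixes f :: "'a::euclidean_space => real"
  assumes "continuous_on (cbox a b) f"
  shows "set_integrable lborel (cbox a b) f"
    "(LINT p:cbox a b|lborel. f p) = integral (cbox a b) f"
proof -
  show 1: "set_integrable lborel (cbox a b) f"
    unfolding set_integrable_def by (rule borel_integrable_compact[OF compact_cbox assms])
  then show "(LINT p:cbox a b|lborel. f p) = integral (cbox a b) f"
    by (rule set_borel_integral_eq_integral)
qed

lemma iterated_swap:
  fixes f :: "real \<times> real => real"
  assumes "continuous_on (cbox (a, c) (b, d)) f"
  shows "integral (cbox (a, c) (b, d)) f = integral {a..b} (%x. integral {c..d} (%y. f (x, y)))"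
    "integral (cbox (a, c) (b, d)) f = integral {c..d} (%y. integral {a..b} (%x. f (x, y)))"
proof -
  show 1: "integral (cbox (a, c) (b, d)) f = integral {a..b} (%x. integral {c..d} (%y. f (x, y)))"
    using integral_prod_continuous[OF assms] by simp
  show "integral (cbox (a, c) (b, d)) f = integral {c..d} (%y. integral {a..b} (%x. f (x, y)))"
    using 1 integral_swap_continuous[of a c b d "%x y. f (x, y)"] assms by simp
qed

lemma null_lines:
  "{p. fst p = c} \<in> null_sets (lborel :: (real \<times> real) measure)"
  "{p. snd p = c} \<in> null_sets (lborel :: (real \<times> real) measure)"
proof -
  have "negligible {p :: real \<times> real. p \<bullet> (1, 0) = c}" "negligible {p :: real \<times> real. p \<bullet> (0, 1) = c}"
    by (rule negligible_standard_hyperplane; simp add: Basis_prod_def)+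
  moreover have "{p :: real \<times> real. p \<bullet> (1, 0) = c} = {p. fst p = c}" "{p :: real \<times> real. p \<bullet> (0, 1) = c} = {p. snd p = c}"
    by (auto simp: inner_prod_def)
  moreover have "closed {p :: real \<times> real. fst p = c}" "closed {p :: real \<times> real. snd p = c}"
    by (intro closed_Collect_eq continuous_intros)+
  ultimately show "{p. fst p = c} \<in> null_sets (lborel :: (real \<times> real) measure)"
    "{p. snd p = c} \<in> null_sets (lborel :: (real \<times> real) measure)"
    by (metis borel_closed negligible_iff_null_sets null_sets_completion_iff sets_lborel)+
qed

lemma AE_off_lines:
  "AE p in (lborel :: (real \<times> real) measure). fst p \<noteq> c"
  "AE p in (lborel :: (real \<times> real) measure). snd p \<noteq> c"
  using AE_not_in[OF null_lines(1)[of c]] AE_not_in[OF null_lines(2)[of c]] by auto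

text \<open>For fixed y the inner integral is a cut-off in y times the difference of two mollified
  values of F, at \<open>l1\<close> and at \<open>r1\<close>. These converge pointwise and are
  bounded by \<open>2 * M\<close>, so dominated convergence handles the outer integral.\<close>

lemma cut_flux_tendsto:
  fixes F :: "real => real => real"
  assumes F: "continuous_on (cbox (a, c) (b, d)) (%p. F (fst p) (snd p))"
    and e: "!!n. e n > 0" "e \<longlonglongrightarrow> 0" "!!n. a <= l1 - e n" "!!n. r1 + e n <= b"
    and lr: "l1 <= r1" "c <= l2" "l2 <= r2" "r2 <= d"
  shows "(%n. integral {c..d} (%y. integral {a..b} (%x. F x y * (cut' (e n) l1 r1 x * cut (e n) l2 r2 y))))
     \<longlonglongrightarrow> integral {l2..r2} (%y. F l1 y) - integral {l2..r2} (%y. F r1 y)"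
proof -
  define m where "m n y = integral {a..b} (%x. F x y * (cut' (e n) l1 r1 x * cut (e n) l2 r2 y))" for n y
  have e': "l1 + e n <= b" "a <= r1 - e n" for n using e(1,3,4)[of n] lr by linarith+
  have ab: "l1 \<in> {a..b}" "r1 \<in> {a..b}" using e(1,3,4)[of 0] lr by auto
  have Fx: "continuous_on {a..b} (%x. F x y)" if "y \<in> {c..d}" for y
    by (rule continuous_on_compose2[OF F, of _ "%x. (x, y)", simplified])
      (use that in \<open>auto simp: cbox_Pair_real intro!: continuous_intros\<close>)
  have Fy: "continuous_on {c..d} (%y. F x y)" if "x \<in> {a..b}" for x
    by (rule continuous_on_compose2[OF F, of _ "%y. (x, y)", simplified])
      (use that in \<open>auto simp: cbox_Pair_real intro!: continuous_intros\<close>)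
  have meq: "m n y = cut (e n) l2 r2 y * (integral {a..b} (%x. F x y * (moll ((x - l1) / e n) / e n))
       - integral {a..b} (%x. F x y * (moll ((x - r1) / e n) / e n)))" if "y \<in> {c..d}" for n y
  proof -
    have I: "(%x. F x y * (moll ((x - l) / e n) / e n)) integrable_on {a..b}" for l
      by (intro integrable_continuous_real continuous_on_mult moll_cont Fx that)
    have "m n y = integral {a..b} (%x. cut (e n) l2 r2 y *
        (F x y * (moll ((x - l1) / e n) / e n) - F x y * (moll ((x - r1) / e n) / e n)))"
      unfolding m_def cut'_def by (intro integral_cong) (simp add: algebra_simps)
    also have "\<dots> = cut (e n) l2 r2 y * integral {a..b} (%x. F x y * (moll ((x - l1) / e n) / e n) - F x y * (moll ((x - r1) / e n) / e n))"
      by simp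
    also have "integral {a..b} (%x. F x y * (moll ((x - l1) / e n) / e n) - F x y * (moll ((x - r1) / e n) / e n))
      = integral {a..b} (%x. F x y * (moll ((x - l1) / e n) / e n)) - integral {a..b} (%x. F x y * (moll ((x - r1) / e n) / e n))"
      by (rule integral_diff[OF I I])
    finally show ?thesis .
  qed
  \<comment> \<open>At y = l2 and y = r2 the cut-off sits on its jump and the limit, which involves
    \<open>step 0\<close>, need not be the indicator. It exists nevertheless, and the two points are
    discarded below as a null set.\<close>
  define L where "L y = lim (%n. cut (e n) l2 r2 y)" for y
  have Lc: "(%n. cut (e n) l2 r2 y) \<longlonglongrightarrow> L y" for y
  proof -
    have c: "convergent (%n. step ((y - z) / e n))" for z
    proof (cases "y = z")
      case False
      then show ?thesis
        using step_tendsto_1[OF e(1,2) tendsto_const, of "y - z"] step_tendsto_0[OF e(1,2) tendsto_const, of "y - z"]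
        by (cases "y > z") (auto simp: convergent_def)
    qed (simp add: convergent_const)
    have "convergent (%n. cut (e n) l2 r2 y)"
      unfolding cut_def by (intro convergent_diff c)
    then show ?thesis unfolding L_def by (rule convergent_LIMSEQ_iff[THEN iffD1])
  qed
  have L1: "L y = indicator {l2..r2} y" if "y \<notin> {l2, r2}" for y
    using LIMSEQ_unique[OF Lc cut_tendsto[OF e(1,2) _ _ lr(3)]] that by auto
  obtain M where M: "!!x y. x \<in> {a..b} ==> y \<in> {c..d} ==> \<bar>F x y\<bar> <= M"
  proof -
    have "bounded ((%p. F (fst p) (snd p)) ` cbox (a, c) (b, d))"
      using F by (intro compact_imp_bounded compact_continuous_image compact_cbox)
    then obtain M where "!!p. p \<in> cbox (a, c) (b, d) ==> \<bar>F (fst p) (snd p)\<bar> <= M"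
      by (auto simp: bounded_iff)
    then show ?thesis by (intro that[of M]) (force simp: cbox_Pair_real)
  qed
  have conv: "(%n. integral {c..d} (m n)) \<longlonglongrightarrow> integral {c..d} (%y. L y * (F l1 y - F r1 y))"
  proof (rule dominated_convergence(2)[where h = "%y. 2 * M"])
    show "m n integrable_on {c..d}" for n
    proof -
      have sw: "continuous_on (cbox (c, a) (d, b)) (%p. (snd p, fst p))"
        by (intro continuous_on_Pair continuous_on_fst continuous_on_snd continuous_on_id)
      have "continuous_on (cbox (c, a) (d, b)) (%p. F (fst (snd p, fst p)) (snd (snd p, fst p)))"
        by (rule continuous_on_compose2[OF F sw]) (auto simp: cbox_Pair_real)
      then have 1: "continuous_on (cbox (c, a) (d, b)) (%p. F (snd p) (fst p))" by simp
      have 2: "continuous_on (cbox (c, a) (d, b)) (%p. cut' (e n) l1 r1 (snd p))"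
        by (rule cut'_cont_comp[OF continuous_on_snd[OF continuous_on_id]])
      have 3: "continuous_on (cbox (c, a) (d, b)) (%p. cut (e n) l2 r2 (fst p))"
        by (rule cut_cont_comp[OF continuous_on_fst[OF continuous_on_id]])
      have "continuous_on (cbox (c, a) (d, b)) (%p. F (snd p) (fst p) * (cut' (e n) l1 r1 (snd p) * cut (e n) l2 r2 (fst p)))"
        by (rule continuous_on_mult[OF 1 continuous_on_mult[OF 2 3]])
      from integral_integrable_2dim[OF this] show ?thesis
        unfolding m_def[abs_def] cbox_interval fst_conv snd_conv .
    qed
    show "(%y. 2 * M) integrable_on {c..d}" by (rule integrable_const_ivl)
    show "norm (m n y) <= 2 * M" if y: "y \<in> {c..d}" for n y
    proof -
      have "\<bar>integral {a..b} (%x. F x y * (moll ((x - l1) / e n) / e n)) - 0\<bar> <= M"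
        using M y by (intro moll_bound Fx e e') auto
      moreover have "\<bar>integral {a..b} (%x. F x y * (moll ((x - r1) / e n) / e n)) - 0\<bar> <= M"
        using M y by (intro moll_bound Fx e e') auto
      ultimately have "\<bar>integral {a..b} (%x. F x y * (moll ((x - l1) / e n) / e n)) - integral {a..b} (%x. F x y * (moll ((x - r1) / e n) / e n))\<bar> <= 2 * M"
        by linarith
      moreover have "0 <= cut (e n) l2 r2 y" "cut (e n) l2 r2 y <= 1" using cut_bounds e lr by auto
      ultimately have "\<bar>cut (e n) l2 r2 y\<bar> * \<bar>integral {a..b} (%x. F x y * (moll ((x - l1) / e n) / e n)) - integral {a..b} (%x. F x y * (moll ((x - r1) / e n) / e n))\<bar> <= 1 * (2 * M)"
        by (intro mult_mono) auto
      then show ?thesis unfolding meq[OF y] real_norm_def abs_mult by simp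
    qed
    show "(%n. m n y) \<longlonglongrightarrow> L y * (F l1 y - F r1 y)" if y: "y \<in> {c..d}" for y
      unfolding meq[OF y]
      by (intro tendsto_mult Lc tendsto_diff moll_tendsto[of a b "%x. F x y"] Fx y e e')
  qed
  have "integral {c..d} (%y. L y * (F l1 y - F r1 y)) = integral {c..d} (%y. if y \<in> {l2..r2} then F l1 y - F r1 y else 0)"
    by (rule integral_spike[of "{l2, r2}"]) (auto simp: L1 indicator_def)
  also have "\<dots> = integral {l2..r2} (%y. F l1 y - F r1 y)"
    using Henstock_Kurzweil_Integration.integral_restrict_Int[of "{c..d}" "{l2..r2}" "%y. F l1 y - F r1 y"] lr by (simp add: Int_absorb1)
  also have "\<dots> = integral {l2..r2} (%y. F l1 y) - integral {l2..r2} (%y. F r1 y)"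
    by (intro integral_diff integrable_continuous_real continuous_on_subset[OF Fy] ab) (use lr in auto)
  finally show ?thesis using conv unfolding m_def[abs_def] by simp
qed

subsection \<open>The divergence theorem for weak divergences\<close>

lemma LINT_supported:
  fixes G :: "'a::euclidean_space => real"
  assumes "cbox a b \<subseteq> \<Omega>" "continuous_on (cbox a b) G" "!!p. p \<in> \<Omega> ==> p \<notin> cbox a b ==> G p = 0"
  shows "set_integrable lborel \<Omega> G" "(LINT p:\<Omega>|lborel. G p) = integral (cbox a b) G"
proof -
  have "(%p. indicator \<Omega> p *\<^sub>R G p) = (%p. indicator (cbox a b) p *\<^sub>R G p)"
    using assms(1,3) by (auto simp: fun_eq_iff indicator_def)
  then show "set_integrable lborel \<Omega> G" "(LINT p:\<Omega>|lborel. G p) = integral (cbox a b) G"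
    using LINT_cbox_HK[OF assms(2)] by (simp_all add: set_integrable_def set_lebesgue_integral_def)
qed

lemma box_Pair_real: "box (a, c) (b, d) = {a<..<b} \<times> {c<..<d}" for a b c d :: real
  by (auto simp: box_def Basis_prod_def)

text \<open>Test with a product of cut-offs of the rectangle and let the transition width tend to 0:
  the two derivative terms become fluxes through the sides, the right-hand side the integral of g.
  The rectangle lies strictly inside the domain, so that the cut-offs are admissible.\<close>

lemma divergence_rect:
  fixes F1 F2 g :: "real \<times> real => real"
  assumes F: "continuous_on (box (a1, a2) (b1, b2)) F1" "continuous_on (box (a1, a2) (b1, b2)) F2"
    and g: "set_integrable lborel (box (a1, a2) (b1, b2)) g"
    and weak: "!!f h. smooth1 f ==> smooth1 h ==> test_fun (box (a1, a2) (b1, b2)) (%p. f (fst p) * h (snd p)) ==>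
      (LINT p:box (a1, a2) (b1, b2)|lborel. F1 p * (deriv f (fst p) * h (snd p)) + F2 p * (f (fst p) * deriv h (snd p)))
      = - (LINT p:box (a1, a2) (b1, b2)|lborel. g p * (f (fst p) * h (snd p)))"
    and lr: "a1 < l1" "l1 <= r1" "r1 < b1" "a2 < l2" "l2 <= r2" "r2 < b2"
  shows "integral {l2..r2} (%y. F1 (r1, y)) - integral {l2..r2} (%y. F1 (l1, y))
       + integral {l1..r1} (%x. F2 (x, r2)) - integral {l1..r1} (%x. F2 (x, l2))
       = (LINT p:cbox (l1, l2) (r1, r2)|lborel. g p)"
proof -
  let ?\<Omega> = "box (a1, a2) (b1, b2)"
  \<comment> \<open>Half the distance to the boundary: all cut-offs of width
    \<open>e n <= e0\<close> are supported in one compact rectangle inside the domain.\<close>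
  define e0 where "e0 = min (min (l1 - a1) (b1 - r1)) (min (l2 - a2) (b2 - r2)) / 2"
  define e where "e n = e0 / (1 + real n)" for n
  have e0: "e0 > 0" using lr by (auto simp: e0_def)
  have e0': "e0 < l1 - a1" "e0 < b1 - r1" "e0 < l2 - a2" "e0 < b2 - r2" 
    using lr by (auto simp: e0_def min_def)
  have epos: "e n > 0" for n using e0 by (simp add: e_def)
  have ele: "e n <= e0" for n using e0 by (auto simp: e_def field_simps)
  have elim: "e \<longlonglongrightarrow> 0" unfolding e_def by real_asymp
  define a b c d where "a = l1 - e0" "b = r1 + e0" "c = l2 - e0" "d = r2 + e0"
  note abcd = this
  let ?K = "cbox (a, c) (b, d)"
  have K: "?K \<subseteq> ?\<Omega>" using e0' by (auto simp: abcd cbox_Pair_real box_Pair_real)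
  have FK: "continuous_on ?K F1" "continuous_on ?K F2" using F K continuous_on_subset by blast+
  define T1 where "T1 n p = F1 p * (cut' (e n) l1 r1 (fst p) * cut (e n) l2 r2 (snd p))" for n p
  define T2 where "T2 n p = F2 p * (cut (e n) l1 r1 (fst p) * cut' (e n) l2 r2 (snd p))" for n p
  have C: "continuous_on ?K (%p. cut (e n) l r (fst p))" "continuous_on ?K (%p. cut (e n) l r (snd p))" 
    "continuous_on ?K (%p. cut' (e n) l r (fst p))" "continuous_on ?K (%p. cut' (e n) l r (snd p))" for n l r
    by (intro cut_cont_comp cut'_cont_comp continuous_on_fst continuous_on_snd continuous_on_id)+
  have T: "continuous_on ?K (T1 n)" "continuous_on ?K (T2 n)" for n
    unfolding T1_def[abs_def] T2_def[abs_def] by (intro continuous_on_mult FK C)+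
  have z: "T1 n p + T2 n p = 0" if "p \<notin> ?K" for n p
  proof -
    have "fst p \<notin> {l1 - e n..r1 + e n} \<or> snd p \<notin> {l2 - e n..r2 + e n}"
      using that ele[of n] by (cases p) (auto simp: cbox_Pair_real abcd)
    then show ?thesis unfolding T1_def T2_def using cut_support[OF epos] lr by auto
  qed
  have L: "(LINT p:?\<Omega>|lborel. T1 n p + T2 n p) = integral ?K (T1 n) + integral ?K (T2 n)" for n
  proof -
    have "(LINT p:?\<Omega>|lborel. T1 n p + T2 n p) = integral ?K (%p. T1 n p + T2 n p)"
      by (rule LINT_supported(2)[OF K continuous_on_add[OF T(1) T(2)] z])
    also have "\<dots> = integral ?K (T1 n) + integral ?K (T2 n)"
      by (intro Henstock_Kurzweil_Integration.integral_add integrable_continuous T)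
    finally show ?thesis .
  qed
  have tf: "test_fun ?\<Omega> (%p. cut (e n) l1 r1 (fst p) * cut (e n) l2 r2 (snd p))" for n
    by (rule test_fun_tensor[OF smooth1_cut smooth1_cut, where ?l1.0 = "l1 - e n" and ?r1.0 = "r1 + e n" and ?l2.0 = "l2 - e n" and ?r2.0 = "r2 + e n"])
      (use lr ele[of n] e0' cut_support[OF epos] in \<open>auto simp: box_Pair_real\<close>)
  have W: "integral ?K (T1 n) + integral ?K (T2 n) = - (LINT p:?\<Omega>|lborel. g p * (cut (e n) l1 r1 (fst p) * cut (e n) l2 r2 (snd p)))" for n
    using weak[OF smooth1_cut smooth1_cut tf] unfolding deriv_cut L[symmetric] T1_def T2_def .
  have ab: "a <= l1 - e n" "r1 + e n <= b" "c <= l2 - e n" "r2 + e n <= d" for n using ele[of n] by (auto simp: abcd)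
  have ab': "a <= l1" "r1 <= b" "c <= l2" "r2 <= d" using e0 by (auto simp: abcd)
  have l1: "(%n. integral ?K (T1 n)) \<longlonglongrightarrow> integral {l2..r2} (%y. F1 (l1, y)) - integral {l2..r2} (%y. F1 (r1, y))"
  proof -
    have "integral ?K (T1 n) = integral {c..d} (%y. integral {a..b} (%x. F1 (x, y) * (cut' (e n) l1 r1 x * cut (e n) l2 r2 y)))" for n
      using iterated_swap(2)[OF T(1)] by (simp add: T1_def)
    then show ?thesis
      using cut_flux_tendsto[of a c b d "%x y. F1 (x, y)" e l1 r1 l2 r2] FK(1) epos elim ab ab' lr by simp
  qed
  have l2: "(%n. integral ?K (T2 n)) \<longlonglongrightarrow> integral {l1..r1} (%x. F2 (x, l2)) - integral {l1..r1} (%x. F2 (x, r2))"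
  proof -
    have "integral ?K (T2 n) = integral {a..b} (%x. integral {c..d} (%y. F2 (x, y) * (cut' (e n) l2 r2 y * cut (e n) l1 r1 x)))" for n
      using iterated_swap(1)[OF T(2)] by (simp add: T2_def mult.commute)
    moreover have "continuous_on (cbox (c, a) (d, b)) (%p. F2 (snd p, fst p))"
    proof (rule continuous_on_compose2[OF FK(2)])
      show "continuous_on (cbox (c, a) (d, b)) (%p. (snd p, fst p))"
        by (intro continuous_on_Pair continuous_on_fst continuous_on_snd continuous_on_id)
    qed (auto simp: cbox_Pair_real)
    ultimately show ?thesis
      using cut_flux_tendsto[of c a d b "%y x. F2 (x, y)" e l2 r2 l1 r1] epos elim ab ab' lr by simp
  qed
  have l3: "(%n. LINT p:?\<Omega>|lborel. g p * (cut (e n) l1 r1 (fst p) * cut (e n) l2 r2 (snd p)))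
     \<longlonglongrightarrow> (LINT p:cbox (l1, l2) (r1, r2)|lborel. g p)"
    unfolding set_lebesgue_integral_def
  proof (rule integral_dominated_convergence[where w = "%p. norm (indicator ?\<Omega> p *\<^sub>R g p)"])
    have gi: "integrable lborel (%p. indicator ?\<Omega> p *\<^sub>R g p)" using g by (simp add: set_integrable_def)
    then show "integrable lborel (%p. norm (indicator ?\<Omega> p *\<^sub>R g p))" by (rule integrable_norm)
    have gm: "(%p. indicator ?\<Omega> p *\<^sub>R g p) \<in> borel_measurable lborel" using gi by auto
    have "(%p. indicator (cbox (l1, l2) (r1, r2)) p * (indicator ?\<Omega> p *\<^sub>R g p)) \<in> borel_measurable lborel"
      using gm by measurable
    moreover have "(%p. indicator (cbox (l1, l2) (r1, r2)) p * (indicator ?\<Omega> p *\<^sub>R g p)) = (%p. indicator (cbox (l1, l2) (r1, r2)) p *\<^sub>R g p)"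
      using lr by (auto simp: fun_eq_iff indicator_def cbox_Pair_real box_Pair_real)
    ultimately show "(%p. indicator (cbox (l1, l2) (r1, r2)) p *\<^sub>R g p) \<in> borel_measurable lborel" by simp
    fix n
    have "(%p. cut (e n) l1 r1 (fst p) * cut (e n) l2 r2 (snd p)) \<in> borel_measurable borel"
      by (intro borel_measurable_continuous_onI continuous_on_mult cut_cont_comp continuous_on_fst continuous_on_snd continuous_on_id)
    then have "(%p. (indicator ?\<Omega> p *\<^sub>R g p) * (cut (e n) l1 r1 (fst p) * cut (e n) l2 r2 (snd p))) \<in> borel_measurable lborel"
      using gm by simp
    then show "(%p. indicator ?\<Omega> p *\<^sub>R (g p * (cut (e n) l1 r1 (fst p) * cut (e n) l2 r2 (snd p)))) \<in> borel_measurable lborel"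
      by (simp add: mult.assoc)
    show "AE p in lborel. norm (indicator ?\<Omega> p *\<^sub>R (g p * (cut (e n) l1 r1 (fst p) * cut (e n) l2 r2 (snd p)))) <= norm (indicator ?\<Omega> p *\<^sub>R g p)"
    proof (intro AE_I2)
      fix p
      have "\<bar>cut (e n) l1 r1 (fst p) * cut (e n) l2 r2 (snd p)\<bar> <= 1"
        using cut_bounds[OF epos lr(2)] cut_bounds[OF epos lr(5)] by (simp add: abs_mult mult_le_one)
      then have "\<bar>g p\<bar> * \<bar>cut (e n) l1 r1 (fst p) * cut (e n) l2 r2 (snd p)\<bar> <= \<bar>g p\<bar> * 1"
        by (intro mult_left_mono) auto
      then show "norm (indicator ?\<Omega> p *\<^sub>R (g p * (cut (e n) l1 r1 (fst p) * cut (e n) l2 r2 (snd p)))) <= norm (indicator ?\<Omega> p *\<^sub>R g p)"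
        by (simp add: abs_mult mult.assoc indicator_def)
    qed
  next
    show "AE p in lborel. (%n. indicator ?\<Omega> p *\<^sub>R (g p * (cut (e n) l1 r1 (fst p) * cut (e n) l2 r2 (snd p))))
       \<longlonglongrightarrow> indicator (cbox (l1, l2) (r1, r2)) p *\<^sub>R g p"
      using AE_off_lines(1)[of l1] AE_off_lines(1)[of r1] AE_off_lines(2)[of l2] AE_off_lines(2)[of r2]
    proof eventually_elim
      case (elim p)
      have "(%n. indicator ?\<Omega> p *\<^sub>R (g p * (cut (e n) l1 r1 (fst p) * cut (e n) l2 r2 (snd p))))
         \<longlonglongrightarrow> indicator ?\<Omega> p *\<^sub>R (g p * (indicator {l1..r1} (fst p) * indicator {l2..r2} (snd p)))"
        by (intro tendsto_intros cut_tendsto epos \<open>e \<longlonglongrightarrow> 0\<close> lr elim)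
      moreover have "indicator ?\<Omega> p *\<^sub>R (g p * (indicator {l1..r1} (fst p) * indicator {l2..r2} (snd p))) = indicator (cbox (l1, l2) (r1, r2)) p *\<^sub>R g p"
        using lr by (cases p) (auto simp: indicator_def cbox_Pair_real box_Pair_real)
      ultimately show ?case by (simp only:)
    qed
  qed
  have "(integral {l2..r2} (%y. F1 (l1, y)) - integral {l2..r2} (%y. F1 (r1, y))) +
    (integral {l1..r1} (%x. F2 (x, l2)) - integral {l1..r1} (%x. F2 (x, r2)))
    = - (LINT p:cbox (l1, l2) (r1, r2)|lborel. g p)"
    by (rule LIMSEQ_unique[OF tendsto_add[OF l1 l2]]) (use tendsto_minus[OF l3] W in simp)
  then show ?thesis by simp
qed

lemma weak_deriv_tensor:
  assumes "weak_deriv \<Omega> (i, j) f g" "smooth1 \<phi>" "smooth1 \<psi>" "test_fun \<Omega> (%p. \<phi> (fst p) * \<psi> (snd p))"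
  shows "(LINT p:\<Omega>|lborel. f p * ((deriv ^^ i) \<phi> (fst p) * (deriv ^^ j) \<psi> (snd p)))
     = (-1) ^ (i + j) * (LINT p:\<Omega>|lborel. g p * (\<phi> (fst p) * \<psi> (snd p)))"
proof -
  have "(LINT p:\<Omega>|lborel. f p * Dcl (i, j) (%p. \<phi> (fst p) * \<psi> (snd p)) p)
     = (-1) ^ (i + j) * (LINT p:\<Omega>|lborel. g p * (\<phi> (fst p) * \<psi> (snd p)))"
    using assms(1,4) unfolding weak_deriv_def fst_conv snd_conv by blast
  then show ?thesis unfolding Dcl_tensor[OF assms(2,3)] .
qed

subsection \<open>Uniqueness of weak derivatives\<close>

text \<open>The positive and the negative part of G are densities of two measures that agree and are
  finite on the intersection-stable generator of open boxes. Hence the measures coincide, and so do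
  the densities almost everywhere.\<close>

lemma box_integrals_zero_imp_AE:
  fixes G :: "'a::euclidean_space => real"
  assumes G: "integrable lborel G"
    and z: "!!c d. (\<integral>x. indicator (box c d) x * G x \<partial>lborel) = 0"
  shows "AE x in lborel. G x = 0"
proof -
  define P N where "P x = ennreal (max 0 (G x))" and "N x = ennreal (max 0 (- G x))" for x
  have [measurable]: "G \<in> borel_measurable borel" using G by auto
  have PNm[measurable]: "P \<in> borel_measurable borel" "N \<in> borel_measurable borel"
    unfolding P_def[abs_def] N_def[abs_def] by measurable
  have eq: "emeasure (density lborel P) (box c d) = emeasure (density lborel N) (box c d)"
    and fin: "emeasure (density lborel P) (box c d) \<noteq> \<infinity>" for c d
  proof -
    have i: "integrable lborel (%x. max 0 (G x) * indicator (box c d) x)"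
      "integrable lborel (%x. max 0 (- G x) * indicator (box c d) x)"
      by (rule Bochner_Integration.integrable_bound[OF G]; auto simp: indicator_def)+
    have "(\<integral>x. max 0 (G x) * indicator (box c d) x \<partial>lborel) - (\<integral>x. max 0 (- G x) * indicator (box c d) x \<partial>lborel)
      = (\<integral>x. indicator (box c d) x * G x \<partial>lborel)"
      unfolding Bochner_Integration.integral_diff[OF i, symmetric]
      by (intro Bochner_Integration.integral_cong) (auto simp: indicator_def)
    then have "(\<integral>x. max 0 (G x) * indicator (box c d) x \<partial>lborel) = (\<integral>x. max 0 (- G x) * indicator (box c d) x \<partial>lborel)"
      using z by simp
    moreover have "emeasure (density lborel P) (box c d) = ennreal (\<integral>x. max 0 (G x) * indicator (box c d) x \<partial>lborel)"
      unfolding nn_integral_eq_integral[OF i(1), simplified, symmetric] P_def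
      by (subst emeasure_density) (auto intro!: nn_integral_cong simp: indicator_def)
    moreover have "emeasure (density lborel N) (box c d) = ennreal (\<integral>x. max 0 (- G x) * indicator (box c d) x \<partial>lborel)"
      unfolding nn_integral_eq_integral[OF i(2), simplified, symmetric] N_def
      by (subst emeasure_density) (auto intro!: nn_integral_cong simp: indicator_def)
    ultimately show "emeasure (density lborel P) (box c d) = emeasure (density lborel N) (box c d)"
      "emeasure (density lborel P) (box c d) \<noteq> \<infinity>" by auto
  qed
  let ?E = "range (%(a, b). box a b :: 'a set)"
  have "density lborel P = density lborel N"
  proof (rule measure_eqI_generator_eq)
    show "Int_stable ?E" by (auto simp: Int_stable_def box_Int_box)
    show "?E \<subseteq> Pow UNIV" by simp
    show "sets (density lborel P) = sigma_sets UNIV ?E" "sets (density lborel N) = sigma_sets UNIV ?E"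
      by (simp_all add: borel_eq_box)
    let ?A = "%n::nat. box (- (real n *\<^sub>R One)) (real n *\<^sub>R One) :: 'a set"
    show "range ?A \<subseteq> ?E" "(\<Union>i. ?A i) = UNIV" unfolding UN_box_eq_UNIV by auto
    show "emeasure (density lborel P) (?A i) \<noteq> \<infinity>" for i by (rule fin)
    show "emeasure (density lborel P) X = emeasure (density lborel N) X" if "X \<in> ?E" for X
      using that eq by auto
  qed
  then have "AE x in lborel. P x = N x"
    by (intro sigma_finite_measure.density_unique[OF sigma_finite_lborel]) auto
  then show ?thesis
    by eventually_elim (auto simp: P_def N_def max_def split: if_splits)
qed

lemma AE_box_iff_cbox:
  "AE p in (lborel :: (real \<times> real) measure). indicator (box (a, c) (b, d)) p = (indicator (cbox (a, c) (b, d)) p :: real)"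
  using AE_off_lines(1)[of a] AE_off_lines(1)[of b] AE_off_lines(2)[of c] AE_off_lines(2)[of d]
proof eventually_elim
  case (elim p)
  then show ?case by (cases p) (auto simp: indicator_def cbox_Pair_real box_Pair_real)
qed

text \<open>Integrals are known only over rectangles away from the boundary. Restricting g to the
  compact rectangles \<open>K n\<close>, which exhaust the domain, makes every box integral an
  integral of g over such a rectangle, up to null sets.\<close>

lemma rect_integrals_zero_imp_AE:
  fixes g :: "real \<times> real => real"
  assumes g: "set_integrable lborel (box (a1, a2) (b1, b2)) g"
    and z: "!!l1 r1 l2 r2. a1 < l1 ==> l1 <= r1 ==> r1 < b1 ==> a2 < l2 ==> l2 <= r2 ==> r2 < b2 ==>
        (LINT p:cbox (l1, l2) (r1, r2)|lborel. g p) = 0"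
  shows "AE p in lborel. p \<in> box (a1, a2) (b1, b2) --> g p = 0"
proof -
  define h where "h n = 1 / (1 + real n)" for n :: nat
  define K where "K n = cbox (a1 + h n, a2 + h n) (b1 - h n, b2 - h n)" for n
  have hpos: "h n > 0" for n by (simp add: h_def)
  have K: "K n \<subseteq> box (a1, a2) (b1, b2)" for n
    using hpos[of n] by (auto simp: K_def cbox_Pair_real box_Pair_real)
  have "AE p in lborel. indicator (K n) p * g p = 0" for n
  proof (rule box_integrals_zero_imp_AE)
    have "set_integrable lborel (K n) g" by (rule set_integrable_subset[OF g _ K]) (simp add: K_def)
    then show i: "integrable lborel (%p. indicator (K n) p * g p)" by (simp add: set_integrable_def)
    then have [measurable]: "(%p. indicator (K n) p * g p) \<in> borel_measurable lborel" by auto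
    fix c d :: "real \<times> real"
    obtain c1 c2 d1 d2 where cd: "c = (c1, c2)" "d = (d1, d2)" by (meson surj_pair)
    have "(\<integral>p. indicator (box c d) p * (indicator (K n) p * g p) \<partial>lborel) = (\<integral>p. indicator (cbox c d) p * (indicator (K n) p * g p) \<partial>lborel)"
    proof (rule integral_cong_AE)
      show "AE p in lborel. indicator (box c d) p * (indicator (K n) p * g p) = indicator (cbox c d) p * (indicator (K n) p * g p)"
        using AE_box_iff_cbox[of c1 c2 d1 d2] unfolding cd by eventually_elim simp
    qed measurable
    also have "\<dots> = (LINT p:cbox (max c1 (a1 + h n), max c2 (a2 + h n)) (min d1 (b1 - h n), min d2 (b2 - h n))|lborel. g p)"
      unfolding set_lebesgue_integral_def
      by (intro Bochner_Integration.integral_cong) (auto simp: indicator_def cd K_def cbox_Pair_real)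
    also have "\<dots> = 0"
    proof (cases "max c1 (a1 + h n) <= min d1 (b1 - h n) \<and> max c2 (a2 + h n) <= min d2 (b2 - h n)")
      case True
      then show ?thesis using hpos[of n] by (intro z) auto
    next
      case False
      then have "cbox (max c1 (a1 + h n), max c2 (a2 + h n)) (min d1 (b1 - h n), min d2 (b2 - h n)) = {}"
        unfolding cbox_Pair_real by auto
      then show ?thesis by (simp only: set_lebesgue_integral_def) simp
    qed
    finally show "(\<integral>p. indicator (box c d) p * (indicator (K n) p * g p) \<partial>lborel) = 0" .
  qed
  then have "AE p in lborel. \<forall>n. indicator (K n) p * g p = 0" unfolding AE_all_countable by blast
  then show ?thesis
  proof eventually_elim
    case (elim p)
    show ?case
    proof
      assume p: "p \<in> box (a1, a2) (b1, b2)"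
      define m where "m = min (min (fst p - a1) (b1 - fst p)) (min (snd p - a2) (b2 - snd p))"
      have "m > 0" using p by (cases p) (auto simp: m_def box_Pair_real)
      then obtain n where "inverse (real (Suc n)) < m" using reals_Archimedean by blast
      then have "h n < m" by (simp add: h_def divide_inverse)
      then have "p \<in> K n" by (cases p) (auto simp: m_def K_def cbox_Pair_real)
      then show "g p = 0" using elim[rule_format, of n] by simp
    qed
  qed
qed

lemma set_integrable_mult_continuous:
  fixes k h :: "'a::euclidean_space => real"
  assumes k: "set_integrable lborel (box a b) k" and h: "continuous_on (cbox a b) h"
  shows "set_integrable lborel (box a b) (%p. k p * h p)"
proof -
  have "bounded (h ` cbox a b)"
    by (intro compact_imp_bounded compact_continuous_image compact_cbox h)
  then obtain M where M: "!!p. p \<in> cbox a b ==> \<bar>h p\<bar> <= M" by (auto simp: bounded_iff)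
  show ?thesis unfolding set_integrable_def
  proof (rule Bochner_Integration.integrable_bound)
  show "integrable lborel (%p. M * (indicator (box a b) p *\<^sub>R k p))" using k by (simp add: set_integrable_def)
  have "(%p. indicator (box a b) p *\<^sub>R k p) \<in> borel_measurable lborel" using k by (auto simp: set_integrable_def)
  moreover have "(%p. indicator (cbox a b) p *\<^sub>R h p) \<in> borel_measurable lborel"
    using borel_measurable_continuous_on_indicator[OF _ h] by simp
  ultimately have "(%p. (indicator (box a b) p *\<^sub>R k p) * (indicator (cbox a b) p *\<^sub>R h p)) \<in> borel_measurable lborel"
    by (rule borel_measurable_times)
  moreover have "(%p. (indicator (box a b) p *\<^sub>R k p) * (indicator (cbox a b) p *\<^sub>R h p)) = (%p. indicator (box a b) p *\<^sub>R (k p * h p))"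
    using box_subset_cbox by (auto simp: indicator_def fun_eq_iff)
  ultimately show "(%p. indicator (box a b) p *\<^sub>R (k p * h p)) \<in> borel_measurable lborel" by simp
  show "AE p in lborel. norm (indicator (box a b) p *\<^sub>R (k p * h p)) <= norm (M * (indicator (box a b) p *\<^sub>R k p))"
  proof (intro AE_I2)
    fix p
    show "norm (indicator (box a b) p *\<^sub>R (k p * h p)) <= norm (M * (indicator (box a b) p *\<^sub>R k p))"
    proof (cases "p \<in> box a b")
      case True
      then have "\<bar>h p\<bar> <= M" using M box_subset_cbox by blast
      then have "\<bar>k p\<bar> * \<bar>h p\<bar> <= \<bar>k p\<bar> * \<bar>M\<bar>" by (intro mult_left_mono) auto
      then show ?thesis using True by (simp add: abs_mult mult_ac)
    qed simp
  qed
  qed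
qed

lemma continuous_on_tensor:
  assumes "smooth1 f" "smooth1 h" shows "continuous_on A (%p. f (fst p) * h (snd p))"
  by (intro continuous_on_mult continuous_on_compose2[OF smooth1_cont[OF assms(1), of UNIV]]
     continuous_on_compose2[OF smooth1_cont[OF assms(2), of UNIV]] continuous_on_fst continuous_on_snd continuous_on_id) auto

text \<open>The difference of the two candidates is a weak divergence of the zero field, so by
  \<open>divergence_rect\<close> its integral over every inner rectangle vanishes.\<close>

lemma weak_deriv_unique:
  assumes "weak_deriv (box (a1, a2) (b1, b2)) \<alpha> f g" "weak_deriv (box (a1, a2) (b1, b2)) \<alpha> f g'"
    and gi: "set_integrable lborel (box (a1, a2) (b1, b2)) g" "set_integrable lborel (box (a1, a2) (b1, b2)) g'"
  shows "AE p in lborel. p \<in> box (a1, a2) (b1, b2) --> g p = g' p"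
proof -
  let ?\<Omega> = "box (a1, a2) (b1, b2)"
  have gd: "set_integrable lborel ?\<Omega> (%p. g p - g' p)" using gi by (rule set_integral_diff)
  have "AE p in lborel. p \<in> ?\<Omega> --> g p - g' p = 0"
  proof (rule rect_integrals_zero_imp_AE[OF gd])
    fix l1 r1 l2 r2 assume lr: "a1 < l1" "l1 <= r1" "r1 < b1" "a2 < l2" "l2 <= r2" "r2 < b2"
    have "integral {l2..r2} (%y. 0) - integral {l2..r2} (%y. 0::real)
       + integral {l1..r1} (%x. 0) - integral {l1..r1} (%x. 0)
       = (LINT p:cbox (l1, l2) (r1, r2)|lborel. g p - g' p)"
    proof (rule divergence_rect[where ?F1.0 = "%_. 0" and ?F2.0 = "%_. 0", OF _ _ gd _ lr])
      fix f' h assume sm: "smooth1 f'" "smooth1 h" "test_fun ?\<Omega> (%p. f' (fst p) * h (snd p))"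
      have si: "set_integrable lborel ?\<Omega> (%p. k p * (f' (fst p) * h (snd p)))" if "set_integrable lborel ?\<Omega> k" for k
        by (rule set_integrable_mult_continuous[OF that continuous_on_tensor[OF sm(1,2)]])
      have "(-1) ^ (fst \<alpha> + snd \<alpha>) * (LINT p:?\<Omega>|lborel. g p * (f' (fst p) * h (snd p)))
        = (-1) ^ (fst \<alpha> + snd \<alpha>) * (LINT p:?\<Omega>|lborel. g' p * (f' (fst p) * h (snd p)))"
        using assms(1)[unfolded weak_deriv_def, THEN conjunct2, THEN conjunct2, rule_format, OF sm(3)]
          assms(2)[unfolded weak_deriv_def, THEN conjunct2, THEN conjunct2, rule_format, OF sm(3)] by (rule trans[OF sym])
      then have "(LINT p:?\<Omega>|lborel. g p * (f' (fst p) * h (snd p))) = (LINT p:?\<Omega>|lborel. g' p * (f' (fst p) * h (snd p)))"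
        by simp
      then have "(LINT p:?\<Omega>|lborel. (g p - g' p) * (f' (fst p) * h (snd p))) = 0"
        unfolding left_diff_distrib set_integral_diff(2)[OF si[OF gi(1)] si[OF gi(2)]] by simp
      then show "(LINT p:?\<Omega>|lborel. 0 * (deriv f' (fst p) * h (snd p)) + 0 * (f' (fst p) * deriv h (snd p))) =
       - (LINT p:?\<Omega>|lborel. (g p - g' p) * (f' (fst p) * h (snd p)))" by simp
    qed auto
    then show "(LINT p:cbox (l1, l2) (r1, r2)|lborel. g p - g' p) = 0" by simp
  qed
  then show ?thesis by simp
qed

text \<open>Weak derivatives control only averages over sides of rectangles; letting the side shrink
  to its left end recovers a bound at a point, as the derivative of the primitive.\<close>

lemma average_bound_imp_bound:
  fixes \<phi> :: "real => real"
  assumes "continuous_on {l..r} \<phi>" "l < r" "!!s. l < s ==> s <= r ==> \<bar>integral {l..s} \<phi>\<bar> <= c * (s - l)"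
  shows "\<bar>\<phi> l\<bar> <= c"
proof -
  have "((%x. integral {l..x} \<phi>) has_real_derivative \<phi> l) (at l within {l..r})"
    by (rule integral_has_real_derivative) (use assms in auto)
  then have "((%y. \<bar>(integral {l..y} \<phi> - integral {l..l} \<phi>) / (y - l)\<bar>) \<longlongrightarrow> \<bar>\<phi> l\<bar>) (at l within {l..r})"
    unfolding has_field_derivative_iff by (rule tendsto_rabs)
  moreover have "eventually (%y. \<bar>(integral {l..y} \<phi> - integral {l..l} \<phi>) / (y - l)\<bar> <= c) (at l within {l..r})"
    unfolding eventually_at_filter
  proof (intro always_eventually allI impI)
    fix y assume "y \<noteq> l" "y \<in> {l..r}"
    then show "\<bar>(integral {l..y} \<phi> - integral {l..l} \<phi>) / (y - l)\<bar> <= c"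
      using assms(3)[of y] by (auto simp: abs_divide divide_le_eq)
  qed
  moreover have "at l within {l..r} \<noteq> bot"
    using assms(2) by (simp add: at_within_Icc_at_right trivial_limit_at_right_real)
  ultimately show ?thesis by (rule tendsto_upperbound)
qed

lemma integrable_indicator_boxes:
  fixes a b :: "'a::euclidean_space"
  shows "integrable lborel (indicator (box a b) :: 'a => real)" "integrable lborel (indicator (cbox a b) :: 'a => real)"
  using emeasure_lborel_box_finite[of a b] emeasure_lborel_cbox_finite[of a b]
  by (intro integrable_real_indicator; simp add: less_top[symmetric])+

lemma rect_LINT_bound:
  fixes g :: "real \<times> real => real"
  assumes g: "set_integrable lborel (cbox (l1, l2) (r1, r2)) g"
    and M: "AE p in lborel. p \<in> cbox (l1, l2) (r1, r2) --> \<bar>g p\<bar> <= M" and lr: "l1 <= r1" "l2 <= r2"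
  shows "\<bar>LINT p:cbox (l1, l2) (r1, r2)|lborel. g p\<bar> <= M * (r1 - l1) * (r2 - l2)"
proof -
  let ?K = "cbox (l1, l2) (r1, r2)"
  have "\<bar>LINT p:?K|lborel. g p\<bar> <= (\<integral>p. norm (indicator ?K p *\<^sub>R g p) \<partial>lborel)"
    unfolding set_lebesgue_integral_def real_norm_def[symmetric] by (rule integral_norm_bound)
  also have "\<dots> <= (\<integral>p. M * indicator ?K p \<partial>lborel)"
  proof (rule integral_mono_AE)
    show "integrable lborel (%p. norm (indicator ?K p *\<^sub>R g p))"
      using g unfolding set_integrable_def by (rule integrable_norm)
    show "integrable lborel (%p. M * indicator ?K p)" by (intro integrable_mult_right integrable_indicator_boxes)
    show "AE p in lborel. norm (indicator ?K p *\<^sub>R g p) <= M * indicator ?K p"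
      using M by eventually_elim (auto simp: indicator_def)
  qed
  also have "\<dots> = M * measure lborel ?K" by simp
  also have "measure lborel ?K = (r1 - l1) * (r2 - l2)" using lr by (simp add: content_Pair)
  finally show ?thesis by (simp add: mult.assoc)
qed

subsection \<open>Bounded weak derivatives and Lipschitz continuity\<close>

lemma box_slice_continuous:
  fixes f :: "real \<times> real => real"
  assumes "continuous_on (box (a1, a2) (b1, b2)) f"
  shows "a1 < x ==> x < b1 ==> a2 < l ==> r < b2 ==> continuous_on {l..r} (%y. f (x, y))"
    "a2 < y ==> y < b2 ==> a1 < l ==> r < b1 ==> continuous_on {l..r} (%x. f (x, y))"
  by (rule continuous_on_compose2[OF assms], auto intro!: continuous_intros simp: box_Pair_real)+

text \<open>The divergence theorem for a field with one component equal to 0.\<close>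

lemma weak_deriv_flux:
  assumes f: "continuous_on (box (a1, a2) (b1, b2)) f" and g: "set_integrable lborel (box (a1, a2) (b1, b2)) g"
    and lr: "a1 < l1" "l1 <= r1" "r1 < b1" "a2 < l2" "l2 <= r2" "r2 < b2"
  shows "weak_deriv (box (a1, a2) (b1, b2)) (1, 0) f g ==>
      integral {l2..r2} (%y. f (r1, y)) - integral {l2..r2} (%y. f (l1, y)) = (LINT p:cbox (l1, l2) (r1, r2)|lborel. g p)"
    "weak_deriv (box (a1, a2) (b1, b2)) (0, 1) f g ==>
      integral {l1..r1} (%x. f (x, r2)) - integral {l1..r1} (%x. f (x, l2)) = (LINT p:cbox (l1, l2) (r1, r2)|lborel. g p)"
proof -
  assume w: "weak_deriv (box (a1, a2) (b1, b2)) (1, 0) f g"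
  have "integral {l2..r2} (%y. f (r1, y)) - integral {l2..r2} (%y. f (l1, y)) 
      + integral {l1..r1} (%x. 0) - integral {l1..r1} (%x. 0) = (LINT p:cbox (l1, l2) (r1, r2)|lborel. g p)"
    by (rule divergence_rect[where ?F2.0 = "%_. 0", OF f continuous_on_const g _ lr]) (use weak_deriv_tensor[OF w] in simp)
  then show "integral {l2..r2} (%y. f (r1, y)) - integral {l2..r2} (%y. f (l1, y)) = (LINT p:cbox (l1, l2) (r1, r2)|lborel. g p)"
    by simp
next
  assume w: "weak_deriv (box (a1, a2) (b1, b2)) (0, 1) f g"
  have "integral {l2..r2} (%y. 0) - integral {l2..r2} (%y. 0) 
      + integral {l1..r1} (%x. f (x, r2)) - integral {l1..r1} (%x. f (x, l2)) = (LINT p:cbox (l1, l2) (r1, r2)|lborel. g p)"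
    by (rule divergence_rect[where ?F1.0 = "%_. 0", OF continuous_on_const f g _ lr]) (use weak_deriv_tensor[OF w] in simp)
  then show "integral {l1..r1} (%x. f (x, r2)) - integral {l1..r1} (%x. f (x, l2)) = (LINT p:cbox (l1, l2) (r1, r2)|lborel. g p)"
    by simp
qed

lemma Linf_integrable:
  fixes g :: "real \<times> real => real"
  assumes "Linf (box a b) g" shows "set_integrable lborel (box a b) g"
proof -
  obtain M where M: "AE x in lborel. x \<in> box a b --> \<bar>g x\<bar> <= M" and m: "set_borel_measurable lborel (box a b) g"
    using assms by (auto simp: Linf_def)
  show ?thesis unfolding set_integrable_def
  proof (rule Bochner_Integration.integrable_bound)
    show "integrable lborel (%p. M * indicator (box a b) p)" by (intro integrable_mult_right integrable_indicator_boxes)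
    show "(%x. indicator (box a b) x *\<^sub>R g x) \<in> borel_measurable lborel" using m by (simp add: set_borel_measurable_def)
    show "AE x in lborel. norm (indicator (box a b) x *\<^sub>R g x) <= norm (M * indicator (box a b) x)"
      using M by eventually_elim (auto simp: indicator_def)
  qed
qed

lemma L2_integrable:
  fixes g :: "real \<times> real => real"
  assumes "L2 (box a b) g" shows "set_integrable lborel (box a b) g"
  unfolding set_integrable_def
proof (rule Bochner_Integration.integrable_bound)
  have "integrable lborel (%p. indicator (box a b) p + indicator (box a b) p *\<^sub>R (g p)\<^sup>2)"
    using assms by (intro Bochner_Integration.integrable_add integrable_indicator_boxes)
      (simp add: L2_def set_integrable_def)
  then show "integrable lborel (%p. indicator (box a b) p + indicator (box a b) p *\<^sub>R (g p)\<^sup>2)" .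
  show "(%x. indicator (box a b) x *\<^sub>R g x) \<in> borel_measurable lborel" using assms by (simp add: L2_def set_borel_measurable_def)
  have "\<bar>t\<bar> <= 1 + t\<^sup>2" for t :: real
    using zero_le_power2[of "\<bar>t\<bar> - 1"] by (simp add: power2_diff)
  then show "AE x in lborel. norm (indicator (box a b) x *\<^sub>R g x) <= norm (indicator (box a b) x + indicator (box a b) x *\<^sub>R (g x)\<^sup>2)"
    by (intro AE_I2) (auto simp: indicator_def)
qed

text \<open>By \<open>weak_deriv_flux\<close> the change of f between two parallel sides, integrated
  along the side, is the integral of a bounded weak derivative over the rectangle between them.
  Shrinking the side gives the pointwise bound.\<close>

lemma W1inf_Lipschitz:
  fixes f :: "real \<times> real => real"
  assumes f: "continuous_on (box (a1, a2) (b1, b2)) f" and w: "W1inf (box (a1, a2) (b1, b2)) f"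
  obtains L where "L >= 0"
    "!!x x' y. a1 < x ==> x <= x' ==> x' < b1 ==> a2 < y ==> y < b2 ==> \<bar>f (x', y) - f (x, y)\<bar> <= L * (x' - x)"
    "!!x y y'. a1 < x ==> x < b1 ==> a2 < y ==> y <= y' ==> y' < b2 ==> \<bar>f (x, y') - f (x, y)\<bar> <= L * (y' - y)"
proof -
  let ?\<Omega> = "box (a1, a2) (b1, b2)"
  obtain g1 g2 where g1: "weak_deriv ?\<Omega> (1, 0) f g1" "Linf ?\<Omega> g1" and g2: "weak_deriv ?\<Omega> (0, 1) f g2" "Linf ?\<Omega> g2"
    using w[unfolded W1inf_def, rule_format, of 1 0] w[unfolded W1inf_def, rule_format, of 0 1] by auto
  obtain M1 M2 where M: "AE x in lborel. x \<in> ?\<Omega> --> \<bar>g1 x\<bar> <= M1" "AE x in lborel. x \<in> ?\<Omega> --> \<bar>g2 x\<bar> <= M2"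
    using g1(2) g2(2) by (auto simp: Linf_def)
  define L where "L = max 0 (max M1 M2)"
  have bd: "\<bar>LINT p:cbox (l1, l2) (r1, r2)|lborel. g p\<bar> <= L * (r1 - l1) * (r2 - l2)"
    if "a1 < l1" "l1 <= r1" "r1 < b1" "a2 < l2" "l2 <= r2" "r2 < b2" "g = g1 \<or> g = g2" for l1 r1 l2 r2 g
  proof (rule rect_LINT_bound)
    have sub: "cbox (l1, l2) (r1, r2) \<subseteq> ?\<Omega>" using that by (auto simp: cbox_Pair_real box_Pair_real)
    have "set_integrable lborel ?\<Omega> g" using that Linf_integrable g1 g2 by auto
    then show "set_integrable lborel (cbox (l1, l2) (r1, r2)) g" using sub by (rule_tac set_integrable_subset) auto
    have "AE p in lborel. p \<in> ?\<Omega> --> \<bar>g p\<bar> <= L"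
      using M by eventually_elim (use that in \<open>auto simp: L_def\<close>)
    then show "AE p in lborel. p \<in> cbox (l1, l2) (r1, r2) --> \<bar>g p\<bar> <= L"
      by eventually_elim (use sub in auto)
  qed (use that in auto)
  show ?thesis
  proof (rule that[of L])
    show "L >= 0" by (simp add: L_def)
    show "\<bar>f (x', y) - f (x, y)\<bar> <= L * (x' - x)" if x: "a1 < x" "x <= x'" "x' < b1" "a2 < y" "y < b2" for x x' y
    proof -
      define r where "r = (y + b2) / 2"
      have r: "y < r" "r < b2" using x by (auto simp: r_def)
      have c: "continuous_on {y..s} (%t. f (x', t))" "continuous_on {y..s} (%t. f (x, t))" if "s <= r" for s
        by (intro box_slice_continuous(1)[OF f]; use x r that in auto)+
      show ?thesis
      proof (rule average_bound_imp_bound[where \<phi> = "%t. f (x', t) - f (x, t)", OF _ r(1)])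
        show "continuous_on {y..r} (%t. f (x', t) - f (x, t))" by (intro continuous_on_diff c) auto
        fix s assume s: "y < s" "s <= r"
        have "integral {y..s} (%t. f (x', t) - f (x, t)) = integral {y..s} (%t. f (x', t)) - integral {y..s} (%t. f (x, t))"
          by (intro Henstock_Kurzweil_Integration.integral_diff integrable_continuous_real c s)
        also have "\<dots> = (LINT p:cbox (x, y) (x', s)|lborel. g1 p)"
          by (rule weak_deriv_flux(1)[OF f Linf_integrable[OF g1(2)] _ _ _ _ _ _ g1(1)]) (use x r s in auto)
        finally show "\<bar>integral {y..s} (%t. f (x', t) - f (x, t))\<bar> <= L * (x' - x) * (s - y)"
          using bd[of x x' y s g1] x r s by simp
      qed
    qed
    show "\<bar>f (x, y') - f (x, y)\<bar> <= L * (y' - y)" if x: "a1 < x" "x < b1" "a2 < y" "y <= y'" "y' < b2" for x y y'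
    proof -
      define r where "r = (x + b1) / 2"
      have r: "x < r" "r < b1" using x by (auto simp: r_def)
      have c: "continuous_on {x..s} (%t. f (t, y'))" "continuous_on {x..s} (%t. f (t, y))" if "s <= r" for s
        by (intro box_slice_continuous(2)[OF f]; use x r that in auto)+
      show ?thesis
      proof (rule average_bound_imp_bound[where \<phi> = "%t. f (t, y') - f (t, y)", OF _ r(1)])
        show "continuous_on {x..r} (%t. f (t, y') - f (t, y))" by (intro continuous_on_diff c) auto
        fix s assume s: "x < s" "s <= r"
        have "integral {x..s} (%t. f (t, y') - f (t, y)) = integral {x..s} (%t. f (t, y')) - integral {x..s} (%t. f (t, y))"
          by (intro Henstock_Kurzweil_Integration.integral_diff integrable_continuous_real c s)
        also have "\<dots> = (LINT p:cbox (x, y) (s, y')|lborel. g2 p)"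
          by (rule weak_deriv_flux(2)[OF f Linf_integrable[OF g2(2)] _ _ _ _ _ _ g2(1)]) (use x r s in auto)
        finally show "\<bar>integral {x..s} (%t. f (t, y') - f (t, y))\<bar> <= L * (y' - y) * (s - x)"
          using bd[of x s y y' g2] x r s by (simp add: mult_ac)
      qed
    qed
  qed
qed

subsection \<open>Piecewise differentiable functions have weak derivatives\<close>

text \<open>The integrand is the derivative of f times the test function off a finite set, and that
  product is continuous, so the gauge integral exists and equals the boundary terms, which
  vanish.\<close>

lemma integration_by_parts_test:
  fixes f \<phi> :: "real => real"
  assumes "a <= b" "finite S" "continuous_on {a..b} f" "!!x. x \<in> {a<..<b} - S ==> (f has_real_derivative f' x) (at x)"
    and "!!x. (\<phi> has_real_derivative \<phi>' x) (at x)" "\<phi> a = 0" "\<phi> b = 0"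
  shows "((%x. f x * \<phi>' x + f' x * \<phi> x) has_integral 0) {a..b}"
proof -
  have "((%x. f x * \<phi>' x + f' x * \<phi> x) has_integral f b * \<phi> b - f a * \<phi> a) {a..b}"
  proof (rule fundamental_theorem_of_calculus_interior_strong[OF assms(2,1)])
    fix x assume "x \<in> {a<..<b} - S"
    then have "((%x. f x * \<phi> x) has_real_derivative f x * \<phi>' x + f' x * \<phi> x) (at x)"
      using DERIV_mult[OF assms(4) assms(5)] by (simp add: algebra_simps)
    then show "((%x. f x * \<phi> x) has_vector_derivative f x * \<phi>' x + f' x * \<phi> x) (at x)"
      by (simp add: has_real_derivative_iff_has_vector_derivative)
  next
    have "continuous_on {a..b} \<phi>"
      using assms(5) by (meson DERIV_isCont continuous_at_imp_continuous_on)
    then show "continuous_on {a..b} (%x. f x * \<phi> x)" by (intro continuous_on_mult assms)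
  qed
  then show ?thesis using assms by simp
qed

lemma test_funD:
  assumes "test_fun \<Omega> \<phi>"
  shows "continuous_on A \<phi>" "continuous_on A (pdir d \<phi>)"
    "((%t. \<phi> (t, y)) has_real_derivative pdir True \<phi> (x, y)) (at x)"
    "((%t. \<phi> (x, t)) has_real_derivative pdir False \<phi> (x, y)) (at y)"
    "p \<notin> \<Omega> ==> \<phi> p = 0"
proof -
  have s: "continuous_on UNIV (iter_pd ds \<phi>)" "pdir_exists d (iter_pd ds \<phi>) p" for ds d p
  proof -
    have "\<forall>ds. continuous_on UNIV (iter_pd ds \<phi>) \<and> (\<forall>d p. pdir_exists d (iter_pd ds \<phi>) p)"
      using assms unfolding test_fun_def smooth2_def by (rule conjunct1)
    from spec[OF this, of ds] show "continuous_on UNIV (iter_pd ds \<phi>)" "pdir_exists d (iter_pd ds \<phi>) p"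
      by (cases p; simp)+
  qed
  show "continuous_on A \<phi>" using s(1)[of "[]"] continuous_on_subset by auto
  show "continuous_on A (pdir d \<phi>)" using s(1)[of "[d]"] continuous_on_subset by auto
  show "((%t. \<phi> (t, y)) has_real_derivative pdir True \<phi> (x, y)) (at x)"
    using s(2)[of True "[]" "(x, y)"] by (auto simp: pdir_exists_def pdir_def DERIV_deriv_iff_real_differentiable)
  show "((%t. \<phi> (x, t)) has_real_derivative pdir False \<phi> (x, y)) (at y)"
    using s(2)[of False "[]" "(x, y)"] by (auto simp: pdir_exists_def pdir_def DERIV_deriv_iff_real_differentiable)
  have "{x. \<phi> x \<noteq> 0} \<subseteq> \<Omega>"
    by (rule subset_trans[OF closure_subset]) (use assms in \<open>simp add: test_fun_def\<close>)
  then show "p \<notin> \<Omega> ==> \<phi> p = 0" by auto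
qed

lemma loc_integrableI:
  "set_integrable lborel \<Omega> f ==> loc_integrable \<Omega> f"
  unfolding loc_integrable_def
proof (intro allI impI, elim conjE)
  fix K assume "set_integrable lborel \<Omega> f" "compact K" "K \<subseteq> \<Omega>"
  then show "set_integrable lborel K f"
    by (intro set_integrable_subset[of lborel \<Omega> f K]) (auto intro: borel_compact)
qed

lemma set_integrable_box_of_continuous:
  fixes f :: "'a::euclidean_space => real"
  assumes "continuous_on (cbox a b) f" shows "set_integrable lborel (box a b) f"
  by (rule set_integrable_subset[OF LINT_cbox_HK(1)[OF assms]]) (auto simp: box_subset_cbox)

lemma weak_deriv_0: 
  assumes "continuous_on (cbox a b) f" shows "weak_deriv (box a b) (0, 0) f f"
  using loc_integrableI[OF set_integrable_box_of_continuous[OF assms]]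
  by (simp add: weak_deriv_def Dcl_def)

text \<open>Bridge from the gauge integral, where the integration by parts is done, to the Lebesgue
  integral that occurs in Fubini's theorem.\<close>

lemma integrable_HK_zero:
  fixes h :: "real => real"
  assumes "integrable lborel (%x. indicator {a<..<b} x * h x)" "(h has_integral 0) {a..b}"
  shows "(\<integral>x. indicator {a<..<b} x * h x \<partial>lborel) = 0"
proof -
  have "((%x. indicator {a<..<b} x * h x) has_integral (\<integral>x. indicator {a<..<b} x * h x \<partial>lborel)) UNIV"
    by (rule has_integral_integral_lborel[OF assms(1)])
  moreover have "((%x. if x \<in> {a..b} then h x else 0) has_integral 0) UNIV"
    using assms(2) by (simp only: has_integral_restrict_UNIV)
  then have "((%x. indicator {a<..<b} x * h x) has_integral 0) UNIV"
    by (rule has_integral_spike[of "{a, b}", rotated 2]) (auto simp: indicator_def)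
  ultimately show ?thesis by (rule has_integral_unique)
qed

text \<open>Fubini reduces the claim to integration by parts along almost every line. Along a line f
  is continuous, so the kinks in \<open>S\<close> leave no jump terms; the lines indexed by
  \<open>T\<close>, on which nothing is known, form a null set.\<close>

lemma weak_deriv_of_piecewise:
  fixes f f' :: "real \<times> real => real"
  assumes ab: "a1 <= b1" "a2 <= b2" and f: "continuous_on (cbox (a1, a2) (b1, b2)) f"
    and f': "set_integrable lborel (box (a1, a2) (b1, b2)) f'" and S: "finite S"
  shows "(!!x y. (x, y) \<in> box (a1, a2) (b1, b2) ==> x \<notin> S ==> y \<notin> T ==> ((%t. f (t, y)) has_real_derivative f' (x, y)) (at x))
     ==> finite T ==> weak_deriv (box (a1, a2) (b1, b2)) (1, 0) f f'"
    "(!!x y. (x, y) \<in> box (a1, a2) (b1, b2) ==> x \<notin> T ==> y \<notin> S ==> ((%t. f (x, t)) has_real_derivative f' (x, y)) (at y))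
     ==> finite T ==> weak_deriv (box (a1, a2) (b1, b2)) (0, 1) f f'"
proof -
  let ?\<Omega> = "box (a1, a2) (b1, b2)"
  have fi: "set_integrable lborel ?\<Omega> f" by (rule set_integrable_box_of_continuous[OF f])
  have split: "(LINT p:?\<Omega>|lborel. f p * \<psi> p) = - (LINT p:?\<Omega>|lborel. f' p * \<phi> p)"
    if "(LINT p:?\<Omega>|lborel. f p * \<psi> p + f' p * \<phi> p) = 0" "continuous_on UNIV \<phi>" "continuous_on UNIV \<psi>" for \<phi> \<psi>
  proof -
    have "(LINT p:?\<Omega>|lborel. f p * \<psi> p + f' p * \<phi> p) = (LINT p:?\<Omega>|lborel. f p * \<psi> p) + (LINT p:?\<Omega>|lborel. f' p * \<phi> p)"
      by (intro set_integral_add(2) set_integrable_mult_continuous fi f')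
        (use that continuous_on_subset in blast)+
    then show ?thesis using that by simp
  qed
  have int: "integrable (lborel \<Otimes>\<^sub>M lborel) (%(x, y). indicator ?\<Omega> (x, y) * (f (x, y) * \<psi> (x, y) + f' (x, y) * \<phi> (x, y)))"
    if "continuous_on UNIV \<phi>" "continuous_on UNIV \<psi>" for \<phi> \<psi>
  proof -
    have "set_integrable lborel ?\<Omega> (%p. f p * \<psi> p + f' p * \<phi> p)"
      by (intro set_integral_add(1) set_integrable_mult_continuous fi f')
        (use that continuous_on_subset in blast)+
    then show ?thesis by (simp add: lborel_prod set_integrable_def split_def)
  qed
  have ind: "indicator ?\<Omega> (x, y) = (indicator {a1<..<b1} x * indicator {a2<..<b2} y :: real)" for x y
    by (auto simp: box_Pair_real indicator_def)
  have AET: "AE y in (lborel :: real measure). y \<notin> T" if "finite T" for T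
    by (rule AE_not_in) (simp add: finite_imp_null_set_lborel that)
  { assume d: "!!x y. (x, y) \<in> ?\<Omega> ==> x \<notin> S ==> y \<notin> T ==> ((%t. f (t, y)) has_real_derivative f' (x, y)) (at x)" and T: "finite T"
    show "weak_deriv ?\<Omega> (1, 0) f f'"
      unfolding weak_deriv_def
    proof (intro conjI allI impI loc_integrableI fi f')
      fix \<phi> assume t: "test_fun ?\<Omega> \<phi>"
      let ?h = "%x y. f (x, y) * pdir True \<phi> (x, y) + f' (x, y) * \<phi> (x, y)"
      note I = int[OF test_funD(1)[OF t] test_funD(2)[OF t, of _ True]]
      have "(LINT p:?\<Omega>|lborel. f p * pdir True \<phi> p + f' p * \<phi> p)
          = (\<integral>y. (\<integral>x. indicator ?\<Omega> (x, y) * ?h x y \<partial>lborel) \<partial>lborel)"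
        unfolding lborel_pair.integral_snd[OF I] by (simp add: lborel_prod set_lebesgue_integral_def split_def)
      also have "\<dots> = integral\<^sup>L lborel (%y::real. 0)"
      proof (rule integral_cong_AE)
        show "(%y. \<integral>x. indicator ?\<Omega> (x, y) * ?h x y \<partial>lborel) \<in> borel_measurable lborel"
          using lborel_pair.integrable_snd[OF I] by auto
        show "AE y in lborel. (\<integral>x. indicator ?\<Omega> (x, y) * ?h x y \<partial>lborel) = 0"
          using lborel_pair.AE_integrable_snd[OF I] AET[OF T]
        proof eventually_elim
          case (elim y)
          show ?case
          proof (cases "y \<in> {a2<..<b2}")
            case True
            have "(\<integral>x. indicator {a1<..<b1} x * ?h x y \<partial>lborel) = 0"
            proof (rule integrable_HK_zero)
              show "integrable lborel (%x. indicator {a1<..<b1} x * ?h x y)" using elim(1) True by (simp add: ind)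
              show "((%x. ?h x y) has_integral 0) {a1..b1}"
              proof (rule integration_by_parts_test[OF ab(1) S])
                show "continuous_on {a1..b1} (%x. f (x, y))"
                  by (rule continuous_on_compose2[OF f]) (use True in \<open>auto intro!: continuous_intros simp: cbox_Pair_real\<close>)
                show "((%x. f (x, y)) has_real_derivative f' (x, y)) (at x)" if "x \<in> {a1<..<b1} - S" for x
                  using d[of x y] that True elim(2) by (auto simp: box_Pair_real)
              qed (use test_funD[OF t] in \<open>auto simp: box_Pair_real\<close>)
            qed
            then show ?thesis using True by (simp add: ind)
          qed (simp add: ind)
        qed
      qed simp
      finally have "(LINT p:?\<Omega>|lborel. f p * pdir True \<phi> p + f' p * \<phi> p) = 0" by simp
      from split[OF this test_funD(1)[OF t] test_funD(2)[OF t]]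
      show "(LINT x:?\<Omega>|lborel. f x * Dcl (1, 0) \<phi> x) = (- 1) ^ (fst (1, 0) + snd (1::nat, 0::nat)) * (LINT x:?\<Omega>|lborel. f' x * \<phi> x)"
        by (simp add: Dcl_def)
    qed }
  { assume d: "!!x y. (x, y) \<in> ?\<Omega> ==> x \<notin> T ==> y \<notin> S ==> ((%t. f (x, t)) has_real_derivative f' (x, y)) (at y)" and T: "finite T"
    show "weak_deriv ?\<Omega> (0, 1) f f'"
      unfolding weak_deriv_def
    proof (intro conjI allI impI loc_integrableI fi f')
      fix \<phi> assume t: "test_fun ?\<Omega> \<phi>"
      let ?h = "%x y. f (x, y) * pdir False \<phi> (x, y) + f' (x, y) * \<phi> (x, y)"
      note I = int[OF test_funD(1)[OF t] test_funD(2)[OF t, of _ False]]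
      have "(LINT p:?\<Omega>|lborel. f p * pdir False \<phi> p + f' p * \<phi> p)
          = (\<integral>x. (\<integral>y. indicator ?\<Omega> (x, y) * ?h x y \<partial>lborel) \<partial>lborel)"
        unfolding lborel_pair.integral_fst[OF I] by (simp add: lborel_prod set_lebesgue_integral_def split_def)
      also have "\<dots> = integral\<^sup>L lborel (%x::real. 0)"
      proof (rule integral_cong_AE)
        show "(%x. \<integral>y. indicator ?\<Omega> (x, y) * ?h x y \<partial>lborel) \<in> borel_measurable lborel"
          using lborel_pair.integrable_fst[OF I] by auto
        show "AE x in lborel. (\<integral>y. indicator ?\<Omega> (x, y) * ?h x y \<partial>lborel) = 0"
          using lborel_pair.AE_integrable_fst[OF I] AET[OF T]
        proof eventually_elim
          case (elim x)
          show ?case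
          proof (cases "x \<in> {a1<..<b1}")
            case True
            have "(\<integral>y. indicator {a2<..<b2} y * ?h x y \<partial>lborel) = 0"
            proof (rule integrable_HK_zero)
              show "integrable lborel (%y. indicator {a2<..<b2} y * ?h x y)" using elim(1) True by (simp add: ind)
              show "((%y. ?h x y) has_integral 0) {a2..b2}"
              proof (rule integration_by_parts_test[OF ab(2) S])
                show "continuous_on {a2..b2} (%y. f (x, y))"
                  by (rule continuous_on_compose2[OF f]) (use True in \<open>auto intro!: continuous_intros simp: cbox_Pair_real\<close>)
                show "((%y. f (x, y)) has_real_derivative f' (x, y)) (at y)" if "y \<in> {a2<..<b2} - S" for y
                  using d[of x y] that True elim(2) by (auto simp: box_Pair_real)
              qed (use test_funD[OF t] in \<open>auto simp: box_Pair_real\<close>)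
            qed
            then show ?thesis using True by (simp add: ind)
          qed (simp add: ind)
        qed
      qed simp
      finally have "(LINT p:?\<Omega>|lborel. f p * pdir False \<phi> p + f' p * \<phi> p) = 0" by simp
      from split[OF this test_funD(1)[OF t] test_funD(2)[OF t]]
      show "(LINT x:?\<Omega>|lborel. f x * Dcl (0, 1) \<phi> x) = (- 1) ^ (fst (0, 1) + snd (0::nat, 1::nat)) * (LINT x:?\<Omega>|lborel. f' x * \<phi> x)"
        by (simp add: Dcl_def)
    qed }
qed

subsection \<open>Interpolation on a rectangle for smooth functions\<close>

lemma diff_le_integral_abs_deriv:
  fixes f f' :: "real => real"
  assumes "!!x. (f has_real_derivative f' x) (at x)" "continuous_on {a..b} f'" "s \<in> {a..b}" "t \<in> {a..b}"
  shows "\<bar>f t - f s\<bar> <= integral {a..b} (%x. \<bar>f' x\<bar>)"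
proof -
  have main: "\<bar>f t - f s\<bar> <= integral {a..b} (%x. \<bar>f' x\<bar>)" if "s <= t" "s \<in> {a..b}" "t \<in> {a..b}" for s t
  proof -
    have sub: "{s..t} \<subseteq> {a..b}" using that by auto
    have c: "continuous_on {s..t} f'" using assms(2) sub continuous_on_subset by blast
    have "(f' has_integral f t - f s) {s..t}"
      using assms(1) that(1) by (intro fundamental_theorem_of_calculus)
        (auto simp: has_real_derivative_iff_has_vector_derivative[symmetric] intro: has_field_derivative_at_within)
    then have "f t - f s = integral {s..t} f'" by (simp add: has_integral_iff)
    also have "\<bar>\<dots>\<bar> <= integral {s..t} (%x. \<bar>f' x\<bar>)"
      using integral_norm_bound_integral[of f' "{s..t}" "%x. \<bar>f' x\<bar>"] c
      by (simp add: integrable_continuous_real continuous_on_rabs)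
    also have "\<dots> <= integral {a..b} (%x. \<bar>f' x\<bar>)"
      by (rule integral_subset_le[OF sub]) (use c assms(2) in \<open>auto intro!: integrable_continuous_real continuous_on_rabs\<close>)
    finally show ?thesis .
  qed
  show ?thesis using main[of s t] main[of t s] assms(3,4) by (cases "s <= t") (auto simp: abs_minus_commute)
qed

lemma linear_approx:
  fixes f f' :: "real => real"
  assumes "!!x. (f has_real_derivative f' x) (at x)" "!!x. x \<in> {a..b} ==> \<bar>f' x - c\<bar> <= J" "s \<in> {a..b}" "t \<in> {a..b}"
  shows "\<bar>f t - f s - (t - s) * c\<bar> <= \<bar>t - s\<bar> * J"
proof -
  have "norm ((%x. f x - c * x) t - (%x. f x - c * x) s) <= J * norm (t - s)"
  proof (rule field_differentiable_bound[where S = "{a..b}" and f' = "%x. f' x - c"])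
    show "((%x. f x - c * x) has_field_derivative f' x - c) (at x within {a..b})" for x
      using assms(1)[of x] by (auto intro!: derivative_eq_intros intro: has_field_derivative_at_within)
  qed (use assms in auto)
  then show ?thesis by (simp add: algebra_simps)
qed

text \<open>Expanding f to first order about y at both ends, the linear terms cancel in the
  interpolant. The remainders carry the weight 2 (y - a)(b - y), at most (b - a)^2. Using the
  oscillation of f' as \<open>J\<close> lets an L1 norm of f'' be inserted.\<close>

lemma linear_interpolation_error:
  fixes f f' :: "real => real"
  assumes "!!x. (f has_real_derivative f' x) (at x)" "!!s t. s \<in> {a..b} ==> t \<in> {a..b} ==> \<bar>f' s - f' t\<bar> <= J"
    "a < b" "y \<in> {a..b}"
  shows "\<bar>f y - (f a * (b - y) + f b * (y - a)) / (b - a)\<bar> <= (b - a) * J"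
proof -
  define A where "A = f a - f y - (a - y) * f' y"
  define B where "B = f b - f y - (b - y) * f' y"
  have "\<bar>A\<bar> <= \<bar>a - y\<bar> * J" "\<bar>B\<bar> <= \<bar>b - y\<bar> * J" unfolding A_def B_def
    by (rule linear_approx[OF assms(1), of a b]; use assms in auto)+
  then have AB: "\<bar>A\<bar> <= (y - a) * J" "\<bar>B\<bar> <= (b - y) * J" using assms by auto
  have J: "J >= 0" using assms(2)[of a a] assms by auto
  have "f y - (f a * (b - y) + f b * (y - a)) / (b - a) = - (A * (b - y) + B * (y - a)) / (b - a)"
    unfolding A_def B_def using \<open>a < b\<close> by (simp add: field_simps)
  also have "\<bar>\<dots>\<bar> <= (b - a) * J"
  proof -
    have "\<bar>A * (b - y) + B * (y - a)\<bar> <= \<bar>A\<bar> * (b - y) + \<bar>B\<bar> * (y - a)"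
      using assms abs_triangle_ineq[of "A * (b - y)" "B * (y - a)"] by (simp add: abs_mult)
    also have "\<dots> <= ((y - a) * J) * (b - y) + ((b - y) * J) * (y - a)"
      using AB assms by (intro add_mono mult_right_mono) auto
    also have "\<dots> = J * (2 * (y - a) * (b - y))" by (simp add: algebra_simps)
    also have "\<dots> <= J * (b - a)\<^sup>2"
    proof (rule mult_left_mono[OF _ J])
      have "(b - a)\<^sup>2 - 2 * (y - a) * (b - y) = (y - a)\<^sup>2 + (b - y)\<^sup>2" by (simp add: power2_eq_square algebra_simps)
      then show "2 * (y - a) * (b - y) <= (b - a)\<^sup>2" by (smt (verit) zero_le_power2)
    qed
    finally show ?thesis using \<open>a < b\<close> by (simp add: abs_divide divide_le_eq power2_eq_square mult_ac)
  qed
  finally show ?thesis .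
qed

text \<open>At the midpoint the second-order terms cancel by symmetry, so the symmetric difference
  quotient is accurate up to the oscillation of f''. The function \<open>g\<close> below is the
  error of that quotient as its half-width grows from 0.\<close>

lemma midpoint_derivative_error:
  fixes f f' f'' :: "real => real"
  assumes "!!x. (f has_real_derivative f' x) (at x)" "!!x. (f' has_real_derivative f'' x) (at x)"
    and J: "!!s t. s \<in> {a..b} ==> t \<in> {a..b} ==> \<bar>f'' s - f'' t\<bar> <= J" and "a < b"
  shows "\<bar>f' ((a + b) / 2) - (f b - f a) / (b - a)\<bar> <= (b - a) * J"
proof -
  define m h where "m = (a + b) / 2" and "h = (b - a) / 2"
  have h: "h > 0" "m + h = b" "m - h = a" "b - a = 2 * h" using \<open>a < b\<close> by (auto simp: m_def h_def field_simps)
  have m: "m \<in> {a..b}" using h by auto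
  have J0: "J >= 0" using J[OF m m] by simp
  define g where "g s = f (m + s) - f (m - s) - 2 * s * f' m" for s
  have "norm (g h - g 0) <= (2 * h * J) * norm (h - 0)"
  proof (rule field_differentiable_bound[where S = "{0..h}" and f' = "%s. f' (m + s) + f' (m - s) - 2 * f' m"])
    show "(g has_field_derivative f' (m + s) + f' (m - s) - 2 * f' m) (at s within {0..h})" for s
      unfolding g_def[abs_def]
      by (rule derivative_eq_intros DERIV_chain2[OF assms(1)] refl | simp)+
    show "norm (f' (m + s) + f' (m - s) - 2 * f' m) <= 2 * h * J" if "s \<in> {0..h}" for s
    proof -
      have "\<bar>f' (m + s) - f' m - ((m + s) - m) * f'' m\<bar> <= \<bar>(m + s) - m\<bar> * J"
        by (rule linear_approx[OF assms(2), of a b]) (use J m h that in auto)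
      moreover have "\<bar>f' (m - s) - f' m - ((m - s) - m) * f'' m\<bar> <= \<bar>(m - s) - m\<bar> * J"
        by (rule linear_approx[OF assms(2), of a b]) (use J m h that in auto)
      moreover have "s * J <= h * J" using that J0 by (intro mult_right_mono) auto
      ultimately show ?thesis using that by simp
    qed
  qed (use h in auto)
  moreover have "g 0 = 0" by (simp add: g_def)
  ultimately have g: "\<bar>g h\<bar> <= 2 * h * J * h" using h(1) by simp
  have "g h = f b - f a - 2 * h * f' m" unfolding g_def h(2,3) ..
  then have "f b - f a = g h + 2 * h * f' m" by simp
  then have "f' m - (f b - f a) / (b - a) = - g h / (2 * h)"
    unfolding h(4) using h(1) by (simp add: add_divide_distrib)
  also have "\<bar>\<dots>\<bar> <= (b - a) * J"
  proof -
    have "\<bar>g h\<bar> <= (2 * h * J) * (2 * h)"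
    proof -
      have "0 <= h * J * h" using h J0 by simp
      then show ?thesis using g by linarith
    qed
    then show ?thesis using h by (simp add: abs_divide divide_le_eq)
  qed
  finally show ?thesis by (simp add: m_def)
qed

text \<open>\<open>V i j\<close> is the derivative of order (i, j) of \<open>V 0 0\<close>. Carrying
  the derivatives as an indexed family makes exchanging the coordinates a mere exchange of
  indices.\<close>

definition smooth_family :: "(nat => nat => real => real => real) => bool" where
  "smooth_family V \<longleftrightarrow> (\<forall>i j x y. ((%x. V i j x y) has_real_derivative V (Suc i) j x y) (at x)) \<and>
     (\<forall>i j x y. ((%y. V i j x y) has_real_derivative V i (Suc j) x y) (at y)) \<and>
     (\<forall>i j. continuous_on UNIV (%p. V i j (fst p) (snd p)))"

definition mass :: "(nat => nat => real => real => real) => real => real => real => real => nat => nat => real" where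
  "mass V x0 x1 y0 y1 i j = integral (cbox (x0, y0) (x1, y1)) (%p. \<bar>V i j (fst p) (snd p)\<bar>)"

text \<open>The x-derivative of the bilinear interpolant of u, which does not depend on x.\<close>

definition cell_dx :: "(real => real => real) => real => real => real => real => real => real" where
  "cell_dx u x0 x1 y0 y1 y = ((u x1 y0 - u x0 y0) * (y1 - y) + (u x1 y1 - u x0 y1) * (y - y0)) / ((x1 - x0) * (y1 - y0))"

text \<open>The y-derivative of the bilinear interpolant on the vertical midline of the cell, where
  a vertical dual edge lies; there it is constant.\<close>

definition cell_dy :: "(real => real => real) => real => real => real => real => real" where
  "cell_dy u x0 x1 y0 y1 = ((u x0 y1 - u x0 y0) + (u x1 y1 - u x1 y0)) / (2 * (y1 - y0))"

text \<open>The error at the midpoint of linear interpolation in the first variable.\<close>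

definition mid_defect :: "(real => real => real) => real => real => real => real" where
  "mid_defect u x0 x1 y = u ((x0 + x1) / 2) y - (u x0 y + u x1 y) / 2"

definition bilin :: "(real => real => real) => real => real => real => real => real => real => real" where
  "bilin u x0 x1 y0 y1 x y =
     (((u x0 y0 * (y1 - y) + u x0 y1 * (y - y0)) / (y1 - y0)) * (x1 - x)
      + ((u x1 y0 * (y1 - y) + u x1 y1 * (y - y0)) / (y1 - y0)) * (x - x0)) / (x1 - x0)"

section \<open>L1 error bounds on one cell for smooth functions\<close>

locale smooth_cell =
  fixes V :: "nat => nat => real => real => real" and x0 x1 y0 y1 :: real
  assumes V: "smooth_family V" and x01: "x0 < x1" and y01: "y0 < y1"
begin

lemma DX: "((%x. V i j x y) has_real_derivative V (Suc i) j x y) (at x)"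
  and DY: "((%y. V i j x y) has_real_derivative V i (Suc j) x y) (at y)"
  using V by (auto simp: smooth_family_def)

lemma contV: "continuous_on A f ==> continuous_on A g ==> continuous_on A (%z. V i j (f z) (g z))"
proof -
  assume fg: "continuous_on A f" "continuous_on A g"
  have "continuous_on UNIV (%p. V i j (fst p) (snd p))" using V by (auto simp: smooth_family_def)
  from continuous_on_compose2[OF this continuous_on_Pair[OF fg]] show ?thesis by simp
qed

lemmas contVs = contV[OF continuous_on_id continuous_on_const] contV[OF continuous_on_const continuous_on_id]
  contV[OF continuous_on_fst[OF continuous_on_id] continuous_on_snd[OF continuous_on_id]]

abbreviation "NM \<equiv> mass V x0 x1 y0 y1"

text \<open>L1 norms on horizontal (\<open>X\<close>) and vertical (\<open>Y\<close>) segments, the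
  intermediate stage between point values and masses on the cell.\<close>

definition X where "X i j y = integral {x0..x1} (%x. \<bar>V i j x y\<bar>)"
definition Y where "Y i j x = integral {y0..y1} (%y. \<bar>V i j x y\<bar>)"

lemma contX: "continuous_on A (X i j)" 
proof -
  have "continuous_on (UNIV \<times> cbox x0 x1) (%(y, x). \<bar>V i j x y\<bar>)"
    unfolding split_def by (intro continuous_on_rabs contV continuous_on_fst continuous_on_snd continuous_on_id)
  from integral_continuous_on_param[OF this] show ?thesis
    unfolding X_def[abs_def] using continuous_on_subset by (auto simp: cbox_interval)
qed

lemma contY: "continuous_on A (Y i j)" 
proof -
  have "continuous_on (UNIV \<times> cbox y0 y1) (%(x, y). \<bar>V i j x y\<bar>)"
    unfolding split_def by (intro continuous_on_rabs contV continuous_on_fst continuous_on_snd continuous_on_id)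
  from integral_continuous_on_param[OF this] show ?thesis
    unfolding Y_def[abs_def] using continuous_on_subset by (auto simp: cbox_interval)
qed

lemma NM_eq: "NM i j = integral {y0..y1} (X i j)" "NM i j = integral {x0..x1} (Y i j)"
  using iterated_swap[OF continuous_on_rabs[OF contVs(3)[of _ i j]], of x0 y0 x1 y1]
  by (simp_all add: mass_def X_def[abs_def] Y_def[abs_def])

lemma NM_nonneg: "NM i j >= 0"
  unfolding mass_def by (intro integral_nonneg integrable_continuous continuous_on_rabs contVs) auto

lemma osc_x: "x \<in> {x0..x1} ==> x' \<in> {x0..x1} ==> \<bar>V i j x' y - V i j x y\<bar> <= X (Suc i) j y"
  unfolding X_def by (rule diff_le_integral_abs_deriv[OF DX contVs(1)])

lemma osc_y: "y \<in> {y0..y1} ==> y' \<in> {y0..y1} ==> \<bar>V i j x y' - V i j x y\<bar> <= Y i (Suc j) x"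
  unfolding Y_def by (rule diff_le_integral_abs_deriv[OF DY contVs(2)])

lemma integral_le_const:
  fixes f :: "real => real"
  assumes "continuous_on {a..b} f" "a <= b" "!!x. x \<in> {a..b} ==> c <= f x" 
  shows "(b - a) * c <= integral {a..b} f"
proof -
  have "integral {a..b} (%x. c) <= integral {a..b} f"
    by (rule integral_le) (use assms in \<open>auto intro: integrable_continuous_real\<close>)
  then show ?thesis using assms(2) by simp
qed

text \<open>A trace inequality: the norms on any two horizontal segments differ by at most the mass
  of the y-derivative, and averaging over the second segment brings in the mass divided by the
  height.\<close>

lemma X_trace: assumes "y \<in> {y0..y1}" shows "X i j y <= NM i j / (y1 - y0) + NM i (Suc j)"
proof -
  have 1: "X i j y - NM i (Suc j) <= X i j y'" if "y' \<in> {y0..y1}" for y'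
  proof -
    have "X i j y <= integral {x0..x1} (%x. \<bar>V i j x y'\<bar> + Y i (Suc j) x)"
      unfolding X_def
    proof (rule integral_le)
      show "\<bar>V i j x y\<bar> <= \<bar>V i j x y'\<bar> + Y i (Suc j) x" for x
        using osc_y[OF that assms, of i j x] by linarith
    qed (intro integrable_continuous_real continuous_on_add continuous_on_rabs contVs contY)+
    also have "\<dots> = X i j y' + NM i (Suc j)"
      unfolding NM_eq(2) X_def
      by (intro Henstock_Kurzweil_Integration.integral_add integrable_continuous_real continuous_on_rabs contVs contY)
    finally show ?thesis by simp
  qed
  have "(y1 - y0) * (X i j y - NM i (Suc j)) <= NM i j"
    unfolding NM_eq(1)[of i j] by (rule integral_le_const[OF contX _ 1]) (use y01 in auto)
  then show ?thesis using y01 by (simp add: field_simps)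
qed

lemma Y_trace: assumes "x \<in> {x0..x1}" shows "Y i j x <= NM i j / (x1 - x0) + NM (Suc i) j"
proof -
  have 1: "Y i j x - NM (Suc i) j <= Y i j x'" if "x' \<in> {x0..x1}" for x'
  proof -
    have "Y i j x <= integral {y0..y1} (%y. \<bar>V i j x' y\<bar> + X (Suc i) j y)"
      unfolding Y_def
    proof (rule integral_le)
      show "\<bar>V i j x y\<bar> <= \<bar>V i j x' y\<bar> + X (Suc i) j y" for y
        using osc_x[OF that assms, of i j y] by linarith
    qed (intro integrable_continuous_real continuous_on_add continuous_on_rabs contVs contX)+
    also have "\<dots> = Y i j x' + NM (Suc i) j"
      unfolding NM_eq(1) Y_def
      by (intro Henstock_Kurzweil_Integration.integral_add integrable_continuous_real continuous_on_rabs contVs contX)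
    finally show ?thesis by simp
  qed
  have "(x1 - x0) * (Y i j x - NM (Suc i) j) <= NM i j"
    unfolding NM_eq(2)[of i j] by (rule integral_le_const[OF contY _ 1]) (use x01 in auto)
  then show ?thesis using x01 by (simp add: field_simps)
qed

abbreviation "xm \<equiv> (x0 + x1) / 2"

lemma xm: "xm \<in> {x0..x1}" using x01 by auto

lemma interp_x: 
  assumes "x \<in> {x0..x1}"
  shows "\<bar>V i j x y - (V i j x0 y * (x1 - x) + V i j x1 y * (x - x0)) / (x1 - x0)\<bar> <= (x1 - x0) * X (Suc (Suc i)) j y"
  by (rule linear_interpolation_error[OF DX osc_x x01 assms])

lemma interp_y: 
  assumes "y \<in> {y0..y1}"
  shows "\<bar>V i j x y - (V i j x y0 * (y1 - y) + V i j x y1 * (y - y0)) / (y1 - y0)\<bar> <= (y1 - y0) * Y i (Suc (Suc j)) x"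
  by (rule linear_interpolation_error[OF DY osc_y y01 assms])

lemma mid_le: "\<bar>V i j xm y - (V i j x0 y + V i j x1 y) / 2\<bar> <= (x1 - x0) * X (Suc (Suc i)) j y"
proof -
  have *: "(V i j x0 y * (x1 - xm) + V i j x1 y * (xm - x0)) / (x1 - x0) = (V i j x0 y + V i j x1 y) / 2"
    using x01 by (simp add: field_simps)
  show ?thesis using interp_x[OF xm, of i j y] unfolding * .
qed

text \<open>The y-derivative of the defect is the defect of the y-derivative. Differencing thus
  removes the second-derivative term of \<open>mid_defect_le\<close>, which has no small factor on a
  cell of bounded aspect ratio.\<close>

lemma mid_defect_osc:
  assumes "y \<in> {y0..y1}" "y' \<in> {y0..y1}"
  shows "\<bar>mid_defect (V 0 0) x0 x1 y' - mid_defect (V 0 0) x0 x1 y\<bar> <= (x1 - x0) * NM 2 1"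
proof -
  let ?D = "%y. V 0 1 xm y - (V 0 1 x0 y + V 0 1 x1 y) / 2"
  have cD: "continuous_on {y0..y1} ?D" by (intro continuous_intros contVs) auto
  have "(mid_defect (V 0 0) x0 x1 has_real_derivative ?D y) (at y)" for y
    unfolding mid_defect_def[abs_def] using DY[of 0 0] by (auto intro!: derivative_eq_intros)
  from diff_le_integral_abs_deriv[OF this cD assms]
  have "\<bar>mid_defect (V 0 0) x0 x1 y' - mid_defect (V 0 0) x0 x1 y\<bar> <= integral {y0..y1} (%y. \<bar>?D y\<bar>)" .
  also have "\<dots> <= integral {y0..y1} (%y. (x1 - x0) * X 2 1 y)"
  proof (rule integral_le)
    show "\<bar>?D y\<bar> <= (x1 - x0) * X 2 1 y" for y using mid_le[of 0 1 y] by (simp add: numeral_2_eq_2)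
  qed (intro integrable_continuous_real continuous_on_mult continuous_on_const continuous_on_rabs cD contX)+
  also have "\<dots> = (x1 - x0) * NM 2 1" unfolding NM_eq(1) by simp
  finally show ?thesis .
qed

lemma mid_defect_le:
  assumes "y \<in> {y0..y1}"
  shows "\<bar>mid_defect (V 0 0) x0 x1 y\<bar> <= (x1 - x0) / (y1 - y0) * NM 2 0 + (x1 - x0) * NM 2 1"
proof -
  have "\<bar>mid_defect (V 0 0) x0 x1 y\<bar> <= (x1 - x0) * X 2 0 y"
    using mid_le[of 0 0 y] by (simp add: mid_defect_def numeral_2_eq_2)
  also have "\<dots> <= (x1 - x0) * (NM 2 0 / (y1 - y0) + NM 2 1)"
    using X_trace[OF assms, of 2 0] x01 by (intro mult_left_mono) (auto simp: numeral_2_eq_2)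
  finally show ?thesis by (simp add: algebra_simps)
qed

text \<open>Two errors add up: replacing the x-derivative on the midline by the difference quotient
  across the cell (order (3, 0)), and interpolating that quotient linearly in y (order (1,
  2)).\<close>

lemma cell_dx_error:
  "integral {y0..y1} (%y. \<bar>V 1 0 xm y - cell_dx (V 0 0) x0 x1 y0 y1 y\<bar>)
     <= (x1 - x0) * NM 3 0 + (y1 - y0)\<^sup>2 / (x1 - x0) * NM 1 2"
proof -
  define hx hy where "hx = x1 - x0" and "hy = y1 - y0"
  have h: "hx > 0" "hy > 0" using x01 y01 by (auto simp: hx_def hy_def)
  let ?m = "%y. V 0 0 x1 y - V 0 0 x0 y"
  have pt: "\<bar>V 1 0 xm y - cell_dx (V 0 0) x0 x1 y0 y1 y\<bar> <= hx * X 3 0 y + hy / hx * NM 1 2" if y: "y \<in> {y0..y1}" for y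
  proof -
    have md: "\<bar>V 1 0 xm y - (V 0 0 x1 y - V 0 0 x0 y) / (x1 - x0)\<bar> <= (x1 - x0) * X 3 0 y"
      by (rule midpoint_derivative_error[OF _ _ _ x01, where f'' = "%x. V 2 0 x y"])
        (use DX[of 0 0 y] DX[of 1 0 y] osc_x[of _ _ 2 0 y] in \<open>simp_all add: numeral_2_eq_2 numeral_3_eq_3\<close>)
    \<comment> \<open>The increment \<open>?m\<close> across the cell has the second y-derivative
      \<open>V 0 2 x1 y - V 0 2 x0 y\<close>, whose L1 norm in y is at most the mass of order (1,
      2).\<close>
    have "\<bar>?m y - (?m y0 * (y1 - y) + ?m y1 * (y - y0)) / (y1 - y0)\<bar> <= (y1 - y0) * NM 1 2"
    proof (rule linear_interpolation_error[where f' = "%y. V 0 1 x1 y - V 0 1 x0 y", OF _ _ y01 y])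
      show "(?m has_real_derivative V 0 1 x1 y - V 0 1 x0 y) (at y)" for y
        using DY[of 0 0] by (auto intro!: derivative_eq_intros)
      show "\<bar>(V 0 1 x1 s - V 0 1 x0 s) - (V 0 1 x1 t - V 0 1 x0 t)\<bar> <= NM 1 2" if st: "s \<in> {y0..y1}" "t \<in> {y0..y1}" for s t
      proof -
        have "\<bar>(V 0 1 x1 s - V 0 1 x0 s) - (V 0 1 x1 t - V 0 1 x0 t)\<bar> <= integral {y0..y1} (%y. \<bar>V 0 2 x1 y - V 0 2 x0 y\<bar>)"
          by (rule diff_le_integral_abs_deriv[where f = "%s. V 0 1 x1 s - V 0 1 x0 s", OF _ _ st(2,1)])
            (use DY[of 0 1] in \<open>auto intro!: derivative_eq_intros continuous_intros contVs simp: numeral_2_eq_2\<close>)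
        also have "\<dots> <= integral {y0..y1} (X 1 2)"
        proof (rule integral_le)
          show "\<bar>V 0 2 x1 y - V 0 2 x0 y\<bar> <= X 1 2 y" for y using osc_x[of x0 x1 0 2 y] x01 by simp
        qed (intro integrable_continuous_real continuous_on_rabs continuous_on_diff contVs contX)+
        finally show ?thesis by (simp add: NM_eq(1))
      qed
    qed
    then have "\<bar>?m y - (?m y0 * (y1 - y) + ?m y1 * (y - y0)) / (y1 - y0)\<bar> / hx <= hy * NM 1 2 / hx"
      using h by (intro divide_right_mono) (auto simp: hy_def)
    moreover have eq: "?m y / hx - cell_dx (V 0 0) x0 x1 y0 y1 y = (?m y - (?m y0 * (y1 - y) + ?m y1 * (y - y0)) / (y1 - y0)) / hx"
      unfolding cell_dx_def hx_def diff_divide_distrib[of "?m y"] by (simp only: divide_divide_eq_left mult.commute)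
    ultimately have "\<bar>?m y / hx - cell_dx (V 0 0) x0 x1 y0 y1 y\<bar> <= hy / hx * NM 1 2"
      using h by (simp add: eq abs_divide)
    then show ?thesis using md unfolding hx_def by linarith
  qed
  have "integral {y0..y1} (%y. \<bar>V 1 0 xm y - cell_dx (V 0 0) x0 x1 y0 y1 y\<bar>) <= integral {y0..y1} (%y. hx * X 3 0 y + hy / hx * NM 1 2)"
    by (rule integral_le[OF _ _ pt])
      (use y01 x01 in \<open>auto simp: cell_dx_def[abs_def] intro!: integrable_continuous_real continuous_intros contVs contX\<close>)
  also have "\<dots> = integral {y0..y1} (%y. hx * X 3 0 y) + integral {y0..y1} (%y. hy / hx * NM 1 2)"
    by (intro Henstock_Kurzweil_Integration.integral_add integrable_continuous_real continuous_intros contX)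
  also have "\<dots> = hx * NM 3 0 + hy * (hy / hx * NM 1 2)"
    unfolding NM_eq(1)[of 3 0] using y01 by (simp add: hy_def)
  finally show ?thesis by (simp add: hx_def hy_def power2_eq_square mult_ac)
qed

text \<open>The y-derivative is compared with the difference quotient on the midline; passing from
  the midline to the average of both sides costs a difference of midpoint defects. The (0, 2) term
  carries only the aspect ratio, so this error is applied later only against the oscillation of a
  coefficient.\<close>

lemma cell_dy_error:
  "integral {y0..y1} (%y. \<bar>V 0 1 xm y - cell_dy (V 0 0) x0 x1 y0 y1\<bar>)
     <= (y1 - y0) / (x1 - x0) * NM 0 2 + (y1 - y0) * NM 1 2 + (x1 - x0) * NM 2 1"
proof -
  define hx hy where "hx = x1 - x0" and "hy = y1 - y0"
  have h: "hx > 0" "hy > 0" using x01 y01 by (auto simp: hx_def hy_def)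
  have pt: "\<bar>V 0 1 xm y - cell_dy (V 0 0) x0 x1 y0 y1\<bar> <= NM 0 2 / hx + NM 1 2 + hx / hy * NM 2 1" if y: "y \<in> {y0..y1}" for y
  proof -
    let ?g = "%y. V 0 0 xm y"
    have "\<bar>?g y1 - ?g y0 - (y1 - y0) * V 0 1 xm y\<bar> <= \<bar>y1 - y0\<bar> * Y 0 2 xm"
      by (rule linear_approx[where f = ?g and f' = "%y. V 0 1 xm y" and a = y0 and b = y1])
        (use DY[of 0 0 xm] osc_y[OF y, of _ 0 1 xm] y01 in \<open>simp_all add: numeral_2_eq_2\<close>)
    also have "\<dots> <= hy * (NM 0 2 / hx + NM 1 2)"
      using Y_trace[OF xm, of 0 2] h by (auto simp: hx_def hy_def)
    finally have 1: "\<bar>?g y1 - ?g y0 - hy * V 0 1 xm y\<bar> <= hy * (NM 0 2 / hx + NM 1 2)" by (simp add: hy_def)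
    have "\<bar>mid_defect (V 0 0) x0 x1 y1 - mid_defect (V 0 0) x0 x1 y0\<bar> <= hx * NM 2 1"
      unfolding hx_def by (rule mid_defect_osc) (use y01 in auto)
    moreover have "mid_defect (V 0 0) x0 x1 y1 - mid_defect (V 0 0) x0 x1 y0 = ?g y1 - ?g y0 - hy * cell_dy (V 0 0) x0 x1 y0 y1"
      using h by (simp add: mid_defect_def cell_dy_def hy_def field_simps)
    ultimately have "\<bar>hy * V 0 1 xm y - hy * cell_dy (V 0 0) x0 x1 y0 y1\<bar> <= hy * (NM 0 2 / hx + NM 1 2) + hx * NM 2 1"
      using 1 by linarith
    then have "hy * \<bar>V 0 1 xm y - cell_dy (V 0 0) x0 x1 y0 y1\<bar> <= hy * (NM 0 2 / hx + NM 1 2 + hx / hy * NM 2 1)"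
      using h by (simp add: right_diff_distrib[symmetric] abs_mult distrib_left)
    then show ?thesis using h by simp
  qed
  have "integral {y0..y1} (%y. \<bar>V 0 1 xm y - cell_dy (V 0 0) x0 x1 y0 y1\<bar>) <= integral {y0..y1} (%y. NM 0 2 / hx + NM 1 2 + hx / hy * NM 2 1)"
    by (rule integral_le[OF _ _ pt]) (auto intro!: integrable_continuous_real continuous_intros contVs)
  also have "\<dots> = hy * (NM 0 2 / hx + NM 1 2 + hx / hy * NM 2 1)" using y01 by (simp add: hy_def)
  also have "\<dots> = hy / hx * NM 0 2 + hy * NM 1 2 + hx * NM 2 1" using h by (simp add: field_simps)
  finally show ?thesis by (simp add: hx_def hy_def)
qed

text \<open>The error splits into that of interpolation in x and the x-interpolant of the
  y-interpolation errors \<open>E\<close> on the two vertical sides; \<open>Y_trace\<close> turns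
  the latter into masses on the cell.\<close>

lemma bilin_error:
  "integral (cbox (x0, y0) (x1, y1)) (%p. \<bar>V 0 0 (fst p) (snd p) - bilin (V 0 0) x0 x1 y0 y1 (fst p) (snd p)\<bar>)
     <= (x1 - x0)\<^sup>2 * NM 2 0 + (y1 - y0)\<^sup>2 * NM 0 2 + (x1 - x0) * (y1 - y0)\<^sup>2 * NM 1 2"
proof -
  define hx hy where "hx = x1 - x0" and "hy = y1 - y0"
  have h: "hx > 0" "hy > 0" using x01 y01 by (auto simp: hx_def hy_def)
  define C where "C = hy * (NM 0 2 / hx + NM 1 2)"
  have pt: "\<bar>V 0 0 x y - bilin (V 0 0) x0 x1 y0 y1 x y\<bar> <= hx * X 2 0 y + C" if x: "x \<in> {x0..x1}" and y: "y \<in> {y0..y1}" for x y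
  proof -
    define E where "E x = V 0 0 x y - (V 0 0 x y0 * (y1 - y) + V 0 0 x y1 * (y - y0)) / (y1 - y0)" for x
    have E: "\<bar>E x\<bar> <= C" if "x \<in> {x0..x1}" for x
    proof -
      have "\<bar>E x\<bar> <= hy * Y 0 2 x" using interp_y[OF y, of 0 0 x] by (simp add: E_def hy_def numeral_2_eq_2)
      also have "\<dots> <= C" unfolding C_def using Y_trace[OF that, of 0 2] h
        by (intro mult_left_mono) (auto simp: hx_def)
      finally show ?thesis .
    qed
    have "V 0 0 x y - bilin (V 0 0) x0 x1 y0 y1 x y = (V 0 0 x y - (V 0 0 x0 y * (x1 - x) + V 0 0 x1 y * (x - x0)) / (x1 - x0))
       + (E x0 * (x1 - x) + E x1 * (x - x0)) / (x1 - x0)"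
      unfolding bilin_def E_def by (simp add: algebra_simps add_divide_distrib diff_divide_distrib)
    moreover have "\<bar>V 0 0 x y - (V 0 0 x0 y * (x1 - x) + V 0 0 x1 y * (x - x0)) / (x1 - x0)\<bar> <= hx * X 2 0 y"
      using interp_x[OF x, of 0 0 y] by (simp add: hx_def numeral_2_eq_2)
    moreover have "\<bar>(E x0 * (x1 - x) + E x1 * (x - x0)) / (x1 - x0)\<bar> <= C"
    proof -
      have "\<bar>E x0 * (x1 - x) + E x1 * (x - x0)\<bar> <= \<bar>E x0\<bar> * (x1 - x) + \<bar>E x1\<bar> * (x - x0)"
        using x abs_triangle_ineq[of "E x0 * (x1 - x)" "E x1 * (x - x0)"] by (simp add: abs_mult)
      also have "\<dots> <= C * (x1 - x) + C * (x - x0)"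
        using E[of x0] E[of x1] x x01 by (intro add_mono mult_right_mono) auto
      also have "\<dots> = C * (x1 - x0)" by (simp add: algebra_simps)
      finally show ?thesis using x01 by (simp add: abs_divide divide_le_eq)
    qed
    ultimately show ?thesis by linarith
  qed
  let ?f = "%p. hx * X 2 0 (snd p) + C"
  have cf: "continuous_on A ?f" for A
    by (intro continuous_intros continuous_on_compose2[OF contX[of UNIV]]) auto
  have "integral (cbox (x0, y0) (x1, y1)) (%p. \<bar>V 0 0 (fst p) (snd p) - bilin (V 0 0) x0 x1 y0 y1 (fst p) (snd p)\<bar>) <= integral (cbox (x0, y0) (x1, y1)) ?f"
  proof (rule integral_le)
    show "(%p. \<bar>V 0 0 (fst p) (snd p) - bilin (V 0 0) x0 x1 y0 y1 (fst p) (snd p)\<bar>) integrable_on cbox (x0, y0) (x1, y1)"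
      unfolding bilin_def by (intro integrable_continuous continuous_intros contV) (use x01 y01 in auto)
    show "?f integrable_on cbox (x0, y0) (x1, y1)" by (intro integrable_continuous cf)
  qed (use pt in \<open>auto simp: cbox_Pair_real\<close>)
  also have "\<dots> = integral {x0..x1} (%x. integral {y0..y1} (%y. hx * X 2 0 y + C))"
    using iterated_swap(1)[OF cf] by simp
  also have "integral {y0..y1} (%y. hx * X 2 0 y + C) = integral {y0..y1} (%y. hx * X 2 0 y) + integral {y0..y1} (%y. C)"
    by (intro Henstock_Kurzweil_Integration.integral_add integrable_continuous_real continuous_intros contX)
  also have "integral {x0..x1} (%x. integral {y0..y1} (%y. hx * X 2 0 y) + integral {y0..y1} (%y. C)) = hx * (hx * NM 2 0 + hy * C)"
    unfolding NM_eq(1)[of 2 0] using x01 y01 by (simp add: hx_def hy_def)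
  also have "\<dots> = hx\<^sup>2 * NM 2 0 + hy\<^sup>2 * NM 0 2 + hx * hy\<^sup>2 * NM 1 2"
    unfolding C_def using h by (simp add: field_simps power2_eq_square)
  finally show ?thesis by (simp add: hx_def hy_def)
qed

end

lemma smooth_family_flip: "smooth_family V ==> smooth_family (%i j x y. V j i y x)"
proof -
  assume V: "smooth_family V"
  have "continuous_on UNIV (%p. V j i (snd p) (fst p))" for i j
  proof -
    have "continuous_on UNIV (%p. V j i (fst p) (snd p))" using V by (auto simp: smooth_family_def)
    from continuous_on_compose2[OF this, of UNIV "%p. (snd p, fst p)"] show ?thesis
      by (simp add: continuous_on_Pair continuous_on_fst continuous_on_snd continuous_on_id)
  qed
  then show ?thesis using V by (simp add: smooth_family_def)
qed

lemma mass_flip: 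
  assumes "smooth_family V"
  shows "mass (%i j x y. V j i y x) y0 y1 x0 x1 i j = mass V x0 x1 y0 y1 j i"
proof -
  have c: "continuous_on A (%p. \<bar>V j i (fst p) (snd p)\<bar>)" "continuous_on A (%p. \<bar>V j i (snd p) (fst p)\<bar>)" for A
  proof -
    have "continuous_on UNIV (%p. V j i (fst p) (snd p))" "continuous_on UNIV (%p. V j i (snd p) (fst p))"
      using assms smooth_family_flip[OF assms] by (simp_all add: smooth_family_def)
    then show "continuous_on A (%p. \<bar>V j i (fst p) (snd p)\<bar>)" "continuous_on A (%p. \<bar>V j i (snd p) (fst p)\<bar>)"
      by (auto intro: continuous_on_rabs continuous_on_subset)
  qed
  show ?thesis
    unfolding mass_def iterated_swap(1)[OF c(1)] iterated_swap(2)[OF c(2)] by simp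
qed

subsection \<open>Passing to the limit along an approximating family\<close>

text \<open>Applied with difference quotients for d: the derivatives of the approximations are
  eventually close to quotients that converge because the values do.\<close>

lemma convergent_by_approx:
  fixes v :: "nat => real"
  assumes "!!e. e > 0 ==> \<exists>d. convergent d \<and> (\<forall>\<^sub>F n in sequentially. \<bar>v n - d n\<bar> <= e)"
  shows "convergent v"
proof -
  have "Cauchy v"
    unfolding Cauchy_def
  proof (intro allI impI)
    fix e :: real assume e: "e > 0"
    obtain d where d: "convergent d" "\<forall>\<^sub>F n in sequentially. \<bar>v n - d n\<bar> <= e/4"
      using assms[of "e/4"] e by auto
    then have "Cauchy d" by (simp add: Cauchy_convergent_iff)
    then obtain N1 where N1: "!!m n. m >= N1 ==> n >= N1 ==> dist (d m) (d n) < e/4"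
      using e unfolding Cauchy_def by (metis zero_less_divide_iff zero_less_numeral)
    obtain N2 where N2: "!!n. n >= N2 ==> \<bar>v n - d n\<bar> <= e/4"
      using d(2) by (auto simp: eventually_sequentially)
    have "dist (v m) (v n) < e" if "m >= max N1 N2" "n >= max N1 N2" for m n
      using N1[of m n] N2[of m] N2[of n] that e unfolding dist_real_def by linarith
    then show "\<exists>M. \<forall>m\<ge>M. \<forall>n\<ge>M. dist (v m) (v n) < e" by blast
  qed
  then show ?thesis by (simp add: Cauchy_convergent_iff)
qed

text \<open>Interface between mollification and its use. \<open>rm\<close> plays the part of the
  masses of the weak derivatives of \<open>u\<close>, and \<open>stripx\<close> and
  \<open>stripy\<close> say that they do not charge lines. Only the upper bounds \<open>B\<close>
  are required to converge, which suffices because masses stand on the larger side of each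
  estimate.\<close>

locale approx =
  fixes a1 b1 a2 b2 :: real and u :: "real => real => real" and V :: "nat => nat => nat => real => real => real"
    and B :: "nat => real => real => real => real => nat => nat => real"
    and rm :: "real => real => real => real => nat => nat => real" and MU :: real
  assumes ab: "a1 < b1" "a2 < b2"
    and fam: "!!n. smooth_family (V n)"
    and ulim: "!!x y. x \<in> {a1..b1} ==> y \<in> {a2..b2} ==> (%n. V n 0 0 x y) \<longlonglongrightarrow> u x y"
    and ubnd: "!!n x y. x \<in> {a1..b1} ==> y \<in> {a2..b2} ==> \<bar>V n 0 0 x y\<bar> <= MU"
    and massB: "!!n k1 k2 l1 l2 i j. a1 <= k1 ==> k1 <= k2 ==> k2 <= b1 ==> a2 <= l1 ==> l1 <= l2 ==> l2 <= b2 ==> i + j <= 3 ==>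
        mass (V n) k1 k2 l1 l2 i j <= B n k1 k2 l1 l2 i j"
    and Blim: "!!k1 k2 l1 l2 i j. a1 <= k1 ==> k1 <= k2 ==> k2 <= b1 ==> a2 <= l1 ==> l1 <= l2 ==> l2 <= b2 ==> i + j <= 3 ==>
        (%n. B n k1 k2 l1 l2 i j) \<longlonglongrightarrow> rm k1 k2 l1 l2 i j"
    and stripx: "!!s t c i j. (!!k. a1 <= s k) ==> (!!k. s k <= t k) ==> (!!k. t k <= b1) ==> s \<longlonglongrightarrow> c ==> t \<longlonglongrightarrow> c ==> i + j <= 3 ==>
        (%k::nat. rm (s k) (t k) a2 b2 i j) \<longlonglongrightarrow> 0"
    and stripy: "!!s t c i j. (!!k. a2 <= s k) ==> (!!k. s k <= t k) ==> (!!k. t k <= b2) ==> s \<longlonglongrightarrow> c ==> t \<longlonglongrightarrow> c ==> i + j <= 3 ==>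
        (%k::nat. rm a1 b1 (s k) (t k) i j) \<longlonglongrightarrow> 0"

text \<open>By this symmetry everything proved about \<open>p\<close> holds for \<open>q\<close> as
  well.\<close>

lemma approx_flip:
  assumes "approx a1 b1 a2 b2 u V B rm MU"
  shows "approx a2 b2 a1 b1 (%x y. u y x) (%n i j x y. V n j i y x) (%n k1 k2 l1 l2 i j. B n l1 l2 k1 k2 j i)
    (%k1 k2 l1 l2 i j. rm l1 l2 k1 k2 j i) MU"
proof -
  interpret approx a1 b1 a2 b2 u V B rm MU by (rule assms)
  show ?thesis
    by unfold_locales
      (use ab smooth_family_flip[OF fam] mass_flip[OF fam] in
        \<open>auto intro: ulim ubnd massB Blim stripx stripy simp: add.commute\<close>)
qed

context approx
begin

definition p where "p x y = lim (%n. V n 1 0 x y)"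
definition q where "q x y = lim (%n. V n 0 1 x y)"

lemma cell: "x0 < x1 ==> y0 < y1 ==> smooth_cell (V n) x0 x1 y0 y1"
  using fam by (simp add: smooth_cell_def)

text \<open>The strip spans the full height of the domain, so the trace inequality costs only the
  fixed factor 1/(b2 - a2), and the bound vanishes as the strip narrows.\<close>

lemma strip_osc_x:
  assumes "a1 <= x" "x < x'" "x' <= b1" "y \<in> {a2..b2}" "s \<in> {x..x'}" "t \<in> {x..x'}"
  shows "\<bar>V n 1 0 s y - V n 1 0 t y\<bar> <= B n x x' a2 b2 2 0 / (b2 - a2) + B n x x' a2 b2 2 1"
proof -
  interpret C: smooth_cell "V n" x x' a2 b2 by (rule cell) (use assms ab in auto)
  have "\<bar>V n 1 0 s y - V n 1 0 t y\<bar> <= C.X 2 0 y" using C.osc_x[of t s 1 0 y] assms by (simp add: numeral_2_eq_2)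
  also have "\<dots> <= mass (V n) x x' a2 b2 2 0 / (b2 - a2) + mass (V n) x x' a2 b2 2 1"
    using C.X_trace[OF assms(4), of 2 0] by simp
  also have "\<dots> <= B n x x' a2 b2 2 0 / (b2 - a2) + B n x x' a2 b2 2 1"
    using assms ab by (intro add_mono divide_right_mono massB) auto
  finally show ?thesis .
qed

lemma strip_osc_y:
  assumes "a2 <= y" "y < y'" "y' <= b2" "x \<in> {a1..b1}" "s \<in> {y..y'}" "t \<in> {y..y'}"
  shows "\<bar>V n 1 0 x s - V n 1 0 x t\<bar> <= B n a1 b1 y y' 1 1 / (b1 - a1) + B n a1 b1 y y' 2 1"
proof -
  interpret C: smooth_cell "V n" a1 b1 y y' by (rule cell) (use assms ab in auto)
  have "\<bar>V n 1 0 x s - V n 1 0 x t\<bar> <= C.Y 1 1 x" using C.osc_y[of t s 1 0 x] assms by simp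
  also have "\<dots> <= mass (V n) a1 b1 y y' 1 1 / (b1 - a1) + mass (V n) a1 b1 y y' 2 1"
    using C.Y_trace[OF assms(4), of 1 1] by (simp add: numeral_2_eq_2)
  also have "\<dots> <= B n a1 b1 y y' 1 1 / (b1 - a1) + B n a1 b1 y y' 2 1"
    using assms ab by (intro add_mono divide_right_mono massB) auto
  finally show ?thesis .
qed

lemma dq_approx:
  assumes "a1 <= x" "x < x'" "x' <= b1" "y \<in> {a2..b2}" "s \<in> {x..x'}"
  shows "\<bar>V n 1 0 s y - (V n 0 0 x' y - V n 0 0 x y) / (x' - x)\<bar> <= B n x x' a2 b2 2 0 / (b2 - a2) + B n x x' a2 b2 2 1"
proof -
  have "\<exists>z. x < z \<and> z < x' \<and> V n 0 0 x' y - V n 0 0 x y = (x' - x) * V n 1 0 z y"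
    using fam[of n] assms(2) by (intro MVT2) (auto simp: smooth_family_def)
  then obtain z where z: "x < z" "z < x'" "(V n 0 0 x' y - V n 0 0 x y) / (x' - x) = V n 1 0 z y"
    by auto
  show ?thesis unfolding z(3) by (rule strip_osc_x) (use assms z in auto)
qed

text \<open>By \<open>dq_approx\<close> the derivative differs from a difference quotient over a
  short interval by a strip mass that is small for all large n. The quotients converge with the
  values, hence the derivatives do too.\<close>

lemma p_lim:
  assumes x: "x \<in> {a1..b1}" and y: "y \<in> {a2..b2}"
  shows "(%n. V n 1 0 x y) \<longlonglongrightarrow> p x y"
proof -
  \<comment> \<open>The intervals lie to the right of x, and for x = b1 to the left, so that the
    limit exists on the whole closed rectangle.\<close>
  obtain s t :: "nat => real" where st: "!!k. a1 <= s k" "!!k. s k < t k" "!!k. t k <= b1" "s \<longlonglongrightarrow> x" "t \<longlonglongrightarrow> x"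
    "!!k. x \<in> {s k..t k}"
  proof (cases "x < b1")
    case True
    let ?t = "%k. x + (b1 - x) / (1 + real k)"
    have "?t \<longlonglongrightarrow> x" by real_asymp
    moreover have "0 < (b1 - x) / (1 + real k)" "(b1 - x) / (1 + real k) <= (b1 - x) / 1" for k
      using True by (simp, intro frac_le, auto)
    ultimately show ?thesis using True x by (intro that[of "%_. x" ?t]) (auto simp: algebra_simps less_imp_le)
  next
    case False
    let ?t = "%k. x - (x - a1) / (1 + real k)"
    have "?t \<longlonglongrightarrow> x" by real_asymp
    moreover have "0 < (x - a1) / (1 + real k)" "(x - a1) / (1 + real k) <= (x - a1) / 1" for k
      using False x ab by (simp, intro frac_le, auto)
    ultimately show ?thesis using False x by (intro that[of ?t "%_. x"]) (auto simp: algebra_simps less_imp_le)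
  qed
  have "(%k. rm (s k) (t k) a2 b2 2 0 / (b2 - a2) + rm (s k) (t k) a2 b2 2 1) \<longlonglongrightarrow> 0 / (b2 - a2) + 0"
    using st ab by (intro tendsto_intros stripx[where c = x]) (auto simp: less_imp_le)
  then have w0: "(%k. rm (s k) (t k) a2 b2 2 0 / (b2 - a2) + rm (s k) (t k) a2 b2 2 1) \<longlonglongrightarrow> 0" by simp
  have "convergent (%n. V n 1 0 x y)"
  proof (rule convergent_by_approx)
    fix e :: real assume e: "e > 0"
    have "\<forall>\<^sub>F k in sequentially. rm (s k) (t k) a2 b2 2 0 / (b2 - a2) + rm (s k) (t k) a2 b2 2 1 < e"
      by (rule order_tendstoD(2)[OF w0 e])
    then obtain k where k: "rm (s k) (t k) a2 b2 2 0 / (b2 - a2) + rm (s k) (t k) a2 b2 2 1 < e"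
      by (auto simp: eventually_sequentially)
    have "(%n. B n (s k) (t k) a2 b2 2 0 / (b2 - a2) + B n (s k) (t k) a2 b2 2 1) \<longlonglongrightarrow>
       rm (s k) (t k) a2 b2 2 0 / (b2 - a2) + rm (s k) (t k) a2 b2 2 1"
      using st(1-3)[of k] ab by (intro tendsto_intros Blim) auto
    then have "\<forall>\<^sub>F n in sequentially. B n (s k) (t k) a2 b2 2 0 / (b2 - a2) + B n (s k) (t k) a2 b2 2 1 < e"
      using k by (rule order_tendstoD(2))
    then have "\<forall>\<^sub>F n in sequentially. \<bar>V n 1 0 x y - (V n 0 0 (t k) y - V n 0 0 (s k) y) / (t k - s k)\<bar> <= e"
    proof eventually_elim
      case (elim n)
      then show ?case using dq_approx[of "s k" "t k" y x n] st(1-3)[of k] st(6)[of k] y by linarith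
    qed
    moreover have "convergent (%n. (V n 0 0 (t k) y - V n 0 0 (s k) y) / (t k - s k))"
    proof -
      have "(%n. (V n 0 0 (t k) y - V n 0 0 (s k) y) / (t k - s k)) \<longlonglongrightarrow> (u (t k) y - u (s k) y) / (t k - s k)"
        using st(1-3)[of k] y by (intro tendsto_intros ulim) auto
      then show ?thesis by (auto simp: convergent_def)
    qed
    ultimately show "\<exists>d. convergent d \<and> (\<forall>\<^sub>F n in sequentially. \<bar>V n 1 0 x y - d n\<bar> <= e)" by blast
  qed
  then show ?thesis unfolding p_def by (simp add: convergent_LIMSEQ_iff)
qed

lemma p_bounded:
  obtains M where "!!n x y. x \<in> {a1..b1} ==> y \<in> {a2..b2} ==> \<bar>V n 1 0 x y\<bar> <= M"
proof -
  let ?W = "%n. B n a1 b1 a2 b2 2 0 / (b2 - a2) + B n a1 b1 a2 b2 2 1"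
  have "convergent ?W"
  proof -
    have "?W \<longlonglongrightarrow> rm a1 b1 a2 b2 2 0 / (b2 - a2) + rm a1 b1 a2 b2 2 1" using ab by (intro tendsto_intros Blim) auto
    then show ?thesis by (auto simp: convergent_def)
  qed
  then obtain W where W: "!!n. \<bar>?W n\<bar> <= W"
    using convergent_imp_Bseq[of ?W] unfolding Bseq_def real_norm_def by blast
  show ?thesis
  proof (rule that[of "W + 2 * MU / (b1 - a1)"])
    fix n x y assume xy: "x \<in> {a1..b1}" "y \<in> {a2..b2}"
    have "\<bar>V n 1 0 x y - (V n 0 0 b1 y - V n 0 0 a1 y) / (b1 - a1)\<bar> <= ?W n"
      by (rule dq_approx) (use xy ab in auto)
    moreover have "\<bar>(V n 0 0 b1 y - V n 0 0 a1 y) / (b1 - a1)\<bar> <= 2 * MU / (b1 - a1)"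
      unfolding abs_divide using ubnd[of b1 y n] ubnd[of a1 y n] xy ab by (intro frac_le) auto
    ultimately show "\<bar>V n 1 0 x y\<bar> <= W + 2 * MU / (b1 - a1)" using W[of n] by linarith
  qed
qed

lemma p_osc:
  assumes "x \<in> {a1..b1}" "x' \<in> {a1..b1}" "y \<in> {a2..b2}" "y' \<in> {a2..b2}"
  shows "\<bar>p x' y' - p x y\<bar> <= (rm (min x x') (max x x') a2 b2 2 0 / (b2 - a2) + rm (min x x') (max x x') a2 b2 2 1)
      + (rm a1 b1 (min y y') (max y y') 1 1 / (b1 - a1) + rm a1 b1 (min y y') (max y y') 2 1)"
proof -
  define s t s' t' where "s = min x x'" "t = max x x'" "s' = min y y'" "t' = max y y'"
  note st = this
  let ?W1 = "%n. B n s t a2 b2 2 0 / (b2 - a2) + B n s t a2 b2 2 1"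
  let ?W2 = "%n. B n a1 b1 s' t' 1 1 / (b1 - a1) + B n a1 b1 s' t' 2 1"
  have nn: "mass (V n) k1 k2 l1 l2 i j >= 0" for n k1 k2 l1 l2 i j
  proof -
    have "continuous_on UNIV (%p. V n i j (fst p) (snd p))" using fam[of n] by (simp add: smooth_family_def)
    then have "continuous_on S (%p. \<bar>V n i j (fst p) (snd p)\<bar>)" for S
      by (intro continuous_on_rabs) (rule continuous_on_subset, auto)
    then show ?thesis unfolding mass_def by (intro integral_nonneg integrable_continuous) auto
  qed
  have Bn: "B n s t a2 b2 i j >= 0" "B n a1 b1 s' t' i j >= 0" if "i + j <= 3" for n i j
    using order_trans[OF nn massB] that assms ab by (auto simp: st)
  have 1: "\<bar>V n 1 0 x' y' - V n 1 0 x y\<bar> <= ?W1 n + ?W2 n" for n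
  proof -
    have "\<bar>V n 1 0 x' y' - V n 1 0 x y'\<bar> <= ?W1 n"
    proof (cases "x = x'")
      case False
      show ?thesis by (rule strip_osc_x) (use assms False in \<open>auto simp: st\<close>)
    qed (use Bn ab in \<open>auto intro!: add_nonneg_nonneg\<close>)
    moreover have "\<bar>V n 1 0 x y' - V n 1 0 x y\<bar> <= ?W2 n"
    proof (cases "y = y'")
      case False
      show ?thesis by (rule strip_osc_y) (use assms False in \<open>auto simp: st\<close>)
    qed (use Bn ab in \<open>auto intro!: add_nonneg_nonneg\<close>)
    ultimately show ?thesis by linarith
  qed
  have l: "(%n. \<bar>V n 1 0 x' y' - V n 1 0 x y\<bar>) \<longlonglongrightarrow> \<bar>p x' y' - p x y\<bar>"
    by (intro tendsto_intros p_lim assms)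
  have r: "(%n. ?W1 n + ?W2 n) \<longlonglongrightarrow> (rm s t a2 b2 2 0 / (b2 - a2) + rm s t a2 b2 2 1) + (rm a1 b1 s' t' 1 1 / (b1 - a1) + rm a1 b1 s' t' 2 1)"
    by (intro tendsto_intros Blim) (use assms ab in \<open>auto simp: st\<close>)
  show ?thesis using LIMSEQ_le[OF l r] 1 unfolding st by blast
qed

text \<open>The right-hand side of \<open>p_osc\<close> acts as a modulus of continuity: the strips
  between the points of a convergent sequence and their limit shrink to lines.\<close>

lemma p_cont: "continuous_on (cbox (a1, a2) (b1, b2)) (%z. p (fst z) (snd z))"
  unfolding continuous_on_sequentially
proof (intro allI ballI impI, elim conjE)
  fix z :: "nat => real \<times> real" and c assume c: "c \<in> cbox (a1, a2) (b1, b2)" and z: "\<forall>n. z n \<in> cbox (a1, a2) (b1, b2)" "z \<longlonglongrightarrow> c"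
  define x y where "x n = fst (z n)" and "y n = snd (z n)" for n
  have lx: "x \<longlonglongrightarrow> fst c" "y \<longlonglongrightarrow> snd c" unfolding x_def[abs_def] y_def[abs_def] using z(2) by (auto intro: tendsto_intros)
  have mem: "fst c \<in> {a1..b1}" "snd c \<in> {a2..b2}" "x n \<in> {a1..b1}" "y n \<in> {a2..b2}" for n
    using c z(1)[rule_format, of n] by (auto simp: x_def y_def mem_Times_iff cbox_Pair_real)
  have mm: "(%n. min (fst c) (x n)) \<longlonglongrightarrow> fst c" "(%n. max (fst c) (x n)) \<longlonglongrightarrow> fst c"
    "(%n. min (snd c) (y n)) \<longlonglongrightarrow> snd c" "(%n. max (snd c) (y n)) \<longlonglongrightarrow> snd c"
    using tendsto_min[OF tendsto_const lx(1), of "fst c"] tendsto_max[OF tendsto_const lx(1), of "fst c"]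
      tendsto_min[OF tendsto_const lx(2), of "snd c"] tendsto_max[OF tendsto_const lx(2), of "snd c"] by simp_all
  have sx: "(%n. rm (min (fst c) (x n)) (max (fst c) (x n)) a2 b2 i j) \<longlonglongrightarrow> 0" if "i + j <= 3" for i j
    by (rule stripx[OF _ _ _ mm(1,2) that]) (use mem in auto)
  have sy: "(%n. rm a1 b1 (min (snd c) (y n)) (max (snd c) (y n)) i j) \<longlonglongrightarrow> 0" if "i + j <= 3" for i j
    by (rule stripy[OF _ _ _ mm(3,4) that]) (use mem in auto)
  have "(%n. (rm (min (fst c) (x n)) (max (fst c) (x n)) a2 b2 2 0 / (b2 - a2) + rm (min (fst c) (x n)) (max (fst c) (x n)) a2 b2 2 1)
      + (rm a1 b1 (min (snd c) (y n)) (max (snd c) (y n)) 1 1 / (b1 - a1) + rm a1 b1 (min (snd c) (y n)) (max (snd c) (y n)) 2 1))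
      \<longlonglongrightarrow> (0 / (b2 - a2) + 0) + (0 / (b1 - a1) + 0)"
    by (intro tendsto_add tendsto_divide sx sy tendsto_const) (use ab in auto)
  then have r0: "(%n. (rm (min (fst c) (x n)) (max (fst c) (x n)) a2 b2 2 0 / (b2 - a2) + rm (min (fst c) (x n)) (max (fst c) (x n)) a2 b2 2 1)
      + (rm a1 b1 (min (snd c) (y n)) (max (snd c) (y n)) 1 1 / (b1 - a1) + rm a1 b1 (min (snd c) (y n)) (max (snd c) (y n)) 2 1)) \<longlonglongrightarrow> 0" by simp
  have "(%n. p (x n) (y n) - p (fst c) (snd c)) \<longlonglongrightarrow> 0"
    by (rule Lim_null_comparison[OF _ r0]) (use p_osc[OF mem(1) mem(3) mem(2) mem(4)] in simp)
  then show "((%z. p (fst z) (snd z)) \<circ> z) \<longlonglongrightarrow> p (fst c) (snd c)"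
    by (simp add: LIM_zero_iff o_def x_def y_def)
qed

text \<open>The fundamental theorem for the approximations, passed to the limit by dominated
  convergence. With the continuity of \<open>p\<close> it shows later that \<open>p\<close> is the
  classical x-derivative of u.\<close>

lemma p_FTC:
  assumes "a1 <= x" "x <= x'" "x' <= b1" "y \<in> {a2..b2}"
  shows "u x' y - u x y = integral {x..x'} (%s. p s y)"
proof -
  obtain M where M: "!!n x y. x \<in> {a1..b1} ==> y \<in> {a2..b2} ==> \<bar>V n 1 0 x y\<bar> <= M" using p_bounded by blast
  have hi: "((%s. V n 1 0 s y) has_integral V n 0 0 x' y - V n 0 0 x y) {x..x'}" for n
    using fam[of n] assms(2) by (intro fundamental_theorem_of_calculus)
      (auto simp: smooth_family_def has_real_derivative_iff_has_vector_derivative[symmetric] intro: has_field_derivative_at_within)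
  have "(%n. integral {x..x'} (%s. V n 1 0 s y)) \<longlonglongrightarrow> integral {x..x'} (%s. p s y)"
    by (rule dominated_convergence(2)[where h = "%_. M"]) (use hi M assms p_lim in \<open>auto simp: has_integral_iff\<close>)
  moreover have "(%n. integral {x..x'} (%s. V n 1 0 s y)) \<longlonglongrightarrow> u x' y - u x y"
    using integral_unique[OF hi] tendsto_diff[OF ulim ulim, of x' y x y] assms by simp
  ultimately show ?thesis by (rule LIMSEQ_unique[symmetric])
qed

section \<open>Transfer of the cell estimates to the limit function\<close>

definition "subcell x0 x1 y0 y1 \<longleftrightarrow> a1 <= x0 \<and> x0 < x1 \<and> x1 <= b1 \<and> a2 <= y0 \<and> y0 < y1 \<and> y1 <= b2"

lemma rm_nonneg: 
  assumes "subcell x0 x1 y0 y1" "i + j <= 3" shows "rm x0 x1 y0 y1 i j >= 0"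
proof (rule LIMSEQ_le_const[OF Blim])
  have "0 <= mass (V n) x0 x1 y0 y1 i j" for n
    using smooth_cell.NM_nonneg[OF cell] assms by (auto simp: subcell_def)
  then show "\<exists>N. \<forall>n\<ge>N. 0 <= B n x0 x1 y0 y1 i j"
    using massB[of x0 x1 y0 y1 i j] assms by (auto simp: subcell_def intro: order_trans)
qed (use assms in \<open>auto simp: subcell_def\<close>)

lemma B_ge:
  assumes "subcell x0 x1 y0 y1" "i + j <= 3" "c >= 0"
  shows "c * mass (V n) x0 x1 y0 y1 i j <= c * B n x0 x1 y0 y1 i j"
  using assms by (intro mult_left_mono massB) (auto simp: subcell_def)

lemma B_tendsto:
  assumes "subcell x0 x1 y0 y1" "i + j <= 3" 
  shows "(%n. c * B n x0 x1 y0 y1 i j) \<longlonglongrightarrow> c * rm x0 x1 y0 y1 i j"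
  using assms by (intro tendsto_intros Blim) (auto simp: subcell_def)

lemma mid_defect_lim:
  assumes "subcell x0 x1 y0 y1" "y \<in> {y0..y1}"
  shows "(%n. mid_defect (V n 0 0) x0 x1 y) \<longlonglongrightarrow> mid_defect u x0 x1 y"
  unfolding mid_defect_def by (intro tendsto_intros ulim) (use assms in \<open>auto simp: subcell_def\<close>)

text \<open>The first of five transfers of the same kind. The left-hand side of the smooth estimate
  converges, pointwise or by dominated convergence; on the right the masses are replaced by the
  bounds \<open>B\<close>, which tend to \<open>rm\<close>.\<close>

lemma u_mid_defect_osc:
  assumes i: "subcell x0 x1 y0 y1" and y: "y \<in> {y0..y1}" "y' \<in> {y0..y1}"
  shows "\<bar>mid_defect u x0 x1 y' - mid_defect u x0 x1 y\<bar> <= (x1 - x0) * rm x0 x1 y0 y1 2 1"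
proof (rule LIMSEQ_le)
  show "(%n. \<bar>mid_defect (V n 0 0) x0 x1 y' - mid_defect (V n 0 0) x0 x1 y\<bar>) \<longlonglongrightarrow> \<bar>mid_defect u x0 x1 y' - mid_defect u x0 x1 y\<bar>"
    by (intro tendsto_intros mid_defect_lim[OF i] y)
  show "(%n. (x1 - x0) * B n x0 x1 y0 y1 2 1) \<longlonglongrightarrow> (x1 - x0) * rm x0 x1 y0 y1 2 1" by (rule B_tendsto[OF i]) simp
  have "\<bar>mid_defect (V n 0 0) x0 x1 y' - mid_defect (V n 0 0) x0 x1 y\<bar> <= (x1 - x0) * B n x0 x1 y0 y1 2 1" for n
    by (rule order_trans[OF smooth_cell.mid_defect_osc[OF cell y] B_ge[OF i]]) (use i in \<open>auto simp: subcell_def\<close>)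
  then show "\<exists>N. \<forall>n\<ge>N. \<bar>mid_defect (V n 0 0) x0 x1 y' - mid_defect (V n 0 0) x0 x1 y\<bar> <= (x1 - x0) * B n x0 x1 y0 y1 2 1" by blast
qed

lemma u_mid_defect_le:
  assumes i: "subcell x0 x1 y0 y1" and y: "y \<in> {y0..y1}"
  shows "\<bar>mid_defect u x0 x1 y\<bar> <= (x1 - x0) / (y1 - y0) * rm x0 x1 y0 y1 2 0 + (x1 - x0) * rm x0 x1 y0 y1 2 1"
proof (rule LIMSEQ_le)
  show "(%n. \<bar>mid_defect (V n 0 0) x0 x1 y\<bar>) \<longlonglongrightarrow> \<bar>mid_defect u x0 x1 y\<bar>"
    by (intro tendsto_intros mid_defect_lim[OF i] y)
  show "(%n. (x1 - x0) / (y1 - y0) * B n x0 x1 y0 y1 2 0 + (x1 - x0) * B n x0 x1 y0 y1 2 1) \<longlonglongrightarrow> 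
    (x1 - x0) / (y1 - y0) * rm x0 x1 y0 y1 2 0 + (x1 - x0) * rm x0 x1 y0 y1 2 1" 
    by (intro tendsto_add B_tendsto[OF i]) simp_all
  have "\<bar>mid_defect (V n 0 0) x0 x1 y\<bar> <= (x1 - x0) / (y1 - y0) * B n x0 x1 y0 y1 2 0 + (x1 - x0) * B n x0 x1 y0 y1 2 1" for n
    by (rule order_trans[OF smooth_cell.mid_defect_le[OF cell y] add_mono[OF B_ge[OF i] B_ge[OF i]]])
      (use i in \<open>auto simp: subcell_def\<close>)
  then show "\<exists>N. \<forall>n\<ge>N. \<bar>mid_defect (V n 0 0) x0 x1 y\<bar> <= (x1 - x0) / (y1 - y0) * B n x0 x1 y0 y1 2 0 + (x1 - x0) * B n x0 x1 y0 y1 2 1" by blast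
qed

lemma u_cell_dx_error:
  assumes i: "subcell x0 x1 y0 y1"
  shows "integral {y0..y1} (%y. \<bar>p ((x0 + x1) / 2) y - cell_dx u x0 x1 y0 y1 y\<bar>)
     <= (x1 - x0) * rm x0 x1 y0 y1 3 0 + (y1 - y0)\<^sup>2 / (x1 - x0) * rm x0 x1 y0 y1 1 2"
proof (rule LIMSEQ_le)
  have i': "a1 <= x0" "x0 < x1" "x1 <= b1" "a2 <= y0" "y0 < y1" "y1 <= b2" using i by (auto simp: subcell_def)
  let ?f = "%n y. \<bar>V n 1 0 ((x0 + x1) / 2) y - cell_dx (V n 0 0) x0 x1 y0 y1 y\<bar>"
  obtain M where M: "!!n x y. x \<in> {a1..b1} ==> y \<in> {a2..b2} ==> \<bar>V n 1 0 x y\<bar> <= M" using p_bounded by blast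
  let ?Z = "(2 * MU * (y1 - y0) + 2 * MU * (y1 - y0)) / ((x1 - x0) * (y1 - y0))"
  show "(%n. integral {y0..y1} (?f n)) \<longlonglongrightarrow> integral {y0..y1} (%y. \<bar>p ((x0 + x1) / 2) y - cell_dx u x0 x1 y0 y1 y\<bar>)"
  proof (rule dominated_convergence(2)[where h = "%_. M + ?Z"])
    show "?f n integrable_on {y0..y1}" for n
      unfolding cell_dx_def
      by (intro integrable_continuous_real continuous_intros smooth_cell.contV[OF cell[OF i'(2,5)]]) (use i' in auto)
    show "(%y. M + ?Z) integrable_on {y0..y1}" by (rule integrable_const_ivl)
    show "norm (?f n y) <= M + ?Z" if y: "y \<in> {y0..y1}" for n y
    proof -
      have MU: "MU >= 0" using ubnd[of a1 a2 0] ab by force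
      have A: "\<bar>V n 0 0 x1 z - V n 0 0 x0 z\<bar> <= 2 * MU" if "z \<in> {y0, y1}" for z
        using ubnd[of x1 z n] ubnd[of x0 z n] i' that by (auto simp: abs_le_iff)
      have "\<bar>(V n 0 0 x1 y0 - V n 0 0 x0 y0) * (y1 - y) + (V n 0 0 x1 y1 - V n 0 0 x0 y1) * (y - y0)\<bar>
         <= \<bar>V n 0 0 x1 y0 - V n 0 0 x0 y0\<bar> * \<bar>y1 - y\<bar> + \<bar>V n 0 0 x1 y1 - V n 0 0 x0 y1\<bar> * \<bar>y - y0\<bar>"
        by (metis abs_mult abs_triangle_ineq)
      also have "\<dots> <= 2 * MU * (y1 - y0) + 2 * MU * (y1 - y0)"
        using y A[of y0] A[of y1] MU by (intro add_mono mult_mono) auto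
      finally have "\<bar>cell_dx (V n 0 0) x0 x1 y0 y1 y\<bar> <= ?Z"
        unfolding cell_dx_def abs_divide using i' by (intro frac_le) auto
      then show ?thesis using M[of "(x0 + x1) / 2" y n] y i' by auto
    qed
    show "(%n. ?f n y) \<longlonglongrightarrow> \<bar>p ((x0 + x1) / 2) y - cell_dx u x0 x1 y0 y1 y\<bar>" if "y \<in> {y0..y1}" for y
      unfolding cell_dx_def by (intro tendsto_intros p_lim ulim) (use i' that in auto)
  qed
  show "(%n. (x1 - x0) * B n x0 x1 y0 y1 3 0 + (y1 - y0)\<^sup>2 / (x1 - x0) * B n x0 x1 y0 y1 1 2) \<longlonglongrightarrow> 
     (x1 - x0) * rm x0 x1 y0 y1 3 0 + (y1 - y0)\<^sup>2 / (x1 - x0) * rm x0 x1 y0 y1 1 2" 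
    by (intro tendsto_add B_tendsto[OF i]) simp_all
  have "integral {y0..y1} (?f n) <= (x1 - x0) * B n x0 x1 y0 y1 3 0 + (y1 - y0)\<^sup>2 / (x1 - x0) * B n x0 x1 y0 y1 1 2" for n
    by (rule order_trans[OF smooth_cell.cell_dx_error[OF cell[OF i'(2,5)]] add_mono[OF B_ge[OF i] B_ge[OF i]]])
      (use i' in auto)
  then show "\<exists>N. \<forall>n\<ge>N. integral {y0..y1} (?f n) <= (x1 - x0) * B n x0 x1 y0 y1 3 0 + (y1 - y0)\<^sup>2 / (x1 - x0) * B n x0 x1 y0 y1 1 2" by blast
qed

lemma u_cell_dy_error:
  assumes i: "subcell x0 x1 y0 y1" 
  shows "integral {y0..y1} (%y. \<bar>q ((x0 + x1) / 2) y - cell_dy u x0 x1 y0 y1\<bar>)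
     <= (y1 - y0) / (x1 - x0) * rm x0 x1 y0 y1 0 2 + (y1 - y0) * rm x0 x1 y0 y1 1 2 + (x1 - x0) * rm x0 x1 y0 y1 2 1"
proof (rule LIMSEQ_le)
  \<comment> \<open>The flipped instance supplies the bound and the limit of the y-derivatives from
    \<open>p_bounded\<close> and \<open>p_lim\<close>.\<close>
  interpret F: approx a2 b2 a1 b1 "%x y. u y x" "%n i j x y. V n j i y x" "%n k1 k2 l1 l2 i j. B n l1 l2 k1 k2 j i"
    "%k1 k2 l1 l2 i j. rm l1 l2 k1 k2 j i" MU by (rule approx_flip) unfold_locales
  have i': "a1 <= x0" "x0 < x1" "x1 <= b1" "a2 <= y0" "y0 < y1" "y1 <= b2" using i by (auto simp: subcell_def)
  let ?f = "%n y. \<bar>V n 0 1 ((x0 + x1) / 2) y - cell_dy (V n 0 0) x0 x1 y0 y1\<bar>"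
  obtain M where M: "!!n x y. x \<in> {a2..b2} ==> y \<in> {a1..b1} ==> \<bar>V n 0 1 y x\<bar> <= M" using F.p_bounded by blast
  let ?Z = "(4 * MU) / (2 * (y1 - y0))"
  show "(%n. integral {y0..y1} (?f n)) \<longlonglongrightarrow> integral {y0..y1} (%y. \<bar>q ((x0 + x1) / 2) y - cell_dy u x0 x1 y0 y1\<bar>)"
  proof (rule dominated_convergence(2)[where h = "%_. M + ?Z"])
    show "?f n integrable_on {y0..y1}" for n
      by (intro integrable_continuous_real continuous_intros smooth_cell.contV[OF cell[OF i'(2,5)]])
    show "(%y. M + ?Z) integrable_on {y0..y1}" by (rule integrable_const_ivl)
    show "norm (?f n y) <= M + ?Z" if y: "y \<in> {y0..y1}" for n y
    proof -
      have "\<bar>V n 0 0 x0 y0\<bar> <= MU" "\<bar>V n 0 0 x1 y0\<bar> <= MU" "\<bar>V n 0 0 x0 y1\<bar> <= MU" "\<bar>V n 0 0 x1 y1\<bar> <= MU"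
        using i' by (intro ubnd; simp)+
      then have "\<bar>(V n 0 0 x0 y1 - V n 0 0 x0 y0) + (V n 0 0 x1 y1 - V n 0 0 x1 y0)\<bar> <= 4 * MU" by linarith
      then have "\<bar>cell_dy (V n 0 0) x0 x1 y0 y1\<bar> <= ?Z"
        unfolding cell_dy_def abs_divide using i' by (intro frac_le) auto
      then show ?thesis using M[of y "(x0 + x1) / 2" n] y i' by auto
    qed
    show "(%n. ?f n y) \<longlonglongrightarrow> \<bar>q ((x0 + x1) / 2) y - cell_dy u x0 x1 y0 y1\<bar>" if "y \<in> {y0..y1}" for y
    proof -
      have "(%n. V n 0 1 ((x0 + x1) / 2) y) \<longlonglongrightarrow> q ((x0 + x1) / 2) y"
        using F.p_lim[of y "(x0 + x1) / 2"] i' that by (simp add: F.p_def q_def)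
      then show ?thesis unfolding cell_dy_def by (intro tendsto_intros ulim) (use i' that in auto)
    qed
  qed
  show "(%n. (y1 - y0) / (x1 - x0) * B n x0 x1 y0 y1 0 2 + (y1 - y0) * B n x0 x1 y0 y1 1 2 + (x1 - x0) * B n x0 x1 y0 y1 2 1) \<longlonglongrightarrow> 
    (y1 - y0) / (x1 - x0) * rm x0 x1 y0 y1 0 2 + (y1 - y0) * rm x0 x1 y0 y1 1 2 + (x1 - x0) * rm x0 x1 y0 y1 2 1" 
    by (intro tendsto_add B_tendsto[OF i]) simp_all
  have "integral {y0..y1} (?f n) <= (y1 - y0) / (x1 - x0) * B n x0 x1 y0 y1 0 2 + (y1 - y0) * B n x0 x1 y0 y1 1 2 + (x1 - x0) * B n x0 x1 y0 y1 2 1" for n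
    by (rule order_trans[OF smooth_cell.cell_dy_error[OF cell[OF i'(2,5)]] add_mono[OF add_mono[OF B_ge[OF i] B_ge[OF i]] B_ge[OF i]]])
      (use i' in auto)
  then show "\<exists>N. \<forall>n\<ge>N. integral {y0..y1} (?f n) <= (y1 - y0) / (x1 - x0) * B n x0 x1 y0 y1 0 2 + (y1 - y0) * B n x0 x1 y0 y1 1 2 + (x1 - x0) * B n x0 x1 y0 y1 2 1" by blast
qed

lemma u_bilin_error:
  assumes i: "subcell x0 x1 y0 y1"
  shows "integral (cbox (x0, y0) (x1, y1)) (%p. \<bar>u (fst p) (snd p) - bilin u x0 x1 y0 y1 (fst p) (snd p)\<bar>)
     <= (x1 - x0)\<^sup>2 * rm x0 x1 y0 y1 2 0 + (y1 - y0)\<^sup>2 * rm x0 x1 y0 y1 0 2 + (x1 - x0) * (y1 - y0)\<^sup>2 * rm x0 x1 y0 y1 1 2"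
proof (rule LIMSEQ_le)
  have i': "a1 <= x0" "x0 < x1" "x1 <= b1" "a2 <= y0" "y0 < y1" "y1 <= b2" using i by (auto simp: subcell_def)
  let ?f = "%n p. \<bar>V n 0 0 (fst p) (snd p) - bilin (V n 0 0) x0 x1 y0 y1 (fst p) (snd p)\<bar>"
  show "(%n. integral (cbox (x0, y0) (x1, y1)) (?f n)) \<longlonglongrightarrow> integral (cbox (x0, y0) (x1, y1)) (%p. \<bar>u (fst p) (snd p) - bilin u x0 x1 y0 y1 (fst p) (snd p)\<bar>)"
  proof (rule dominated_convergence(2)[where h = "%_. MU + MU"])
    show "?f n integrable_on cbox (x0, y0) (x1, y1)" for n
      unfolding bilin_def
      by (intro integrable_continuous continuous_intros smooth_cell.contV[OF cell[OF i'(2,5)]]) (use i' in auto)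
    show "(%p. MU + MU) integrable_on cbox (x0, y0) (x1, y1)" by (rule integrable_const)
    show "norm (?f n p) <= MU + MU" if p: "p \<in> cbox (x0, y0) (x1, y1)" for n p
    proof -
      obtain x y where xy: "p = (x, y)" "x \<in> {x0..x1}" "y \<in> {y0..y1}" using p by (cases p) (auto simp: cbox_Pair_real)
      have conv: "\<bar>(A * (b - t) + A' * (t - a)) / (b - a)\<bar> <= MU" if "\<bar>A\<bar> <= MU" "\<bar>A'\<bar> <= MU" "a < b" "t \<in> {a..b}" for A A' a b t
      proof -
        have "\<bar>A * (b - t) + A' * (t - a)\<bar> <= \<bar>A\<bar> * (b - t) + \<bar>A'\<bar> * (t - a)"
          using that(4) abs_triangle_ineq[of "A * (b - t)" "A' * (t - a)"] by (simp add: abs_mult)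
        also have "\<dots> <= MU * (b - t) + MU * (t - a)" using that by (intro add_mono mult_right_mono) auto
        also have "\<dots> = MU * (b - a)" by (simp add: algebra_simps)
        finally show ?thesis using that by (simp add: abs_divide divide_le_eq)
      qed
      have "\<bar>V n 0 0 x0 y0\<bar> <= MU" "\<bar>V n 0 0 x1 y0\<bar> <= MU" "\<bar>V n 0 0 x0 y1\<bar> <= MU" "\<bar>V n 0 0 x1 y1\<bar> <= MU"
        using i' by (intro ubnd; simp)+
      then have "\<bar>bilin (V n 0 0) x0 x1 y0 y1 x y\<bar> <= MU"
        unfolding bilin_def by (intro conv i' xy)
      moreover have "\<bar>V n 0 0 x y\<bar> <= MU" using xy i' by (intro ubnd) auto
      ultimately show ?thesis by (simp add: xy)
    qed
    show "(%n. ?f n p) \<longlonglongrightarrow> \<bar>u (fst p) (snd p) - bilin u x0 x1 y0 y1 (fst p) (snd p)\<bar>" if "p \<in> cbox (x0, y0) (x1, y1)" for p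
      unfolding bilin_def by (intro tendsto_intros ulim) (use i' that in \<open>auto simp: cbox_Pair_real\<close>)
  qed
  show "(%n. (x1 - x0)\<^sup>2 * B n x0 x1 y0 y1 2 0 + (y1 - y0)\<^sup>2 * B n x0 x1 y0 y1 0 2 + (x1 - x0) * (y1 - y0)\<^sup>2 * B n x0 x1 y0 y1 1 2) \<longlonglongrightarrow> 
     (x1 - x0)\<^sup>2 * rm x0 x1 y0 y1 2 0 + (y1 - y0)\<^sup>2 * rm x0 x1 y0 y1 0 2 + (x1 - x0) * (y1 - y0)\<^sup>2 * rm x0 x1 y0 y1 1 2" 
    by (intro tendsto_add B_tendsto[OF i]) simp_all
  have "integral (cbox (x0, y0) (x1, y1)) (?f n) <= (x1 - x0)\<^sup>2 * B n x0 x1 y0 y1 2 0 + (y1 - y0)\<^sup>2 * B n x0 x1 y0 y1 0 2 + (x1 - x0) * (y1 - y0)\<^sup>2 * B n x0 x1 y0 y1 1 2" for n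
    by (rule order_trans[OF smooth_cell.bilin_error[OF cell[OF i'(2,5)]] add_mono[OF add_mono[OF B_ge[OF i] B_ge[OF i]] B_ge[OF i]]])
      (use i' in auto)
  then show "\<exists>N. \<forall>n\<ge>N. integral (cbox (x0, y0) (x1, y1)) (?f n) <= (x1 - x0)\<^sup>2 * B n x0 x1 y0 y1 2 0 + (y1 - y0)\<^sup>2 * B n x0 x1 y0 y1 0 2 + (x1 - x0) * (y1 - y0)\<^sup>2 * B n x0 x1 y0 y1 1 2" by blast
qed

end

subsection \<open>Mollification after a contraction towards the centre\<close>

lemma moll_minus: "moll (- t) = moll t"
  by (simp add: moll_eq bump_def mult.commute)

locale weak_h3 =
  fixes a1 b1 a2 b2 :: real and u :: "real \<times> real => real" and r :: "nat => nat => real \<times> real => real"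
  assumes ab: "a1 < b1" "a2 < b2"
    and u_cont: "continuous_on (cbox (a1, a2) (b1, b2)) u"
    and wdr: "!!i j. i + j <= 3 ==> weak_deriv (box (a1, a2) (b1, b2)) (i, j) u (r i j)"
    and r_int: "!!i j. i + j <= 3 ==> set_integrable lborel (box (a1, a2) (b1, b2)) (r i j)"
begin

abbreviation "\<Omega> \<equiv> box (a1, a2) (b1, b2)"
abbreviation "R \<equiv> cbox (a1, a2) (b1, b2)"

text \<open>The contraction by \<open>lam = 1 - dl\<close> moves a boundary point inwards by half of
  \<open>dl\<close> times the side length, while \<open>eps\<close> is at most a quarter of that
  product. Hence the \<open>eps\<close>-neighbourhood of a contracted point stays inside the domain
  (\<open>S_in\<close>).\<close>

definition dl :: "nat => real" where "dl n = 1 / (real n + 2)"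
definition lam :: "nat => real" where "lam n = 1 - dl n"
definition eps :: "nat => real" where "eps n = dl n * min (b1 - a1) (b2 - a2) / 4"
definition S1 :: "nat => real => real" where "S1 n x = (a1 + b1) / 2 + lam n * (x - (a1 + b1) / 2)"
definition S2 :: "nat => real => real" where "S2 n y = (a2 + b2) / 2 + lam n * (y - (a2 + b2) / 2)"
definition M :: "nat => real => real" where "M k = (deriv ^^ k) moll"

text \<open>The derivative of order (i, j) of the mollified and dilated u: all derivatives fall on
  the kernel, each giving a chain-rule factor \<open>lam / eps\<close>, and \<open>1 / eps^2\<close>
  normalises the kernel.\<close>

definition V :: "nat => nat => nat => real => real => real" where
  "V n i j x y = (lam n / eps n) ^ (i + j) / (eps n)\<^sup>2 *
     integral R (%w. u w * (M i ((S1 n x - fst w) / eps n) * M j ((S2 n y - snd w) / eps n)))"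

definition kern :: "nat => real => real => real \<times> real => real" where
  "kern n x y w = (moll ((S1 n x - fst w) / eps n) / eps n) * (moll ((S2 n y - snd w) / eps n) / eps n)"

text \<open>Up to the factor \<open>lam^2\<close>, the integral of \<open>kern n x y w\<close> over
  (x, y) in the rectangle (\<open>kern_integral\<close>). It approximates the indicator of the
  rectangle in the variable w.\<close>

definition G :: "nat => real => real => real => real => real \<times> real => real" where
  "G n k1 k2 l1 l2 w = (step ((S1 n k2 - fst w) / eps n) - step ((S1 n k1 - fst w) / eps n))
     * (step ((S2 n l2 - snd w) / eps n) - step ((S2 n l1 - snd w) / eps n))"

definition B :: "nat => real => real => real => real => nat => nat => real" where
  "B n k1 k2 l1 l2 i j = (\<integral>w. (indicator \<Omega> w * \<bar>r i j w\<bar>) * G n k1 k2 l1 l2 w \<partial>lborel) / (lam n)\<^sup>2"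

definition rm :: "real => real => real => real => nat => nat => real" where
  "rm k1 k2 l1 l2 i j = (LINT w:box (k1, l1) (k2, l2)|lborel. \<bar>r i j w\<bar>)"

lemma dl: "dl n > 0" "dl n <= 1/2" "dl \<longlonglongrightarrow> 0"
proof -
  show "dl n > 0" "dl n <= 1/2" by (auto simp: dl_def field_simps)
  show "dl \<longlonglongrightarrow> 0" unfolding dl_def by real_asymp
qed

lemma lam: "lam n >= 1/2" "lam n < 1" "lam n > 0" "lam \<longlonglongrightarrow> 1"
proof -
  show "lam n >= 1/2" "lam n < 1" "lam n > 0" using dl(1,2)[of n] by (auto simp: lam_def)
  have "(%n. 1 - dl n) \<longlonglongrightarrow> 1 - 0" by (intro tendsto_intros dl)
  then show "lam \<longlonglongrightarrow> 1" by (simp add: lam_def[abs_def])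
qed

lemma eps: "eps n > 0" "eps \<longlonglongrightarrow> 0" "eps n <= dl n * (b1 - a1) / 4" "eps n <= dl n * (b2 - a2) / 4"
proof -
  show "eps n > 0" using dl(1)[of n] ab by (simp add: eps_def)
  have "(%n. dl n * min (b1 - a1) (b2 - a2) / 4) \<longlonglongrightarrow> 0 * min (b1 - a1) (b2 - a2) / 4" by (intro tendsto_intros dl) auto
  then show "eps \<longlonglongrightarrow> 0" by (simp add: eps_def[abs_def])
  show "eps n <= dl n * (b1 - a1) / 4" "eps n <= dl n * (b2 - a2) / 4"
    unfolding eps_def using dl(1)[of n] by (intro divide_right_mono mult_left_mono; simp)+
qed

lemma S_in:
  "x \<in> {a1..b1} ==> a1 < S1 n x - eps n \<and> S1 n x + eps n < b1"
  "y \<in> {a2..b2} ==> a2 < S2 n y - eps n \<and> S2 n y + eps n < b2"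
proof -
  have *: "a < (a + b) / 2 + lam n * (x - (a + b) / 2) - eps n \<and> (a + b) / 2 + lam n * (x - (a + b) / 2) + eps n < b"
    if "a < b" "x \<in> {a..b}" "eps n <= dl n * (b - a) / 4" for a b x
  proof -
    have "lam n * (a - (a + b) / 2) <= lam n * (x - (a + b) / 2)" "lam n * (x - (a + b) / 2) <= lam n * (b - (a + b) / 2)"
      using lam(3)[of n] that by (intro mult_left_mono; auto)+
    moreover have "lam n * (a - (a + b) / 2) = - (b - a) / 2 + dl n * (b - a) / 2" "lam n * (b - (a + b) / 2) = (b - a) / 2 - dl n * (b - a) / 2"
      by (simp_all add: lam_def field_simps)
    moreover have "dl n * (b - a) > 0" using dl(1)[of n] that by simp
    ultimately show ?thesis using that(3) by (simp add: field_simps)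
  qed
  show "x \<in> {a1..b1} ==> a1 < S1 n x - eps n \<and> S1 n x + eps n < b1" unfolding S1_def by (rule *[OF ab(1) _ eps(3)])
  show "y \<in> {a2..b2} ==> a2 < S2 n y - eps n \<and> S2 n y + eps n < b2" unfolding S2_def by (rule *[OF ab(2) _ eps(4)])
qed

lemma S_lim: "(%n. S1 n x) \<longlonglongrightarrow> x" "(%n. S2 n y) \<longlonglongrightarrow> y"
proof -
  have "(%n. S1 n x) \<longlonglongrightarrow> (a1 + b1) / 2 + 1 * (x - (a1 + b1) / 2)" unfolding S1_def by (intro tendsto_intros lam)
  then show "(%n. S1 n x) \<longlonglongrightarrow> x" by simp
  have "(%n. S2 n y) \<longlonglongrightarrow> (a2 + b2) / 2 + 1 * (y - (a2 + b2) / 2)" unfolding S2_def by (intro tendsto_intros lam)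
  then show "(%n. S2 n y) \<longlonglongrightarrow> y" by simp
qed

lemma S_mono: "k <= k' ==> S1 n k <= S1 n k'" "k <= k' ==> S2 n k <= S2 n k'"
  unfolding S1_def S2_def using lam(3)[of n] by (auto intro!: mult_left_mono)

lemma S_cont: "continuous_on A f ==> continuous_on A (%x. S1 n (f x))" "continuous_on A f ==> continuous_on A (%x. S2 n (f x))"
  unfolding S1_def S2_def by (intro continuous_intros; simp)+

lemma M_deriv: "(M k has_real_derivative M (Suc k) t) (at t)"
  unfolding M_def by (rule smooth1_funpow_deriv[OF smooth1_moll])

lemma M_cont: "continuous_on A f ==> continuous_on A (%z. M k (f z))"
  unfolding M_def by (rule continuous_on_compose2[OF smooth1_cont[OF smooth1_funpow[OF smooth1_moll], of UNIV]]) auto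

lemma DS: "((%x. M k ((S1 n x - s) / eps n)) has_real_derivative M (Suc k) ((S1 n x - s) / eps n) * (lam n / eps n)) (at x within A)"
  "((%x. M k ((S2 n x - s) / eps n)) has_real_derivative M (Suc k) ((S2 n x - s) / eps n) * (lam n / eps n)) (at x within A)"
proof -
  have "((%x. (S1 n x - s) / eps n) has_real_derivative lam n / eps n) (at x within A)"
    unfolding S1_def by (rule DERIV_cdivide) (auto intro!: derivative_eq_intros)
  from DERIV_chain2[OF M_deriv this] show "((%x. M k ((S1 n x - s) / eps n)) has_real_derivative M (Suc k) ((S1 n x - s) / eps n) * (lam n / eps n)) (at x within A)" .
  have "((%x. (S2 n x - s) / eps n) has_real_derivative lam n / eps n) (at x within A)"
    unfolding S2_def by (rule DERIV_cdivide) (auto intro!: derivative_eq_intros)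
  from DERIV_chain2[OF M_deriv this] show "((%x. M k ((S2 n x - s) / eps n)) has_real_derivative M (Suc k) ((S2 n x - s) / eps n) * (lam n / eps n)) (at x within A)" .
qed

lemma cont_integrand:
  assumes "continuous_on A f" "continuous_on A g" "continuous_on A h" "h ` A \<subseteq> R"
  shows "continuous_on A (%z. u (h z) * (M i ((S1 n (f z) - fst (h z)) / eps n) * M j ((S2 n (g z) - snd (h z)) / eps n)))"
  by (intro continuous_on_mult M_cont continuous_on_divide continuous_on_diff S_cont continuous_on_fst continuous_on_snd
     continuous_on_const continuous_on_compose2[OF u_cont] assms) (use eps(1)[of n] in auto)

lemma V_family: "smooth_family (V n)"
  unfolding smooth_family_def
proof (intro conjI allI)
  fix i j x y
  let ?f = "%x w. u w * (M i ((S1 n x - fst w) / eps n) * M j ((S2 n y - snd w) / eps n))"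
  let ?f' = "%x w. lam n / eps n * (u w * (M (Suc i) ((S1 n x - fst w) / eps n) * M j ((S2 n y - snd w) / eps n)))"
  have "((%x. integral R (?f x)) has_field_derivative integral R (?f' x)) (at x within UNIV)"
  proof (rule leibniz_rule_field_derivative)
    show "((%x. ?f x t) has_field_derivative ?f' x t) (at x within UNIV)" for x t
      by (rule DERIV_cong[OF DERIV_cmult[OF DERIV_cmult_right[OF DS(1)]]]) simp
    show "?f x integrable_on R" for x
      by (intro integrable_continuous cont_integrand continuous_on_const continuous_on_id) auto
    have "continuous_on (UNIV \<times> R) (%z. lam n / eps n * (u (snd z) * (M (Suc i) ((S1 n (fst z) - fst (snd z)) / eps n) * M j ((S2 n y - snd (snd z)) / eps n))))"
      by (intro continuous_on_mult_left cont_integrand continuous_on_const continuous_on_id continuous_on_fst continuous_on_snd) auto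
    then show "continuous_on (UNIV \<times> R) (%(x, t). ?f' x t)" by (simp add: split_def)
  qed auto
  from DERIV_cmult[OF this, of "(lam n / eps n) ^ (i + j) / (eps n)\<^sup>2"]
  show "((%x. V n i j x y) has_real_derivative V n (Suc i) j x y) (at x)"
    unfolding V_def by (simp add: mult_ac)
next
  fix i j x y
  let ?f = "%y w. u w * (M i ((S1 n x - fst w) / eps n) * M j ((S2 n y - snd w) / eps n))"
  let ?f' = "%y w. lam n / eps n * (u w * (M i ((S1 n x - fst w) / eps n) * M (Suc j) ((S2 n y - snd w) / eps n)))"
  have "((%y. integral R (?f y)) has_field_derivative integral R (?f' y)) (at y within UNIV)"
  proof (rule leibniz_rule_field_derivative)
    show "((%y. ?f y t) has_field_derivative ?f' y t) (at y within UNIV)" for y t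
      by (rule DERIV_cong[OF DERIV_cmult[OF DERIV_cmult[OF DS(2)]]]) simp
    show "?f y integrable_on R" for y
      by (intro integrable_continuous cont_integrand continuous_on_const continuous_on_id) auto
    have "continuous_on (UNIV \<times> R) (%z. lam n / eps n * (u (snd z) * (M i ((S1 n x - fst (snd z)) / eps n) * M (Suc j) ((S2 n (fst z) - snd (snd z)) / eps n))))"
      by (intro continuous_on_mult_left cont_integrand continuous_on_const continuous_on_id continuous_on_fst continuous_on_snd) auto
    then show "continuous_on (UNIV \<times> R) (%(x, t). ?f' x t)" by (simp add: split_def)
  qed auto
  from DERIV_cmult[OF this, of "(lam n / eps n) ^ (i + j) / (eps n)\<^sup>2"]
  show "((%y. V n i j x y) has_real_derivative V n i (Suc j) x y) (at y)"
    unfolding V_def by (simp add: mult_ac)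
next
  fix i j
  have "continuous_on (UNIV \<times> R) (%z. u (snd z) * (M i ((S1 n (fst (fst z)) - fst (snd z)) / eps n) * M j ((S2 n (snd (fst z)) - snd (snd z)) / eps n)))"
    by (intro cont_integrand continuous_on_const continuous_on_id continuous_on_fst continuous_on_snd) auto
  then have "continuous_on (UNIV \<times> R) (%(p, w). u w * (M i ((S1 n (fst p) - fst w) / eps n) * M j ((S2 n (snd p) - snd w) / eps n)))"
    by (simp add: split_def)
  from integral_continuous_on_param[OF this]
  show "continuous_on UNIV (%p. V n i j (fst p) (snd p))"
    unfolding V_def by (intro continuous_on_mult_left)
qed

text \<open>As a function of w the kernel is a test function supported inside \<Omega>, so its
  derivatives can be moved onto u. A derivative in w brings -1/eps where one in x or y brings
  lam/eps: the signs cancel those of the weak derivative and \<open>lam^(i + j)\<close>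
  remains.\<close>

lemma V_eq:
  assumes xy: "x \<in> {a1..b1}" "y \<in> {a2..b2}" and ij: "i + j <= 3"
  shows "V n i j x y = lam n ^ (i + j) * (LINT w:\<Omega>|lborel. r i j w * kern n x y w)"
proof -
  define e where "e = eps n"
  have e: "e > 0" using eps by (simp add: e_def)
  define \<phi> where "\<phi> s = (1 / e) * moll ((- 1 / e) * s + S1 n x / e)" for s
  define \<psi> where "\<psi> s = (1 / e) * moll ((- 1 / e) * s + S2 n y / e)" for s
  have sm: "smooth1 \<phi>" "smooth1 \<psi>" unfolding \<phi>_def[abs_def] \<psi>_def[abs_def] by (rule smooth1_affine[OF smooth1_moll])+
  have arg: "(- 1 / e) * s + c / e = (c - s) / e" for s c by (simp add: diff_divide_distrib)
  have d: "(deriv ^^ k) \<phi> s = (1 / e) * (- 1 / e) ^ k * M k ((S1 n x - s) / e)" 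
    "(deriv ^^ k) \<psi> s = (1 / e) * (- 1 / e) ^ k * M k ((S2 n y - s) / e)" for k s
  proof -
    have "(deriv ^^ k) \<phi> = (%s. (1 / e) * (- 1 / e) ^ k * (deriv ^^ k) moll ((- 1 / e) * s + S1 n x / e))"
      unfolding \<phi>_def[abs_def] by (rule funpow_deriv_affine[OF smooth1_moll])
    then show "(deriv ^^ k) \<phi> s = (1 / e) * (- 1 / e) ^ k * M k ((S1 n x - s) / e)" by (simp only: arg M_def)
    have "(deriv ^^ k) \<psi> = (%s. (1 / e) * (- 1 / e) ^ k * (deriv ^^ k) moll ((- 1 / e) * s + S2 n y / e))"
      unfolding \<psi>_def[abs_def] by (rule funpow_deriv_affine[OF smooth1_moll])
    then show "(deriv ^^ k) \<psi> s = (1 / e) * (- 1 / e) ^ k * M k ((S2 n y - s) / e)" by (simp only: arg M_def)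
  qed
  have z: "moll ((c - s) / e) = 0" if "s \<notin> {c - e..c + e}" for c s
  proof (rule moll_eq_0)
    have "\<bar>c - s\<bar> >= e" using that e by auto
    then show "\<bar>(c - s) / e\<bar> >= 1" using e by (simp add: abs_divide)
  qed
  have tf: "test_fun \<Omega> (%p. \<phi> (fst p) * \<psi> (snd p))"
  proof (rule test_fun_tensor[OF sm])
    show "\<phi> s = 0" if "s \<notin> {S1 n x - e..S1 n x + e}" for s unfolding \<phi>_def arg z[OF that] by simp
    show "\<psi> s = 0" if "s \<notin> {S2 n y - e..S2 n y + e}" for s unfolding \<psi>_def arg z[OF that] by simp
    show "{S1 n x - e..S1 n x + e} \<times> {S2 n y - e..S2 n y + e} \<subseteq> \<Omega>"
      using S_in(1)[OF xy(1), of n] S_in(2)[OF xy(2), of n] by (auto simp: box_Pair_real e_def)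
  qed
  have pk: "\<phi> (fst w) * \<psi> (snd w) = kern n x y w" for w
    unfolding \<phi>_def \<psi>_def arg unfolding kern_def e_def by simp
  have W: "(LINT p:\<Omega>|lborel. u p * ((deriv ^^ i) \<phi> (fst p) * (deriv ^^ j) \<psi> (snd p)))
     = (-1) ^ (i + j) * (LINT p:\<Omega>|lborel. r i j p * kern n x y p)"
    using weak_deriv_tensor[OF wdr[OF ij] sm tf] unfolding pk .
  let ?g = "%w. u w * (M i ((S1 n x - fst w) / e) * M j ((S2 n y - snd w) / e))"
  have cg: "continuous_on R ?g" unfolding e_def
    by (intro cont_integrand continuous_on_const continuous_on_id) auto
  have "(LINT p:\<Omega>|lborel. u p * ((deriv ^^ i) \<phi> (fst p) * (deriv ^^ j) \<psi> (snd p)))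
     = (LINT p:\<Omega>|lborel. ((1 / e)\<^sup>2 * (- 1 / e) ^ (i + j)) * ?g p)"
    unfolding d by (simp add: power2_eq_square power_add mult_ac)
  also have "\<dots> = ((1 / e)\<^sup>2 * (- 1 / e) ^ (i + j)) * integral R ?g"
    using set_borel_integral_eq_integral(2)[OF set_integrable_box_of_continuous[OF cg]]
    by (simp add: integral_open_interval)
  finally have "((1 / e)\<^sup>2 * (- 1 / e) ^ (i + j)) * integral R ?g = (-1) ^ (i + j) * (LINT p:\<Omega>|lborel. r i j p * kern n x y p)"
    using W by simp
  moreover have "(- 1 / e) ^ (i + j) = (-1) ^ (i + j) * (1 / e) ^ (i + j)"
    unfolding power_mult_distrib[symmetric] by simp
  ultimately have "(1 / e)\<^sup>2 * (1 / e) ^ (i + j) * integral R ?g = (LINT p:\<Omega>|lborel. r i j p * kern n x y p)"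
    by (simp add: mult_ac)
  then have "(LINT p:\<Omega>|lborel. r i j p * kern n x y p) = (1 / e)\<^sup>2 * (1 / e) ^ (i + j) * integral R ?g" by (rule sym)
  then show ?thesis unfolding V_def e_def[symmetric] by (simp only:) (simp add: power_divide)
qed

lemma kern_nonneg: "kern n x y w >= 0"
  unfolding kern_def using moll_nonneg eps(1)[of n] by (simp add: less_imp_le)

lemma moll_contc: "continuous_on A f ==> continuous_on A (%z. moll (f z))"
  by (rule continuous_on_compose2[OF smooth1_cont[OF smooth1_moll, of UNIV]]) auto

lemma step_contc: "continuous_on A f ==> continuous_on A (%z. step (f z))"
  by (rule continuous_on_compose2[OF smooth1_cont[OF smooth1_step, of UNIV]]) auto

lemma kern_cont:
  assumes "continuous_on A f" "continuous_on A g" "continuous_on A h"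
  shows "continuous_on A (%z. kern n (f z) (g z) (h z))"
  unfolding kern_def
  by (intro continuous_on_mult moll_contc continuous_on_divide continuous_on_diff S_cont continuous_on_fst continuous_on_snd
     continuous_on_const assms) (use eps(1)[of n] in auto)

lemma kern_integral:
  assumes "k1 <= k2" "l1 <= l2"
  shows "integral (cbox (k1, l1) (k2, l2)) (%z. kern n (fst z) (snd z) w) = G n k1 k2 l1 l2 w / (lam n)\<^sup>2"
proof -
  have D: "((%x. step ((S1 n x - s) / eps n) / lam n) has_real_derivative moll ((S1 n x - s) / eps n) / eps n) (at x within A)"
    "((%x. step ((S2 n x - s) / eps n) / lam n) has_real_derivative moll ((S2 n x - s) / eps n) / eps n) (at x within A)" for s x A
  proof -
    have d: "((%x. (S1 n x - s) / eps n) has_real_derivative lam n / eps n) (at x within A)" "((%x. (S2 n x - s) / eps n) has_real_derivative lam n / eps n) (at x within A)"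
      unfolding S1_def S2_def by (rule DERIV_cdivide, (auto intro!: derivative_eq_intros)[1])+
    show "((%x. step ((S1 n x - s) / eps n) / lam n) has_real_derivative moll ((S1 n x - s) / eps n) / eps n) (at x within A)"
      by (rule DERIV_cong[OF DERIV_cdivide[OF DERIV_chain2[OF step_deriv d(1)]]]) (use lam(3)[of n] eps(1)[of n] in simp)
    show "((%x. step ((S2 n x - s) / eps n) / lam n) has_real_derivative moll ((S2 n x - s) / eps n) / eps n) (at x within A)"
      by (rule DERIV_cong[OF DERIV_cdivide[OF DERIV_chain2[OF step_deriv d(2)]]]) (use lam(3)[of n] eps(1)[of n] in simp)
  qed
  have I1: "integral {k1..k2} (%x. moll ((S1 n x - s) / eps n) / eps n) = step ((S1 n k2 - s) / eps n) / lam n - step ((S1 n k1 - s) / eps n) / lam n" for s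
    by (intro integral_unique fundamental_theorem_of_calculus assms)
      (use D(1) in \<open>simp add: has_real_derivative_iff_has_vector_derivative[symmetric]\<close>)
  have I2: "integral {l1..l2} (%x. moll ((S2 n x - s) / eps n) / eps n) = step ((S2 n l2 - s) / eps n) / lam n - step ((S2 n l1 - s) / eps n) / lam n" for s
    by (intro integral_unique fundamental_theorem_of_calculus assms)
      (use D(2) in \<open>simp add: has_real_derivative_iff_has_vector_derivative[symmetric]\<close>)
  have "integral (cbox (k1, l1) (k2, l2)) (%z. kern n (fst z) (snd z) w)
     = integral {k1..k2} (%x. integral {l1..l2} (%y. kern n x y w))"
    using iterated_swap(1)[of k1 l1 k2 l2 "%z. kern n (fst z) (snd z) w"] kern_cont[OF continuous_on_fst[OF continuous_on_id] continuous_on_snd[OF continuous_on_id] continuous_on_const]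
    by simp
  also have "\<dots> = integral {k1..k2} (%x. (moll ((S1 n x - fst w) / eps n) / eps n) * integral {l1..l2} (%y. moll ((S2 n y - snd w) / eps n) / eps n))"
    unfolding kern_def by (intro integral_cong) (rule integral_mult_right)
  also have "\<dots> = integral {k1..k2} (%x. moll ((S1 n x - fst w) / eps n) / eps n) * integral {l1..l2} (%y. moll ((S2 n y - snd w) / eps n) / eps n)"
    by (rule integral_mult_left)
  also have "\<dots> = G n k1 k2 l1 l2 w / (lam n)\<^sup>2"
    unfolding I1 I2 G_def by (simp add: diff_divide_distrib[symmetric] power2_eq_square)
  finally show ?thesis .
qed

lemma G_bounds: assumes "k1 <= k2" "l1 <= l2" shows "0 <= G n k1 k2 l1 l2 w" "G n k1 k2 l1 l2 w <= 1"
proof -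
  have 1: "0 <= step ((S1 n k2 - s) / eps n) - step ((S1 n k1 - s) / eps n)" "step ((S1 n k2 - s) / eps n) - step ((S1 n k1 - s) / eps n) <= 1" for s
    using step_mono[of "(S1 n k1 - s) / eps n" "(S1 n k2 - s) / eps n"] step_ge0[of "(S1 n k1 - s) / eps n"] step_le1[of "(S1 n k2 - s) / eps n"]
      S_mono(1)[OF assms(1), of n] eps(1)[of n] by (auto simp: divide_right_mono)
  have 2: "0 <= step ((S2 n l2 - s) / eps n) - step ((S2 n l1 - s) / eps n)" "step ((S2 n l2 - s) / eps n) - step ((S2 n l1 - s) / eps n) <= 1" for s
    using step_mono[of "(S2 n l1 - s) / eps n" "(S2 n l2 - s) / eps n"] step_ge0[of "(S2 n l1 - s) / eps n"] step_le1[of "(S2 n l2 - s) / eps n"]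
      S_mono(2)[OF assms(2), of n] eps(1)[of n] by (auto simp: divide_right_mono)
  show "0 <= G n k1 k2 l1 l2 w" unfolding G_def using 1 2 by simp
  show "G n k1 k2 l1 l2 w <= 1" unfolding G_def by (intro mult_le_one 1 2)
qed

lemma G_meas: "G n k1 k2 l1 l2 \<in> borel_measurable borel"
  unfolding G_def[abs_def]
  by (intro borel_measurable_continuous_onI continuous_on_mult step_contc continuous_on_divide continuous_on_diff continuous_on_fst continuous_on_snd
     continuous_on_const continuous_on_id) (use eps(1)[of n] in auto)

lemma r_abs: assumes "i + j <= 3"
  shows "integrable lborel (%w. indicator \<Omega> w * \<bar>r i j w\<bar>)" "(%w. indicator \<Omega> w * r i j w) \<in> borel_measurable borel"
proof -
  have i: "integrable lborel (%w. indicator \<Omega> w * r i j w)" using r_int[OF assms] by (simp add: set_integrable_def)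
  then have "integrable lborel (%w. \<bar>indicator \<Omega> w * r i j w\<bar>)" by (rule integrable_abs)
  then show "integrable lborel (%w. indicator \<Omega> w * \<bar>r i j w\<bar>)" by (simp add: abs_mult)
  show "(%w. indicator \<Omega> w * r i j w) \<in> borel_measurable borel" using borel_measurable_integrable[OF i] by simp
qed

lemma rG_integrable: assumes "i + j <= 3" "k1 <= k2" "l1 <= l2"
  shows "integrable lborel (%w. (indicator \<Omega> w * \<bar>r i j w\<bar>) * G n k1 k2 l1 l2 w)"
proof (rule Bochner_Integration.integrable_bound[OF r_abs(1)[OF assms(1)]])
  show "(%w. (indicator \<Omega> w * \<bar>r i j w\<bar>) * G n k1 k2 l1 l2 w) \<in> borel_measurable lborel"
    using borel_measurable_integrable[OF r_abs(1)[OF assms(1)]] G_meas by simp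
  show "AE w in lborel. norm (indicator \<Omega> w * \<bar>r i j w\<bar> * G n k1 k2 l1 l2 w) <= norm (indicator \<Omega> w * \<bar>r i j w\<bar>)"
    using G_bounds[OF assms(2,3), of n] by (intro AE_I2) (auto simp: abs_mult mult_left_le indicator_def)
qed

text \<open>Bound |V| by the mollification of |r i j|, dropping \<open>lam^(i + j)\<close>, which is
  at most 1, and exchange the integrals. Working with nonnegative integrals makes Tonelli available
  from measurability alone.\<close>

lemma mass_le_B:
  assumes K: "a1 <= k1" "k1 <= k2" "k2 <= b1" "a2 <= l1" "l1 <= l2" "l2 <= b2" and ij: "i + j <= 3"
  shows "mass (V n) k1 k2 l1 l2 i j <= B n k1 k2 l1 l2 i j"
proof -
  let ?K = "cbox (k1, l1) (k2, l2)"
  have cV: "continuous_on ?K (%p. \<bar>V n i j (fst p) (snd p)\<bar>)"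
    using V_family[of n] continuous_on_subset[of UNIV "%p. V n i j (fst p) (snd p)" ?K]
    by (intro continuous_on_rabs) (simp add: smooth_family_def)
  define g where "g w = indicator \<Omega> w * r i j w" for w
  have gm[measurable]: "g \<in> borel_measurable borel" using r_abs(2)[OF ij] by (simp add: g_def[abs_def])
  have km: "(%(z, w). kern n (fst z) (snd z) w) \<in> borel_measurable (lborel \<Otimes>\<^sub>M lborel)"
  proof -
    have "(%p. kern n (fst (fst p)) (snd (fst p)) (snd p)) \<in> borel_measurable borel"
      by (intro borel_measurable_continuous_onI kern_cont continuous_on_fst continuous_on_snd continuous_on_id)
    then show ?thesis by (simp add: lborel_prod split_def)
  qed
  have kmw: "(%w. kern n x y w) \<in> borel_measurable borel" "(%z. kern n (fst z) (snd z) w) \<in> borel_measurable borel" for x y w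
    by (intro borel_measurable_continuous_onI kern_cont continuous_on_fst continuous_on_snd continuous_on_id continuous_on_const)+
  have pt: "ennreal \<bar>V n i j (fst z) (snd z)\<bar> <= (\<integral>\<^sup>+w. ennreal (\<bar>g w\<bar> * kern n (fst z) (snd z) w) \<partial>lborel)" if "z \<in> ?K" for z
  proof -
    have z: "fst z \<in> {a1..b1}" "snd z \<in> {a2..b2}" using that K by (auto simp: mem_Times_iff cbox_Pair_real)
    have "integrable lborel (%w. g w * kern n (fst z) (snd z) w)"
      using set_integrable_mult_continuous[OF r_int[OF ij], of "%w. kern n (fst z) (snd z) w"] kern_cont[OF continuous_on_const continuous_on_const continuous_on_id]
      by (simp add: set_integrable_def g_def mult.assoc)
    from integral_norm_bound_ennreal[OF this]
    have "ennreal \<bar>LINT w:\<Omega>|lborel. r i j w * kern n (fst z) (snd z) w\<bar> <= (\<integral>\<^sup>+w. ennreal (\<bar>g w\<bar> * kern n (fst z) (snd z) w) \<partial>lborel)"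
      using kern_nonneg by (simp add: set_lebesgue_integral_def g_def abs_mult mult.assoc)
    moreover have "\<bar>V n i j (fst z) (snd z)\<bar> <= \<bar>LINT w:\<Omega>|lborel. r i j w * kern n (fst z) (snd z) w\<bar>"
    proof -
      have "\<bar>lam n\<bar> ^ (i + j) <= 1" using lam(2,3)[of n] by (intro power_le_one) auto
      then show ?thesis unfolding V_eq[OF z ij] abs_mult power_abs by (intro mult_left_le_one_le) auto
    qed
    ultimately show ?thesis by (meson ennreal_leI order_trans)
  qed
  have mK: "mass (V n) k1 k2 l1 l2 i j = (\<integral>z. indicator ?K z * \<bar>V n i j (fst z) (snd z)\<bar> \<partial>lborel)"
    using LINT_cbox_HK(2)[OF cV] by (simp add: mass_def set_lebesgue_integral_def)
  have iK: "integrable lborel (%z. indicator ?K z * \<bar>V n i j (fst z) (snd z)\<bar>)"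
    using LINT_cbox_HK(1)[OF cV] by (simp add: set_integrable_def)
  have "ennreal (mass (V n) k1 k2 l1 l2 i j) = (\<integral>\<^sup>+z. ennreal (indicator ?K z * \<bar>V n i j (fst z) (snd z)\<bar>) \<partial>lborel)"
    unfolding mK by (rule nn_integral_eq_integral[OF iK, symmetric]) auto
  also have "\<dots> <= (\<integral>\<^sup>+z. (\<integral>\<^sup>+w. indicator ?K z * ennreal (\<bar>g w\<bar> * kern n (fst z) (snd z) w) \<partial>lborel) \<partial>lborel)"
    by (intro nn_integral_mono) (use pt in \<open>auto simp: indicator_def\<close>)
  also have "\<dots> = (\<integral>\<^sup>+w. (\<integral>\<^sup>+z. indicator ?K z * ennreal (\<bar>g w\<bar> * kern n (fst z) (snd z) w) \<partial>lborel) \<partial>lborel)"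
  proof (rule lborel_pair.Fubini'[symmetric])
    have [measurable]: "(%p. kern n (fst (fst p)) (snd (fst p)) (snd p)) \<in> borel_measurable (lborel \<Otimes>\<^sub>M lborel)" 
      using km by (simp add: split_def)
    have [measurable]: "?K \<in> sets borel" by simp
    show "(%(z, w). indicator ?K z * ennreal (\<bar>g w\<bar> * kern n (fst z) (snd z) w)) \<in> borel_measurable (lborel \<Otimes>\<^sub>M lborel)"
      unfolding split_def by measurable
  qed
  also have "\<dots> = (\<integral>\<^sup>+w. ennreal (\<bar>g w\<bar> * (G n k1 k2 l1 l2 w / (lam n)\<^sup>2)) \<partial>lborel)"
  proof (rule nn_integral_cong)
    fix w
    have ck: "continuous_on ?K (%z. kern n (fst z) (snd z) w)"
      by (intro kern_cont continuous_on_fst continuous_on_snd continuous_on_id continuous_on_const)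
    have "(\<integral>\<^sup>+z. indicator ?K z * ennreal (\<bar>g w\<bar> * kern n (fst z) (snd z) w) \<partial>lborel)
       = (\<integral>\<^sup>+z. ennreal \<bar>g w\<bar> * ennreal (indicator ?K z * kern n (fst z) (snd z) w) \<partial>lborel)"
      by (intro nn_integral_cong) (auto simp: indicator_def ennreal_mult kern_nonneg)
    also have "\<dots> = ennreal \<bar>g w\<bar> * (\<integral>\<^sup>+z. ennreal (indicator ?K z * kern n (fst z) (snd z) w) \<partial>lborel)"
      by (rule nn_integral_cmult) (use kmw(2)[of w] in measurable)
    also have "(\<integral>\<^sup>+z. ennreal (indicator ?K z * kern n (fst z) (snd z) w) \<partial>lborel) = ennreal (\<integral>z. indicator ?K z * kern n (fst z) (snd z) w \<partial>lborel)"
      by (rule nn_integral_eq_integral) (use LINT_cbox_HK(1)[OF ck] kern_nonneg in \<open>auto simp: set_integrable_def\<close>)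
    also have "(\<integral>z. indicator ?K z * kern n (fst z) (snd z) w \<partial>lborel) = G n k1 k2 l1 l2 w / (lam n)\<^sup>2"
      using LINT_cbox_HK(2)[OF ck] kern_integral[OF K(2,5)] by (simp add: set_lebesgue_integral_def)
    finally show "(\<integral>\<^sup>+z. indicator ?K z * ennreal (\<bar>g w\<bar> * kern n (fst z) (snd z) w) \<partial>lborel) = ennreal (\<bar>g w\<bar> * (G n k1 k2 l1 l2 w / (lam n)\<^sup>2))"
      using G_bounds(1)[OF K(2,5), of n w] by (simp add: ennreal_mult[symmetric])
  qed
  also have "\<dots> = ennreal (\<integral>w. \<bar>g w\<bar> * (G n k1 k2 l1 l2 w / (lam n)\<^sup>2) \<partial>lborel)"
  proof (rule nn_integral_eq_integral)
    have "integrable lborel (%w. (indicator \<Omega> w * \<bar>r i j w\<bar>) * G n k1 k2 l1 l2 w / (lam n)\<^sup>2)"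
      using rG_integrable[OF ij K(2,5)] by (rule integrable_divide)
    then show "integrable lborel (%w. \<bar>g w\<bar> * (G n k1 k2 l1 l2 w / (lam n)\<^sup>2))"
      by (simp add: g_def abs_mult)
  qed (use G_bounds(1)[OF K(2,5)] in auto)
  also have "(\<integral>w. \<bar>g w\<bar> * (G n k1 k2 l1 l2 w / (lam n)\<^sup>2) \<partial>lborel) = B n k1 k2 l1 l2 i j"
    unfolding B_def g_def abs_mult by simp
  finally have "ennreal (mass (V n) k1 k2 l1 l2 i j) <= ennreal (B n k1 k2 l1 l2 i j)" .
  moreover have "B n k1 k2 l1 l2 i j >= 0"
    unfolding B_def using G_bounds(1)[OF K(2,5)] by (intro divide_nonneg_nonneg Bochner_Integration.integral_nonneg mult_nonneg_nonneg) auto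
  ultimately show ?thesis by (simp add: ennreal_le_iff)
qed

lemma G_tendsto:
  assumes "k1 <= k2" "l1 <= l2" "fst w \<noteq> k1" "fst w \<noteq> k2" "snd w \<noteq> l1" "snd w \<noteq> l2"
  shows "(%n. G n k1 k2 l1 l2 w) \<longlonglongrightarrow> indicator (box (k1, l1) (k2, l2)) w"
proof -
  have s1: "(%n. step ((S1 n k - s) / eps n)) \<longlonglongrightarrow> (if s < k then 1 else 0)" if "s \<noteq> k" for s k
  proof -
    have l: "(%n. S1 n k - s) \<longlonglongrightarrow> k - s" by (intro tendsto_intros S_lim)
    show ?thesis
      using step_tendsto_1[OF eps(1,2) l] step_tendsto_0[OF eps(1,2) l] that by (cases "s < k") auto
  qed
  have s2: "(%n. step ((S2 n k - s) / eps n)) \<longlonglongrightarrow> (if s < k then 1 else 0)" if "s \<noteq> k" for s k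
  proof -
    have l: "(%n. S2 n k - s) \<longlonglongrightarrow> k - s" by (intro tendsto_intros S_lim)
    show ?thesis
      using step_tendsto_1[OF eps(1,2) l] step_tendsto_0[OF eps(1,2) l] that by (cases "s < k") auto
  qed
  have "(%n. G n k1 k2 l1 l2 w) \<longlonglongrightarrow> ((if fst w < k2 then 1 else 0) - (if fst w < k1 then 1 else 0)) * ((if snd w < l2 then 1 else 0) - (if snd w < l1 then 1 else 0))"
    unfolding G_def by (intro tendsto_mult tendsto_diff s1 s2 assms)
  moreover have "((if fst w < k2 then 1 else 0) - (if fst w < k1 then 1 else 0)) * ((if snd w < l2 then 1 else 0) - (if snd w < l1 then 1 else 0)) = (indicator (box (k1, l1) (k2, l2)) w :: real)"
    using assms by (cases w) (auto simp: box_Pair_real indicator_def)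
  ultimately show ?thesis by simp
qed

lemma B_lim:
  assumes K: "a1 <= k1" "k1 <= k2" "k2 <= b1" "a2 <= l1" "l1 <= l2" "l2 <= b2" and ij: "i + j <= 3"
  shows "(%n. B n k1 k2 l1 l2 i j) \<longlonglongrightarrow> rm k1 k2 l1 l2 i j"
proof -
  let ?g = "%w. indicator \<Omega> w * \<bar>r i j w\<bar>"
  have rmeq: "rm k1 k2 l1 l2 i j = (\<integral>w. ?g w * indicator (box (k1, l1) (k2, l2)) w \<partial>lborel)"
    unfolding rm_def set_lebesgue_integral_def
    by (intro Bochner_Integration.integral_cong) (use K in \<open>auto simp: indicator_def box_Pair_real\<close>)
  have "(%n. \<integral>w. ?g w * G n k1 k2 l1 l2 w \<partial>lborel) \<longlonglongrightarrow> (\<integral>w. ?g w * indicator (box (k1, l1) (k2, l2)) w \<partial>lborel)"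
  proof (rule integral_dominated_convergence[where w = ?g])
    show gi: "integrable lborel ?g" by (rule r_abs(1)[OF ij])
    show "(%w. ?g w * indicator (box (k1, l1) (k2, l2)) w) \<in> borel_measurable lborel"
      using borel_measurable_integrable[OF gi] by measurable
    show "(%w. ?g w * G n k1 k2 l1 l2 w) \<in> borel_measurable lborel" for n
      using borel_measurable_integrable[OF gi] G_meas by simp
    show "AE w in lborel. norm (?g w * G n k1 k2 l1 l2 w) <= ?g w" for n
      using G_bounds[OF K(2,5), of n] by (intro AE_I2) (auto simp: abs_mult mult_left_le indicator_def)
    show "AE w in lborel. (%n. ?g w * G n k1 k2 l1 l2 w) \<longlonglongrightarrow> ?g w * indicator (box (k1, l1) (k2, l2)) w"
      using AE_off_lines(1)[of k1] AE_off_lines(1)[of k2] AE_off_lines(2)[of l1] AE_off_lines(2)[of l2]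
    proof eventually_elim
      case (elim w)
      show ?case by (intro tendsto_mult_left G_tendsto K elim)
    qed
  qed
  then have "(%n. (\<integral>w. ?g w * G n k1 k2 l1 l2 w \<partial>lborel) / (lam n)\<^sup>2) \<longlonglongrightarrow> rm k1 k2 l1 l2 i j / 1\<^sup>2"
    unfolding rmeq by (intro tendsto_divide tendsto_power lam) auto
  then show ?thesis by (simp add: B_def)
qed

lemma strip_lim_aux:
  fixes E :: "nat => (real \<times> real) set"
  assumes ij: "i + j <= 3" and E: "!!k. E k \<in> sets borel" "!!k. E k \<subseteq> \<Omega>" 
    and ev: "AE w in lborel. \<forall>\<^sub>F k in sequentially. w \<notin> E k"
  shows "(%k. LINT w:E k|lborel. \<bar>r i j w\<bar>) \<longlonglongrightarrow> 0"
proof -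
  let ?g = "%w. indicator \<Omega> w * \<bar>r i j w\<bar>"
  have "(%k. \<integral>w. ?g w * indicator (E k) w \<partial>lborel) \<longlonglongrightarrow> (\<integral>w. 0 \<partial>(lborel :: (real \<times> real) measure))"
  proof (rule integral_dominated_convergence[where w = ?g])
    show gi: "integrable lborel ?g" by (rule r_abs(1)[OF ij])
    have [measurable]: "E k \<in> sets borel" for k by (rule E)
    show "(%w. ?g w * indicator (E k) w) \<in> borel_measurable lborel" for k
      using borel_measurable_integrable[OF gi] by measurable
    show "AE w in lborel. norm (?g w * indicator (E k) w) <= ?g w" for k
      by (intro AE_I2) (auto simp: indicator_def)
    show "AE w in lborel. (%k. ?g w * indicator (E k) w) \<longlonglongrightarrow> 0"
      using ev
    proof eventually_elim
      case (elim w)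
      then have "\<forall>\<^sub>F k in sequentially. ?g w * indicator (E k) w = 0" by eventually_elim simp
      then show ?case by (rule tendsto_eventually)
    qed
  qed simp
  moreover have "(\<integral>w. ?g w * indicator (E k) w \<partial>lborel) = (LINT w:E k|lborel. \<bar>r i j w\<bar>)" for k
    unfolding set_lebesgue_integral_def
    by (intro Bochner_Integration.integral_cong) (use E(2)[of k] in \<open>auto simp: indicator_def\<close>)
  ultimately show ?thesis by simp
qed

text \<open>A point off the limiting line lies in none of the strips eventually, so dominated
  convergence applies.\<close>

lemma strip_lim:
  fixes s t :: "nat => real"
  assumes st: "s \<longlonglongrightarrow> c" "t \<longlonglongrightarrow> c" and ij: "i + j <= 3"
  shows "(!!k. a1 <= s k) ==> (!!k. t k <= b1) ==> (%k. rm (s k) (t k) a2 b2 i j) \<longlonglongrightarrow> 0"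
    "(!!k. a2 <= s k) ==> (!!k. t k <= b2) ==> (%k. rm a1 b1 (s k) (t k) i j) \<longlonglongrightarrow> 0"
proof -
  have ev: "\<forall>\<^sub>F k in sequentially. \<not> (s k < x \<and> x < t k)" if "x \<noteq> c" for x
  proof (cases "x < c")
    case True
    then have "\<forall>\<^sub>F k in sequentially. x < s k" using st(1) by (rule_tac order_tendstoD(1))
    then show ?thesis by eventually_elim auto
  next
    case False
    then have "\<forall>\<^sub>F k in sequentially. t k < x" using st(2) that by (rule_tac order_tendstoD(2)) auto
    then show ?thesis by eventually_elim auto
  qed
  { assume "!!k. a1 <= s k" "!!k. t k <= b1"
    then have "{s k<..<t k} \<subseteq> {a1<..<b1}" for k by (intro greaterThanLessThan_subseteq_greaterThanLessThan[THEN iffD2]) auto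
    then have sub: "box (s k, a2) (t k, b2) \<subseteq> \<Omega>" for k unfolding box_Pair_real by (intro Sigma_mono) auto
    show "(%k. rm (s k) (t k) a2 b2 i j) \<longlonglongrightarrow> 0" unfolding rm_def
    proof (rule strip_lim_aux[OF ij _ sub])
      show "AE w in lborel. \<forall>\<^sub>F k in sequentially. w \<notin> box (s k, a2) (t k, b2)"
        using AE_off_lines(1)[of c]
      proof eventually_elim
        case (elim w)
        show ?case using ev[OF elim] by eventually_elim (auto simp: box_Pair_real)
      qed
    qed simp }
  { assume "!!k. a2 <= s k" "!!k. t k <= b2"
    then have "{s k<..<t k} \<subseteq> {a2<..<b2}" for k by (intro greaterThanLessThan_subseteq_greaterThanLessThan[THEN iffD2]) auto
    then have sub: "box (a1, s k) (b1, t k) \<subseteq> \<Omega>" for k unfolding box_Pair_real by (intro Sigma_mono) auto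
    show "(%k. rm a1 b1 (s k) (t k) i j) \<longlonglongrightarrow> 0" unfolding rm_def
    proof (rule strip_lim_aux[OF ij _ sub])
      show "AE w in lborel. \<forall>\<^sub>F k in sequentially. w \<notin> box (a1, s k) (b1, t k)"
        using AE_off_lines(2)[of c]
      proof eventually_elim
        case (elim w)
        show ?case using ev[OF elim] by eventually_elim (auto simp: box_Pair_real)
      qed
    qed simp }
qed

text \<open>The kernel has mass 1 over the rectangle because its support lies inside, also when (x,
  y) is a boundary point; no mass is lost across the boundary.\<close>

lemma V00_average:
  assumes xy: "x \<in> {a1..b1}" "y \<in> {a2..b2}"
    and near: "!!w. w \<in> R ==> \<bar>fst w - S1 n x\<bar> <= eps n ==> \<bar>snd w - S2 n y\<bar> <= eps n ==> \<bar>u w - c\<bar> <= d"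
  shows "\<bar>V n 0 0 x y - c\<bar> <= d"
proof -
  have ck: "continuous_on R (kern n x y)"
    using kern_cont[OF continuous_on_const continuous_on_const continuous_on_id, of R n x y] by simp
  have sw: "moll ((c - s) / eps n) = moll ((s - c) / eps n)" for c s
    using moll_minus[of "(s - c) / eps n"] by (simp add: minus_divide_left)
  have "integral R (kern n x y) = integral {a1..b1} (%s. integral {a2..b2} (%t. kern n x y (s, t)))"
    by (rule iterated_swap(1)[OF ck])
  also have "\<dots> = integral {a1..b1} (%s. (moll ((s - S1 n x) / eps n) / eps n) * integral {a2..b2} (%t. moll ((t - S2 n y) / eps n) / eps n))"
    unfolding kern_def fst_conv snd_conv sw[of "S1 n x"] sw[of "S2 n y"] by (intro integral_cong) (rule integral_mult_right)
  also have "integral {a2..b2} (%t. moll ((t - S2 n y) / eps n) / eps n) = 1"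
    by (rule integral_unique[OF moll_mass]) (use S_in(2)[OF xy(2), of n] eps(1)[of n] in auto)
  also have "integral {a1..b1} (%s. (moll ((s - S1 n x) / eps n) / eps n) * 1) = 1"
    unfolding mult_1_right by (rule integral_unique[OF moll_mass]) (use S_in(1)[OF xy(1), of n] eps(1)[of n] in auto)
  finally have k1: "(kern n x y has_integral 1) R"
    using integrable_continuous[OF ck] by (simp add: has_integral_iff)
  have eq: "V n 0 0 x y = integral R (%w. u w * kern n x y w)"
  proof -
    have "V n 0 0 x y = integral R (%w. (1 / (eps n)\<^sup>2) * (u w * (moll ((S1 n x - fst w) / eps n) * moll ((S2 n y - snd w) / eps n))))"
      unfolding V_def M_def integral_mult_right by simp
    also have "\<dots> = integral R (%w. u w * kern n x y w)"
      by (intro integral_cong) (simp add: kern_def power2_eq_square)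
    finally show ?thesis .
  qed
  show ?thesis unfolding eq
  proof (rule weighted_average_bound[OF k1])
    show "kern n x y w >= 0" for w by (rule kern_nonneg)
    show "(%w. u w * kern n x y w) integrable_on R"
      by (intro integrable_continuous continuous_on_mult u_cont ck)
    show "\<bar>u w - c\<bar> <= d" if w: "w \<in> R" "kern n x y w \<noteq> 0" for w
    proof (rule near[OF w(1)])
      have "\<not> \<bar>(S1 n x - fst w) / eps n\<bar> >= 1" "\<not> \<bar>(S2 n y - snd w) / eps n\<bar> >= 1"
        using w(2) moll_eq_0 by (auto simp: kern_def simp del: abs_divide)
      then show "\<bar>fst w - S1 n x\<bar> <= eps n" "\<bar>snd w - S2 n y\<bar> <= eps n"
        using eps(1)[of n] by (auto simp: abs_divide field_simps abs_minus_commute)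
    qed
  qed
qed

lemma V00_lim:
  assumes xy: "x \<in> {a1..b1}" "y \<in> {a2..b2}"
  shows "(%n. V n 0 0 x y) \<longlonglongrightarrow> u (x, y)"
proof (rule LIMSEQ_I)
  fix e :: real assume e: "e > 0"
  have "(x, y) \<in> R" using xy by (simp add: cbox_Pair_real)
  then obtain d where d: "d > 0" "!!w. w \<in> R ==> dist w (x, y) < d ==> dist (u w) (u (x, y)) < e / 2"
    using u_cont e unfolding continuous_on_iff by (metis half_gt_zero)
  define D where "D n = (eps n + \<bar>S1 n x - x\<bar>) + (eps n + \<bar>S2 n y - y\<bar>)" for n
  have "D \<longlonglongrightarrow> (0 + \<bar>x - x\<bar>) + (0 + \<bar>y - y\<bar>)"
    unfolding D_def by (intro tendsto_intros eps S_lim)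
  then have "\<forall>\<^sub>F n in sequentially. D n < d" using d(1) by (rule_tac order_tendstoD(2)) auto
  then obtain N where N: "!!n. n >= N ==> D n < d" by (auto simp: eventually_sequentially)
  have le: "\<bar>V n 0 0 x y - u (x, y)\<bar> <= e / 2" if n: "n >= N" for n
  proof (rule V00_average[OF xy])
    fix w assume w: "w \<in> R" "\<bar>fst w - S1 n x\<bar> <= eps n" "\<bar>snd w - S2 n y\<bar> <= eps n"
    have "dist w (x, y) <= \<bar>fst w - x\<bar> + \<bar>snd w - y\<bar>"
      by (cases w) (simp add: dist_Pair_Pair dist_real_def sqrt_sum_squares_le_sum_abs)
    also have "\<dots> <= D n" using w(2,3) unfolding D_def by linarith
    finally show "\<bar>u w - u (x, y)\<bar> <= e / 2" using d(2)[OF w(1)] N[OF n] by (simp add: dist_real_def)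
  qed
  show "\<exists>no. \<forall>n\<ge>no. norm (V n 0 0 x y - u (x, y)) < e"
  proof (intro exI allI impI)
    fix n assume "N <= n"
    from le[OF this] show "norm (V n 0 0 x y - u (x, y)) < e" using e by simp
  qed
qed

lemma approx_exists: "\<exists>MU. approx a1 b1 a2 b2 (%x y. u (x, y)) V B rm MU"
proof -
  have "bounded (u ` R)" by (intro compact_imp_bounded compact_continuous_image compact_cbox u_cont)
  then obtain MU where MU: "!!w. w \<in> R ==> \<bar>u w\<bar> <= MU" by (auto simp: bounded_iff)
  have b: "\<bar>V n 0 0 x y\<bar> <= MU" if xy: "x \<in> {a1..b1}" "y \<in> {a2..b2}" for n x y
    using V00_average[OF xy, of n 0 MU] MU by simp
  have "approx a1 b1 a2 b2 (%x y. u (x, y)) V B rm MU"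
    by unfold_locales (use ab V_family V00_lim b mass_le_B B_lim strip_lim in auto)
  then show ?thesis by blast
qed

end

subsection \<open>Sums over the mesh\<close>

definition mid :: "(nat => real) => nat => real" where
  "mid xs i = (xs i + xs (Suc i)) / 2"

text \<open>In cell (i, j) the lower half of the vertical dual edge separates the control volumes of
  the nodes (i, j) and (i + 1, j), the upper half those of (i, j + 1) and (i + 1, j + 1). Each half
  is weighted by the jump of W across it. Exchanging the coordinates gives the horizontal dual
  edges.\<close>

definition flux_sum :: "(real => real => real) => (nat => real) => nat => (nat => real) => nat => (nat => nat => real) => real" where
  "flux_sum g xs nx ys ny W = (\<Sum>i<nx. \<Sum>j<ny.
     integral {ys j..mid ys j} (g (mid xs i)) * (W (Suc i) j - W i j)
     + integral {mid ys j..ys (Suc j)} (g (mid xs i)) * (W (Suc i) (Suc j) - W i (Suc j)))"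

text \<open>Regroups a sum over nodes as a sum over cells: node i receives \<open>R i\<close> from
  the cell on its right and \<open>L i\<close> from the cell on its left, and the end nodes drop out
  because V vanishes there.\<close>

lemma summation_by_parts_nodes:
  fixes V :: "nat => real"
  assumes "V 0 = 0" "V n = 0" and "!!i. 1 <= i ==> i < n ==> R i = r i" "!!i. Suc i < n ==> L (Suc i) = l i"
  shows "(\<Sum>i\<le>n. (R i + L i) * V i) = (\<Sum>i<n. r i * V i + l i * V (Suc i))"
proof -
  have "(\<Sum>i\<le>n. R i * V i) = (\<Sum>i<n. r i * V i)"
  proof -
    have *: "R i * V i = r i * V i" if "i < n" for i using assms(1) assms(3)[of i] that by (cases "i = 0") auto
    have "(\<Sum>i<n. R i * V i) = (\<Sum>i<n. r i * V i)" by (rule sum.cong[OF refl]) (rule *, simp)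
    then show ?thesis unfolding lessThan_Suc_atMost[symmetric] sum.lessThan_Suc using assms(2) by simp
  qed
  moreover have "(\<Sum>i\<le>n. L i * V i) = (\<Sum>i<n. l i * V (Suc i))"
  proof (cases n)
    case 0 then show ?thesis using assms by simp
  next
    case (Suc m)
    have "(\<Sum>i\<le>n. L i * V i) = (\<Sum>i<n. L (Suc i) * V (Suc i))"
      unfolding lessThan_Suc_atMost[symmetric] sum.lessThan_Suc_shift using assms by simp
    also have "\<dots> = (\<Sum>i<n. l i * V (Suc i))"
    proof (rule sum.cong)
      fix i assume "i \<in> {..<n}"
      then show "L (Suc i) * V (Suc i) = l i * V (Suc i)"
        using assms(2,4) by (cases "Suc i < n") (auto simp: not_less, metis Suc_leI le_antisym)
    qed simp
    finally show ?thesis .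
  qed
  ultimately show ?thesis by (simp add: sum.distrib distrib_right)
qed

text \<open>Regroup twice: across the rows, so that each vertical dual line carries the jump of W,
  and along the line, so that the side of a control volume is cut at the node height into halves of
  dual edges.\<close>

lemma flux_sum_nodes:
  assumes "!!i j. W i 0 = 0 \<and> W i ny = 0 \<and> W 0 j = 0 \<and> W nx j = 0"
    and mono: "!!j. j < ny ==> ys j < ys (Suc j)"
    and g: "!!i j. i < nx ==> j < ny ==> g (mid xs i) integrable_on {ys j..ys (Suc j)}"
  shows "(\<Sum>i\<le>nx. \<Sum>j\<le>ny. - (integral {lo ys j..hi ys ny j} (g (hi xs nx i)) - integral {lo ys j..hi ys ny j} (g (lo xs i))) * W i j)
     = flux_sum g xs nx ys ny W"
proof -
  have 1: "(\<Sum>i\<le>nx. - (integral {lo ys j..hi ys ny j} (g (hi xs nx i)) - integral {lo ys j..hi ys ny j} (g (lo xs i))) * W i j)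
     = (\<Sum>i<nx. integral {lo ys j..hi ys ny j} (g (mid xs i)) * (W (Suc i) j - W i j))" for j
  proof -
    have "(\<Sum>i\<le>nx. (- integral {lo ys j..hi ys ny j} (g (hi xs nx i)) + integral {lo ys j..hi ys ny j} (g (lo xs i))) * W i j)
     = (\<Sum>i<nx. - integral {lo ys j..hi ys ny j} (g (mid xs i)) * W i j + integral {lo ys j..hi ys ny j} (g (mid xs i)) * W (Suc i) j)"
      by (rule summation_by_parts_nodes) (use assms(1) in \<open>auto simp: hi_def lo_def mid_def\<close>)
    then show ?thesis by (simp add: algebra_simps)
  qed
  have 2: "(\<Sum>j\<le>ny. integral {lo ys j..hi ys ny j} (g (mid xs i)) * (W (Suc i) j - W i j))
     = (\<Sum>j<ny. integral {ys j..mid ys j} (g (mid xs i)) * (W (Suc i) j - W i j)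
       + integral {mid ys j..ys (Suc j)} (g (mid xs i)) * (W (Suc i) (Suc j) - W i (Suc j)))" if i: "i < nx" for i
  proof -
    have "(\<Sum>j\<le>ny. integral {lo ys j..hi ys ny j} (g (mid xs i)) * (W (Suc i) j - W i j))
      = (\<Sum>j\<le>ny. (integral {ys j..mid ys j} (g (mid xs i)) + integral {lo ys j..ys j} (g (mid xs i))) * (W (Suc i) j - W i j))"
    proof (rule sum.cong)
      fix j assume j: "j \<in> {..ny}"
      show "integral {lo ys j..hi ys ny j} (g (mid xs i)) * (W (Suc i) j - W i j)
         = (integral {ys j..mid ys j} (g (mid xs i)) + integral {lo ys j..ys j} (g (mid xs i))) * (W (Suc i) j - W i j)"
      \<comment> \<open>On the first and the last row W vanishes. In between, the side runs from
        \<open>mid ys (j - 1)\<close> to \<open>mid ys j\<close> and is cut at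
        \<open>ys j\<close>.\<close>
      proof (cases "j = 0 \<or> j = ny")
        case True then show ?thesis using assms(1) by auto
      next
        case False
        then obtain k where k: "j = Suc k" using not0_implies_Suc by blast
        have jn: "j < ny" "k < ny" using False j k by auto
        have m: "ys k < mid ys k" "mid ys k < ys j" "ys j < mid ys j" "mid ys j < ys (Suc j)"
          using mono[OF jn(1)] mono[OF jn(2)] by (auto simp: mid_def k)
        have e: "lo ys j = mid ys k" "hi ys ny j = mid ys j" using False by (auto simp: lo_def hi_def mid_def k)
        have "g (mid xs i) integrable_on {mid ys k..ys j}" "g (mid xs i) integrable_on {ys j..mid ys j}"
          using integrable_on_subinterval[OF g[OF i jn(1)]] integrable_on_subinterval[OF g[OF i jn(2)]] m k by auto
        then have "g (mid xs i) integrable_on {mid ys k..mid ys j}"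
          using m by (intro Henstock_Kurzweil_Integration.integrable_combine[of "mid ys k" "ys j" "mid ys j"]) auto
        then have "integral {mid ys k..ys j} (g (mid xs i)) + integral {ys j..mid ys j} (g (mid xs i)) = integral {mid ys k..mid ys j} (g (mid xs i))"
          using m by (intro Henstock_Kurzweil_Integration.integral_combine) auto
        then show ?thesis unfolding e by (simp add: add.commute)
      qed
    qed simp
    also have "\<dots> = (\<Sum>j<ny. integral {ys j..mid ys j} (g (mid xs i)) * (W (Suc i) j - W i j)
       + integral {mid ys j..ys (Suc j)} (g (mid xs i)) * (W (Suc i) (Suc j) - W i (Suc j)))"
      by (rule summation_by_parts_nodes) (use assms(1) in \<open>auto simp: lo_def mid_def\<close>)
    finally show ?thesis .
  qed
  have "(\<Sum>i\<le>nx. \<Sum>j\<le>ny. - (integral {lo ys j..hi ys ny j} (g (hi xs nx i)) - integral {lo ys j..hi ys ny j} (g (lo xs i))) * W i j)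
    = (\<Sum>j\<le>ny. \<Sum>i<nx. integral {lo ys j..hi ys ny j} (g (mid xs i)) * (W (Suc i) j - W i j))"
    by (subst sum.swap) (simp only: 1)
  also have "\<dots> = flux_sum g xs nx ys ny W"
    unfolding flux_sum_def by (subst sum.swap) (auto intro!: sum.cong 2)
  finally show ?thesis .
qed

section \<open>Flux errors of the bilinear interpolant\<close>

definition vcell :: "(real => real => real) => (real => real => real) => (real => real => real) => real => real => real => real => real => real => real" where
  "vcell a b u x0 x1 y0 y1 d1 d2 =
     integral {y0..(y0 + y1) / 2} (%y. a ((x0 + x1) / 2) y * cell_dx u x0 x1 y0 y1 y + b ((x0 + x1) / 2) y * cell_dy u x0 x1 y0 y1) * d1
   + integral {(y0 + y1) / 2..y1} (%y. a ((x0 + x1) / 2) y * cell_dx u x0 x1 y0 y1 y + b ((x0 + x1) / 2) y * cell_dy u x0 x1 y0 y1) * d2"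

definition edges :: "(nat => nat => real) => nat => nat => real" where
  "edges W i j = \<bar>W (Suc i) j - W i j\<bar> + \<bar>W (Suc i) (Suc j) - W i (Suc j)\<bar>
     + \<bar>W i (Suc j) - W i j\<bar> + \<bar>W (Suc i) (Suc j) - W (Suc i) j\<bar>"

text \<open>The flux sum of the bilinear interpolant of u, where a and b are meant to be one row of
  the coefficient matrix. It sees u only through the nodal values.\<close>

definition vsum :: "(real => real => real) => (real => real => real) => (real => real => real) => (nat => real) => nat => (nat => real) => nat => (nat => nat => real) => real" where
  "vsum a b u xs nx ys ny W = (\<Sum>i<nx. \<Sum>j<ny. vcell a b u (xs i) (xs (Suc i)) (ys j) (ys (Suc j)) (W (Suc i) j - W i j) (W (Suc i) (Suc j) - W i (Suc j)))"

text \<open>The error of a half flux is not small enough on its own: it contains the quantity \<open>b0 * Tb\<close> below,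
  with opposite signs on the two halves. Its total contribution becomes of second order only after
  summation by parts along a row of cells, where it is differenced in the direction in which the
  height of the cells does not change.\<close>

lemma half_flux_error:
  fixes a b u p q :: "real => real => real"
  defines "m \<equiv> %x0 x1 :: real. (x0 + x1) / 2"
  assumes cell: "x0 < x1" "y0 < y1" and st: "y0 <= s" "s <= t" "t <= y1"
    and cont: "continuous_on {y0..y1} (a (m x0 x1))" "continuous_on {y0..y1} (b (m x0 x1))"
      "continuous_on {y0..y1} (p (m x0 x1))" "continuous_on {y0..y1} (q (m x0 x1))"
    and ab: "!!y. y \<in> {y0..y1} ==> \<bar>a (m x0 x1) y\<bar> <= Mb" "\<bar>b0\<bar> <= Mb" "!!y. y \<in> {y0..y1} ==> \<bar>b (m x0 x1) y - b0\<bar> <= L * h"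
    and A: "integral {y0..y1} (%y. \<bar>p (m x0 x1) y - cell_dx u x0 x1 y0 y1 y\<bar>) <= K * h * U"
    and Q: "integral {y0..y1} (%y. \<bar>q (m x0 x1) y - cell_dy u x0 x1 y0 y1\<bar>) <= K * U"
    and F: "integral {s..t} (q (m x0 x1)) = u (m x0 x1) t - u (m x0 x1) s"
    and E: "\<bar>u (m x0 x1) t - u (m x0 x1) s - (t - s) * cell_dy u x0 x1 y0 y1 - Tb\<bar> <= K * h * U"
  shows "\<bar>integral {s..t} (%y. a (m x0 x1) y * p (m x0 x1) y + b (m x0 x1) y * q (m x0 x1) y)
     - integral {s..t} (%y. a (m x0 x1) y * cell_dx u x0 x1 y0 y1 y + b (m x0 x1) y * cell_dy u x0 x1 y0 y1) - b0 * Tb\<bar>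
     <= K * h * (2 * Mb + L) * U"
proof -
  define X where "X = m x0 x1"
  let ?wx = "cell_dx u x0 x1 y0 y1" and ?wy = "cell_dy u x0 x1 y0 y1"
  have sub: "{s..t} \<subseteq> {y0..y1}" using st by auto
  note cont' = cont[THEN continuous_on_subset[OF _ sub], folded X_def]
  have cwx: "continuous_on S ?wx" for S unfolding cell_dx_def[abs_def] using cell by (intro continuous_intros) auto
  have Mb: "Mb >= 0" using ab(2) by linarith
  have LH: "L * h >= 0" using ab(3)[of y0] cell by force
  let ?f1 = "%y. a X y * (p X y - ?wx y)" and ?f2 = "%y. (b X y - b0) * (q X y - ?wy)"
  have c1: "continuous_on {s..t} ?f1" "continuous_on {s..t} ?f2"
    by (intro continuous_intros cont' cwx)+
  have "integral {s..t} (%y. a X y * p X y + b X y * q X y) - integral {s..t} (%y. a X y * ?wx y + b X y * ?wy)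
     = integral {s..t} (%y. (a X y * p X y + b X y * q X y) - (a X y * ?wx y + b X y * ?wy))"
    by (intro Henstock_Kurzweil_Integration.integral_diff[symmetric] integrable_continuous_real continuous_intros cont' cwx)
  also have "\<dots> = integral {s..t} (%y. (?f1 y + ?f2 y) + b0 * (q X y - ?wy))"
    by (intro integral_cong) (simp add: algebra_simps)
  also have "\<dots> = integral {s..t} (%y. ?f1 y + ?f2 y) + integral {s..t} (%y. b0 * (q X y - ?wy))"
    by (intro Henstock_Kurzweil_Integration.integral_add integrable_continuous_real continuous_intros cont' cwx)
  also have "integral {s..t} (%y. ?f1 y + ?f2 y) = integral {s..t} ?f1 + integral {s..t} ?f2"
    by (intro Henstock_Kurzweil_Integration.integral_add integrable_continuous_real c1)
  also have "integral {s..t} (%y. b0 * (q X y - ?wy)) = b0 * (u X t - u X s - (t - s) * ?wy)"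
  proof -
    have "integral {s..t} (%y. q X y - ?wy) = integral {s..t} (q X) - integral {s..t} (%y. ?wy)"
      by (intro Henstock_Kurzweil_Integration.integral_diff integrable_continuous_real cont' continuous_intros)
    then show ?thesis using F st by (simp add: X_def)
  qed
  finally have eq: "integral {s..t} (%y. a X y * p X y + b X y * q X y) - integral {s..t} (%y. a X y * ?wx y + b X y * ?wy) - b0 * Tb
     = integral {s..t} ?f1 + integral {s..t} ?f2 + b0 * (u X t - u X s - (t - s) * ?wy - Tb)" by (simp add: algebra_simps)
  have i: "\<bar>integral {s..t} f\<bar> <= c * integral {y0..y1} k" if "continuous_on {s..t} f" "continuous_on {y0..y1} k" "!!y. y \<in> {y0..y1} ==> \<bar>f y\<bar> <= c * k y" "!!y. k y >= 0" "c >= 0" for f k :: "real => real" and c :: real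
  proof -
    have "norm (integral {s..t} f) <= integral {s..t} (%y. c * k y)"
      using that sub by (intro integral_norm_bound_integral integrable_continuous_real continuous_on_mult_left)
        (auto intro: continuous_on_subset)
    also have "\<dots> = c * integral {s..t} k" by simp
    also have "\<dots> <= c * integral {y0..y1} k"
      using that sub by (intro mult_left_mono integral_subset_le integrable_continuous_real) (auto intro: continuous_on_subset)
    finally show ?thesis by simp
  qed
  have I1: "\<bar>integral {s..t} ?f1\<bar> <= Mb * (K * h * U)"
  proof -
    have "\<bar>integral {s..t} ?f1\<bar> <= Mb * integral {y0..y1} (%y. \<bar>p X y - ?wx y\<bar>)"
      by (rule i[OF c1(1)]) (use ab(1) Mb cont cwx in \<open>auto simp: abs_mult X_def intro!: mult_right_mono continuous_intros\<close>)
    also have "\<dots> <= Mb * (K * h * U)" using A Mb by (intro mult_left_mono) (auto simp: X_def)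
    finally show ?thesis .
  qed
  have I2: "\<bar>integral {s..t} ?f2\<bar> <= L * h * (K * U)"
  proof -
    have "\<bar>integral {s..t} ?f2\<bar> <= L * h * integral {y0..y1} (%y. \<bar>q X y - ?wy\<bar>)"
      by (rule i[OF c1(2)]) (use ab(3) LH cont in \<open>auto simp: abs_mult X_def intro!: mult_right_mono continuous_intros\<close>)
    also have "\<dots> <= L * h * (K * U)" using Q LH by (intro mult_left_mono) (auto simp: X_def)
    finally show ?thesis .
  qed
  have I3: "\<bar>b0 * (u X t - u X s - (t - s) * ?wy - Tb)\<bar> <= Mb * (K * h * U)"
    unfolding abs_mult using E ab(2) Mb by (intro mult_mono) (auto simp: X_def)
  have "\<bar>integral {s..t} (%y. a X y * p X y + b X y * q X y) - integral {s..t} (%y. a X y * ?wx y + b X y * ?wy) - b0 * Tb\<bar>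
    <= Mb * (K * h * U) + L * h * (K * U) + Mb * (K * h * U)"
    unfolding eq using I1 I2 I3 by linarith
  also have "\<dots> = K * h * (2 * Mb + L) * U" by (simp add: algebra_simps)
  finally show ?thesis by (simp add: X_def)
qed

lemma summation_by_parts:
  fixes w \<tau> :: "nat => real"
  assumes "w 0 = 0" "w n = 0"
  shows "(\<Sum>i<n. \<tau> i * (w (Suc i) - w i)) = (\<Sum>i<n - 1. (\<tau> i - \<tau> (Suc i)) * w (Suc i))"
proof (cases n)
  case (Suc m)
  have "(\<Sum>i<Suc m. \<tau> i * w (Suc i)) = (\<Sum>i<m. \<tau> i * w (Suc i))" using assms Suc by simp
  moreover have "(\<Sum>i<Suc m. \<tau> i * w i) = (\<Sum>i<m. \<tau> (Suc i) * w (Suc i))"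
    unfolding sum.lessThan_Suc_shift using assms by simp
  ultimately show ?thesis using Suc by (simp add: sum_subtractf right_diff_distrib left_diff_distrib del: sum.lessThan_Suc)
qed simp

text \<open>Summation by parts moves the difference from w to \<tau>; each difference of \<tau> is
  then charged to the two cells that share the side.\<close>

lemma row_sum_bound:
  fixes w \<tau> U :: "nat => real"
  assumes w: "w 0 = 0" "w n = 0" and U: "!!i. i < n ==> U i >= 0" and C: "C >= 0"
    and \<tau>: "!!i. Suc i < n ==> \<bar>\<tau> i - \<tau> (Suc i)\<bar> <= C * (U i + U (Suc i))"
  shows "\<bar>\<Sum>i<n. \<tau> i * (w (Suc i) - w i)\<bar> <= (\<Sum>i<n. C * U i * (\<bar>w i\<bar> + \<bar>w (Suc i)\<bar>))"
proof (cases n)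
  case (Suc m)
  have "\<bar>\<Sum>i<n. \<tau> i * (w (Suc i) - w i)\<bar> <= (\<Sum>i<m. \<bar>(\<tau> i - \<tau> (Suc i)) * w (Suc i)\<bar>)"
    unfolding summation_by_parts[OF w] unfolding Suc diff_Suc_1 by (rule sum_abs)
  also have "\<dots> <= (\<Sum>i<m. C * (U i + U (Suc i)) * \<bar>w (Suc i)\<bar>)"
    unfolding abs_mult using \<tau> Suc by (intro sum_mono mult_right_mono) auto
  also have "\<dots> = (\<Sum>i<m. C * U i * \<bar>w (Suc i)\<bar>) + (\<Sum>i<m. C * U (Suc i) * \<bar>w (Suc i)\<bar>)"
    by (simp add: sum.distrib[symmetric] algebra_simps)
  also have "\<dots> <= (\<Sum>i<n. C * U i * \<bar>w (Suc i)\<bar>) + (\<Sum>i<n. C * U i * \<bar>w i\<bar>)"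
    unfolding Suc sum.lessThan_Suc_shift[of "%i. C * U i * \<bar>w i\<bar>"] using U C Suc w by simp
  also have "\<dots> = (\<Sum>i<n. C * U i * (\<bar>w i\<bar> + \<bar>w (Suc i)\<bar>))"
    by (simp add: sum.distrib[symmetric] algebra_simps)
  finally show ?thesis .
qed simp

text \<open>Each half flux is a good part plus or minus \<open>b0 * Tb\<close>. The bad parts of a
  cell combine to \<open>b0 * Tb\<close> times the mixed second difference of W, which is also the
  x-difference of the vertical differences w. Summing by parts along the row then differences
  \<open>b0 * Tb\<close> between neighbours.\<close>

lemma vertical_flux_error:
  fixes a b u p q :: "real => real => real" and U :: "nat => nat => real" and W :: "nat => nat => real"
  assumes W0: "!!j. W 0 j = 0 \<and> W nx j = 0"
    and mx: "!!i. i < nx ==> xs i < xs (Suc i)" and my: "!!j. j < ny ==> ys j < ys (Suc j)"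
    and hx: "!!i. i < nx ==> xs (Suc i) - xs i <= h"
    and U0: "!!i j. i < nx ==> j < ny ==> U i j >= 0" and K: "K >= 0" and h: "h >= 0" and L: "L >= 0"
    and cont: "!!i j. i < nx ==> j < ny ==> continuous_on {ys j..ys (Suc j)} (a (mid xs i)) \<and> continuous_on {ys j..ys (Suc j)} (b (mid xs i))
      \<and> continuous_on {ys j..ys (Suc j)} (p (mid xs i)) \<and> continuous_on {ys j..ys (Suc j)} (q (mid xs i))"
    and bound: "!!i j y. i < nx ==> j < ny ==> y \<in> {ys j..ys (Suc j)} ==> \<bar>a (mid xs i) y\<bar> <= Mb \<and> \<bar>b (mid xs i) y\<bar> <= Mb"
    and bL: "!!i j y. i < nx ==> j < ny ==> y \<in> {ys j..ys (Suc j)} ==> \<bar>b (mid xs i) y - b (mid xs i) (mid ys j)\<bar> <= L * h"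
    and bL': "!!i j. Suc i < nx ==> j < ny ==> \<bar>b (mid xs i) (mid ys j) - b (mid xs (Suc i)) (mid ys j)\<bar> <= L * h"
    and A: "!!i j. i < nx ==> j < ny ==> integral {ys j..ys (Suc j)} (%y. \<bar>p (mid xs i) y - cell_dx u (xs i) (xs (Suc i)) (ys j) (ys (Suc j)) y\<bar>) <= K * h * U i j"
    and Q: "!!i j. i < nx ==> j < ny ==> integral {ys j..ys (Suc j)} (%y. \<bar>q (mid xs i) y - cell_dy u (xs i) (xs (Suc i)) (ys j) (ys (Suc j))\<bar>) <= K * U i j"
    and F: "!!i j s t. i < nx ==> j < ny ==> ys j <= s ==> s <= t ==> t <= ys (Suc j) ==> integral {s..t} (q (mid xs i)) = u (mid xs i) t - u (mid xs i) s"
    and D: "!!i j y y'. i < nx ==> j < ny ==> y \<in> {ys j..ys (Suc j)} ==> y' \<in> {ys j..ys (Suc j)} ==>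
       \<bar>mid_defect u (xs i) (xs (Suc i)) y' - mid_defect u (xs i) (xs (Suc i)) y\<bar> <= K * h * U i j"
    and T: "!!i j x x'. i < nx ==> j < ny ==> x \<in> {xs i..xs (Suc i)} ==> x' \<in> {xs i..xs (Suc i)} ==>
       \<bar>mid_defect (%y x. u x y) (ys j) (ys (Suc j)) x' - mid_defect (%y x. u x y) (ys j) (ys (Suc j)) x\<bar> <= K * h * U i j"
    and T': "!!i j x. i < nx ==> j < ny ==> x \<in> {xs i..xs (Suc i)} ==> \<bar>mid_defect (%y x. u x y) (ys j) (ys (Suc j)) x\<bar> <= K * U i j"
  shows "\<bar>flux_sum (%x y. a x y * p x y + b x y * q x y) xs nx ys ny W - vsum a b u xs nx ys ny W\<bar>
     <= (\<Sum>i<nx. \<Sum>j<ny. K * h * (2 * Mb + L) * U i j * edges W i j)"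
proof -
  let ?g = "%x y. a x y * p x y + b x y * q x y"
  \<comment> \<open>\<open>S j x\<close> is the defect at mid-height on the vertical line through x,
    and \<open>Tb\<close> its mean over both sides of the cell. After subtracting \<open>Tb\<close>
    the error of a half edge is exactly a difference of the horizontal defect, as \<open>e1\<close>
    and \<open>e2\<close> show.\<close>
  define S where "S j x = mid_defect (%y x. u x y) (ys j) (ys (Suc j)) x" for j x
  define Tb where "Tb i j = (S j (xs i) + S j (xs (Suc i))) / 2" for i j
  define b0 where "b0 i j = b (mid xs i) (mid ys j)" for i j
  define d1 where "d1 i j = W (Suc i) j - W i j" for i j
  define w where "w i j = W i (Suc j) - W i j" for i j
  define low where "low i j = integral {ys j..mid ys j} (?g (mid xs i)) -
     integral {ys j..mid ys j} (%y. a (mid xs i) y * cell_dx u (xs i) (xs (Suc i)) (ys j) (ys (Suc j)) y + b (mid xs i) y * cell_dy u (xs i) (xs (Suc i)) (ys j) (ys (Suc j)))" for i j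
  define upp where "upp i j = integral {mid ys j..ys (Suc j)} (?g (mid xs i)) -
     integral {mid ys j..ys (Suc j)} (%y. a (mid xs i) y * cell_dx u (xs i) (xs (Suc i)) (ys j) (ys (Suc j)) y + b (mid xs i) y * cell_dy u (xs i) (xs (Suc i)) (ys j) (ys (Suc j)))" for i j
  define C where "C = K * h * (2 * Mb + L)"
  have diff: "flux_sum ?g xs nx ys ny W - vsum a b u xs nx ys ny W = (\<Sum>i<nx. \<Sum>j<ny. low i j * d1 i j + upp i j * d1 i (Suc j))"
    unfolding flux_sum_def vsum_def vcell_def sum_subtractf[symmetric] low_def upp_def d1_def mid_def
    by (intro sum.cong refl) (simp add: algebra_simps)
  have m: "ys j < mid ys j" "mid ys j < ys (Suc j)" if "j < ny" for j
    using my[OF that] by (auto simp: mid_def)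
  have LU: "\<bar>low i j - b0 i j * Tb i j\<bar> <= C * U i j \<and> \<bar>upp i j - b0 i j * (- Tb i j)\<bar> <= C * U i j" if ij: "i < nx" "j < ny" for i j
  proof
    note c = cont[OF ij] and bd = bound[OF ij] and A' = A[OF ij] and Q' = Q[OF ij] and bL1 = bL[OF ij]
    have hy: "ys (Suc j) - ys j > 0" using my[OF ij(2)] by simp
    have yy: "ys j \<in> {ys j..ys (Suc j)}" "mid ys j \<in> {ys j..ys (Suc j)}" "ys (Suc j) \<in> {ys j..ys (Suc j)}"
      using m[OF ij(2)] by auto
    let ?D = "mid_defect u (xs i) (xs (Suc i))"
    have cd: "(ys (Suc j) - ys j) * cell_dy u (xs i) (xs (Suc i)) (ys j) (ys (Suc j))
       = ((u (xs i) (ys (Suc j)) - u (xs i) (ys j)) + (u (xs (Suc i)) (ys (Suc j)) - u (xs (Suc i)) (ys j))) / 2"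
      using hy by (simp add: cell_dy_def field_simps)
    have t: "mid ys j - ys j = (ys (Suc j) - ys j) / 2" "ys (Suc j) - mid ys j = (ys (Suc j) - ys j) / 2"
      by (simp_all add: mid_def field_simps)
    have e1: "u (mid xs i) (mid ys j) - u (mid xs i) (ys j) - (mid ys j - ys j) * cell_dy u (xs i) (xs (Suc i)) (ys j) (ys (Suc j)) - Tb i j
       = ?D (mid ys j) - ?D (ys j)"
      using cd unfolding t Tb_def S_def mid_defect_def mid_def by (simp add: field_simps)
    have e2: "u (mid xs i) (ys (Suc j)) - u (mid xs i) (mid ys j) - (ys (Suc j) - mid ys j) * cell_dy u (xs i) (xs (Suc i)) (ys j) (ys (Suc j)) - (- Tb i j)
       = ?D (ys (Suc j)) - ?D (mid ys j)"
      using cd unfolding t Tb_def S_def mid_defect_def mid_def by (simp add: field_simps)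
    show "\<bar>low i j - b0 i j * Tb i j\<bar> <= C * U i j"
      unfolding low_def C_def mid_def[of xs]
      by (rule half_flux_error[OF mx[OF ij(1)] my[OF ij(2)]])
        (use m[OF ij(2)] c bd yy A' Q' F[OF ij, of "ys j" "mid ys j"] e1 D[OF ij yy(1,2)] bL1 in \<open>auto simp: mid_def[of xs, symmetric] b0_def\<close>)
    show "\<bar>upp i j - b0 i j * (- Tb i j)\<bar> <= C * U i j"
      unfolding upp_def C_def mid_def[of xs]
      by (rule half_flux_error[OF mx[OF ij(1)] my[OF ij(2)]])
        (use m[OF ij(2)] c bd yy A' Q' F[OF ij, of "mid ys j" "ys (Suc j)"] e2 D[OF ij yy(2,3)] bL1 in \<open>auto simp: mid_def[of xs, symmetric] b0_def\<close>)
  qed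
  \<comment> \<open>Uses \<open>d1 i (Suc j) - d1 i j = w (Suc i) j - w i j\<close>: the mixed
    second difference of W can be formed in either order.\<close>
  have split: "low i j * d1 i j + upp i j * d1 i (Suc j) = ((low i j - b0 i j * Tb i j) * d1 i j + (upp i j - b0 i j * (- Tb i j)) * d1 i (Suc j))
     + (- (b0 i j * Tb i j)) * (w (Suc i) j - w i j)" for i j
    by (simp add: d1_def w_def algebra_simps)
  have first: "\<bar>(low i j - b0 i j * Tb i j) * d1 i j + (upp i j - b0 i j * (- Tb i j)) * d1 i (Suc j)\<bar> <= C * U i j * (\<bar>d1 i j\<bar> + \<bar>d1 i (Suc j)\<bar>)"
    if "i < nx" "j < ny" for i j
  proof -
    have "\<bar>(low i j - b0 i j * Tb i j) * d1 i j + (upp i j - b0 i j * (- Tb i j)) * d1 i (Suc j)\<bar> <= \<bar>low i j - b0 i j * Tb i j\<bar> * \<bar>d1 i j\<bar> + \<bar>upp i j - b0 i j * (- Tb i j)\<bar> * \<bar>d1 i (Suc j)\<bar>"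
      unfolding abs_mult[symmetric] by (rule abs_triangle_ineq)
    also have "\<dots> <= C * U i j * \<bar>d1 i j\<bar> + C * U i j * \<bar>d1 i (Suc j)\<bar>"
      using LU[OF that] by (intro add_mono mult_right_mono) auto
    finally show ?thesis by (simp add: distrib_left)
  qed
  have second: "\<bar>\<Sum>i<nx. (- (b0 i j * Tb i j)) * (w (Suc i) j - w i j)\<bar> <= (\<Sum>i<nx. C * U i j * (\<bar>w i j\<bar> + \<bar>w (Suc i) j\<bar>))" if j: "j < ny" for j
  proof (cases "nx = 0")
    case False
    have Mb: "Mb >= 0" using bound[of 0 j "ys j"] False j m[OF j] by fastforce
    show ?thesis
    proof (rule row_sum_bound)
      show "w 0 j = 0" "w nx j = 0" using W0 by (auto simp: w_def)
      show "U i j >= 0" if "i < nx" for i using U0 that j by auto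
      show "C >= 0" using K h Mb L by (simp add: C_def)
      fix i assume i: "Suc i < nx"
      have i': "i < nx" using i by simp
      have x: "xs i \<in> {xs i..xs (Suc i)}" "xs (Suc i) \<in> {xs i..xs (Suc i)}" "xs (Suc i) \<in> {xs (Suc i)..xs (Suc (Suc i))}" "xs (Suc (Suc i)) \<in> {xs (Suc i)..xs (Suc (Suc i))}"
        using mx[OF i] mx[OF i'] by auto
      \<comment> \<open>The two means share the value of \<open>S j\<close> at the common side,
        since both cells have the same height. What remains is half the sum of the oscillations of
        \<open>S j\<close> in the two cells, a quantity of third derivatives.\<close>
      have TT: "\<bar>Tb i j - Tb (Suc i) j\<bar> <= K * h * (U i j + U (Suc i) j) / 2"
        using T[OF i' j x(1,2)] T[OF i j x(3,4)] unfolding Tb_def S_def[symmetric] by (simp add: field_simps abs_le_iff)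
      have "\<bar>S j (xs (Suc i))\<bar> <= K * U (Suc i) j" "\<bar>S j (xs (Suc (Suc i)))\<bar> <= K * U (Suc i) j"
        using T'[OF i j x(3)] T'[OF i j x(4)] by (auto simp: S_def)
      then have Tb: "\<bar>Tb (Suc i) j\<bar> <= K * U (Suc i) j" unfolding Tb_def by (simp add: abs_le_iff)
      have bb: "\<bar>b0 i j\<bar> <= Mb" using bound[OF i' j, of "mid ys j"] m[OF j] by (auto simp: b0_def)
      have UU: "0 <= U i j" "0 <= U (Suc i) j" using U0 i i' j by auto
      have "- (b0 i j * Tb i j) - - (b0 (Suc i) j * Tb (Suc i) j) = - (b0 i j * (Tb i j - Tb (Suc i) j) + (b0 i j - b0 (Suc i) j) * Tb (Suc i) j)"
        by (simp add: algebra_simps)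
      also have "\<bar>\<dots>\<bar> <= \<bar>b0 i j\<bar> * \<bar>Tb i j - Tb (Suc i) j\<bar> + \<bar>b0 i j - b0 (Suc i) j\<bar> * \<bar>Tb (Suc i) j\<bar>"
        unfolding abs_minus_cancel abs_mult[symmetric] by (rule abs_triangle_ineq)
      also have "\<dots> <= Mb * (K * h * (U i j + U (Suc i) j) / 2) + L * h * (K * U (Suc i) j)"
        using bb TT Tb bL'[OF i j] Mb K h L by (intro add_mono mult_mono) (auto simp: b0_def)
      also have "\<dots> <= C * (U i j + U (Suc i) j)"
      proof -
        have "0 <= Mb * (K * h * (U i j + U (Suc i) j))" "0 <= L * h * (K * U i j)" using Mb K h L UU by simp_all
        moreover have "C * (U i j + U (Suc i) j) = 2 * (Mb * (K * h * (U i j + U (Suc i) j))) + L * h * (K * U i j) + L * h * (K * U (Suc i) j)"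
          by (simp add: C_def algebra_simps)
        ultimately show ?thesis by linarith
      qed
      finally show "\<bar>- (b0 i j * Tb i j) - - (b0 (Suc i) j * Tb (Suc i) j)\<bar> <= C * (U i j + U (Suc i) j)" .
    qed
  qed simp
  have "\<bar>\<Sum>i<nx. \<Sum>j<ny. low i j * d1 i j + upp i j * d1 i (Suc j)\<bar>
    = \<bar>(\<Sum>i<nx. \<Sum>j<ny. (low i j - b0 i j * Tb i j) * d1 i j + (upp i j - b0 i j * (- Tb i j)) * d1 i (Suc j))
      + (\<Sum>j<ny. \<Sum>i<nx. (- (b0 i j * Tb i j)) * (w (Suc i) j - w i j))\<bar>"
    unfolding split sum.distrib by (subst (2) sum.swap) simp
  also have "\<dots> <= (\<Sum>i<nx. \<Sum>j<ny. C * U i j * (\<bar>d1 i j\<bar> + \<bar>d1 i (Suc j)\<bar>)) + (\<Sum>j<ny. \<Sum>i<nx. C * U i j * (\<bar>w i j\<bar> + \<bar>w (Suc i) j\<bar>))"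
  proof -
    have "\<bar>\<Sum>i<nx. \<Sum>j<ny. (low i j - b0 i j * Tb i j) * d1 i j + (upp i j - b0 i j * (- Tb i j)) * d1 i (Suc j)\<bar> <= (\<Sum>i<nx. \<Sum>j<ny. C * U i j * (\<bar>d1 i j\<bar> + \<bar>d1 i (Suc j)\<bar>))"
      by (intro order_trans[OF sum_abs] sum_mono) (use first in auto)
    moreover have "\<bar>\<Sum>j<ny. \<Sum>i<nx. (- (b0 i j * Tb i j)) * (w (Suc i) j - w i j)\<bar> <= (\<Sum>j<ny. \<Sum>i<nx. C * U i j * (\<bar>w i j\<bar> + \<bar>w (Suc i) j\<bar>))"
      by (rule order_trans[OF sum_abs sum_mono]) (use second in simp)
    ultimately show ?thesis by linarith
  qed
  also have "\<dots> = (\<Sum>i<nx. \<Sum>j<ny. C * U i j * edges W i j)"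
    by (subst (2) sum.swap) (simp add: sum.distrib[symmetric] edges_def d1_def w_def algebra_simps)
  finally show ?thesis unfolding diff C_def .
qed

subsection \<open>Coercivity on one cell\<close>

text \<open>3/8 and 1/8 are the integrals of the two linear shape functions over one half of the
  unit interval.\<close>

lemma cell_dx_half_integrals:
  assumes "x0 < x1" "y0 < y1"
  shows "integral {y0..(y0 + y1) / 2} (cell_dx u x0 x1 y0 y1)
      = (y1 - y0) / (x1 - x0) * (3/8 * (u x1 y0 - u x0 y0) + 1/8 * (u x1 y1 - u x0 y1))"
    "integral {(y0 + y1) / 2..y1} (cell_dx u x0 x1 y0 y1)
      = (y1 - y0) / (x1 - x0) * (1/8 * (u x1 y0 - u x0 y0) + 3/8 * (u x1 y1 - u x0 y1))"
proof -
  define d1 d2 where "d1 = u x1 y0 - u x0 y0" and "d2 = u x1 y1 - u x0 y1"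
  define P where "P y = (d2 * (y - y0)\<^sup>2 / 2 - d1 * (y1 - y)\<^sup>2 / 2) / ((x1 - x0) * (y1 - y0))" for y
  have "(P has_real_derivative cell_dx u x0 x1 y0 y1 y) (at y within S)" for y S
    unfolding P_def[abs_def] cell_dx_def d1_def[symmetric] d2_def[symmetric]
    by (rule DERIV_cdivide) (auto intro!: derivative_eq_intros simp: field_simps)
  then have I: "integral {s..t} (cell_dx u x0 x1 y0 y1) = P t - P s" if "s <= t" for s t
    using that by (intro integral_unique fundamental_theorem_of_calculus)
      (auto simp: has_real_derivative_iff_has_vector_derivative[symmetric])
  have h: "(y0 + y1) / 2 - y0 = (y1 - y0) / 2" "y1 - (y0 + y1) / 2 = (y1 - y0) / 2" by (simp_all add: field_simps)
  have *: "(c * (y1 - y0)\<^sup>2) / ((x1 - x0) * (y1 - y0)) = (y1 - y0) / (x1 - x0) * c" for c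
    using assms by (simp add: power2_eq_square)
  have "P ((y0 + y1) / 2) - P y0 = ((3/8 * d1 + 1/8 * d2) * (y1 - y0)\<^sup>2) / ((x1 - x0) * (y1 - y0))"
    unfolding P_def h diff_divide_distrib[symmetric] by (rule arg_cong[where f = "%z. z / _"]) (simp add: power_divide algebra_simps)
  then show "integral {y0..(y0 + y1) / 2} (cell_dx u x0 x1 y0 y1)
      = (y1 - y0) / (x1 - x0) * (3/8 * (u x1 y0 - u x0 y0) + 1/8 * (u x1 y1 - u x0 y1))"
    using I[of y0 "(y0 + y1) / 2"] assms unfolding * by (simp add: d1_def d2_def)
  have "P y1 - P ((y0 + y1) / 2) = ((1/8 * d1 + 3/8 * d2) * (y1 - y0)\<^sup>2) / ((x1 - x0) * (y1 - y0))"
    unfolding P_def h diff_divide_distrib[symmetric] by (rule arg_cong[where f = "%z. z / _"]) (simp add: power_divide algebra_simps)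
  then show "integral {(y0 + y1) / 2..y1} (cell_dx u x0 x1 y0 y1)
      = (y1 - y0) / (x1 - x0) * (1/8 * (u x1 y0 - u x0 y0) + 3/8 * (u x1 y1 - u x0 y1))"
    using I[of "(y0 + y1) / 2" y1] assms unfolding * by (simp add: d1_def d2_def)
qed

lemma cell_dx_cont: "continuous_on S (cell_dx u x0 x1 y0 y1)"
  unfolding cell_dx_def[abs_def] divide_inverse by (intro continuous_intros)

text \<open>With constant coefficients the half integrals give the displayed form exactly. Freezing
  the coefficients costs \<epsilon>; \<gamma> enters because derivatives of size 1/(x1 - x0) are
  integrated over the length y1 - y0.\<close>

lemma vcell_lower:
  fixes w :: "real => real => real" and x0 x1 y0 y1 :: real
  defines "d1 \<equiv> w x1 y0 - w x0 y0" and "d2 \<equiv> w x1 y1 - w x0 y1" and "e1 \<equiv> w x0 y1 - w x0 y0" and "e2 \<equiv> w x1 y1 - w x1 y0"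
  assumes cell: "x0 < x1" "y0 < y1" and ratio: "y1 - y0 <= \<gamma> * (x1 - x0)" "1 <= \<gamma>"
    and cont: "continuous_on {y0..y1} (a ((x0 + x1) / 2))" "continuous_on {y0..y1} (b ((x0 + x1) / 2))"
    and ab: "!!y. y \<in> {y0..y1} ==> \<bar>a ((x0 + x1) / 2) y - a0\<bar> <= \<epsilon>" "!!y. y \<in> {y0..y1} ==> \<bar>b ((x0 + x1) / 2) y - b0\<bar> <= \<epsilon>"
  shows "a0 * ((y1 - y0) / (x1 - x0)) * (3/8 * d1\<^sup>2 + 1/4 * d1 * d2 + 3/8 * d2\<^sup>2) + b0 * ((d1 + d2) / 2) * ((e1 + e2) / 2)
      - \<epsilon> * \<gamma> * (\<bar>d1\<bar> + \<bar>d2\<bar> + \<bar>e1\<bar> + \<bar>e2\<bar>)\<^sup>2 <= vcell a b w x0 x1 y0 y1 d1 d2"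
proof -
  define X where "X = (x0 + x1) / 2"
  define ym where "ym = (y0 + y1) / 2"
  define wy where "wy = cell_dy w x0 x1 y0 y1"
  let ?wx = "cell_dx w x0 x1 y0 y1"
  define E where "E = \<bar>d1\<bar> + \<bar>d2\<bar> + \<bar>e1\<bar> + \<bar>e2\<bar>"
  have h: "0 < x1 - x0" "0 < y1 - y0" using cell by auto
  have ym: "y0 < ym" "ym < y1" using cell by (auto simp: ym_def)
  have eps: "\<epsilon> >= 0" using ab(1)[of y0] cell by force
  have wy: "wy = (e1 + e2) / (2 * (y1 - y0))" by (simp add: wy_def cell_dy_def e1_def e2_def)
  have pert: "\<bar>integral {s..t} (%y. a X y * ?wx y + b X y * wy) - (a0 * integral {s..t} ?wx + b0 * (wy * (t - s)))\<bar> <= \<epsilon> * \<gamma> * E"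
    if st: "y0 <= s" "s <= t" "t <= y1" "t - s = (y1 - y0) / 2" for s t
  proof -
    have sub: "{s..t} \<subseteq> {y0..y1}" using st by auto
    note c = cont[THEN continuous_on_subset[OF _ sub], folded X_def]
    have "integral {s..t} (%y. a X y * ?wx y + b X y * wy) - integral {s..t} (%y. a0 * ?wx y + b0 * wy)
       = integral {s..t} (%y. (a X y * ?wx y + b X y * wy) - (a0 * ?wx y + b0 * wy))"
      by (intro Henstock_Kurzweil_Integration.integral_diff[symmetric] integrable_continuous_real continuous_intros c cell_dx_cont)
    moreover have "integral {s..t} (%y. a0 * ?wx y + b0 * wy) = integral {s..t} (%y. a0 * ?wx y) + integral {s..t} (%y. b0 * wy)"
      by (intro Henstock_Kurzweil_Integration.integral_add integrable_continuous_real continuous_intros cell_dx_cont)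
    moreover have "\<dots> = a0 * integral {s..t} ?wx + b0 * (wy * (t - s))" using st by simp
    moreover have "norm (integral {s..t} (%y. (a X y * ?wx y + b X y * wy) - (a0 * ?wx y + b0 * wy))) 
       <= (\<epsilon> * ((\<bar>d1\<bar> + \<bar>d2\<bar>) / (x1 - x0) + (\<bar>e1\<bar> + \<bar>e2\<bar>) / (2 * (y1 - y0)))) * (t - s)"
    proof (rule integral_bound[OF st(2)])
      show "continuous_on {s..t} (%y. (a X y * ?wx y + b X y * wy) - (a0 * ?wx y + b0 * wy))"
        by (intro continuous_intros c cell_dx_cont)
      fix y assume y: "y \<in> {s..t}"
      have "\<bar>d1 * (y1 - y) + d2 * (y - y0)\<bar> <= \<bar>d1\<bar> * (y1 - y0) + \<bar>d2\<bar> * (y1 - y0)"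
        using y st by (intro order_trans[OF abs_triangle_ineq] add_mono) (auto simp: abs_mult intro!: mult_left_mono)
      then have "\<bar>d1 * (y1 - y) + d2 * (y - y0)\<bar> <= (\<bar>d1\<bar> + \<bar>d2\<bar>) * (y1 - y0)" by (simp add: distrib_right)
      then have "\<bar>d1 * (y1 - y) + d2 * (y - y0)\<bar> / ((x1 - x0) * (y1 - y0)) <= (\<bar>d1\<bar> + \<bar>d2\<bar>) * (y1 - y0) / ((x1 - x0) * (y1 - y0))"
        using h by (intro divide_right_mono) auto
      then have wx: "\<bar>?wx y\<bar> <= (\<bar>d1\<bar> + \<bar>d2\<bar>) / (x1 - x0)"
        using h by (simp add: cell_dx_def d1_def d2_def abs_divide abs_mult)
      have wy': "\<bar>wy\<bar> <= (\<bar>e1\<bar> + \<bar>e2\<bar>) / (2 * (y1 - y0))"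
        unfolding wy abs_divide using h by (simp add: divide_right_mono abs_triangle_ineq)
      have "(a X y * ?wx y + b X y * wy) - (a0 * ?wx y + b0 * wy) = (a X y - a0) * ?wx y + (b X y - b0) * wy" by (simp add: algebra_simps)
      also have "\<bar>\<dots>\<bar> <= \<bar>a X y - a0\<bar> * \<bar>?wx y\<bar> + \<bar>b X y - b0\<bar> * \<bar>wy\<bar>" 
        unfolding abs_mult[symmetric] by (rule abs_triangle_ineq)
      also have "\<dots> <= \<epsilon> * ((\<bar>d1\<bar> + \<bar>d2\<bar>) / (x1 - x0)) + \<epsilon> * ((\<bar>e1\<bar> + \<bar>e2\<bar>) / (2 * (y1 - y0)))"
        using ab[of y] y sub wx wy' eps by (intro add_mono mult_mono) (auto simp: X_def)
      finally show "norm ((a X y * ?wx y + b X y * wy) - (a0 * ?wx y + b0 * wy)) <= \<epsilon> * ((\<bar>d1\<bar> + \<bar>d2\<bar>) / (x1 - x0) + (\<bar>e1\<bar> + \<bar>e2\<bar>) / (2 * (y1 - y0)))"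
        by (simp add: distrib_left)
    qed
    moreover have "(\<epsilon> * ((\<bar>d1\<bar> + \<bar>d2\<bar>) / (x1 - x0) + (\<bar>e1\<bar> + \<bar>e2\<bar>) / (2 * (y1 - y0)))) * (t - s) <= \<epsilon> * \<gamma> * E"
    proof -
      have g: "(y1 - y0) / (x1 - x0) <= \<gamma>" using ratio h by (simp add: divide_le_eq)
      have "((\<bar>d1\<bar> + \<bar>d2\<bar>) / (x1 - x0) + (\<bar>e1\<bar> + \<bar>e2\<bar>) / (2 * (y1 - y0))) * (t - s)
         = ((y1 - y0) / (x1 - x0)) * ((\<bar>d1\<bar> + \<bar>d2\<bar>) / 2) + (\<bar>e1\<bar> + \<bar>e2\<bar>) / 4"
      proof -
        have "(P / r + S / (2 * t)) * (t / 2) = (t / r) * (P / 2) + S / 4" if "r > 0" "t > 0" for P S r t :: real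
          using that by (simp add: field_simps)
        from this[OF h] show ?thesis unfolding st(4) .
      qed
      also have "\<dots> <= \<gamma> * (\<bar>d1\<bar> + \<bar>d2\<bar>) + \<gamma> * (\<bar>e1\<bar> + \<bar>e2\<bar>)"
      proof (rule add_mono)
        show "((y1 - y0) / (x1 - x0)) * ((\<bar>d1\<bar> + \<bar>d2\<bar>) / 2) <= \<gamma> * (\<bar>d1\<bar> + \<bar>d2\<bar>)"
          using g ratio(2) by (intro mult_mono) auto
        have "1 * (\<bar>e1\<bar> + \<bar>e2\<bar>) <= \<gamma> * (\<bar>e1\<bar> + \<bar>e2\<bar>)" using ratio(2) by (intro mult_right_mono) auto
        then show "(\<bar>e1\<bar> + \<bar>e2\<bar>) / 4 <= \<gamma> * (\<bar>e1\<bar> + \<bar>e2\<bar>)" by simp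
      qed
      also have "\<dots> = \<gamma> * E" by (simp add: E_def algebra_simps)
      finally have "\<epsilon> * (((\<bar>d1\<bar> + \<bar>d2\<bar>) / (x1 - x0) + (\<bar>e1\<bar> + \<bar>e2\<bar>) / (2 * (y1 - y0))) * (t - s)) <= \<epsilon> * (\<gamma> * E)"
        using eps by (rule mult_left_mono)
      then show ?thesis by (simp add: mult.assoc)
    qed
    ultimately show ?thesis unfolding real_norm_def by linarith
  qed
  define I1 where "I1 = integral {y0..ym} (%y. a X y * ?wx y + b X y * wy)"
  define I2 where "I2 = integral {ym..y1} (%y. a X y * ?wx y + b X y * wy)"
  define J1 where "J1 = a0 * integral {y0..ym} ?wx + b0 * (wy * (ym - y0))"
  define J2 where "J2 = a0 * integral {ym..y1} ?wx + b0 * (wy * (y1 - ym))"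
  have hm: "ym - y0 = (y1 - y0) / 2" "y1 - ym = (y1 - y0) / 2" by (simp_all add: ym_def field_simps)
  have p1: "\<bar>I1 - J1\<bar> <= \<epsilon> * \<gamma> * E" unfolding I1_def J1_def by (rule pert) (use ym hm in auto)
  have p2: "\<bar>I2 - J2\<bar> <= \<epsilon> * \<gamma> * E" unfolding I2_def J2_def by (rule pert) (use ym hm in auto)
  have vc: "vcell a b w x0 x1 y0 y1 d1 d2 = I1 * d1 + I2 * d2"
    unfolding vcell_def I1_def I2_def X_def ym_def wy_def ..
  have wyh: "wy * ((y1 - y0) / 2) = (e1 + e2) / 4"
  proof -
    have "S / (2 * t) * (t / 2) = S / 4" if "t > 0" for S t :: real using that by simp
    from this[OF h(2)] show ?thesis unfolding wy .
  qed
  have J1: "J1 = a0 * ((y1 - y0) / (x1 - x0) * (3/8 * d1 + 1/8 * d2)) + b0 * ((e1 + e2) / 4)"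
    unfolding J1_def hm wyh using cell_dx_half_integrals(1)[OF cell, of w] by (simp add: ym_def d1_def d2_def)
  have J2: "J2 = a0 * ((y1 - y0) / (x1 - x0) * (1/8 * d1 + 3/8 * d2)) + b0 * ((e1 + e2) / 4)"
    unfolding J2_def hm wyh using cell_dx_half_integrals(2)[OF cell, of w] by (simp add: ym_def d1_def d2_def)
  have J: "J1 * d1 + J2 * d2 = a0 * ((y1 - y0) / (x1 - x0)) * (3/8 * d1\<^sup>2 + 1/4 * d1 * d2 + 3/8 * d2\<^sup>2) + b0 * ((d1 + d2) / 2) * ((e1 + e2) / 2)"
  proof -
    have "(a0 * (r * (3/8 * d1 + 1/8 * d2)) + b0 * (S / 4)) * d1 + (a0 * (r * (1/8 * d1 + 3/8 * d2)) + b0 * (S / 4)) * d2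
      = a0 * r * (3/8 * d1\<^sup>2 + 1/4 * d1 * d2 + 3/8 * d2\<^sup>2) + b0 * ((d1 + d2) / 2) * (S / 2)" for r S
      by (simp add: power2_eq_square field_simps)
    then show ?thesis unfolding J1 J2 .
  qed
  have "\<bar>(I1 - J1) * d1 + (I2 - J2) * d2\<bar> <= \<epsilon> * \<gamma> * E * \<bar>d1\<bar> + \<epsilon> * \<gamma> * E * \<bar>d2\<bar>"
    using p1 p2 by (intro order_trans[OF abs_triangle_ineq] add_mono) (auto simp: abs_mult intro!: mult_right_mono)
  also have "\<dots> <= \<epsilon> * \<gamma> * E * E"
  proof -
    have "0 <= \<epsilon> * \<gamma> * E" using eps ratio(2) by (simp add: E_def)
    then have "\<epsilon> * \<gamma> * E * (\<bar>d1\<bar> + \<bar>d2\<bar>) <= \<epsilon> * \<gamma> * E * E" by (intro mult_left_mono) (auto simp: E_def)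
    then show ?thesis by (simp add: distrib_left)
  qed
  finally have "J1 * d1 + J2 * d2 - \<epsilon> * \<gamma> * E\<^sup>2 <= I1 * d1 + I2 * d2"
    by (simp add: algebra_simps power2_eq_square abs_le_iff)
  then show ?thesis unfolding J vc E_def .
qed

text \<open>In the means \<beta>, \<delta> and the mixed difference \<kappa>, common to both
  directions by \<open>de\<close>, each 3/8-1/4-3/8 form becomes a square plus \<kappa>^2/8.
  Ellipticity at the vector (\<beta>/hx, \<delta>/hy) bounds the part in the means, positivity of
  the diagonal entries the part in \<kappa>.\<close>

lemma cell_form_lower:
  fixes d1 d2 e1 e2 :: real
  assumes ell: "!!s t. C1 * (s\<^sup>2 + t\<^sup>2) <= a11 * s\<^sup>2 + (a12 + a21) * s * t + a22 * t\<^sup>2" and C1: "C1 > 0"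
    and h: "hx > 0" "hy > 0" "hx <= \<gamma> * hy" "hy <= \<gamma> * hx" "\<gamma> >= 1" and de: "d2 - d1 = e2 - e1"
  shows "C1 / (4 * \<gamma>) * (d1\<^sup>2 + d2\<^sup>2 + e1\<^sup>2 + e2\<^sup>2) <=
    (a11 * (hy / hx) * (3/8 * d1\<^sup>2 + 1/4 * d1 * d2 + 3/8 * d2\<^sup>2) + a12 * ((d1 + d2) / 2) * ((e1 + e2) / 2))
    + (a22 * (hx / hy) * (3/8 * e1\<^sup>2 + 1/4 * e1 * e2 + 3/8 * e2\<^sup>2) + a21 * ((e1 + e2) / 2) * ((d1 + d2) / 2))"
proof -
  define \<beta> \<delta> \<kappa> where "\<beta> = (d1 + d2) / 2" and "\<delta> = (e1 + e2) / 2" and "\<kappa> = d2 - d1"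
  note defs = this
  have d: "d1 = \<beta> - \<kappa> / 2" "d2 = \<beta> + \<kappa> / 2" "e1 = \<delta> - \<kappa> / 2" "e2 = \<delta> + \<kappa> / 2"
    using de by (auto simp: defs field_simps)
  have q: "3/8 * (s - \<kappa> / 2)\<^sup>2 + 1/4 * (s - \<kappa> / 2) * (s + \<kappa> / 2) + 3/8 * (s + \<kappa> / 2)\<^sup>2 = s\<^sup>2 + \<kappa>\<^sup>2 / 8" for s
    by (simp add: power2_eq_square field_simps)
  have Q: "d1\<^sup>2 + d2\<^sup>2 + e1\<^sup>2 + e2\<^sup>2 = 2 * \<beta>\<^sup>2 + 2 * \<delta>\<^sup>2 + \<kappa>\<^sup>2"
    unfolding d by (simp add: power2_eq_square field_simps)
  have t: "1 / \<gamma> <= hy / hx" "1 / \<gamma> <= hx / hy" using h by (auto simp: field_simps)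
  have tp: "hy / hx > 0" "hx / hy > 0" using h by auto
  have a: "C1 <= a11" "C1 <= a22" using ell[of 1 0] ell[of 0 1] by auto
  have e: "C1 * (hy / hx * \<beta>\<^sup>2 + hx / hy * \<delta>\<^sup>2) <= a11 * (hy / hx) * \<beta>\<^sup>2 + (a12 + a21) * \<beta> * \<delta> + a22 * (hx / hy) * \<delta>\<^sup>2"
  proof -
    have "hx * hy * (C1 * ((\<beta> / hx)\<^sup>2 + (\<delta> / hy)\<^sup>2)) <= hx * hy * (a11 * (\<beta> / hx)\<^sup>2 + (a12 + a21) * (\<beta> / hx) * (\<delta> / hy) + a22 * (\<delta> / hy)\<^sup>2)"
      using h by (intro mult_left_mono ell) auto
    moreover have "hx * hy * (C1 * ((\<beta> / hx)\<^sup>2 + (\<delta> / hy)\<^sup>2)) = C1 * (hy / hx * \<beta>\<^sup>2 + hx / hy * \<delta>\<^sup>2)"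
      using h by (simp add: power2_eq_square field_simps)
    moreover have "hx * hy * (a11 * (\<beta> / hx)\<^sup>2 + (a12 + a21) * (\<beta> / hx) * (\<delta> / hy) + a22 * (\<delta> / hy)\<^sup>2)
       = a11 * (hy / hx) * \<beta>\<^sup>2 + (a12 + a21) * \<beta> * \<delta> + a22 * (hx / hy) * \<delta>\<^sup>2"
      using h by (simp add: power2_eq_square field_simps)
    ultimately show ?thesis by simp
  qed
  have k: "C1 * (1 / \<gamma>) * (\<kappa>\<^sup>2 / 8) <= a11 * (hy / hx) * (\<kappa>\<^sup>2 / 8)" "C1 * (1 / \<gamma>) * (\<kappa>\<^sup>2 / 8) <= a22 * (hx / hy) * (\<kappa>\<^sup>2 / 8)"
    using a t tp C1 h by (intro mult_right_mono mult_mono; simp)+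
  have b: "C1 * (1 / \<gamma>) * \<beta>\<^sup>2 + C1 * (1 / \<gamma>) * \<delta>\<^sup>2 <= C1 * (hy / hx * \<beta>\<^sup>2 + hx / hy * \<delta>\<^sup>2)"
    unfolding distrib_left mult.assoc[symmetric] using t C1 by (intro add_mono mult_right_mono mult_left_mono) auto
  have "C1 / (4 * \<gamma>) * (2 * \<beta>\<^sup>2 + 2 * \<delta>\<^sup>2 + \<kappa>\<^sup>2) <= C1 * (1 / \<gamma>) * (\<beta>\<^sup>2 + \<delta>\<^sup>2 + \<kappa>\<^sup>2 / 4)"
    using C1 h by (simp add: field_simps)
  then have "C1 / (4 * \<gamma>) * (2 * \<beta>\<^sup>2 + 2 * \<delta>\<^sup>2 + \<kappa>\<^sup>2) <= C1 * (1 / \<gamma>) * \<beta>\<^sup>2 + C1 * (1 / \<gamma>) * \<delta>\<^sup>2 + 2 * (C1 * (1 / \<gamma>) * (\<kappa>\<^sup>2 / 8))"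
    by (simp add: distrib_left)
  also have "\<dots> <= (a11 * (hy / hx) * \<beta>\<^sup>2 + (a12 + a21) * \<beta> * \<delta> + a22 * (hx / hy) * \<delta>\<^sup>2) + (a11 * (hy / hx) * (\<kappa>\<^sup>2 / 8) + a22 * (hx / hy) * (\<kappa>\<^sup>2 / 8))"
    unfolding mult_2 by (rule add_mono[OF order_trans[OF b e] add_mono[OF k]])
  also have "\<dots> = (a11 * (hy / hx) * (\<beta>\<^sup>2 + \<kappa>\<^sup>2 / 8) + a12 * \<beta> * \<delta>) + (a22 * (hx / hy) * (\<delta>\<^sup>2 + \<kappa>\<^sup>2 / 8) + a21 * \<delta> * \<beta>)"
    by (simp add: algebra_simps)
  finally show ?thesis unfolding Q q[symmetric] d[symmetric] by (simp only: defs(1,2))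
qed

subsection \<open>Meshes and the trial space\<close>

lemma bilin_flip: "bilin u x0 x1 y0 y1 x y = bilin (%y x. u x y) y0 y1 x0 x1 y x"
  unfolding bilin_def by (simp add: field_simps add_divide_distrib diff_divide_distrib)

lemma bilin_DERIV_x: "((%x. bilin u x0 x1 y0 y1 x y) has_real_derivative cell_dx u x0 x1 y0 y1 y) (at x)"
proof -
  define P where "P = (u x0 y0 * (y1 - y) + u x0 y1 * (y - y0)) / (y1 - y0)"
  define Q where "Q = (u x1 y0 * (y1 - y) + u x1 y1 * (y - y0)) / (y1 - y0)"
  have "((%x. (P * (x1 - x) + Q * (x - x0)) / (x1 - x0)) has_real_derivative (Q - P) / (x1 - x0)) (at x)"
    by (rule DERIV_cdivide) (auto intro!: derivative_eq_intros)
  moreover have "(Q - P) / (x1 - x0) = cell_dx u x0 x1 y0 y1 y"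
    unfolding P_def Q_def cell_dx_def diff_divide_distrib[symmetric] divide_divide_eq_left
    by (simp add: algebra_simps)
  ultimately show ?thesis unfolding bilin_def P_def Q_def by simp
qed

lemma bilin_DERIV_y_mid:
  assumes "x0 < x1"
  shows "((%y. bilin u x0 x1 y0 y1 ((x0 + x1) / 2) y) has_real_derivative cell_dy u x0 x1 y0 y1) (at y)"
proof -
  have "cell_dx (%y x. u x y) y0 y1 x0 x1 ((x0 + x1) / 2) = cell_dy u x0 x1 y0 y1"
  proof -
    have m: "x1 - (x0 + x1) / 2 = (x1 - x0) / 2" "(x0 + x1) / 2 - x0 = (x1 - x0) / 2" by (simp_all add: field_simps)
    have "cell_dx (%y x. u x y) y0 y1 x0 x1 ((x0 + x1) / 2) = (((u x0 y1 - u x0 y0) + (u x1 y1 - u x1 y0)) * ((x1 - x0) / 2)) / ((y1 - y0) * (x1 - x0))"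
      unfolding cell_dx_def m by (simp only: distrib_right)
    moreover have "(S * (t / 2)) / (r * t) = S / (2 * r)" if "t > 0" for S t r :: real using that by simp
    ultimately show ?thesis unfolding cell_dy_def using assms by (simp only: diff_gt_0_iff_gt)
  qed
  then show ?thesis using bilin_DERIV_x[of "%y x. u x y" y0 y1 x0 x1 "(x0 + x1) / 2" y]
    unfolding bilin_flip[of "%y x. u x y"] by simp
qed

lemma Q1_on_bilin:
  assumes "Q1_on ({x0..x1} \<times> {y0..y1}) w" "x0 < x1" "y0 < y1" "x \<in> {x0..x1}" "y \<in> {y0..y1}"
  shows "w (x, y) = bilin (%x y. w (x, y)) x0 x1 y0 y1 x y"
proof -
  obtain c0 c1 c2 c3 where c: "!!x y. x \<in> {x0..x1} ==> y \<in> {y0..y1} ==> w (x, y) = c0 + c1 * x + c2 * y + c3 * x * y"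
    using assms(1) unfolding Q1_on_def by fastforce
  have lin: "((p + q * s) * (t - z) + (p + q * t) * (z - s)) / (t - s) = p + q * z" if "s < t" for p q s t z :: real
  proof -
    have "(p + q * s) * (t - z) + (p + q * t) * (z - s) = (p + q * z) * (t - s)" by (simp add: algebra_simps)
    then show ?thesis using that by simp
  qed
  have v: "w (s, t) = (c0 + c1 * s) + (c2 + c3 * s) * t" if "s \<in> {x0..x1}" "t \<in> {y0..y1}" for s t
    using c[OF that] by (simp add: algebra_simps)
  have "bilin (%x y. w (x, y)) x0 x1 y0 y1 x y
     = (((c0 + c1 * x0) + (c2 + c3 * x0) * y) * (x1 - x) + ((c0 + c1 * x1) + (c2 + c3 * x1) * y) * (x - x0)) / (x1 - x0)"
    unfolding bilin_def using assms(2,3) v by (simp add: lin[OF assms(3)])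
  also have "\<dots> = (((c0 + c2 * y) + (c1 + c3 * y) * x0) * (x1 - x) + ((c0 + c2 * y) + (c1 + c3 * y) * x1) * (x - x0)) / (x1 - x0)"
    by (simp add: algebra_simps)
  also have "\<dots> = (c0 + c2 * y) + (c1 + c3 * y) * x" by (rule lin[OF assms(2)])
  finally show ?thesis using c[OF assms(4,5)] by (simp add: algebra_simps)
qed

text \<open>Zero at the boundary indices by definition, so that summation by parts has its end
  conditions for any w; for trial functions it gives the nodal values (\<open>UhD\<close>).\<close>

definition nodal :: "(real \<times> real => real) => (nat => real) => nat => (nat => real) => nat => nat => nat => real" where
  "nodal w xs nx ys ny i j = (if 0 < i \<and> i < nx \<and> 0 < j \<and> j < ny then w (xs i, ys j) else 0)"

locale mesh =
  fixes a1 b1 a2 b2 :: real and xs :: "nat => real" and nx :: nat and ys :: "nat => real" and ny :: nat and \<gamma> :: real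
  assumes vm: "valid_mesh a1 b1 a2 b2 xs nx ys ny" and rm: "regular_mesh \<gamma> xs nx ys ny"
begin

definition "h = mesh_size xs nx ys ny"

abbreviation "elt i j \<equiv> cbox (xs i, ys j) (xs (Suc i), ys (Suc j))"
abbreviation "elt0 i j \<equiv> box (xs i, ys j) (xs (Suc i), ys (Suc j))"
abbreviation "vdx w i j \<equiv> cell_dx (%x y. w (x, y)) (xs i) (xs (Suc i)) (ys j) (ys (Suc j))"
abbreviation "vdy w i j \<equiv> cell_dy (%x y. w (x, y)) (xs i) (xs (Suc i)) (ys j) (ys (Suc j))"
abbreviation "hdx w i j \<equiv> cell_dx (%y x. w (x, y)) (ys j) (ys (Suc j)) (xs i) (xs (Suc i))"
abbreviation "hdy w i j \<equiv> cell_dy (%y x. w (x, y)) (ys j) (ys (Suc j)) (xs i) (xs (Suc i))"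
abbreviation "bil w i j \<equiv> bilin (%x y. w (x, y)) (xs i) (xs (Suc i)) (ys j) (ys (Suc j))"
abbreviation "circulation g1 g2 i j \<equiv> integral {lo ys j..hi ys ny j} (g1 (hi xs nx i)) - integral {lo ys j..hi ys ny j} (g1 (lo xs i))
      + integral {lo xs i..hi xs nx i} (g2 (hi ys ny j)) - integral {lo xs i..hi xs nx i} (g2 (lo ys j :: real) :: real => real)"
abbreviation corners :: "(nat => nat => real) => nat => nat => real" where
  "corners W i j \<equiv> \<bar>W i j\<bar> + \<bar>W (Suc i) j\<bar> + \<bar>W i (Suc j)\<bar> + \<bar>W (Suc i) (Suc j)\<bar>"

lemma n_pos: "0 < nx" "0 < ny" using vm by (auto simp: valid_mesh_def)
lemma xs_step: "i < nx ==> xs i < xs (Suc i)" and ys_step: "j < ny ==> ys j < ys (Suc j)"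
  using vm by (auto simp: valid_mesh_def)
lemma ends: "xs 0 = a1" "xs nx = b1" "ys 0 = a2" "ys ny = b2" using vm by (auto simp: valid_mesh_def)

lemma xs_mono: "i < j ==> j <= nx ==> xs i < xs j"
proof (induction j)
  case (Suc j)
  then show ?case using xs_step[of j] by (cases "i = j") auto
qed simp

lemma ys_mono: "i < j ==> j <= ny ==> ys i < ys j"
proof (induction j)
  case (Suc j)
  then show ?case using ys_step[of j] by (cases "i = j") auto
qed simp

lemma xs_in: "i <= nx ==> a1 <= xs i \<and> xs i <= b1" and ys_in: "j <= ny ==> a2 <= ys j \<and> ys j <= b2"
  using xs_mono[of 0 i] xs_mono[of i nx] ys_mono[of 0 j] ys_mono[of j ny] ends
  by (cases "i = 0"; cases "i = nx"; cases "j = 0"; cases "j = ny"; force)+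

lemma hK_le: assumes "i < nx" "j < ny" shows "hK xs ys i j <= h"
proof -
  have "{hK xs ys i j | i j. i < nx \<and> j < ny} = (%(i, j). hK xs ys i j) ` ({..<nx} \<times> {..<ny})" by auto
  then have "finite {hK xs ys i j | i j. i < nx \<and> j < ny}" by simp
  then show ?thesis unfolding h_def mesh_size_def using assms by (intro Max_ge) auto
qed

lemma hx_hK: "i < nx ==> xs (Suc i) - xs i <= hK xs ys i j" "j < ny ==> ys (Suc j) - ys j <= hK xs ys i j"
  unfolding hK_def by (rule real_le_rsqrt; simp)+

lemma hx_le: "i < nx ==> xs (Suc i) - xs i <= h"
  using hx_hK(1)[of i 0] hK_le[of i 0] n_pos by simp

lemma hy_le: "j < ny ==> ys (Suc j) - ys j <= h"
  using hx_hK(2)[of j 0] hK_le[of 0 j] n_pos by simp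

lemma h_pos: "h > 0" using hx_le[of 0] xs_step[of 0] n_pos by simp

lemma hK_ratio: assumes "i < nx" "j < ny" shows "hK xs ys i j <= \<gamma> * min (xs (Suc i) - xs i) (ys (Suc j) - ys j)"
proof -
  have "min (xs (Suc i) - xs i) (ys (Suc j) - ys j) > 0" using xs_step ys_step assms by simp
  moreover have "hK xs ys i j / min (xs (Suc i) - xs i) (ys (Suc j) - ys j) <= \<gamma>"
    using rm assms by (auto simp: regular_mesh_def rhoK_def)
  ultimately show ?thesis by (simp add: divide_le_eq)
qed

lemma gamma_ge1: "\<gamma> >= 1"
proof (rule ccontr)
  assume g: "\<not> 1 <= \<gamma>"
  define m where "m = min (xs (Suc 0) - xs 0) (ys (Suc 0) - ys 0)"
  have m: "m > 0" using xs_step[of 0] ys_step[of 0] n_pos by (simp add: m_def)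
  have "m <= hK xs ys 0 0" using hx_hK(1)[of 0 0] n_pos by (simp add: m_def)
  also have "\<dots> <= \<gamma> * m" unfolding m_def by (rule hK_ratio) (use n_pos in auto)
  finally have "m <= \<gamma> * m" .
  moreover have "\<gamma> * m < 1 * m" using g m by (intro mult_strict_right_mono) auto
  ultimately show False by linarith
qed

text \<open>Every column of the tensor grid meets every row in a cell, so regularity compares each
  width with each height, not merely the sides of one cell.\<close>

lemma ratio: assumes "i < nx" "j < ny"
  shows "xs (Suc i) - xs i <= \<gamma> * (ys (Suc j) - ys j)" "ys (Suc j) - ys j <= \<gamma> * (xs (Suc i) - xs i)"
proof -
  have g: "\<gamma> >= 0" using gamma_ge1 by simp
  have "\<gamma> * min (xs (Suc i) - xs i) (ys (Suc j) - ys j) <= \<gamma> * (ys (Suc j) - ys j)"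
    "\<gamma> * min (xs (Suc i) - xs i) (ys (Suc j) - ys j) <= \<gamma> * (xs (Suc i) - xs i)"
    using g by (intro mult_left_mono; simp)+
  then show "xs (Suc i) - xs i <= \<gamma> * (ys (Suc j) - ys j)" "ys (Suc j) - ys j <= \<gamma> * (xs (Suc i) - xs i)"
    using hK_ratio[OF assms] hx_hK(1)[OF assms(1), of j] hx_hK(2)[OF assms(2), of i] by auto
qed

lemma mid_in: "i < nx ==> xs i < mid xs i \<and> mid xs i < xs (Suc i)" "j < ny ==> ys j < mid ys j \<and> mid ys j < ys (Suc j)"
  using xs_step[of i] ys_step[of j] by (auto simp: mid_def)

lemma mid_in': "i < nx ==> a1 < mid xs i \<and> mid xs i < b1" "j < ny ==> a2 < mid ys j \<and> mid ys j < b2"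
  using mid_in(1)[of i] mid_in(2)[of j] xs_in[of i] xs_in[of "Suc i"] ys_in[of j] ys_in[of "Suc j"] by force+

lemma UhD:
  assumes w: "w \<in> Uh a1 b1 a2 b2 xs nx ys ny"
  shows "continuous_on (cbox (a1, a2) (b1, b2)) w"
    "i < nx ==> j < ny ==> x \<in> {xs i..xs (Suc i)} ==> y \<in> {ys j..ys (Suc j)} ==>
      w (x, y) = bil w i j x y"
    "p \<in> cbox (a1, a2) (b1, b2) - box (a1, a2) (b1, b2) ==> w p = 0"
    "i <= nx ==> j <= ny ==> w (xs i, ys j) = nodal w xs nx ys ny i j"
proof -
  show "continuous_on (cbox (a1, a2) (b1, b2)) w" using w by (simp add: Uh_def)
  show "i < nx ==> j < ny ==> x \<in> {xs i..xs (Suc i)} ==> y \<in> {ys j..ys (Suc j)} ==>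
      w (x, y) = bil w i j x y"
    by (rule Q1_on_bilin) (use w xs_step ys_step in \<open>auto simp: Uh_def elem_def\<close>)
  have ab: "a1 < b1" "a2 < b2" using xs_mono[of 0 nx] ys_mono[of 0 ny] n_pos ends by auto
  have "box (a1, a2) (b1, b2) \<noteq> {}" using ab by (simp add: box_Pair_real)
  then have fr: "frontier (box (a1, a2) (b1, b2)) = cbox (a1, a2) (b1, b2) - box (a1, a2) (b1, b2)"
    by (simp add: frontier_box)
  show z: "w p = 0" if "p \<in> cbox (a1, a2) (b1, b2) - box (a1, a2) (b1, b2)" for p using w that by (simp add: Uh_def fr)
  assume ij: "i <= nx" "j <= ny"
  show "w (xs i, ys j) = nodal w xs nx ys ny i j"
  proof (cases "0 < i \<and> i < nx \<and> 0 < j \<and> j < ny")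
    case False
    then have "i = 0 \<or> i = nx \<or> j = 0 \<or> j = ny" using ij by auto
    then have "(xs i, ys j) \<in> cbox (a1, a2) (b1, b2) - box (a1, a2) (b1, b2)"
      using xs_in[OF ij(1)] ys_in[OF ij(2)] ends by (auto simp: cbox_Pair_real box_Pair_real)
    then show ?thesis using z False by (simp add: nodal_def)
  qed (simp add: nodal_def)
qed

lemma grad_vertical:
  assumes w: "w \<in> Uh a1 b1 a2 b2 xs nx ys ny" and ij: "i < nx" "j < ny" and y: "ys j < y" "y < ys (Suc j)"
  shows "pdir True w (mid xs i, y) = vdx w i j y"
    "pdir False w (mid xs i, y) = vdy w i j"
proof -
  let ?b = "bil w i j"
  have "((%t. w (t, y)) has_real_derivative vdx w i j y) (at (mid xs i))"
    by (rule has_field_derivative_transform_within_open[OF bilin_DERIV_x, where S = "{xs i<..<xs (Suc i)}"])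
      (use mid_in(1)[OF ij(1)] y in \<open>auto simp: UhD(2)[OF w ij]\<close>)
  then show "pdir True w (mid xs i, y) = vdx w i j y"
    by (simp add: pdir_def DERIV_imp_deriv)
  have "((%t. w (mid xs i, t)) has_real_derivative vdy w i j) (at y)"
    by (rule has_field_derivative_transform_within_open[OF bilin_DERIV_y_mid[OF xs_step[OF ij(1)]], where S = "{ys j<..<ys (Suc j)}"])
      (use mid_in(1)[OF ij(1)] y in \<open>auto simp: UhD(2)[OF w ij] mid_def[symmetric]\<close>)
  then show "pdir False w (mid xs i, y) = vdy w i j"
    by (simp add: pdir_def DERIV_imp_deriv)
qed

lemma grad_horizontal:
  assumes w: "w \<in> Uh a1 b1 a2 b2 xs nx ys ny" and ij: "i < nx" "j < ny" and x: "xs i < x" "x < xs (Suc i)"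
  shows "pdir False w (x, mid ys j) = hdx w i j x"
    "pdir True w (x, mid ys j) = hdy w i j"
proof -
  have wb: "w (s, t) = bilin (%y x. w (x, y)) (ys j) (ys (Suc j)) (xs i) (xs (Suc i)) t s" if "s \<in> {xs i..xs (Suc i)}" "t \<in> {ys j..ys (Suc j)}" for s t
    using UhD(2)[OF w ij that] bilin_flip[of "%x y. w (x, y)"] by simp
  have "((%t. w (x, t)) has_real_derivative hdx w i j x) (at (mid ys j))"
    by (rule has_field_derivative_transform_within_open[OF bilin_DERIV_x, where S = "{ys j<..<ys (Suc j)}"])
      (use mid_in(2)[OF ij(2)] x in \<open>auto simp: wb\<close>)
  then show "pdir False w (x, mid ys j) = hdx w i j x"
    by (simp add: pdir_def DERIV_imp_deriv)
  have "((%t. w (t, mid ys j)) has_real_derivative hdy w i j) (at x)"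
    by (rule has_field_derivative_transform_within_open[OF bilin_DERIV_y_mid[OF ys_step[OF ij(2)]], where S = "{xs i<..<xs (Suc i)}"])
      (use mid_in(2)[OF ij(2)] x in \<open>auto simp: wb mid_def[symmetric]\<close>)
  then show "pdir True w (x, mid ys j) = hdy w i j"
    by (simp add: pdir_def DERIV_imp_deriv)
qed

end

subsection \<open>The dual partition\<close>

lemma LINT_split_x:
  fixes f :: "real \<times> real => real"
  assumes f: "integrable lborel f" and m: "a <= m" "m <= b"
  shows "(LINT x:cbox (a, c) (b, d)|lborel. f x) = (LINT x:cbox (a, c) (m, d)|lborel. f x) + (LINT x:cbox (m, c) (b, d)|lborel. f x)"
proof -
  have [measurable]: "f \<in> borel_measurable lborel" using f by auto
  have i: "integrable lborel (%x. indicator (cbox p q) x *\<^sub>R f x)" for p q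
    by (rule integrable_mult_indicator[OF _ f]) simp
  have "(LINT x:cbox (a, c) (b, d)|lborel. f x) = (\<integral>x. indicator (cbox (a, c) (m, d)) x *\<^sub>R f x + indicator (cbox (m, c) (b, d)) x *\<^sub>R f x \<partial>lborel)"
    unfolding set_lebesgue_integral_def
  proof (rule integral_cong_AE)
    show "AE x in lborel. indicator (cbox (a, c) (b, d)) x *\<^sub>R f x = indicator (cbox (a, c) (m, d)) x *\<^sub>R f x + indicator (cbox (m, c) (b, d)) x *\<^sub>R f x"
      using AE_off_lines(1)[of m]
    proof eventually_elim
      case (elim x)
      then show ?case using m by (cases x) (auto simp: cbox_Pair_real indicator_def)
    qed
  qed measurable
  also have "\<dots> = (LINT x:cbox (a, c) (m, d)|lborel. f x) + (LINT x:cbox (m, c) (b, d)|lborel. f x)"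
    unfolding set_lebesgue_integral_def by (rule Bochner_Integration.integral_add[OF i i])
  finally show ?thesis .
qed

lemma LINT_split_y:
  fixes f :: "real \<times> real => real"
  assumes f: "integrable lborel f" and m: "c <= m" "m <= d"
  shows "(LINT x:cbox (a, c) (b, d)|lborel. f x) = (LINT x:cbox (a, c) (b, m)|lborel. f x) + (LINT x:cbox (a, m) (b, d)|lborel. f x)"
proof -
  have [measurable]: "f \<in> borel_measurable lborel" using f by auto
  have i: "integrable lborel (%x. indicator (cbox p q) x *\<^sub>R f x)" for p q
    by (rule integrable_mult_indicator[OF _ f]) simp
  have "(LINT x:cbox (a, c) (b, d)|lborel. f x) = (\<integral>x. indicator (cbox (a, c) (b, m)) x *\<^sub>R f x + indicator (cbox (a, m) (b, d)) x *\<^sub>R f x \<partial>lborel)"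
    unfolding set_lebesgue_integral_def
  proof (rule integral_cong_AE)
    show "AE x in lborel. indicator (cbox (a, c) (b, d)) x *\<^sub>R f x = indicator (cbox (a, c) (b, m)) x *\<^sub>R f x + indicator (cbox (a, m) (b, d)) x *\<^sub>R f x"
      using AE_off_lines(2)[of m]
    proof eventually_elim
      case (elim x)
      then show ?case using m by (cases x) (auto simp: cbox_Pair_real indicator_def)
    qed
  qed measurable
  also have "\<dots> = (LINT x:cbox (a, c) (b, m)|lborel. f x) + (LINT x:cbox (a, m) (b, d)|lborel. f x)"
    unfolding set_lebesgue_integral_def by (rule Bochner_Integration.integral_add[OF i i])
  finally show ?thesis .
qed

lemma LINT_degenerate:
  "(LINT x:cbox (a, c) (a, d)|lborel. f x) = (0::real)" "(LINT x:cbox (a, c) (b, c)|lborel. f x) = (0::real)" for a b c d :: real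
proof -
  have "AE x in lborel. indicator (cbox (a, c) (a, d)) x *\<^sub>R f x = 0"
    using AE_off_lines(1)[of a]
  proof eventually_elim
    case (elim x) then show ?case by (cases x) (auto simp: cbox_Pair_real indicator_def)
  qed
  then show "(LINT x:cbox (a, c) (a, d)|lborel. f x) = 0"
    unfolding set_lebesgue_integral_def by (rule integral_eq_zero_AE)
  have "AE x in lborel. indicator (cbox (a, c) (b, c)) x *\<^sub>R f x = 0"
    using AE_off_lines(2)[of c]
  proof eventually_elim
    case (elim x) then show ?case by (cases x) (auto simp: cbox_Pair_real indicator_def)
  qed
  then show "(LINT x:cbox (a, c) (b, c)|lborel. f x) = 0"
    unfolding set_lebesgue_integral_def by (rule integral_eq_zero_AE)
qed

lemma chain_le:
  fixes t :: "nat => real"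
  shows "(!!j. j < m ==> t j <= t (Suc j)) ==> t 0 <= t m"
proof (induction m)
  case (Suc m)
  then have "t 0 <= t m" "t m <= t (Suc m)" by auto
  then show ?case by (rule order_trans)
qed simp

lemma LINT_grid:
  fixes f :: "real \<times> real => real"
  assumes f: "integrable lborel f" and s: "!!i. i < n ==> s i <= s (Suc i)" and t: "!!j. j < m ==> t j <= t (Suc j)"
  shows "(\<Sum>i<n. \<Sum>j<m. LINT x:cbox (s i, t j) (s (Suc i), t (Suc j))|lborel. f x) = (LINT x:cbox (s 0, t 0) (s n, t m)|lborel. f x)"
proof -
  have row: "(\<Sum>j<m. LINT x:cbox (p, t j) (q, t (Suc j))|lborel. f x) = (LINT x:cbox (p, t 0) (q, t m)|lborel. f x)" for p q
    using t
  proof (induction m)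
    case 0 then show ?case by (simp add: LINT_degenerate)
  next
    case (Suc m)
    have "t 0 <= t m" using Suc.prems by (intro chain_le) auto
    then show ?case using Suc LINT_split_y[OF f, of "t 0" "t m" "t (Suc m)" p q] by simp
  qed
  show ?thesis unfolding row using s
  proof (induction n)
    case 0 then show ?case by (simp add: LINT_degenerate)
  next
    case (Suc n)
    have "s 0 <= s n" using Suc.prems by (intro chain_le) auto
    then show ?case using Suc LINT_split_x[OF f, of "s 0" "s n" "s (Suc n)"] by simp
  qed
qed

lemma ctrl_interval_node:
  fixes s :: "nat => real"
  assumes mono: "!!i j. i < j ==> j <= n ==> s i < s j" and "i <= n" "k <= n"
  shows "s i \<in> {lo s k..hi s n k} \<longleftrightarrow> k = i"
proof -
  have lk: "s (k - 1) < lo s k" if "k > 0" using mono[of "k - 1" k] that assms(3) by (auto simp: lo_def)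
  have hk: "hi s n k < s (Suc k)" if "k < n" using mono[of k "Suc k"] that by (auto simp: hi_def)
  have in_k: "lo s k <= s k" "s k <= hi s n k"
    using mono[of "k - 1" k] mono[of k "Suc k"] assms(3) by (auto simp: lo_def hi_def)
  consider "i < k" | "i = k" | "k < i" by linarith
  then show ?thesis
  proof cases
    case 1
    have "i = k - 1 \<or> i < k - 1" using 1 by linarith
    then have "s i <= s (k - 1)" using mono[of i "k - 1"] assms(3) by (auto intro: less_imp_le)
    then show ?thesis using lk 1 by auto
  next
    case 3
    have "s (Suc k) <= s i" using mono[of "Suc k" i] 3 assms(2) by (cases "i = Suc k") auto
    then show ?thesis using hk 3 assms(2) by auto
  qed (use in_k in auto)
qed

lemma ctrl_interval_cell:
  fixes s :: "nat => real"
  assumes mono: "!!i j. i < j ==> j <= n ==> s i < s j" and "i < n" "k <= n" and x: "s i < x" "x < s (Suc i)" "x \<noteq> mid s i"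
  shows "x \<in> {lo s k..hi s n k} \<longleftrightarrow> k = (if x < mid s i then i else Suc i)"
proof -
  consider "k < i" | "k = i" | "k = Suc i" | "Suc i < k" by linarith
  then show ?thesis
  proof cases
    case 1
    have "hi s n k <= s (Suc k)" using mono[of k "Suc k"] 1 assms(2) by (auto simp: hi_def)
    moreover have "s (Suc k) <= s i" using mono[of "Suc k" i] 1 assms(2) by (cases "i = Suc k") auto
    ultimately show ?thesis using 1 x by auto
  next
    case 2
    have "lo s i <= s i" using mono[of "i - 1" i] assms(2) by (auto simp: lo_def)
    moreover have "hi s n i = mid s i" using assms(2) by (simp add: hi_def mid_def)
    ultimately show ?thesis using 2 x by auto
  next
    case 3
    have "s (Suc i) <= hi s n (Suc i)" using mono[of "Suc i" "Suc (Suc i)"] 3 assms(3) by (auto simp: hi_def)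
    moreover have "lo s (Suc i) = mid s i" by (simp add: lo_def mid_def)
    ultimately show ?thesis using 3 x by auto
  next
    case 4
    have "s (k - 1) <= lo s k" using mono[of "k - 1" k] 4 assms(3) by (auto simp: lo_def)
    moreover have "Suc i = k - 1 \<or> Suc i < k - 1" using 4 by linarith
    then have "s (Suc i) <= s (k - 1)" using mono[of "Suc i" "k - 1"] assms(3) by (auto intro: less_imp_le)
    ultimately show ?thesis using 4 x by auto
  qed
qed

text \<open>The n + 2 points that bound the n + 1 control intervals, namely both ends and the n
  midpoints. In this form the control volumes are the cells of a grid.\<close>

definition dual_grid :: "(nat => real) => nat => nat => real" where
  "dual_grid s n k = (if k = 0 then s 0 else if k <= n then mid s (k - 1) else s n)"

lemma dual_grid:
  fixes s :: "nat => real"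
  assumes mono: "!!i j. i < j ==> j <= n ==> s i < s j" and "0 < n" "k < Suc n"
  shows "lo s k = dual_grid s n k" "hi s n k = dual_grid s n (Suc k)" "dual_grid s n k <= dual_grid s n (Suc k)"
proof -
  show l: "lo s k = dual_grid s n k" and h: "hi s n k = dual_grid s n (Suc k)"
    using assms by (auto simp: lo_def hi_def dual_grid_def mid_def)
  have "lo s k <= s k" "s k <= hi s n k"
    using mono[of "k - 1" k] mono[of k "Suc k"] assms(3) by (auto simp: lo_def hi_def)
  then show "dual_grid s n k <= dual_grid s n (Suc k)" using l h by simp
qed

context mesh
begin

abbreviation "V\<^sub>N w \<equiv> nodal w xs nx ys ny"

lemma nodal_0: "V\<^sub>N w i 0 = 0 \<and> V\<^sub>N w i ny = 0 \<and> V\<^sub>N w 0 j = 0 \<and> V\<^sub>N w nx j = 0"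
  by (simp add: nodal_def)

lemma ab: "a1 < b1" "a2 < b2" using xs_mono[of 0 nx] ys_mono[of 0 ny] n_pos ends by auto

lemma Pistar_eq:
  assumes v: "v \<in> Uh a1 b1 a2 b2 xs nx ys ny"
  shows "Pistar xs nx ys ny v x = (\<Sum>i\<le>nx. \<Sum>j\<le>ny. V\<^sub>N v i j * indicator (ctrl_vol xs nx ys ny (i, j)) x)"
  unfolding Pistar_def node_idx_def sum.cartesian_product node_def
  by (intro sum.cong) (use UhD(4)[OF v] in auto)

lemma sum_delta2:
  fixes F :: "nat => nat => real"
  assumes "k <= nx" "l <= ny" "!!i j. i <= nx ==> j <= ny ==> G i j = (if i = k \<and> j = l then F k l else 0)"
  shows "(\<Sum>i\<le>nx. \<Sum>j\<le>ny. G i j) = F k l"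
proof -
  have "(\<Sum>i\<le>nx. \<Sum>j\<le>ny. G i j) = (\<Sum>i\<le>nx. if i = k then F k l else 0)"
  proof (rule sum.cong[OF refl])
    fix i assume "i \<in> {..nx}"
    then have "(\<Sum>j\<le>ny. G i j) = (\<Sum>j\<le>ny. if j = l then (if i = k then F k l else 0) else 0)"
      by (intro sum.cong) (use assms(3) in auto)
    then show "(\<Sum>j\<le>ny. G i j) = (if i = k then F k l else 0)" using assms(2) by simp
  qed
  then show ?thesis using assms(1) by simp
qed

lemma Pistar_node:
  assumes v: "v \<in> Uh a1 b1 a2 b2 xs nx ys ny" and ij: "i <= nx" "j <= ny"
  shows "Pistar xs nx ys ny v (xs i, ys j) = V\<^sub>N v i j"
  unfolding Pistar_eq[OF v]
  by (rule sum_delta2[OF ij])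
    (use ctrl_interval_node[where s = xs, OF xs_mono ij(1)] ctrl_interval_node[where s = ys, OF ys_mono ij(2)] in \<open>auto simp: ctrl_vol_def indicator_def\<close>)

text \<open>The control volumes are closed and overlap along dual edges, where \<open>Pistar\<close>
  adds several nodal values. Off the two midlines an interior point of the cell lies in exactly one
  of them, that of a corner.\<close>

lemma Pistar_cell:
  assumes v: "v \<in> Uh a1 b1 a2 b2 xs nx ys ny" and ij: "i < nx" "j < ny"
    and x: "xs i < x" "x < xs (Suc i)" "x \<noteq> mid xs i" and y: "ys j < y" "y < ys (Suc j)" "y \<noteq> mid ys j"
  obtains k l where "k = i \<or> k = Suc i" "l = j \<or> l = Suc j" "Pistar xs nx ys ny v (x, y) = V\<^sub>N v k l"
proof -
  define k l where "k = (if x < mid xs i then i else Suc i)" and "l = (if y < mid ys j then j else Suc j)"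
  have kl: "k <= nx" "l <= ny" using ij by (auto simp: k_def l_def)
  have "Pistar xs nx ys ny v (x, y) = V\<^sub>N v k l"
    unfolding Pistar_eq[OF v]
  proof (rule sum_delta2[OF kl])
    fix i' j' assume i': "i' <= nx" and j': "j' <= ny"
    have "x \<in> {lo xs i'..hi xs nx i'} \<longleftrightarrow> i' = k" unfolding k_def by (rule ctrl_interval_cell[OF xs_mono ij(1) i' x])
    moreover have "y \<in> {lo ys j'..hi ys ny j'} \<longleftrightarrow> j' = l" unfolding l_def by (rule ctrl_interval_cell[OF ys_mono ij(2) j' y])
    ultimately show "V\<^sub>N v i' j' * indicator (ctrl_vol xs nx ys ny (i', j')) (x, y) = (if i' = k \<and> j' = l then V\<^sub>N v k l else 0)"
      unfolding ctrl_vol_def indicator_def fst_conv snd_conv mem_Times_iff by simp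
  qed
  then show ?thesis by (intro that[of k l]) (auto simp: k_def l_def)
qed

lemma ctrl_inner:
  assumes "0 < i" "i < nx" "0 < j" "j < ny"
  shows "a1 < lo xs i" "lo xs i <= hi xs nx i" "hi xs nx i < b1" "a2 < lo ys j" "lo ys j <= hi ys ny j" "hi ys ny j < b2"
proof -
  obtain i' j' where s: "i = Suc i'" "j = Suc j'" using assms by (meson gr0_conv_Suc)
  have e: "lo xs i = mid xs i'" "hi xs nx i = mid xs i" "lo ys j = mid ys j'" "hi ys ny j = mid ys j"
    using assms by (auto simp: lo_def hi_def mid_def s)
  have "i' < nx" "j' < ny" using assms s by auto
  then show "a1 < lo xs i" "lo xs i <= hi xs nx i" "hi xs nx i < b1" "a2 < lo ys j" "lo ys j <= hi ys ny j" "hi ys ny j < b2"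
    unfolding e using mid_in'(1)[of i'] mid_in'(2)[of j'] mid_in'(1)[of i] mid_in'(2)[of j] mid_in(1)[of i'] mid_in(2)[of j'] mid_in(1)[of i] mid_in(2)[of j] assms
    by (auto simp: s)
qed

text \<open>A nonzero nodal value belongs to an inner node, whose control volume keeps a distance
  from the boundary. The divergence theorem is needed on these control volumes alone.\<close>

lemma ctrl_inner_sub:
  assumes "V\<^sub>N v i j \<noteq> 0" shows "ctrl_vol xs nx ys ny (i, j) \<subseteq> box (a1, a2) (b1, b2)"
proof -
  have "0 < i" "i < nx" "0 < j" "j < ny" using assms by (auto simp: nodal_def split: if_splits)
  from ctrl_inner[OF this] show ?thesis by (auto simp: ctrl_vol_def box_Pair_real)
qed

lemma Pistar_outside:
  assumes v: "v \<in> Uh a1 b1 a2 b2 xs nx ys ny" and "x \<notin> box (a1, a2) (b1, b2)"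
  shows "Pistar xs nx ys ny v x = 0"
  unfolding Pistar_eq[OF v]
proof (intro sum.neutral ballI)
  fix i j
  show "V\<^sub>N v i j * indicator (ctrl_vol xs nx ys ny (i, j)) x = 0"
    using ctrl_inner_sub[of v i j] assms(2) by (cases "V\<^sub>N v i j = 0") (auto simp: indicator_def)
qed

lemma Pistar_meas: "Pistar xs nx ys ny v \<in> borel_measurable borel"
proof -
  have [measurable]: "ctrl_vol xs nx ys ny P \<in> sets borel" for P
    unfolding ctrl_vol_def by (simp add: borel_closed closed_Times)
  show ?thesis unfolding Pistar_def[abs_def] by measurable
qed

lemma LINT_Pistar:
  assumes v: "v \<in> Uh a1 b1 a2 b2 xs nx ys ny" and g: "set_integrable lborel (box (a1, a2) (b1, b2)) g"
  shows "(LINT x:box (a1, a2) (b1, b2)|lborel. g x * Pistar xs nx ys ny v x)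
    = (\<Sum>i\<le>nx. \<Sum>j\<le>ny. V\<^sub>N v i j * (LINT x:ctrl_vol xs nx ys ny (i, j)|lborel. g x))"
proof -
  let ?\<Omega> = "box (a1, a2) (b1, b2)"
  have ci: "integrable lborel (%x. V\<^sub>N v i j * (indicator (ctrl_vol xs nx ys ny (i, j)) x *\<^sub>R g x))" for i j
  proof (cases "V\<^sub>N v i j = 0")
    case False
    have "set_integrable lborel (ctrl_vol xs nx ys ny (i, j)) g"
      by (rule set_integrable_subset[OF g _ ctrl_inner_sub[OF False]]) (simp add: ctrl_vol_def borel_closed closed_Times)
    then show ?thesis by (intro integrable_mult_right) (simp add: set_integrable_def)
  qed simp
  have "(LINT x:?\<Omega>|lborel. g x * Pistar xs nx ys ny v x)
     = (\<integral>x. (\<Sum>i\<le>nx. \<Sum>j\<le>ny. V\<^sub>N v i j * (indicator (ctrl_vol xs nx ys ny (i, j)) x *\<^sub>R g x)) \<partial>lborel)"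
    unfolding set_lebesgue_integral_def
  proof (rule Bochner_Integration.integral_cong[OF refl])
    fix x
    have "indicator ?\<Omega> x *\<^sub>R (g x * Pistar xs nx ys ny v x) = g x * Pistar xs nx ys ny v x"
      using Pistar_outside[OF v, of x] by (cases "x \<in> ?\<Omega>") auto
    also have "\<dots> = (\<Sum>i\<le>nx. \<Sum>j\<le>ny. V\<^sub>N v i j * (indicator (ctrl_vol xs nx ys ny (i, j)) x *\<^sub>R g x))"
      unfolding Pistar_eq[OF v] sum_distrib_left by (simp add: mult_ac)
    finally show "indicator ?\<Omega> x *\<^sub>R (g x * Pistar xs nx ys ny v x) = (\<Sum>i\<le>nx. \<Sum>j\<le>ny. V\<^sub>N v i j * (indicator (ctrl_vol xs nx ys ny (i, j)) x *\<^sub>R g x))" .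
  qed
  also have "\<dots> = (\<Sum>i\<le>nx. \<Sum>j\<le>ny. V\<^sub>N v i j * (LINT x:ctrl_vol xs nx ys ny (i, j)|lborel. g x))"
    using ci by (simp add: set_lebesgue_integral_def)
  finally show ?thesis .
qed

lemma LINT_ctrl_vols:
  fixes f :: "real \<times> real => real"
  assumes "integrable lborel f"
  shows "(\<Sum>i\<le>nx. \<Sum>j\<le>ny. LINT x:ctrl_vol xs nx ys ny (i, j)|lborel. f x) = (LINT x:cbox (a1, a2) (b1, b2)|lborel. f x)"
proof -
  have "ctrl_vol xs nx ys ny (i, j) = cbox (dual_grid xs nx i, dual_grid ys ny j) (dual_grid xs nx (Suc i), dual_grid ys ny (Suc j))"
    if "i < Suc nx" "j < Suc ny" for i j
    unfolding ctrl_vol_def cbox_Pair_real fst_conv snd_conv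
    using dual_grid(1,2)[OF xs_mono n_pos(1) that(1)] dual_grid(1,2)[OF ys_mono n_pos(2) that(2)] by simp
  then have "(\<Sum>i\<le>nx. \<Sum>j\<le>ny. LINT x:ctrl_vol xs nx ys ny (i, j)|lborel. f x)
     = (\<Sum>i<Suc nx. \<Sum>j<Suc ny. LINT x:cbox (dual_grid xs nx i, dual_grid ys ny j) (dual_grid xs nx (Suc i), dual_grid ys ny (Suc j))|lborel. f x)"
    unfolding lessThan_Suc_atMost by (intro sum.cong) auto
  also have "\<dots> = (LINT x:cbox (dual_grid xs nx 0, dual_grid ys ny 0) (dual_grid xs nx (Suc nx), dual_grid ys ny (Suc ny))|lborel. f x)"
    by (rule LINT_grid[OF assms]) (use dual_grid(3)[OF xs_mono n_pos(1)] dual_grid(3)[OF ys_mono n_pos(2)] in auto)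
  finally show ?thesis by (simp add: dual_grid_def ends)
qed

lemma LINT_cells:
  fixes f :: "real \<times> real => real"
  assumes "integrable lborel f"
  shows "(\<Sum>i<nx. \<Sum>j<ny. LINT x:elt i j|lborel. f x) = (LINT x:cbox (a1, a2) (b1, b2)|lborel. f x)"
  using LINT_grid[OF assms, of nx xs ny ys] xs_step ys_step by (simp add: ends less_imp_le)

definition esq :: "(nat => nat => real) => nat => nat => real" where
  "esq W i j = (W (Suc i) j - W i j)\<^sup>2 + (W (Suc i) (Suc j) - W i (Suc j))\<^sup>2
     + (W i (Suc j) - W i j)\<^sup>2 + (W (Suc i) (Suc j) - W (Suc i) j)\<^sup>2"

text \<open>A discrete H1 seminorm squared: hx hy (d/hx)^2 is d^2 up to the aspect ratio, so no
  weights are needed in two dimensions.\<close>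

definition energy :: "(nat => nat => real) => real" where
  "energy W = (\<Sum>i<nx. \<Sum>j<ny. esq W i j)"

lemma esq_nonneg: "esq W i j >= 0" by (simp add: esq_def)

lemma edges_sq: "(edges W i j)\<^sup>2 <= 4 * esq W i j"
proof -
  have "(\<bar>a\<bar> + \<bar>b\<bar> + \<bar>c\<bar> + \<bar>d\<bar>)\<^sup>2 <= 4 * (a\<^sup>2 + b\<^sup>2 + c\<^sup>2 + d\<^sup>2)" for a b c d :: real
  proof -
    have "4 * (\<bar>a\<bar>\<^sup>2 + \<bar>b\<bar>\<^sup>2 + \<bar>c\<bar>\<^sup>2 + \<bar>d\<bar>\<^sup>2) - (\<bar>a\<bar> + \<bar>b\<bar> + \<bar>c\<bar> + \<bar>d\<bar>)\<^sup>2
      = (\<bar>a\<bar> - \<bar>b\<bar>)\<^sup>2 + (\<bar>a\<bar> - \<bar>c\<bar>)\<^sup>2 + (\<bar>a\<bar> - \<bar>d\<bar>)\<^sup>2 + (\<bar>b\<bar> - \<bar>c\<bar>)\<^sup>2 + (\<bar>b\<bar> - \<bar>d\<bar>)\<^sup>2 + (\<bar>c\<bar> - \<bar>d\<bar>)\<^sup>2"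
      by (simp add: power2_eq_square algebra_simps)
    moreover have "\<dots> >= 0" by simp
    ultimately show ?thesis unfolding power2_abs by linarith
  qed
  then show ?thesis by (simp add: edges_def esq_def)
qed

lemma edges_nonneg: "edges W i j >= 0" by (simp add: edges_def)

text \<open>A bilinear function is a convex combination of its corner values, and any two corners
  are joined by edges of the cell.\<close>

lemma cell_corner_diff:
  assumes w: "w \<in> Uh a1 b1 a2 b2 xs nx ys ny" and ij: "i < nx" "j < ny"
    and x: "x \<in> {xs i..xs (Suc i)}" and y: "y \<in> {ys j..ys (Suc j)}" and kl: "k = i \<or> k = Suc i" "l = j \<or> l = Suc j"
  shows "\<bar>w (x, y) - V\<^sub>N w k l\<bar> <= edges (V\<^sub>N w) i j"
proof -
  let ?W = "V\<^sub>N w"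
  have conv: "\<bar>(P * (b - t) + Q * (t - a)) / (b - a) - c\<bar> <= E" if "\<bar>P - c\<bar> <= E" "\<bar>Q - c\<bar> <= E" "a < b" "t \<in> {a..b}" for P Q a b t c E :: real
  proof -
    have "\<bar>(P - c) * (b - t) + (Q - c) * (t - a)\<bar> <= \<bar>P - c\<bar> * (b - t) + \<bar>Q - c\<bar> * (t - a)"
      using that(4) by (intro order_trans[OF abs_triangle_ineq]) (auto simp: abs_mult)
    also have "\<dots> <= E * (b - t) + E * (t - a)" using that by (intro add_mono mult_right_mono) auto
    also have "\<dots> = E * (b - a)" by (simp add: algebra_simps)
    finally have "\<bar>((P - c) * (b - t) + (Q - c) * (t - a)) / (b - a)\<bar> <= E" using that(3) by (simp add: abs_divide divide_le_eq)
    moreover have "((P - c) * (b - t) + (Q - c) * (t - a)) / (b - a) = (P * (b - t) + Q * (t - a)) / (b - a) - c"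
    proof -
      have "(P - c) * (b - t) + (Q - c) * (t - a) = (P * (b - t) + Q * (t - a)) - c * (b - a)" by (simp add: algebra_simps)
      then show ?thesis using that(3) by (simp add: diff_divide_distrib)
    qed
    ultimately show ?thesis by simp
  qed
  have c: "\<bar>?W k' l' - ?W k l\<bar> <= edges ?W i j" if "k' = i \<or> k' = Suc i" "l' = j \<or> l' = Suc j" for k' l'
    using that kl unfolding edges_def by auto
  have n: "w (xs i, ys j) = ?W i j" "w (xs (Suc i), ys j) = ?W (Suc i) j" "w (xs i, ys (Suc j)) = ?W i (Suc j)" "w (xs (Suc i), ys (Suc j)) = ?W (Suc i) (Suc j)"
    using UhD(4)[OF w] ij by auto
  show ?thesis
    unfolding UhD(2)[OF w ij x y] bilin_def n
    by (intro conv c xs_step ys_step ij x y) auto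
qed

end

lemma LINT_box_cbox: "(LINT x:cbox a b|lborel. indicator (box a b) x *\<^sub>R f x) = (LINT x:box a b|lborel. (f x :: real))"
  unfolding set_lebesgue_integral_def using box_subset_cbox[of a b]
  by (intro Bochner_Integration.integral_cong) (auto simp: indicator_def)

lemma LINT_cell_upper:
  fixes f :: "real \<times> real => real"
  assumes f: "integrable lborel f" and K: "AE x in lborel. x \<in> cbox (l1, l2) (r1, r2) --> f x <= K" and lr: "l1 <= r1" "l2 <= r2"
  shows "(LINT x:cbox (l1, l2) (r1, r2)|lborel. f x) <= K * ((r1 - l1) * (r2 - l2))"
proof -
  let ?K = "cbox (l1, l2) (r1, r2)"
  have "(LINT x:?K|lborel. f x) <= (\<integral>x. K * indicator ?K x \<partial>lborel)"
    unfolding set_lebesgue_integral_def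
  proof (rule integral_mono_AE)
    show "integrable lborel (%x. indicator ?K x *\<^sub>R f x)" by (rule integrable_mult_indicator[OF _ f]) simp
    show "integrable lborel (%x. K * indicator ?K x)" by (intro integrable_mult_right integrable_indicator_boxes)
    show "AE x in lborel. indicator ?K x *\<^sub>R f x <= K * indicator ?K x"
      using K by eventually_elim (auto simp: indicator_def)
  qed
  also have "\<dots> = K * measure lborel ?K" by simp
  also have "measure lborel ?K = (r1 - l1) * (r2 - l2)" using lr by (simp add: content_Pair)
  finally show ?thesis .
qed

lemma LINT_cell_lower:
  fixes f :: "real \<times> real => real"
  assumes f: "integrable lborel f" and K: "AE x in lborel. x \<in> cbox (l1, l2) (r1, r2) --> - K <= f x" and lr: "l1 <= r1" "l2 <= r2"
  shows "- (K * ((r1 - l1) * (r2 - l2))) <= (LINT x:cbox (l1, l2) (r1, r2)|lborel. f x)"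
proof -
  have "(LINT x:cbox (l1, l2) (r1, r2)|lborel. - f x) <= K * ((r1 - l1) * (r2 - l2))"
    by (rule LINT_cell_upper) (use f K lr in \<open>auto elim: eventually_mono\<close>)
  then show ?thesis by (simp add: set_lebesgue_integral_def)
qed

context mesh
begin

abbreviation "\<Omega> \<equiv> box (a1, a2) (b1, b2)"
abbreviation "UU \<equiv> Uh a1 b1 a2 b2 xs nx ys ny"

lemma flux_sum_dual:
  assumes g1: "!!i j. i < nx ==> j < ny ==> g1 (mid xs i) integrable_on {ys j..ys (Suc j)}"
    and g2: "!!i j. i < nx ==> j < ny ==> g2 (mid ys j) integrable_on {xs i..xs (Suc i)}"
  shows "(\<Sum>i\<le>nx. \<Sum>j\<le>ny. - (circulation g1 g2 i j) * V\<^sub>N v i j)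
    = flux_sum g1 xs nx ys ny (V\<^sub>N v) + flux_sum g2 ys ny xs nx (%j i. V\<^sub>N v i j)"
proof -
  have 1: "(\<Sum>i\<le>nx. \<Sum>j\<le>ny. - (integral {lo ys j..hi ys ny j} (g1 (hi xs nx i)) - integral {lo ys j..hi ys ny j} (g1 (lo xs i))) * V\<^sub>N v i j)
    = flux_sum g1 xs nx ys ny (V\<^sub>N v)"
    by (rule flux_sum_nodes) (use nodal_0 ys_step g1 in auto)
  have 2: "(\<Sum>j\<le>ny. \<Sum>i\<le>nx. - (integral {lo xs i..hi xs nx i} (g2 (hi ys ny j)) - integral {lo xs i..hi xs nx i} (g2 (lo ys j))) * V\<^sub>N v i j)
    = flux_sum g2 ys ny xs nx (%j i. V\<^sub>N v i j)"
    by (rule flux_sum_nodes) (use nodal_0 xs_step g2 in auto)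
  show ?thesis unfolding 1[symmetric] 2[symmetric]
    by (subst (3) sum.swap) (simp add: sum.distrib[symmetric] algebra_simps)
qed

text \<open>Telescoping along a row from the zero boundary value, with Cauchy-Schwarz, bounds each
  squared nodal value by nx times the squared differences of the row. The factor nx is absorbed by
  the height of the row, and the sum of the widths gives the second factor b1 - a1.\<close>

lemma poincare:
  "(\<Sum>i<nx. \<Sum>j<ny. (xs (Suc i) - xs i) * (ys (Suc j) - ys j) *
      (corners (V\<^sub>N w) i j)\<^sup>2)
   <= 8 * \<gamma> * (b1 - a1)\<^sup>2 * energy (V\<^sub>N w)"
proof -
  let ?W = "V\<^sub>N w"
  define S where "S l = (\<Sum>i<nx. (?W (Suc i) l - ?W i l)\<^sup>2)" for l
  define E where "E j = (\<Sum>i<nx. esq ?W i j)" for j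
  have hp: "xs (Suc i) - xs i > 0" if "i < nx" for i using xs_step[OF that] by simp
  have hq: "ys (Suc j) - ys j > 0" if "j < ny" for j using ys_step[OF that] by simp
  have 1: "(?W k l)\<^sup>2 <= real nx * S l" if "k <= nx" for k l
  proof -
    have "(\<Sum>i<k. ?W (Suc i) l - ?W i l) = ?W k l - ?W 0 l" by (rule sum_lessThan_telescope[of "%i. ?W i l"])
    moreover have "?W 0 l = 0" by (simp add: nodal_def)
    ultimately have "?W k l = (\<Sum>i<k. ?W (Suc i) l - ?W i l)" by simp
    then have "(?W k l)\<^sup>2 <= (\<Sum>i<k. (?W (Suc i) l - ?W i l)\<^sup>2) * real k"
      using sum_squared_le_sum_of_squares[of "%i. ?W (Suc i) l - ?W i l" "{..<k}"] by simp
    also have "\<dots> <= S l * real nx"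
      unfolding S_def using that by (intro mult_mono sum_mono2) (auto intro: sum_nonneg)
    finally show ?thesis by (simp add: mult.commute)
  qed
  have SE: "S j + S (Suc j) <= E j" for j
    unfolding S_def E_def sum.distrib[symmetric] by (intro sum_mono) (simp add: esq_def)
  have E0: "E j >= 0" for j unfolding E_def by (intro sum_nonneg esq_nonneg)
  have vm: "(corners ?W i j)\<^sup>2 <= 8 * real nx * E j" if "i < nx" for i j
  proof -
    have "(\<bar>a\<bar> + \<bar>b\<bar> + \<bar>c\<bar> + \<bar>d\<bar>)\<^sup>2 <= 4 * (a\<^sup>2 + b\<^sup>2 + c\<^sup>2 + d\<^sup>2)" for a b c d :: real
    proof -
      have "4 * (\<bar>a\<bar>\<^sup>2 + \<bar>b\<bar>\<^sup>2 + \<bar>c\<bar>\<^sup>2 + \<bar>d\<bar>\<^sup>2) - (\<bar>a\<bar> + \<bar>b\<bar> + \<bar>c\<bar> + \<bar>d\<bar>)\<^sup>2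
        = (\<bar>a\<bar> - \<bar>b\<bar>)\<^sup>2 + (\<bar>a\<bar> - \<bar>c\<bar>)\<^sup>2 + (\<bar>a\<bar> - \<bar>d\<bar>)\<^sup>2 + (\<bar>b\<bar> - \<bar>c\<bar>)\<^sup>2 + (\<bar>b\<bar> - \<bar>d\<bar>)\<^sup>2 + (\<bar>c\<bar> - \<bar>d\<bar>)\<^sup>2"
        by (simp add: power2_eq_square algebra_simps)
      moreover have "\<dots> >= 0" by simp
      ultimately show ?thesis unfolding power2_abs by linarith
    qed
    then have "(corners ?W i j)\<^sup>2
       <= 4 * ((?W i j)\<^sup>2 + (?W (Suc i) j)\<^sup>2 + (?W i (Suc j))\<^sup>2 + (?W (Suc i) (Suc j))\<^sup>2)" .
    also have "\<dots> <= 4 * (real nx * S j + real nx * S j + real nx * S (Suc j) + real nx * S (Suc j))"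
      using that by (intro mult_left_mono add_mono 1) auto
    also have "\<dots> = 8 * real nx * (S j + S (Suc j))" by (simp add: algebra_simps)
    also have "\<dots> <= 8 * real nx * E j" using SE by (intro mult_left_mono) auto
    finally show ?thesis .
  qed
  have tel: "(\<Sum>i<nx. xs (Suc i) - xs i) = b1 - a1" by (simp add: sum_lessThan_telescope ends)
  \<comment> \<open>The height of row j is at most \<gamma> times the width of every column; summing
    over the columns turns the widths into b1 - a1.\<close>
  have nh: "real nx * (ys (Suc j) - ys j) <= \<gamma> * (b1 - a1)" if "j < ny" for j
  proof -
    have "(\<Sum>i<nx. ys (Suc j) - ys j) <= (\<Sum>i<nx. \<gamma> * (xs (Suc i) - xs i))"
      by (intro sum_mono) (use ratio that in auto)
    then show ?thesis unfolding sum_distrib_left[symmetric] tel by simp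
  qed
  have "(\<Sum>i<nx. \<Sum>j<ny. (xs (Suc i) - xs i) * (ys (Suc j) - ys j) *
      (corners ?W i j)\<^sup>2)
    <= (\<Sum>i<nx. \<Sum>j<ny. (xs (Suc i) - xs i) * (8 * (\<gamma> * (b1 - a1)) * E j))"
  proof (intro sum_mono)
    fix i j assume "i \<in> {..<nx}" "j \<in> {..<ny}"
    then have ij: "i < nx" "j < ny" by auto
    have "(xs (Suc i) - xs i) * (ys (Suc j) - ys j) * (corners ?W i j)\<^sup>2
      <= (xs (Suc i) - xs i) * (ys (Suc j) - ys j) * (8 * real nx * E j)"
      using vm[OF ij(1)] hp[OF ij(1)] hq[OF ij(2)] by (intro mult_left_mono) auto
    also have "\<dots> = (xs (Suc i) - xs i) * (8 * (real nx * (ys (Suc j) - ys j)) * E j)" by (simp add: mult_ac)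
    also have "\<dots> <= (xs (Suc i) - xs i) * (8 * (\<gamma> * (b1 - a1)) * E j)"
      using nh[OF ij(2)] hp[OF ij(1)] E0 by (intro mult_left_mono mult_right_mono) auto
    finally show "(xs (Suc i) - xs i) * (ys (Suc j) - ys j) * (corners ?W i j)\<^sup>2 <= (xs (Suc i) - xs i) * (8 * (\<gamma> * (b1 - a1)) * E j)" .
  qed
  also have "\<dots> = (b1 - a1) * (8 * (\<gamma> * (b1 - a1)) * (\<Sum>j<ny. E j))"
    unfolding sum_distrib_left[symmetric] sum_distrib_right[symmetric] tel ..
  also have "(\<Sum>j<ny. E j) = energy ?W" unfolding E_def energy_def by (rule sum.swap)
  finally show ?thesis by (simp add: power2_eq_square mult_ac)
qed

lemma Uh_le_max:
  assumes w: "w \<in> UU" and ij: "i < nx" "j < ny" and x: "x \<in> {xs i..xs (Suc i)}" and y: "y \<in> {ys j..ys (Suc j)}"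
  shows "\<bar>w (x, y)\<bar> <= corners (V\<^sub>N w) i j"
proof -
  have conv: "\<bar>(P * (b - t) + Q * (t - a)) / (b - a)\<bar> <= E" if "\<bar>P\<bar> <= E" "\<bar>Q\<bar> <= E" "a < b" "t \<in> {a..b}" for P Q a b t E :: real
  proof -
    have "\<bar>P * (b - t) + Q * (t - a)\<bar> <= \<bar>P\<bar> * (b - t) + \<bar>Q\<bar> * (t - a)"
      using that(4) by (intro order_trans[OF abs_triangle_ineq]) (auto simp: abs_mult)
    also have "\<dots> <= E * (b - t) + E * (t - a)" using that by (intro add_mono mult_right_mono) auto
    also have "\<dots> = E * (b - a)" by (simp add: algebra_simps)
    finally show ?thesis using that(3) by (simp add: abs_divide divide_le_eq)
  qed
  have n: "w (xs i, ys j) = V\<^sub>N w i j" "w (xs (Suc i), ys j) = V\<^sub>N w (Suc i) j" "w (xs i, ys (Suc j)) = V\<^sub>N w i (Suc j)" "w (xs (Suc i), ys (Suc j)) = V\<^sub>N w (Suc i) (Suc j)"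
    using UhD(4)[OF w] ij by auto
  show ?thesis
    unfolding UhD(2)[OF w ij x y] bilin_def n
    by (intro conv xs_step ys_step ij x y) auto
qed

lemma cell_index:
  assumes "x \<in> {a1<..<b1}" "x \<notin> xs ` {..nx}"
  obtains i where "i < nx" "xs i < x" "x < xs (Suc i)"
proof -
  define i where "i = (LEAST k. x < xs k)"
  have ex: "x < xs nx" using assms ends by simp
  have 1: "x < xs i" unfolding i_def by (rule LeastI[of _ nx]) (rule ex)
  have 2: "i <= nx" unfolding i_def by (rule Least_le) (rule ex)
  have "i \<noteq> 0" using 1 assms ends by (metis greaterThanLessThan_iff less_asym)
  then obtain k where k: "i = Suc k" using not0_implies_Suc by blast
  have "\<not> x < xs k" using not_less_Least[of k "%k. x < xs k"] k by (simp add: i_def)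
  moreover have "x \<noteq> xs k" using assms(2) 2 k by auto
  ultimately show ?thesis using that[of k] 1 2 k by auto
qed

lemma flip_mesh: "mesh a2 b2 a1 b1 ys ny xs nx \<gamma>"
proof
  show "valid_mesh a2 b2 a1 b1 ys ny xs nx" using vm by (auto simp: valid_mesh_def)
  show "regular_mesh \<gamma> ys ny xs nx"
    using rm by (auto simp: regular_mesh_def hK_def rhoK_def add.commute min.commute)
qed

section \<open>The weak gradient and the H1 norm of trial functions\<close>

definition piece_x :: "(real \<times> real => real) => real \<times> real => real" where
  "piece_x w p = (\<Sum>i<nx. \<Sum>j<ny. indicator (elt0 i j) p
     * vdx w i j (snd p))"

definition piece_y :: "(real \<times> real => real) => real \<times> real => real" where
  "piece_y w p = (\<Sum>i<nx. \<Sum>j<ny. indicator (elt0 i j) p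
     * hdx w i j (fst p))"

lemma sum_cell_delta:
  fixes F :: "nat => nat => real"
  assumes ij: "i < nx" "j < ny" and x: "xs i < x" "x < xs (Suc i)" and y: "ys j < y" "y < ys (Suc j)"
  shows "(\<Sum>k<nx. \<Sum>l<ny. indicator (box (xs k, ys l) (xs (Suc k), ys (Suc l))) (x, y) * F k l) = F i j"
proof -
  have k: "xs k < x \<and> x < xs (Suc k) \<longleftrightarrow> k = i" if "k < nx" for k
  proof -
    consider "k < i" | "k = i" | "i < k" by linarith
    then show ?thesis
    proof cases
      case 1 then have "xs (Suc k) <= xs i" using xs_mono[of "Suc k" i] ij by (cases "Suc k = i") auto
      then show ?thesis using 1 x by auto
    next
      case 3 then have "xs (Suc i) <= xs k" using xs_mono[of "Suc i" k] that by (cases "Suc i = k") auto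
      then show ?thesis using 3 x by auto
    qed (use x in auto)
  qed
  have l: "ys l < y \<and> y < ys (Suc l) \<longleftrightarrow> l = j" if "l < ny" for l
  proof -
    consider "l < j" | "l = j" | "j < l" by linarith
    then show ?thesis
    proof cases
      case 1 then have "ys (Suc l) <= ys j" using ys_mono[of "Suc l" j] ij by (cases "Suc l = j") auto
      then show ?thesis using 1 y by auto
    next
      case 3 then have "ys (Suc j) <= ys l" using ys_mono[of "Suc j" l] that by (cases "Suc j = l") auto
      then show ?thesis using 3 y by auto
    qed (use y in auto)
  qed
  have "(\<Sum>k<nx. \<Sum>l<ny. indicator (box (xs k, ys l) (xs (Suc k), ys (Suc l))) (x, y) * F k l)
     = (\<Sum>k<nx. \<Sum>l<ny. if l = j then (if k = i then F i j else 0) else 0)"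
    by (intro sum.cong refl) (use k l in \<open>auto simp: box_Pair_real indicator_def\<close>)
  also have "\<dots> = F i j" using ij by simp
  finally show ?thesis .
qed

lemma piece_cell:
  assumes ij: "i < nx" "j < ny" and x: "xs i < x" "x < xs (Suc i)" and y: "ys j < y" "y < ys (Suc j)"
  shows "piece_x w (x, y) = vdx w i j y"
    "piece_y w (x, y) = hdx w i j x"
  unfolding piece_x_def piece_y_def fst_conv snd_conv by (rule sum_cell_delta[OF assms])+

lemma piece_DERIV:
  assumes w: "w \<in> UU" and xy: "(x, y) \<in> \<Omega>" "x \<notin> xs ` {..nx}" "y \<notin> ys ` {..ny}"
  shows "((%t. w (t, y)) has_real_derivative piece_x w (x, y)) (at x)"
    "((%t. w (x, t)) has_real_derivative piece_y w (x, y)) (at y)"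
proof -
  obtain i where i: "i < nx" "xs i < x" "x < xs (Suc i)" using cell_index[of x] xy by (auto simp: box_Pair_real)
  obtain j where j: "j < ny" "ys j < y" "y < ys (Suc j)" using mesh.cell_index[OF flip_mesh, of y] xy by (auto simp: box_Pair_real)
  have b: "w (s, t) = bil w i j s t"
    "w (s, t) = bilin (%y x. w (x, y)) (ys j) (ys (Suc j)) (xs i) (xs (Suc i)) t s" if "s \<in> {xs i..xs (Suc i)}" "t \<in> {ys j..ys (Suc j)}" for s t
    using UhD(2)[OF w i(1) j(1) that] bilin_flip[of "%x y. w (x, y)"] by simp_all
  show "((%t. w (t, y)) has_real_derivative piece_x w (x, y)) (at x)"
    unfolding piece_cell[OF i(1) j(1) i(2,3) j(2,3)]
    by (rule has_field_derivative_transform_within_open[OF bilin_DERIV_x, where S = "{xs i<..<xs (Suc i)}"])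
      (use i j b(1) in auto)
  show "((%t. w (x, t)) has_real_derivative piece_y w (x, y)) (at y)"
    unfolding piece_cell[OF i(1) j(1) i(2,3) j(2,3)]
    by (rule has_field_derivative_transform_within_open[OF bilin_DERIV_x, where S = "{ys j<..<ys (Suc j)}"])
      (use i j b(2) in auto)
qed

lemma piece_meas: "piece_x w \<in> borel_measurable borel" "piece_y w \<in> borel_measurable borel"
proof -
  have "(%p. cell_dx u p0 p1 q0 q1 (snd p)) \<in> borel_measurable borel" "(%p. cell_dx u p0 p1 q0 q1 (fst p)) \<in> borel_measurable borel" for u p0 p1 q0 q1
    by (intro borel_measurable_continuous_onI continuous_on_compose2[OF cell_dx_cont[of UNIV]] continuous_on_fst continuous_on_snd continuous_on_id; simp)+
  then show "piece_x w \<in> borel_measurable borel" "piece_y w \<in> borel_measurable borel"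
    unfolding piece_x_def[abs_def] piece_y_def[abs_def] by measurable
qed

lemma cell_dx_bound:
  fixes u :: "real => real => real"
  assumes "x0 < x1" "y0 < y1" "y \<in> {y0..y1}"
  shows "\<bar>cell_dx u x0 x1 y0 y1 y\<bar> <= (\<bar>u x1 y0 - u x0 y0\<bar> + \<bar>u x1 y1 - u x0 y1\<bar>) / (x1 - x0)"
proof -
  have "\<bar>(u x1 y0 - u x0 y0) * (y1 - y) + (u x1 y1 - u x0 y1) * (y - y0)\<bar> <= \<bar>u x1 y0 - u x0 y0\<bar> * (y1 - y0) + \<bar>u x1 y1 - u x0 y1\<bar> * (y1 - y0)"
    using assms by (intro order_trans[OF abs_triangle_ineq] add_mono) (auto simp: abs_mult intro!: mult_left_mono)
  then have "\<bar>(u x1 y0 - u x0 y0) * (y1 - y) + (u x1 y1 - u x0 y1) * (y - y0)\<bar> / ((x1 - x0) * (y1 - y0))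
     <= ((\<bar>u x1 y0 - u x0 y0\<bar> + \<bar>u x1 y1 - u x0 y1\<bar>) * (y1 - y0)) / ((x1 - x0) * (y1 - y0))"
    using assms by (intro divide_right_mono) (auto simp: distrib_right)
  then show ?thesis using assms by (simp add: cell_dx_def abs_divide abs_mult)
qed

lemma piece_bound:
  assumes w: "w \<in> UU" and ij: "i < nx" "j < ny"
  shows "AE p in lborel. p \<in> elt i j -->
      (piece_x w p)\<^sup>2 <= 2 * esq (V\<^sub>N w) i j / (xs (Suc i) - xs i)\<^sup>2 \<and> (piece_y w p)\<^sup>2 <= 2 * esq (V\<^sub>N w) i j / (ys (Suc j) - ys j)\<^sup>2"
  using AE_off_lines(1)[of "xs i"] AE_off_lines(1)[of "xs (Suc i)"] AE_off_lines(2)[of "ys j"] AE_off_lines(2)[of "ys (Suc j)"]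
proof eventually_elim
  case (elim p)
  show ?case
  proof
    assume p: "p \<in> elt i j"
    obtain x y where xy: "p = (x, y)" by force
    have x: "xs i < x" "x < xs (Suc i)" and y: "ys j < y" "y < ys (Suc j)" using p elim by (auto simp: xy cbox_Pair_real)
    have n: "w (xs i, ys j) = V\<^sub>N w i j" "w (xs (Suc i), ys j) = V\<^sub>N w (Suc i) j" "w (xs i, ys (Suc j)) = V\<^sub>N w i (Suc j)" "w (xs (Suc i), ys (Suc j)) = V\<^sub>N w (Suc i) (Suc j)"
      using UhD(4)[OF w] ij by auto
    have sq: "t\<^sup>2 <= 2 * E / k\<^sup>2" if "\<bar>t\<bar> <= (\<bar>a\<bar> + \<bar>b\<bar>) / k" "k > 0" "a\<^sup>2 + b\<^sup>2 <= E" for t a b k E :: real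
    proof -
      have "t\<^sup>2 <= ((\<bar>a\<bar> + \<bar>b\<bar>) / k)\<^sup>2" using that(1) by (metis abs_ge_zero power2_abs power_mono)
      also have "\<dots> = (\<bar>a\<bar> + \<bar>b\<bar>)\<^sup>2 / k\<^sup>2" by (simp add: power_divide)
      also have "\<dots> <= 2 * E / k\<^sup>2"
      proof (rule divide_right_mono)
        have "(p + q)\<^sup>2 <= 2 * (p\<^sup>2 + q\<^sup>2)" for p q :: real
          using zero_le_power2[of "p - q"] by (simp add: power2_eq_square algebra_simps)
        from this[of "\<bar>a\<bar>" "\<bar>b\<bar>"] have "(\<bar>a\<bar> + \<bar>b\<bar>)\<^sup>2 <= 2 * (a\<^sup>2 + b\<^sup>2)" unfolding power2_abs .
        also have "\<dots> <= 2 * E" using that(3) by simp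
        finally show "(\<bar>a\<bar> + \<bar>b\<bar>)\<^sup>2 <= 2 * E" .
      qed simp
      finally show ?thesis .
    qed
    have "(piece_x w p)\<^sup>2 <= 2 * esq (V\<^sub>N w) i j / (xs (Suc i) - xs i)\<^sup>2"
      unfolding xy piece_cell(1)[OF ij x y]
      by (rule sq[OF cell_dx_bound[OF xs_step[OF ij(1)] ys_step[OF ij(2)]]]) (use y xs_step[OF ij(1)] in \<open>auto simp: n esq_def\<close>)
    moreover have "(piece_y w p)\<^sup>2 <= 2 * esq (V\<^sub>N w) i j / (ys (Suc j) - ys j)\<^sup>2"
      unfolding xy piece_cell(2)[OF ij x y]
      by (rule sq[OF cell_dx_bound[OF ys_step[OF ij(2)] xs_step[OF ij(1)]]]) (use x ys_step[OF ij(2)] in \<open>auto simp: n esq_def\<close>)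
    ultimately show "(piece_x w p)\<^sup>2 <= 2 * esq (V\<^sub>N w) i j / (xs (Suc i) - xs i)\<^sup>2 \<and> (piece_y w p)\<^sup>2 <= 2 * esq (V\<^sub>N w) i j / (ys (Suc j) - ys j)\<^sup>2" ..
  qed
qed

text \<open>A crude bound that depends on the mesh and on w and serves integrability only; the
  quantitative bound is \<open>piece_bound\<close>.\<close>

lemma piece_le:
  "\<exists>M. \<forall>p. \<bar>piece_x w p\<bar> <= M \<and> \<bar>piece_y w p\<bar> <= M"
proof -
  have cb: "\<exists>M. \<forall>t\<in>{a..b}. \<bar>cell_dx u p0 p1 q0 q1 t\<bar> <= M" for u p0 p1 q0 q1 a b
  proof -
    have "bounded (cell_dx u p0 p1 q0 q1 ` {a..b})"
      by (intro compact_imp_bounded compact_continuous_image cell_dx_cont compact_Icc)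
    then show ?thesis by (auto simp: bounded_iff)
  qed
  define M1 where "M1 i j = (SOME M. \<forall>t\<in>{ys j..ys (Suc j)}. \<bar>vdx w i j t\<bar> <= M)" for i j
  define M2 where "M2 i j = (SOME M. \<forall>t\<in>{xs i..xs (Suc i)}. \<bar>hdx w i j t\<bar> <= M)" for i j
  have M1: "\<bar>vdx w i j t\<bar> <= M1 i j" if "t \<in> {ys j..ys (Suc j)}" for i j t
    using someI_ex[OF cb] that unfolding M1_def by (rule bspec)
  have M2: "\<bar>hdx w i j t\<bar> <= M2 i j" if "t \<in> {xs i..xs (Suc i)}" for i j t
    using someI_ex[OF cb] that unfolding M2_def by (rule bspec)
  define M where "M = (\<Sum>i<nx. \<Sum>j<ny. \<bar>M1 i j\<bar>) + (\<Sum>i<nx. \<Sum>j<ny. \<bar>M2 i j\<bar>)"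
  have t1: "\<bar>indicator (elt0 i j) p * vdx w i j (snd p)\<bar> <= \<bar>M1 i j\<bar>" for i j p
  proof (cases "p \<in> elt0 i j")
    case True
    then have "snd p \<in> {ys j..ys (Suc j)}" by (cases p) (simp add: box_Pair_real)
    from order_trans[OF M1[OF this] abs_ge_self] show ?thesis using True by simp
  qed simp
  have t2: "\<bar>indicator (elt0 i j) p * hdx w i j (fst p)\<bar> <= \<bar>M2 i j\<bar>" for i j p
  proof (cases "p \<in> elt0 i j")
    case True
    then have "fst p \<in> {xs i..xs (Suc i)}" by (cases p) (simp add: box_Pair_real)
    from order_trans[OF M2[OF this] abs_ge_self] show ?thesis using True by simp
  qed simp
  have "\<bar>piece_x w p\<bar> <= (\<Sum>i<nx. \<Sum>j<ny. \<bar>M1 i j\<bar>)" for p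
    unfolding piece_x_def by (rule order_trans[OF sum_abs], rule sum_mono, rule order_trans[OF sum_abs], rule sum_mono, rule t1)
  moreover have "\<bar>piece_y w p\<bar> <= (\<Sum>i<nx. \<Sum>j<ny. \<bar>M2 i j\<bar>)" for p
    unfolding piece_y_def by (rule order_trans[OF sum_abs], rule sum_mono, rule order_trans[OF sum_abs], rule sum_mono, rule t2)
  moreover have "0 <= (\<Sum>i<nx. \<Sum>j<ny. \<bar>M1 i j\<bar>)" "0 <= (\<Sum>i<nx. \<Sum>j<ny. \<bar>M2 i j\<bar>)" by (intro sum_nonneg; simp)+
  ultimately have "\<bar>piece_x w p\<bar> <= M \<and> \<bar>piece_y w p\<bar> <= M" for p
    unfolding M_def by (meson add_increasing add_increasing2)
  then show ?thesis by blast
qed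

lemma bounded_meas_box:
  fixes f :: "real \<times> real => real"
  assumes "f \<in> borel_measurable borel" "!!p. \<bar>f p\<bar> <= M"
  shows "set_integrable lborel \<Omega> f" "L2 \<Omega> f"
proof -
  have i: "integrable lborel (%p. indicator \<Omega> p *\<^sub>R g p)" if "g \<in> borel_measurable borel" "!!p. \<bar>g p\<bar> <= K" for g :: "real \<times> real => real" and K
  proof (rule Bochner_Integration.integrable_bound)
    show "integrable lborel (%p. K * indicator \<Omega> p)" by (intro integrable_mult_right integrable_indicator_boxes)
    show "(%p. indicator \<Omega> p *\<^sub>R g p) \<in> borel_measurable lborel" using that(1) by measurable
    show "AE p in lborel. norm (indicator \<Omega> p *\<^sub>R g p) <= norm (K * indicator \<Omega> p)"
      using that(2) by (intro AE_I2) (auto simp: indicator_def intro: order_trans[OF _ abs_ge_self])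
  qed
  show "set_integrable lborel \<Omega> f" unfolding set_integrable_def using i[OF assms] .
  have "(f p)\<^sup>2 <= M\<^sup>2" for p using assms(2)[of p] by (metis abs_ge_zero power2_abs power_mono)
  then have "integrable lborel (%p. indicator \<Omega> p *\<^sub>R (f p)\<^sup>2)"
    using assms(1) by (intro i[where K = "M\<^sup>2"]) auto
  moreover have "(%p. indicator \<Omega> p *\<^sub>R f p) \<in> borel_measurable lborel" using assms(1) by measurable
  ultimately show "L2 \<Omega> f" unfolding L2_def set_integrable_def set_borel_measurable_def by blast
qed

text \<open>\<open>wd\<close> is an unspecified choice; uniqueness almost everywhere allows
  replacing it by the explicit g, which is then bounded cell by cell.\<close>

lemma wd_square:
  assumes "weak_deriv \<Omega> \<alpha> w g" "L2 \<Omega> g" and K: "!!i j. i < nx ==> j < ny ==>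
     AE p in lborel. p \<in> elt i j --> (g p)\<^sup>2 <= K i j"
    and K0: "!!i j. K i j >= 0"
  shows "(LINT x:\<Omega>|lborel. (wd \<Omega> \<alpha> w x)\<^sup>2) <= (\<Sum>i<nx. \<Sum>j<ny. K i j * ((xs (Suc i) - xs i) * (ys (Suc j) - ys j)))"
proof -
  have wd: "weak_deriv \<Omega> \<alpha> w (wd \<Omega> \<alpha> w) \<and> L2 \<Omega> (wd \<Omega> \<alpha> w)"
    unfolding wd_def by (rule someI[of _ g]) (use assms in blast)
  have ae: "AE p in lborel. p \<in> \<Omega> --> wd \<Omega> \<alpha> w p = g p"
    by (rule weak_deriv_unique[OF _ assms(1)]) (use wd assms L2_integrable in auto)
  let ?f = "%p. indicator \<Omega> p *\<^sub>R (g p)\<^sup>2"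
  have fi: "integrable lborel ?f" using assms(2) by (simp add: L2_def set_integrable_def)
  have m: "(%p. indicator \<Omega> p *\<^sub>R (wd \<Omega> \<alpha> w p)\<^sup>2) \<in> borel_measurable lborel"
    using wd by (auto simp: L2_def set_integrable_def)
  have "(LINT x:\<Omega>|lborel. (wd \<Omega> \<alpha> w x)\<^sup>2) = (\<integral>p. ?f p \<partial>lborel)"
    unfolding set_lebesgue_integral_def
  proof (rule integral_cong_AE[OF m borel_measurable_integrable[OF fi]])
    show "AE p in lborel. indicator \<Omega> p *\<^sub>R (wd \<Omega> \<alpha> w p)\<^sup>2 = ?f p"
      using ae by eventually_elim (auto simp: indicator_def)
  qed
  also have "\<dots> = (LINT p:cbox (a1, a2) (b1, b2)|lborel. ?f p)"
    unfolding set_lebesgue_integral_def using box_subset_cbox[of "(a1, a2)" "(b1, b2)"]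
    by (intro Bochner_Integration.integral_cong) (auto simp: indicator_def)
  also have "\<dots> = (\<Sum>i<nx. \<Sum>j<ny. LINT x:elt i j|lborel. ?f x)"
    by (rule LINT_cells[OF fi, symmetric])
  also have "\<dots> <= (\<Sum>i<nx. \<Sum>j<ny. K i j * ((xs (Suc i) - xs i) * (ys (Suc j) - ys j)))"
  proof (intro sum_mono LINT_cell_upper fi)
    fix i j assume "i \<in> {..<nx}" "j \<in> {..<ny}"
    then have ij: "i < nx" "j < ny" by auto
    show "AE p in lborel. p \<in> elt i j --> ?f p <= K i j"
      using K[OF ij] by eventually_elim (use K0 in \<open>auto simp: indicator_def\<close>)
    show "xs i <= xs (Suc i)" "ys j <= ys (Suc j)" using xs_step[OF ij(1)] ys_step[OF ij(2)] by auto
  qed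
  finally show ?thesis .
qed

text \<open>Each first derivative contributes 2\<gamma>, from 2 hx hy / hx^2 = 2 hy / hx and its
  mirror image; the function itself contributes the Poincare constant.\<close>

lemma Hnorm1_le:
  assumes w: "w \<in> UU"
  shows "Hnorm 1 \<Omega> w <= sqrt ((4 * \<gamma> + 8 * \<gamma> * (b1 - a1)\<^sup>2) * energy (V\<^sub>N w))"
proof -
  obtain M where M: "!!p. \<bar>piece_x w p\<bar> <= M" "!!p. \<bar>piece_y w p\<bar> <= M" using piece_le by blast
  have fin: "finite (xs ` {..nx})" "finite (ys ` {..ny})" by auto
  note le = less_imp_le[OF ab(1)] less_imp_le[OF ab(2)]
  have wx: "weak_deriv \<Omega> (1, 0) w (piece_x w)"
    by (rule weak_deriv_of_piecewise(1)[OF le UhD(1)[OF w] bounded_meas_box(1)[OF piece_meas(1) M(1)] fin(1) _ fin(2)])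
      (rule piece_DERIV(1)[OF w])
  have wy: "weak_deriv \<Omega> (0, 1) w (piece_y w)"
    by (rule weak_deriv_of_piecewise(2)[OF le UhD(1)[OF w] bounded_meas_box(1)[OF piece_meas(2) M(2)] fin(2) _ fin(1)])
      (rule piece_DERIV(2)[OF w])
  have w0: "weak_deriv \<Omega> (0, 0) w w" by (rule weak_deriv_0[OF UhD(1)[OF w]])
  have L0: "L2 \<Omega> w"
    unfolding L2_def
  proof
    show "set_borel_measurable lborel \<Omega> w"
      using set_integrable_box_of_continuous[OF UhD(1)[OF w]] by (auto simp: set_integrable_def set_borel_measurable_def)
    show "set_integrable lborel \<Omega> (%x. (w x)\<^sup>2)"
      by (intro set_integrable_box_of_continuous continuous_on_power UhD(1)[OF w])
  qed
  let ?hx = "%i. xs (Suc i) - xs i" and ?hy = "%j. ys (Suc j) - ys j"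
  have I1: "(LINT x:\<Omega>|lborel. (wd \<Omega> (1, 0) w x)\<^sup>2) <= 2 * \<gamma> * energy (V\<^sub>N w)"
  proof -
    have "(LINT x:\<Omega>|lborel. (wd \<Omega> (1, 0) w x)\<^sup>2) <= (\<Sum>i<nx. \<Sum>j<ny. 2 * esq (V\<^sub>N w) i j / (?hx i)\<^sup>2 * (?hx i * ?hy j))"
    proof (rule wd_square[OF wx bounded_meas_box(2)[OF piece_meas(1) M(1)]])
      fix i j assume ij: "i < nx" "j < ny"
      show "AE p in lborel. p \<in> elt i j --> (piece_x w p)\<^sup>2 <= 2 * esq (V\<^sub>N w) i j / (?hx i)\<^sup>2"
        using piece_bound[OF w ij] by eventually_elim simp
    qed (simp add: esq_nonneg)
    also have "\<dots> <= (\<Sum>i<nx. \<Sum>j<ny. 2 * \<gamma> * esq (V\<^sub>N w) i j)"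
    proof (intro sum_mono)
      fix i j assume "i \<in> {..<nx}" "j \<in> {..<ny}"
      then have ij: "i < nx" "j < ny" by auto
      have h: "?hx i > 0" using xs_step[OF ij(1)] by simp
      have "2 * esq (V\<^sub>N w) i j / (?hx i)\<^sup>2 * (?hx i * ?hy j) = 2 * esq (V\<^sub>N w) i j * (?hy j / ?hx i)"
        using h by (simp add: power2_eq_square)
      also have "\<dots> <= 2 * esq (V\<^sub>N w) i j * \<gamma>"
        using ratio(2)[OF ij] h esq_nonneg by (intro mult_left_mono) (auto simp: divide_le_eq)
      finally show "2 * esq (V\<^sub>N w) i j / (?hx i)\<^sup>2 * (?hx i * ?hy j) <= 2 * \<gamma> * esq (V\<^sub>N w) i j" by (simp add: mult_ac)
    qed
    also have "\<dots> = 2 * \<gamma> * energy (V\<^sub>N w)" by (simp add: energy_def sum_distrib_left)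
    finally show ?thesis .
  qed
  have I2: "(LINT x:\<Omega>|lborel. (wd \<Omega> (0, 1) w x)\<^sup>2) <= 2 * \<gamma> * energy (V\<^sub>N w)"
  proof -
    have "(LINT x:\<Omega>|lborel. (wd \<Omega> (0, 1) w x)\<^sup>2) <= (\<Sum>i<nx. \<Sum>j<ny. 2 * esq (V\<^sub>N w) i j / (?hy j)\<^sup>2 * (?hx i * ?hy j))"
    proof (rule wd_square[OF wy bounded_meas_box(2)[OF piece_meas(2) M(2)]])
      fix i j assume ij: "i < nx" "j < ny"
      show "AE p in lborel. p \<in> elt i j --> (piece_y w p)\<^sup>2 <= 2 * esq (V\<^sub>N w) i j / (?hy j)\<^sup>2"
        using piece_bound[OF w ij] by eventually_elim simp
    qed (simp add: esq_nonneg)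
    also have "\<dots> <= (\<Sum>i<nx. \<Sum>j<ny. 2 * \<gamma> * esq (V\<^sub>N w) i j)"
    proof (intro sum_mono)
      fix i j assume "i \<in> {..<nx}" "j \<in> {..<ny}"
      then have ij: "i < nx" "j < ny" by auto
      have h: "?hy j > 0" using ys_step[OF ij(2)] by simp
      have "2 * esq (V\<^sub>N w) i j / (?hy j)\<^sup>2 * (?hx i * ?hy j) = 2 * esq (V\<^sub>N w) i j * (?hx i / ?hy j)"
        using h by (simp add: power2_eq_square)
      also have "\<dots> <= 2 * esq (V\<^sub>N w) i j * \<gamma>"
        using ratio(1)[OF ij] h esq_nonneg by (intro mult_left_mono) (auto simp: divide_le_eq)
      finally show "2 * esq (V\<^sub>N w) i j / (?hy j)\<^sup>2 * (?hx i * ?hy j) <= 2 * \<gamma> * esq (V\<^sub>N w) i j" by (simp add: mult_ac)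
    qed
    also have "\<dots> = 2 * \<gamma> * energy (V\<^sub>N w)" by (simp add: energy_def sum_distrib_left)
    finally show ?thesis .
  qed
  have I0: "(LINT x:\<Omega>|lborel. (wd \<Omega> (0, 0) w x)\<^sup>2) <= 8 * \<gamma> * (b1 - a1)\<^sup>2 * energy (V\<^sub>N w)"
  proof -
    let ?m = "%i j. corners (V\<^sub>N w) i j"
    have "(LINT x:\<Omega>|lborel. (wd \<Omega> (0, 0) w x)\<^sup>2) <= (\<Sum>i<nx. \<Sum>j<ny. (?m i j)\<^sup>2 * (?hx i * ?hy j))"
    proof (rule wd_square[OF w0 L0])
      fix i j assume ij: "i < nx" "j < ny"
      show "AE p in lborel. p \<in> elt i j --> (w p)\<^sup>2 <= (?m i j)\<^sup>2"
      proof (intro AE_I2 impI)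
        fix p assume "p \<in> elt i j"
        then have "\<bar>w p\<bar> <= ?m i j" using Uh_le_max[OF w ij, of "fst p" "snd p"] by (cases p) (auto simp: cbox_Pair_real)
        then show "(w p)\<^sup>2 <= (?m i j)\<^sup>2" by (metis abs_ge_zero power2_abs power_mono)
      qed
    qed simp
    also have "\<dots> <= 8 * \<gamma> * (b1 - a1)\<^sup>2 * energy (V\<^sub>N w)"
      using poincare[of w] by (simp add: mult.commute)
    finally show ?thesis .
  qed
  have "Hnorm 1 \<Omega> w = sqrt ((LINT x:\<Omega>|lborel. (wd \<Omega> (0, 0) w x)\<^sup>2) + (LINT x:\<Omega>|lborel. (wd \<Omega> (0, 1) w x)\<^sup>2) + (LINT x:\<Omega>|lborel. (wd \<Omega> (1, 0) w x)\<^sup>2))"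
    unfolding Hnorm_def by (simp add: atMost_Suc)
  also have "\<dots> <= sqrt ((4 * \<gamma> + 8 * \<gamma> * (b1 - a1)\<^sup>2) * energy (V\<^sub>N w))"
    using I0 I1 I2 by (intro real_sqrt_le_mono) (simp add: algebra_simps)
  finally show ?thesis .
qed

end

subsection \<open>The finite volume form\<close>

lemma mat2_mult:
  fixes M :: "real^2^2"
  shows "(M *v vector [s, t]) $ 1 = M $ 1 $ 1 * s + M $ 1 $ 2 * t" "(M *v vector [s, t]) $ 2 = M $ 2 $ 1 * s + M $ 2 $ 2 * t"
  by (simp_all add: matrix_vector_mult_def sum_2)

text \<open>The Lipschitz bounds are used along dual edges and between centres. A dual edge reaches
  the boundary only at its ends, hence the closed range in the varied coordinate and the open range
  in the other.\<close>

locale fvm = mesh +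
  fixes A :: "real \<times> real => real^2^2" and c :: "real \<times> real => real" and C1 L Mb Mc :: real
  assumes A_cont: "!!k l. continuous_on (cbox (a1, a2) (b1, b2)) (%x. A x $ k $ l)"
    and A_bd: "!!k l p. p \<in> cbox (a1, a2) (b1, b2) ==> \<bar>A p $ k $ l\<bar> <= Mb"
    and A_lipx: "!!k l x x' y. a1 <= x ==> x <= x' ==> x' <= b1 ==> a2 < y ==> y < b2 ==> \<bar>A (x', y) $ k $ l - A (x, y) $ k $ l\<bar> <= L * (x' - x)"
    and A_lipy: "!!k l x y y'. a1 < x ==> x < b1 ==> a2 <= y ==> y <= y' ==> y' <= b2 ==> \<bar>A (x, y') $ k $ l - A (x, y) $ k $ l\<bar> <= L * (y' - y)"
    and ell: "!!p \<xi>. p \<in> box (a1, a2) (b1, b2) ==> C1 * (\<xi> \<bullet> \<xi>) <= \<xi> \<bullet> (A p *v \<xi>)"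
    and const_pos: "C1 > 0" "L >= 0" "Mc >= 0"
    and c_Linf: "Linf (box (a1, a2) (b1, b2)) c" and c_bd: "AE x in lborel. x \<in> box (a1, a2) (b1, b2) --> \<bar>c x\<bar> <= Mc"
    and c_nn: "!!x. x \<in> box (a1, a2) (b1, b2) ==> c x >= 0"
begin

abbreviation "vsum1 \<equiv> vsum (%x y. A (x, y) $ 1 $ 1) (%x y. A (x, y) $ 1 $ 2)"
abbreviation "vsum2 \<equiv> vsum (%y x. A (x, y) $ 2 $ 2) (%y x. A (x, y) $ 2 $ 1)"

text \<open>The diffusion part of the form for the bilinear interpolant of u. As it depends on nodal
  values only, u and its interpolant may be interchanged (\<open>dform_cong\<close>).\<close>

definition dform :: "(real => real => real) => (nat => nat => real) => real" where
  "dform u V = vsum1 u xs nx ys ny V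
     + vsum2 (%y x. u x y) ys ny xs nx (%j i. V i j)"

lemma A_slice_y: "x \<in> {a1..b1} ==> S \<subseteq> {a2..b2} ==> continuous_on S (%y. A (x, y) $ k $ l)"
  by (rule continuous_on_compose2[OF A_cont]) (auto intro!: continuous_intros simp: cbox_Pair_real)

lemma A_slice_x: "y \<in> {a2..b2} ==> S \<subseteq> {a1..b1} ==> continuous_on S (%x. A (x, y) $ k $ l)"
  by (rule continuous_on_compose2[OF A_cont]) (auto intro!: continuous_intros simp: cbox_Pair_real)

lemma A_mid_y: "i < nx ==> j < ny ==> continuous_on {ys j..ys (Suc j)} (%y. A (mid xs i, y) $ k $ l)"
  by (rule A_slice_y) (use mid_in'(1)[of i] ys_in[of j] ys_in[of "Suc j"] in auto)

lemma A_mid_x: "i < nx ==> j < ny ==> continuous_on {xs i..xs (Suc i)} (%x. A (x, mid ys j) $ k $ l)"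
  by (rule A_slice_x) (use mid_in'(2)[of j] xs_in[of i] xs_in[of "Suc i"] in auto)

text \<open>Where a dual edge crosses a mesh line, a trial function may fail to be differentiable
  and \<open>deriv\<close> is then arbitrary. Within one cell this concerns only the two end
  points.\<close>

lemma spike_integral:
  fixes f g :: "real => real"
  assumes "!!t. t \<in> {a<..<b} ==> f t = g t" "continuous_on {a..b} g" "a <= s" "s <= t" "t <= b"
  shows "f integrable_on {s..t}" "integral {s..t} f = integral {s..t} g"
proof -
  have "g integrable_on {s..t}" using assms by (intro integrable_continuous_real) (auto intro: continuous_on_subset)
  then show "f integrable_on {s..t}"
    by (rule integrable_spike[of _ _ "{a, b}"]) (use assms in auto)
  show "integral {s..t} f = integral {s..t} g"
    by (rule integral_spike[of "{a, b}"]) (use assms in auto)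
qed

lemma flux_vertical:
  assumes w: "w \<in> UU" and ij: "i < nx" "j < ny" and st: "ys j <= s" "s <= t" "t <= ys (Suc j)"
  defines "g \<equiv> %x y. (A (x, y) *v grad w (x, y)) $ 1"
  shows "g (mid xs i) integrable_on {s..t}"
    "integral {s..t} (g (mid xs i)) = integral {s..t} (%y. A (mid xs i, y) $ 1 $ 1 * vdx w i j y
       + A (mid xs i, y) $ 1 $ 2 * vdy w i j)"
proof -
  let ?f = "%y. A (mid xs i, y) $ 1 $ 1 * vdx w i j y
       + A (mid xs i, y) $ 1 $ 2 * vdy w i j"
  have e: "g (mid xs i) y = ?f y" if "y \<in> {ys j<..<ys (Suc j)}" for y
    using that grad_vertical[OF w ij] by (simp add: g_def grad_def mat2_mult)
  have c: "continuous_on {ys j..ys (Suc j)} ?f" by (intro continuous_intros A_mid_y ij cell_dx_cont)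
  show "g (mid xs i) integrable_on {s..t}" "integral {s..t} (g (mid xs i)) = integral {s..t} ?f"
    by (rule spike_integral[OF e c st], assumption)+
qed

lemma flux_horizontal:
  assumes w: "w \<in> UU" and ij: "i < nx" "j < ny" and st: "xs i <= s" "s <= t" "t <= xs (Suc i)"
  defines "g \<equiv> %y x. (A (x, y) *v grad w (x, y)) $ 2"
  shows "g (mid ys j) integrable_on {s..t}"
    "integral {s..t} (g (mid ys j)) = integral {s..t} (%x. A (x, mid ys j) $ 2 $ 2 * hdx w i j x
       + A (x, mid ys j) $ 2 $ 1 * hdy w i j)"
proof -
  let ?f = "%x. A (x, mid ys j) $ 2 $ 2 * hdx w i j x
       + A (x, mid ys j) $ 2 $ 1 * hdy w i j"
  have e: "g (mid ys j) y = ?f y" if "y \<in> {xs i<..<xs (Suc i)}" for y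
    using that grad_horizontal[OF w ij] by (simp add: g_def grad_def mat2_mult)
  have c: "continuous_on {xs i..xs (Suc i)} ?f" by (intro continuous_intros A_mid_x ij cell_dx_cont)
  show "g (mid ys j) integrable_on {s..t}" "integral {s..t} (g (mid ys j)) = integral {s..t} ?f"
    by (rule spike_integral[OF e c st], assumption)+
qed

lemma flux_sum_Uh:
  assumes w: "w \<in> UU"
  shows "flux_sum (%x y. (A (x, y) *v grad w (x, y)) $ 1) xs nx ys ny V + flux_sum (%y x. (A (x, y) *v grad w (x, y)) $ 2) ys ny xs nx (%j i. V i j)
    = dform (%x y. w (x, y)) V"
proof -
  have "flux_sum (%x y. (A (x, y) *v grad w (x, y)) $ 1) xs nx ys ny V = vsum1 (%x y. w (x, y)) xs nx ys ny V"
    unfolding flux_sum_def vsum_def vcell_def mid_def[symmetric]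
  proof (intro sum.cong refl arg_cong2[where f = "(+)"] arg_cong2[where f = "(*)"])
    fix i j assume "i \<in> {..<nx}" "j \<in> {..<ny}"
    then have ij: "i < nx" "j < ny" by auto
    show "integral {ys j..mid ys j} (%y. (A (mid xs i, y) *v grad w (mid xs i, y)) $ 1) =
       integral {ys j..mid ys j} (%y. A (mid xs i, y) $ 1 $ 1 * vdx w i j y
       + A (mid xs i, y) $ 1 $ 2 * vdy w i j)"
      by (rule flux_vertical(2)[OF w ij]) (use mid_in(2)[OF ij(2)] in auto)
    show "integral {mid ys j..ys (Suc j)} (%y. (A (mid xs i, y) *v grad w (mid xs i, y)) $ 1) =
       integral {mid ys j..ys (Suc j)} (%y. A (mid xs i, y) $ 1 $ 1 * vdx w i j y
       + A (mid xs i, y) $ 1 $ 2 * vdy w i j)"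
      by (rule flux_vertical(2)[OF w ij]) (use mid_in(2)[OF ij(2)] in auto)
  qed
  moreover have "flux_sum (%y x. (A (x, y) *v grad w (x, y)) $ 2) ys ny xs nx (%j i. V i j)
     = vsum2 (%y x. w (x, y)) ys ny xs nx (%j i. V i j)"
    unfolding flux_sum_def vsum_def vcell_def mid_def[symmetric]
  proof (intro sum.cong refl arg_cong2[where f = "(+)"] arg_cong2[where f = "(*)"])
    fix j i assume "j \<in> {..<ny}" "i \<in> {..<nx}"
    then have ij: "i < nx" "j < ny" by auto
    show "integral {xs i..mid xs i} (%x. (A (x, mid ys j) *v grad w (x, mid ys j)) $ 2) =
       integral {xs i..mid xs i} (%x. A (x, mid ys j) $ 2 $ 2 * hdx w i j x
       + A (x, mid ys j) $ 2 $ 1 * hdy w i j)"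
      by (rule flux_horizontal(2)[OF w ij]) (use mid_in(1)[OF ij(1)] in auto)
    show "integral {mid xs i..xs (Suc i)} (%x. (A (x, mid ys j) *v grad w (x, mid ys j)) $ 2) =
       integral {mid xs i..xs (Suc i)} (%x. A (x, mid ys j) $ 2 $ 2 * hdx w i j x
       + A (x, mid ys j) $ 2 $ 1 * hdy w i j)"
      by (rule flux_horizontal(2)[OF w ij]) (use mid_in(1)[OF ij(1)] in auto)
  qed
  ultimately show ?thesis by (simp add: dform_def)
qed

lemma Pistar_bounded: "\<exists>M. \<forall>x. \<bar>Pistar xs nx ys ny v x\<bar> <= M"
proof -
  have "\<bar>Pistar xs nx ys ny v x\<bar> <= (\<Sum>P\<in>node_idx nx ny. \<bar>v (node xs ys P)\<bar>)" for x
  proof -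
  have "\<bar>Pistar xs nx ys ny v x\<bar> <= (\<Sum>P\<in>node_idx nx ny. \<bar>v (node xs ys P) * indicator (ctrl_vol xs nx ys ny P) x\<bar>)"
    unfolding Pistar_def by (rule sum_abs)
  also have "\<dots> <= (\<Sum>P\<in>node_idx nx ny. \<bar>v (node xs ys P)\<bar>)"
    by (intro sum_mono) (auto simp: indicator_def)
  finally show ?thesis .
  qed
  then show ?thesis by blast
qed

lemma int_Pistar:
  assumes g: "set_integrable lborel \<Omega> g"
  shows "set_integrable lborel \<Omega> (%x. g x * Pistar xs nx ys ny v x)"
proof -
  obtain M where M: "!!x. \<bar>Pistar xs nx ys ny v x\<bar> <= M" using Pistar_bounded[of v] by blast
  have gi: "integrable lborel (%x. indicator \<Omega> x *\<^sub>R g x)" using g by (simp add: set_integrable_def)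
  show ?thesis unfolding set_integrable_def
  proof (rule Bochner_Integration.integrable_bound)
    show "integrable lborel (%x. M * (indicator \<Omega> x *\<^sub>R g x))" using gi by simp
    have "(%x. (indicator \<Omega> x *\<^sub>R g x) * Pistar xs nx ys ny v x) \<in> borel_measurable lborel"
      using borel_measurable_integrable[OF gi] Pistar_meas[of v] by simp
    then show "(%x. indicator \<Omega> x *\<^sub>R (g x * Pistar xs nx ys ny v x)) \<in> borel_measurable lborel" by (simp add: mult.assoc)
    show "AE x in lborel. norm (indicator \<Omega> x *\<^sub>R (g x * Pistar xs nx ys ny v x)) <= norm (M * (indicator \<Omega> x *\<^sub>R g x))"
    proof (intro AE_I2)
      fix x
      have "\<bar>g x\<bar> * \<bar>Pistar xs nx ys ny v x\<bar> <= \<bar>g x\<bar> * \<bar>M\<bar>"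
        using M[of x] by (intro mult_left_mono) auto
      then show "norm (indicator \<Omega> x *\<^sub>R (g x * Pistar xs nx ys ny v x)) <= norm (M * (indicator \<Omega> x *\<^sub>R g x))"
        by (simp add: abs_mult mult_ac indicator_def)
    qed
  qed
qed

lemma c_mult_int: "continuous_on (cbox (a1, a2) (b1, b2)) w ==> set_integrable lborel \<Omega> (%x. c x * w x)"
  by (rule set_integrable_mult_continuous[OF Linf_integrable[OF c_Linf]])

text \<open>The boundary fluxes of the control volumes regroup into flux sums over dual edges, and
  the reaction terms into one integral, because the control volumes tile the rectangle up to null
  sets.\<close>

lemma ah_eq:
  assumes w: "w \<in> UU" and v: "v \<in> UU"
  shows "ah A c xs nx ys ny w (Pistar xs nx ys ny v) = dform (%x y. w (x, y)) (V\<^sub>N v) + (LINT x:\<Omega>|lborel. c x * w x * Pistar xs nx ys ny v x)"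
proof -
  let ?z = "Pistar xs nx ys ny v"
  let ?g1 = "%x y. (A (x, y) *v grad w (x, y)) $ 1" and ?g2 = "%y x. (A (x, y) *v grad w (x, y)) $ 2"
  let ?f = "%x. indicator \<Omega> x *\<^sub>R (c x * w x * ?z x)"
  have fi: "integrable lborel ?f"
    using int_Pistar[OF c_mult_int[OF UhD(1)[OF w]], of v] by (simp add: set_integrable_def)
  have "ah A c xs nx ys ny w ?z = (\<Sum>i\<le>nx. \<Sum>j\<le>ny. neg_flux A w (lo xs i) (hi xs nx i) (lo ys j) (hi ys ny j) * ?z (xs i, ys j)
      + (LINT x:ctrl_vol xs nx ys ny (i, j)|lborel. c x * w x * ?z x))"
    unfolding ah_def node_idx_def node_def sum.cartesian_product by (intro sum.cong) auto
  also have "\<dots> = (\<Sum>i\<le>nx. \<Sum>j\<le>ny. neg_flux A w (lo xs i) (hi xs nx i) (lo ys j) (hi ys ny j) * V\<^sub>N v i j)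
      + (\<Sum>i\<le>nx. \<Sum>j\<le>ny. LINT x:ctrl_vol xs nx ys ny (i, j)|lborel. ?f x)"
    unfolding sum.distrib[symmetric]
  proof (intro sum.cong refl arg_cong2[where f = "(+)"] arg_cong2[where f = "(*)"])
    fix i j assume "i \<in> {..nx}" "j \<in> {..ny}"
    then show "?z (xs i, ys j) = V\<^sub>N v i j" by (intro Pistar_node[OF v]) auto
    \<comment> \<open>\<open>c\<close> is controlled only inside \<Omega>; since
      \<open>Pistar\<close> vanishes outside, the indicator of \<Omega> can be inserted.\<close>
    have "c x * w x * ?z x = ?f x" for x using Pistar_outside[OF v, of x] by (auto simp: indicator_def)
    then show "(LINT x:ctrl_vol xs nx ys ny (i, j)|lborel. c x * w x * ?z x) = (LINT x:ctrl_vol xs nx ys ny (i, j)|lborel. ?f x)"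
      by (simp only:)
  qed
  also have "(\<Sum>i\<le>nx. \<Sum>j\<le>ny. neg_flux A w (lo xs i) (hi xs nx i) (lo ys j) (hi ys ny j) * V\<^sub>N v i j)
     = flux_sum ?g1 xs nx ys ny (V\<^sub>N v) + flux_sum ?g2 ys ny xs nx (%j i. V\<^sub>N v i j)"
    unfolding neg_flux_def
    by (rule flux_sum_dual[of ?g1 ?g2]) (use flux_vertical(1)[OF w] flux_horizontal(1)[OF w] xs_step ys_step in \<open>auto simp: less_imp_le\<close>)
  also have "\<dots> = dform (%x y. w (x, y)) (V\<^sub>N v)" by (rule flux_sum_Uh[OF w])
  also have "(\<Sum>i\<le>nx. \<Sum>j\<le>ny. LINT x:ctrl_vol xs nx ys ny (i, j)|lborel. ?f x) = (LINT x:cbox (a1, a2) (b1, b2)|lborel. ?f x)"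
    by (rule LINT_ctrl_vols[OF fi])
  also have "\<dots> = (LINT x:\<Omega>|lborel. c x * w x * ?z x)"
    by (rule LINT_box_cbox)
  finally show ?thesis .
qed

lemma cell_dx_diff: "cell_dx (%x y. u x y - w x y) x0 x1 y0 y1 y = cell_dx u x0 x1 y0 y1 y - cell_dx w x0 x1 y0 y1 y"
  unfolding cell_dx_def diff_divide_distrib[symmetric] by (simp add: algebra_simps)

lemma cell_dy_diff: "cell_dy (%x y. u x y - w x y) x0 x1 y0 y1 = cell_dy u x0 x1 y0 y1 - cell_dy w x0 x1 y0 y1"
  unfolding cell_dy_def diff_divide_distrib[symmetric] by (simp add: algebra_simps)

lemma vcell_diff:
  assumes "continuous_on {y0..y1} (a ((x0 + x1) / 2))" "continuous_on {y0..y1} (b ((x0 + x1) / 2))" "y0 < y1"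
  shows "vcell a b (%x y. u x y - w x y) x0 x1 y0 y1 d1 d2 = vcell a b u x0 x1 y0 y1 d1 d2 - vcell a b w x0 x1 y0 y1 d1 d2"
proof -
  let ?F = "%u y. a ((x0 + x1) / 2) y * cell_dx u x0 x1 y0 y1 y + b ((x0 + x1) / 2) y * cell_dy u x0 x1 y0 y1"
  have "integral {s..t} (?F (%x y. u x y - w x y)) = integral {s..t} (?F u) - integral {s..t} (?F w)" if "{s..t} \<subseteq> {y0..y1}" for s t
  proof -
    note c = assms(1,2)[THEN continuous_on_subset[OF _ that]]
    have "integral {s..t} (?F u) - integral {s..t} (?F w) = integral {s..t} (%y. ?F u y - ?F w y)"
      by (intro Henstock_Kurzweil_Integration.integral_diff[symmetric] integrable_continuous_real continuous_intros c cell_dx_cont)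
    then show ?thesis by (simp add: cell_dx_diff cell_dy_diff algebra_simps)
  qed
  then have "integral {y0..(y0 + y1) / 2} (?F (%x y. u x y - w x y)) = integral {y0..(y0 + y1) / 2} (?F u) - integral {y0..(y0 + y1) / 2} (?F w)"
    "integral {(y0 + y1) / 2..y1} (?F (%x y. u x y - w x y)) = integral {(y0 + y1) / 2..y1} (?F u) - integral {(y0 + y1) / 2..y1} (?F w)"
    using assms(3) by auto
  note e = this
  have "(p - q) * d1 + (r - s) * d2 = (p * d1 + r * d2) - (q * d1 + s * d2)" for p q r s :: real
    by (simp add: algebra_simps)
  then show ?thesis unfolding vcell_def e .
qed

lemma dform_diff: "dform (%x y. u x y - w x y) V = dform u V - dform w V"
proof -
  have "vsum1 (%x y. u x y - w x y) xs nx ys ny V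
    = vsum1 u xs nx ys ny V - vsum1 w xs nx ys ny V"
    unfolding vsum_def sum_subtractf[symmetric]
    by (intro sum.cong refl vcell_diff) (use A_mid_y ys_step in \<open>auto simp: mid_def\<close>)
  moreover have "vsum2 (%y x. u x y - w x y) ys ny xs nx (%j i. V i j)
    = vsum2 (%y x. u x y) ys ny xs nx (%j i. V i j) - vsum2 (%y x. w x y) ys ny xs nx (%j i. V i j)"
    unfolding vsum_def sum_subtractf[symmetric]
    by (intro sum.cong refl vcell_diff) (use A_mid_x xs_step in \<open>auto simp: mid_def\<close>)
  ultimately show ?thesis unfolding dform_def by simp
qed

lemma dform_cong:
  assumes "!!i j. i <= nx ==> j <= ny ==> u (xs i) (ys j) = w (xs i) (ys j)"
  shows "dform u V = dform w V"
  unfolding dform_def vsum_def vcell_def cell_dx_def cell_dy_def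
  using assms by (auto intro!: arg_cong2[where f = "(+)"] sum.cong simp: Suc_le_eq less_imp_le)

section \<open>Coercivity of the form and bounds for the reaction term\<close>

lemma dform_coercive:
  assumes w: "w \<in> UU"
  shows "(C1 / (4 * \<gamma>) - 8 * L * h * \<gamma>) * energy (V\<^sub>N w) <= dform (%x y. w (x, y)) (V\<^sub>N w)"
proof -
  let ?W = "V\<^sub>N w"
  let ?v1 = "%i j. vcell (%x y. A (x, y) $ 1 $ 1) (%x y. A (x, y) $ 1 $ 2) (%x y. w (x, y)) (xs i) (xs (Suc i)) (ys j) (ys (Suc j)) (?W (Suc i) j - ?W i j) (?W (Suc i) (Suc j) - ?W i (Suc j))"
  let ?v2 = "%i j. vcell (%y x. A (x, y) $ 2 $ 2) (%y x. A (x, y) $ 2 $ 1) (%y x. w (x, y)) (ys j) (ys (Suc j)) (xs i) (xs (Suc i)) (?W i (Suc j) - ?W i j) (?W (Suc i) (Suc j) - ?W (Suc i) j)"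
  have cell: "(C1 / (4 * \<gamma>) - 8 * L * h * \<gamma>) * esq ?W i j <= ?v1 i j + ?v2 i j" if ij: "i < nx" "j < ny" for i j
  proof -
    define d1 d2 e1 e2 where "d1 = ?W (Suc i) j - ?W i j" and "d2 = ?W (Suc i) (Suc j) - ?W i (Suc j)"
      and "e1 = ?W i (Suc j) - ?W i j" and "e2 = ?W (Suc i) (Suc j) - ?W (Suc i) j"
    note de = this
    define E where "E = \<bar>d1\<bar> + \<bar>d2\<bar> + \<bar>e1\<bar> + \<bar>e2\<bar>"
    have Eq: "E = edges ?W i j" by (simp add: E_def de edges_def)
    have n: "w (xs i, ys j) = ?W i j" "w (xs (Suc i), ys j) = ?W (Suc i) j" "w (xs i, ys (Suc j)) = ?W i (Suc j)" "w (xs (Suc i), ys (Suc j)) = ?W (Suc i) (Suc j)"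
      using UhD(4)[OF w] ij by auto
    define A0 where "A0 k l = A (mid xs i, mid ys j) $ k $ l" for k l
    let ?hx = "xs (Suc i) - xs i" and ?hy = "ys (Suc j) - ys j"
    note m1 = mid_in(1)[OF ij(1)] and m2 = mid_in(2)[OF ij(2)] and m1' = mid_in'(1)[OF ij(1)] and m2' = mid_in'(2)[OF ij(2)]
    have xin: "a1 <= xs i" "xs (Suc i) <= b1" "a2 <= ys j" "ys (Suc j) <= b2" using xs_in[of i] xs_in[of "Suc i"] ys_in[of j] ys_in[of "Suc j"] ij by auto
    \<comment> \<open>Both directions freeze the coefficients at the centre of the cell, so that
      ellipticity can be applied to the whole matrix there.\<close>
    have Ly: "\<bar>A (mid xs i, y) $ k $ l - A0 k l\<bar> <= L * h" if "y \<in> {ys j..ys (Suc j)}" for y k l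
    proof -
      have "\<bar>A (mid xs i, y) $ k $ l - A0 k l\<bar> <= L * \<bar>y - mid ys j\<bar>"
        using A_lipy[of "mid xs i" "mid ys j" y k l] A_lipy[of "mid xs i" y "mid ys j" k l] m1' m2' xin that
        by (cases "y <= mid ys j") (auto simp: A0_def abs_minus_commute)
      also have "\<dots> <= L * h" using that m2 hy_le[OF ij(2)] const_pos by (intro mult_left_mono) auto
      finally show ?thesis .
    qed
    have Lx: "\<bar>A (x, mid ys j) $ k $ l - A0 k l\<bar> <= L * h" if "x \<in> {xs i..xs (Suc i)}" for x k l
    proof -
      have "\<bar>A (x, mid ys j) $ k $ l - A0 k l\<bar> <= L * \<bar>x - mid xs i\<bar>"
        using A_lipx[of "mid xs i" x "mid ys j" k l] A_lipx[of x "mid xs i" "mid ys j" k l] m1' m2' xin that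
        by (cases "x <= mid xs i") (auto simp: A0_def abs_minus_commute)
      also have "\<dots> <= L * h" using that m1 hx_le[OF ij(1)] const_pos by (intro mult_left_mono) auto
      finally show ?thesis .
    qed
    have v1: "A0 1 1 * (?hy / ?hx) * (3/8 * d1\<^sup>2 + 1/4 * d1 * d2 + 3/8 * d2\<^sup>2) + A0 1 2 * ((d1 + d2) / 2) * ((e1 + e2) / 2)
      - L * h * \<gamma> * E\<^sup>2 <= ?v1 i j"
    proof -
      have "A0 1 1 * (?hy / ?hx) * (3/8 * (w (xs (Suc i), ys j) - w (xs i, ys j))\<^sup>2 + 1/4 * (w (xs (Suc i), ys j) - w (xs i, ys j)) * (w (xs (Suc i), ys (Suc j)) - w (xs i, ys (Suc j))) + 3/8 * (w (xs (Suc i), ys (Suc j)) - w (xs i, ys (Suc j)))\<^sup>2)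
         + A0 1 2 * (((w (xs (Suc i), ys j) - w (xs i, ys j)) + (w (xs (Suc i), ys (Suc j)) - w (xs i, ys (Suc j)))) / 2) * (((w (xs i, ys (Suc j)) - w (xs i, ys j)) + (w (xs (Suc i), ys (Suc j)) - w (xs (Suc i), ys j))) / 2)
         - L * h * \<gamma> * (\<bar>w (xs (Suc i), ys j) - w (xs i, ys j)\<bar> + \<bar>w (xs (Suc i), ys (Suc j)) - w (xs i, ys (Suc j))\<bar> + \<bar>w (xs i, ys (Suc j)) - w (xs i, ys j)\<bar> + \<bar>w (xs (Suc i), ys (Suc j)) - w (xs (Suc i), ys j)\<bar>)\<^sup>2
         <= vcell (%x y. A (x, y) $ 1 $ 1) (%x y. A (x, y) $ 1 $ 2) (%x y. w (x, y)) (xs i) (xs (Suc i)) (ys j) (ys (Suc j)) (w (xs (Suc i), ys j) - w (xs i, ys j)) (w (xs (Suc i), ys (Suc j)) - w (xs i, ys (Suc j)))"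
        by (rule vcell_lower[OF xs_step[OF ij(1)] ys_step[OF ij(2)] ratio(2)[OF ij] gamma_ge1])
          (use A_mid_y[OF ij] Ly in \<open>auto simp: mid_def\<close>)
      then show ?thesis unfolding n E_def de .
    qed
    have v2: "A0 2 2 * (?hx / ?hy) * (3/8 * e1\<^sup>2 + 1/4 * e1 * e2 + 3/8 * e2\<^sup>2) + A0 2 1 * ((e1 + e2) / 2) * ((d1 + d2) / 2)
      - L * h * \<gamma> * E\<^sup>2 <= ?v2 i j"
    proof -
      have "A0 2 2 * (?hx / ?hy) * (3/8 * (w (xs i, ys (Suc j)) - w (xs i, ys j))\<^sup>2 + 1/4 * (w (xs i, ys (Suc j)) - w (xs i, ys j)) * (w (xs (Suc i), ys (Suc j)) - w (xs (Suc i), ys j)) + 3/8 * (w (xs (Suc i), ys (Suc j)) - w (xs (Suc i), ys j))\<^sup>2)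
         + A0 2 1 * (((w (xs i, ys (Suc j)) - w (xs i, ys j)) + (w (xs (Suc i), ys (Suc j)) - w (xs (Suc i), ys j))) / 2) * (((w (xs (Suc i), ys j) - w (xs i, ys j)) + (w (xs (Suc i), ys (Suc j)) - w (xs i, ys (Suc j)))) / 2)
         - L * h * \<gamma> * (\<bar>w (xs i, ys (Suc j)) - w (xs i, ys j)\<bar> + \<bar>w (xs (Suc i), ys (Suc j)) - w (xs (Suc i), ys j)\<bar> + \<bar>w (xs (Suc i), ys j) - w (xs i, ys j)\<bar> + \<bar>w (xs (Suc i), ys (Suc j)) - w (xs i, ys (Suc j))\<bar>)\<^sup>2
         <= vcell (%y x. A (x, y) $ 2 $ 2) (%y x. A (x, y) $ 2 $ 1) (%y x. w (x, y)) (ys j) (ys (Suc j)) (xs i) (xs (Suc i)) (w (xs i, ys (Suc j)) - w (xs i, ys j)) (w (xs (Suc i), ys (Suc j)) - w (xs (Suc i), ys j))"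
        by (rule vcell_lower[OF ys_step[OF ij(2)] xs_step[OF ij(1)] ratio(1)[OF ij] gamma_ge1])
          (use A_mid_x[OF ij] Lx in \<open>auto simp: mid_def\<close>)
      then show ?thesis unfolding n E_def de by (simp only: add_ac)
    qed
    have el: "C1 * (s\<^sup>2 + t\<^sup>2) <= A0 1 1 * s\<^sup>2 + (A0 1 2 + A0 2 1) * s * t + A0 2 2 * t\<^sup>2" for s t
    proof -
      have "(mid xs i, mid ys j) \<in> \<Omega>" using m1' m2' by (simp add: box_Pair_real)
      from ell[OF this, of "vector [s, t]"] show ?thesis
        by (simp add: inner_vec_def sum_2 mat2_mult A0_def power2_eq_square algebra_simps)
    qed
    have low: "C1 / (4 * \<gamma>) * (d1\<^sup>2 + d2\<^sup>2 + e1\<^sup>2 + e2\<^sup>2) <=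
      (A0 1 1 * (?hy / ?hx) * (3/8 * d1\<^sup>2 + 1/4 * d1 * d2 + 3/8 * d2\<^sup>2) + A0 1 2 * ((d1 + d2) / 2) * ((e1 + e2) / 2))
      + (A0 2 2 * (?hx / ?hy) * (3/8 * e1\<^sup>2 + 1/4 * e1 * e2 + 3/8 * e2\<^sup>2) + A0 2 1 * ((e1 + e2) / 2) * ((d1 + d2) / 2))"
      by (rule cell_form_lower[OF el const_pos(1) _ _ ratio(1)[OF ij] ratio(2)[OF ij] gamma_ge1])
        (use xs_step[OF ij(1)] ys_step[OF ij(2)] in \<open>auto simp: de\<close>)
    \<comment> \<open>The freezing error is at most 4 L h \<gamma> times \<open>esq\<close> in each
      of the two directions, whence the constant 8.\<close>
    have "L * h * \<gamma> * E\<^sup>2 <= L * h * \<gamma> * (4 * esq ?W i j)"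
      using edges_sq[of ?W i j] const_pos h_pos gamma_ge1 unfolding Eq by (intro mult_left_mono) auto
    then have "C1 / (4 * \<gamma>) * (d1\<^sup>2 + d2\<^sup>2 + e1\<^sup>2 + e2\<^sup>2) - 2 * (L * h * \<gamma> * (4 * esq ?W i j)) <= ?v1 i j + ?v2 i j"
      using v1 v2 low by linarith
    moreover have "d1\<^sup>2 + d2\<^sup>2 + e1\<^sup>2 + e2\<^sup>2 = esq ?W i j" by (simp add: de esq_def)
    moreover have "(C1 / (4 * \<gamma>) - 8 * L * h * \<gamma>) * esq ?W i j = C1 / (4 * \<gamma>) * esq ?W i j - 2 * (L * h * \<gamma> * (4 * esq ?W i j))"
      by (simp add: algebra_simps)
    ultimately show ?thesis by (simp only:)
  qed
  have "(C1 / (4 * \<gamma>) - 8 * L * h * \<gamma>) * energy ?W <= (\<Sum>i<nx. \<Sum>j<ny. ?v1 i j + ?v2 i j)"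
    unfolding energy_def sum_distrib_left by (intro sum_mono cell) auto
  also have "\<dots> = dform (%x y. w (x, y)) ?W"
    unfolding dform_def vsum_def sum.distrib by (subst (2) sum.swap) simp
  finally show ?thesis .
qed

lemma AE_cell_interior:
  "AE p in lborel. p \<in> elt i j -->
     xs i < fst p \<and> fst p < xs (Suc i) \<and> fst p \<noteq> mid xs i \<and> ys j < snd p \<and> snd p < ys (Suc j) \<and> snd p \<noteq> mid ys j"
  using AE_off_lines(1)[of "xs i"] AE_off_lines(1)[of "xs (Suc i)"] AE_off_lines(2)[of "ys j"] AE_off_lines(2)[of "ys (Suc j)"]
    AE_off_lines(1)[of "mid xs i"] AE_off_lines(2)[of "mid ys j"]
proof eventually_elim
  case (elim p)
  then show ?case by (cases p) (auto simp: cbox_Pair_real)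
qed

text \<open>The lower bound rests on \<open>4 * w * z >= - (z - w)\<^sup>2\<close>.\<close>

lemma reaction_lower:
  assumes w: "w \<in> UU"
  shows "- (Mc * h\<^sup>2 * energy (V\<^sub>N w)) <= (LINT x:\<Omega>|lborel. c x * w x * Pistar xs nx ys ny w x)"
proof -
  let ?z = "Pistar xs nx ys ny w"
  let ?f = "%x. indicator \<Omega> x *\<^sub>R (c x * w x * ?z x)"
  have fi: "integrable lborel ?f"
    using int_Pistar[OF c_mult_int[OF UhD(1)[OF w]], of w] by (simp add: set_integrable_def)
  have "- (Mc * h\<^sup>2 * energy (V\<^sub>N w)) = (\<Sum>i<nx. \<Sum>j<ny. - (Mc * esq (V\<^sub>N w) i j * h\<^sup>2))"
    by (simp add: energy_def sum_distrib_left sum_negf mult_ac)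
  also have "\<dots> <= (\<Sum>i<nx. \<Sum>j<ny. LINT x:elt i j|lborel. ?f x)"
  proof (intro sum_mono)
    fix i j assume "i \<in> {..<nx}" "j \<in> {..<ny}"
    then have ij: "i < nx" "j < ny" by auto
    let ?K = "Mc * esq (V\<^sub>N w) i j"
    have K: "?K >= 0" using const_pos esq_nonneg by simp
    have "(xs (Suc i) - xs i) * (ys (Suc j) - ys j) <= h * h"
      using hx_le[OF ij(1)] hy_le[OF ij(2)] xs_step[OF ij(1)] ys_step[OF ij(2)] h_pos by (intro mult_mono) auto
    then have "- (?K * h\<^sup>2) <= - (?K * ((xs (Suc i) - xs i) * (ys (Suc j) - ys j)))"
      using K by (simp add: power2_eq_square mult_left_mono)
    also have "\<dots> <= (LINT x:elt i j|lborel. ?f x)"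
    proof (rule LINT_cell_lower[OF fi])
      show "AE p in lborel. p \<in> elt i j --> - ?K <= ?f p"
        using AE_cell_interior[of i j] c_bd
      proof eventually_elim
        case (elim p)
        show ?case
        proof
          assume p: "p \<in> elt i j"
          obtain x y where xy: "p = (x, y)" by force
          have in': "xs i < x" "x < xs (Suc i)" "x \<noteq> mid xs i" "ys j < y" "y < ys (Suc j)" "y \<noteq> mid ys j"
            using elim(1) p by (auto simp: xy)
          obtain k l where kl: "k = i \<or> k = Suc i" "l = j \<or> l = Suc j" "?z (x, y) = V\<^sub>N w k l"
            using Pistar_cell[OF w ij in'] by blast
          \<comment> \<open>Since \<open>?z\<close> is a corner value of the same cell, the square
            of \<open>w - ?z\<close> is at most \<open>4 * esq\<close>. With the cell area at most
            \<open>h^2\<close>, a possible negative contribution is of order \<open>h^2\<close>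
            times the energy.\<close>
          have "\<bar>w (x, y) - ?z (x, y)\<bar> <= edges (V\<^sub>N w) i j"
            unfolding kl(3) by (rule cell_corner_diff[OF w ij _ _ kl(1,2)]) (use in' in auto)
          then have "(w p - ?z p)\<^sup>2 <= (edges (V\<^sub>N w) i j)\<^sup>2" unfolding xy by (metis abs_ge_zero power2_abs power_mono)
          then have sq: "(w p - ?z p)\<^sup>2 <= 4 * esq (V\<^sub>N w) i j" using edges_sq[of "V\<^sub>N w" i j] by linarith
          have "4 * (w p * ?z p) = (w p + ?z p)\<^sup>2 - (w p - ?z p)\<^sup>2" by (simp add: power2_eq_square algebra_simps)
          then have wz: "- esq (V\<^sub>N w) i j <= w p * ?z p" using sq zero_le_power2[of "w p + ?z p"] by linarith
          show "- ?K <= ?f p"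
          proof (cases "p \<in> \<Omega>")
            case True
            have c0: "0 <= c p" "c p <= Mc" using c_nn[OF True] elim(2) True by auto
            have "- ?K <= c p * (- esq (V\<^sub>N w) i j)" using c0 esq_nonneg[of "V\<^sub>N w" i j] by (simp add: mult_right_mono)
            also have "\<dots> <= c p * (w p * ?z p)" using wz c0 by (intro mult_left_mono) auto
            finally show ?thesis using True by (simp add: mult.assoc)
          qed (use K in simp)
        qed
      qed
    qed (use xs_step[OF ij(1)] ys_step[OF ij(2)] in auto)
    finally show "- (Mc * esq (V\<^sub>N w) i j * h\<^sup>2) <= (LINT x:elt i j|lborel. ?f x)" .
  qed
  also have "\<dots> = (LINT x:cbox (a1, a2) (b1, b2)|lborel. ?f x)" by (rule LINT_cells[OF fi])
  also have "\<dots> = (LINT x:\<Omega>|lborel. c x * w x * ?z x)"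
    by (rule LINT_box_cbox)
  finally show ?thesis .
qed

lemma ah_coercive:
  assumes w: "w \<in> UU"
  shows "(C1 / (4 * \<gamma>) - 8 * L * h * \<gamma> - Mc * h\<^sup>2) * energy (V\<^sub>N w) <= ah A c xs nx ys ny w (Pistar xs nx ys ny w)"
  using dform_coercive[OF w] reaction_lower[OF w] unfolding ah_eq[OF w w] by (simp add: algebra_simps)

text \<open>On each cell \<open>Pistar\<close> takes corner values of v almost everywhere, so it is
  bounded by \<open>corners\<close> and only the L1 norm of g on the cell remains.\<close>

lemma reaction_upper:
  assumes v: "v \<in> UU" and g: "continuous_on (cbox (a1, a2) (b1, b2)) g"
  shows "\<bar>LINT x:\<Omega>|lborel. c x * g x * Pistar xs nx ys ny v x\<bar> <= (\<Sum>i<nx. \<Sum>j<ny.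
     Mc * (corners (V\<^sub>N v) i j)
       * integral (elt i j) (%p. \<bar>g p\<bar>))"
proof -
  let ?z = "Pistar xs nx ys ny v"
  let ?m = "%i j. corners (V\<^sub>N v) i j"
  let ?f = "%x. indicator \<Omega> x *\<^sub>R (c x * g x * ?z x)"
  have fi: "integrable lborel ?f"
    using int_Pistar[OF c_mult_int[OF g], of v] by (simp add: set_integrable_def)
  have "(LINT x:\<Omega>|lborel. c x * g x * ?z x) = (LINT x:cbox (a1, a2) (b1, b2)|lborel. ?f x)"
    by (rule LINT_box_cbox[symmetric])
  also have "\<dots> = (\<Sum>i<nx. \<Sum>j<ny. LINT x:elt i j|lborel. ?f x)"
    by (rule LINT_cells[OF fi, symmetric])
  finally have e: "(LINT x:\<Omega>|lborel. c x * g x * ?z x) = \<dots>" .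
  have s: "\<bar>\<Sum>i<nx. \<Sum>j<ny. F i j\<bar> <= (\<Sum>i<nx. \<Sum>j<ny. \<bar>F i j\<bar>)" for F :: "nat => nat => real"
    by (rule order_trans[OF sum_abs sum_mono]) (rule sum_abs)
  have "\<bar>LINT x:\<Omega>|lborel. c x * g x * ?z x\<bar> <= (\<Sum>i<nx. \<Sum>j<ny. \<bar>LINT x:elt i j|lborel. ?f x\<bar>)"
    unfolding e by (rule s)
  also have "\<dots> <= (\<Sum>i<nx. \<Sum>j<ny. Mc * ?m i j * integral (elt i j) (%p. \<bar>g p\<bar>))"
  proof (intro sum_mono)
    fix i j assume "i \<in> {..<nx}" "j \<in> {..<ny}"
    then have ij: "i < nx" "j < ny" by auto
    let ?C = "elt i j"
    have sub: "?C \<subseteq> cbox (a1, a2) (b1, b2)"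
      using xs_in[of i] xs_in[of "Suc i"] ys_in[of j] ys_in[of "Suc j"] ij by (auto simp: cbox_Pair_real)
    have cg: "continuous_on ?C (%p. \<bar>g p\<bar>)" by (intro continuous_on_rabs continuous_on_subset[OF g sub])
    have "\<bar>LINT x:?C|lborel. ?f x\<bar> <= (\<integral>x. norm (indicator ?C x *\<^sub>R ?f x) \<partial>lborel)"
      unfolding set_lebesgue_integral_def real_norm_def[symmetric] by (rule integral_norm_bound)
    also have "\<dots> <= (\<integral>x. Mc * ?m i j * (indicator ?C x *\<^sub>R \<bar>g x\<bar>) \<partial>lborel)"
    proof (rule integral_mono_AE)
      show "integrable lborel (%x. norm (indicator ?C x *\<^sub>R ?f x))"
        by (intro integrable_norm integrable_mult_indicator[OF _ fi]) simp
      show "integrable lborel (%x. Mc * ?m i j * (indicator ?C x *\<^sub>R \<bar>g x\<bar>))"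
        using LINT_cbox_HK(1)[OF cg] by (intro integrable_mult_right) (simp add: set_integrable_def)
      show "AE x in lborel. norm (indicator ?C x *\<^sub>R ?f x) <= Mc * ?m i j * (indicator ?C x *\<^sub>R \<bar>g x\<bar>)"
        using AE_cell_interior[of i j] c_bd
      proof eventually_elim
        case (elim p)
        show ?case
        proof (cases "p \<in> ?C \<and> p \<in> \<Omega>")
          case True
          obtain x y where xy: "p = (x, y)" by force
          have in': "xs i < x" "x < xs (Suc i)" "x \<noteq> mid xs i" "ys j < y" "y < ys (Suc j)" "y \<noteq> mid ys j"
            using elim(1) True by (auto simp: xy)
          obtain k l where kl: "k = i \<or> k = Suc i" "l = j \<or> l = Suc j" "?z (x, y) = V\<^sub>N v k l"
            using Pistar_cell[OF v ij in'] by blast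
          have "\<bar>?z p\<bar> <= ?m i j" unfolding xy kl(3) using kl(1,2) by (elim disjE) simp_all
          then have "\<bar>c p\<bar> * \<bar>?z p\<bar> * \<bar>g p\<bar> <= Mc * ?m i j * \<bar>g p\<bar>"
            using elim(2) True const_pos by (intro mult_right_mono mult_mono) auto
          then show ?thesis using True by (simp add: abs_mult mult_ac)
        next
          case False
          then show ?thesis using const_pos by (auto simp: indicator_def)
        qed
      qed
    qed
    also have "\<dots> = Mc * ?m i j * integral ?C (%p. \<bar>g p\<bar>)"
      using LINT_cbox_HK(2)[OF cg] by (simp add: set_lebesgue_integral_def)
    finally show "\<bar>LINT x:?C|lborel. ?f x\<bar> <= Mc * ?m i j * integral ?C (%p. \<bar>g p\<bar>)" .
  qed
  finally show ?thesis .
qed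

end

subsection \<open>The bilinear interpolant\<close>

lemma hat_sum:
  fixes s :: "nat => real"
  assumes s: "!!i j. i < j ==> j <= n ==> s i < s j" and i: "i < n" and t: "t \<in> {s i..s (Suc i)}"
  shows "(\<Sum>k\<le>n. F k * hat s n k t) = (F i * (s (Suc i) - t) + F (Suc i) * (t - s i)) / (s (Suc i) - s i)"
proof -
  have st: "s i < s (Suc i)" using s[of i "Suc i"] i by simp
  have mono: "s k <= s l" if "k <= l" "l <= n" for k l using s[of k l] that by (cases "k = l") auto
  have h0: "hat s n k t = 0" if k: "k <= n" "k \<noteq> i" "k \<noteq> Suc i" for k
  proof (cases "k < i")
    case True
    then have "s k < s i" "s (Suc k) <= s i" using s[of k i] mono[of "Suc k" i] i by auto
    then show ?thesis using t by (auto simp: hat_def)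
  next
    case False
    then have "s (Suc i) < s k" "s (Suc i) <= s (k - 1)" using s[of "Suc i" k] mono[of "Suc i" "k - 1"] k by auto
    then show ?thesis using t by (auto simp: hat_def)
  qed
  have h1: "hat s n i t = (s (Suc i) - t) / (s (Suc i) - s i)"
  \<comment> \<open>At the node itself the first branch of \<open>hat\<close> applies when
    \<open>0 < i\<close>; both branches have the value 1 there.\<close>
  proof (cases "t = s i")
    case True
    have "0 < i ==> s (i - 1) < s i" using s[of "i - 1" i] i by simp
    then show ?thesis using True st i by (cases "i = 0") (auto simp: hat_def)
  qed (use t i in \<open>auto simp: hat_def\<close>)
  have h2: "hat s n (Suc i) t = (t - s i) / (s (Suc i) - s i)" using t by (simp add: hat_def)
  have "(\<Sum>k\<le>n. F k * hat s n k t) = (\<Sum>k\<in>{i, Suc i}. F k * hat s n k t)"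
    by (rule sum.mono_neutral_right) (use h0 i in auto)
  also have "\<dots> = (F i * (s (Suc i) - t) + F (Suc i) * (t - s i)) / (s (Suc i) - s i)"
    by (simp add: h1 h2 add_divide_distrib)
  finally show ?thesis .
qed

lemma interval_cover:
  fixes s :: "nat => real"
  assumes "0 < n" "t \<in> {s 0..s n}"
  obtains i where "i < n" "t \<in> {s i..s (Suc i)}"
proof -
  have "\<exists>i<n. t \<in> {s i..s (Suc i)}" using assms
  proof (induction n)
    case (Suc n)
    show ?case
    proof (cases "t <= s n \<and> n > 0")
      case True
      then show ?thesis using Suc by (auto intro: less_SucI)
    next
      case False
      then show ?thesis using Suc.prems by (intro exI[of _ n]) (auto simp: not_le)
    qed
  qed simp
  then show ?thesis using that by blast
qed

lemma bilin_Q1: "Q1_on S (%p. bilin u x0 x1 y0 y1 (fst p) (snd p))"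
proof -
  let ?D = "(x1 - x0) * (y1 - y0)"
  have "bilin u x0 x1 y0 y1 x y
    = (u x0 y0 * x1 * y1 - u x0 y1 * x1 * y0 - u x1 y0 * x0 * y1 + u x1 y1 * x0 * y0) / ?D
      + ((- u x0 y0 * y1 + u x0 y1 * y0 + u x1 y0 * y1 - u x1 y1 * y0) / ?D) * x
      + ((- u x0 y0 * x1 + u x0 y1 * x1 + u x1 y0 * x0 - u x1 y1 * x0) / ?D) * y
      + ((u x0 y0 - u x0 y1 - u x1 y0 + u x1 y1) / ?D) * x * y" for x y
  proof -
    have "bilin u x0 x1 y0 y1 x y = ((u x0 y0 * (y1 - y) + u x0 y1 * (y - y0)) * (x1 - x) + (u x1 y0 * (y1 - y) + u x1 y1 * (y - y0)) * (x - x0)) / ?D"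
    proof -
      have "(p / m * r + q / m * s) / n = (p * r + q * s) / (n * m)" for p q r s m n :: real
        by (simp add: add_divide_distrib mult.commute)
      then show ?thesis unfolding bilin_def .
    qed
    also have "(u x0 y0 * (y1 - y) + u x0 y1 * (y - y0)) * (x1 - x) + (u x1 y0 * (y1 - y) + u x1 y1 * (y - y0)) * (x - x0)
      = (u x0 y0 * x1 * y1 - u x0 y1 * x1 * y0 - u x1 y0 * x0 * y1 + u x1 y1 * x0 * y0)
      + (- u x0 y0 * y1 + u x0 y1 * y0 + u x1 y0 * y1 - u x1 y1 * y0) * x
      + (- u x0 y0 * x1 + u x0 y1 * x1 + u x1 y0 * x0 - u x1 y1 * x0) * y
      + (u x0 y0 - u x0 y1 - u x1 y0 + u x1 y1) * x * y"
      by (simp add: algebra_simps)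
    moreover have "(P + Q * x + R * y + S * x * y) / D = P / D + Q / D * x + R / D * y + S / D * x * y" for P Q R S D :: real
      by (simp add: add_divide_distrib)
    ultimately show ?thesis by (simp only:)
  qed
  then show ?thesis unfolding Q1_on_def by blast
qed

lemma Q1_on_diff: "Q1_on S v ==> Q1_on S w ==> Q1_on S (%p. v p - w p)"
  unfolding Q1_on_def
proof (elim exE)
  fix c0 c1 c2 c3 d0 d1 d2 d3
  assume "\<forall>p\<in>S. v p = c0 + c1 * fst p + c2 * snd p + c3 * fst p * snd p" "\<forall>p\<in>S. w p = d0 + d1 * fst p + d2 * snd p + d3 * fst p * snd p"
  then have "\<forall>p\<in>S. v p - w p = (c0 - d0) + (c1 - d1) * fst p + (c2 - d2) * snd p + (c3 - d3) * fst p * snd p"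
    by (simp add: algebra_simps)
  then show "\<exists>c0 c1 c2 c3. \<forall>p\<in>S. v p - w p = c0 + c1 * fst p + c2 * snd p + c3 * fst p * snd p" by blast
qed

context mesh
begin

lemma Pih_cell:
  assumes ij: "i < nx" "j < ny" and x: "x \<in> {xs i..xs (Suc i)}" and y: "y \<in> {ys j..ys (Suc j)}"
  shows "Pih xs nx ys ny u (x, y) = bil u i j x y"
proof -
  have hx: "(\<Sum>k\<le>nx. F k * hat xs nx k x) = (F i * (xs (Suc i) - x) + F (Suc i) * (x - xs i)) / (xs (Suc i) - xs i)" for F
    by (rule hat_sum[OF _ ij(1) x]) (rule xs_mono)
  have hy: "(\<Sum>k\<le>ny. F k * hat ys ny k y) = (F j * (ys (Suc j) - y) + F (Suc j) * (y - ys j)) / (ys (Suc j) - ys j)" for F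
    by (rule hat_sum[OF _ ij(2) y]) (rule ys_mono)
  have "Pih xs nx ys ny u (x, y) = (\<Sum>k\<le>nx. (\<Sum>l\<le>ny. u (xs k, ys l) * hat ys ny l y) * hat xs nx k x)"
    unfolding Pih_def node_idx_def sum_distrib_right sum.cartesian_product node_def by (intro sum.cong) auto
  also have "\<dots> = bil u i j x y"
    unfolding hx hy bilin_def by (rule refl)
  finally show ?thesis .
qed

lemma Pih_in_Uh:
  assumes u: "!!p. p \<in> cbox (a1, a2) (b1, b2) - \<Omega> ==> u p = 0"
  shows "Pih xs nx ys ny u \<in> UU"
proof -
  let ?C = "%(i, j). {xs i..xs (Suc i)} \<times> {ys j..ys (Suc j)}" and ?P = "Pih xs nx ys ny u"
  have e: "?P p = bil u i j (fst p) (snd p)" if "i < nx" "j < ny" "p \<in> ?C (i, j)" for i j p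
    using Pih_cell[OF that(1,2), of "fst p" "snd p"] that(3) by auto
  have cover: "cbox (a1, a2) (b1, b2) \<subseteq> (\<Union>K\<in>{..<nx} \<times> {..<ny}. ?C K)"
  proof
    fix p assume "p \<in> cbox (a1, a2) (b1, b2)"
    then obtain x y where xy: "p = (x, y)" "x \<in> {xs 0..xs nx}" "y \<in> {ys 0..ys ny}"
      by (cases p) (auto simp: cbox_Pair_real ends)
    obtain i where i: "i < nx" "x \<in> {xs i..xs (Suc i)}" by (rule interval_cover[OF n_pos(1) xy(2)])
    obtain j where j: "j < ny" "y \<in> {ys j..ys (Suc j)}" by (rule interval_cover[OF n_pos(2) xy(3)])
    show "p \<in> (\<Union>K\<in>{..<nx} \<times> {..<ny}. ?C K)" using i j xy(1) by (intro UN_I[of "(i, j)"]) auto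
  qed
  have c: "continuous_on (?C K) ?P" if K: "K \<in> {..<nx} \<times> {..<ny}" for K
  proof -
    obtain i j where ij: "K = (i, j)" "i < nx" "j < ny" using K by auto
    have "continuous_on (?C K) (%p. bil u i j (fst p) (snd p))"
      unfolding bilin_def using xs_step[OF ij(2)] ys_step[OF ij(3)] by (intro continuous_intros) auto
    then show ?thesis by (rule continuous_on_eq) (use e[OF ij(2,3)] ij(1) in auto)
  qed
  have "continuous_on (\<Union>K\<in>{..<nx} \<times> {..<ny}. ?C K) ?P"
    by (rule continuous_on_closed_Union) (use c in \<open>auto simp: closed_Times\<close>)
  then have 1: "continuous_on (cbox (a1, a2) (b1, b2)) ?P" using cover continuous_on_subset by blast
  have 2: "Q1_on (elem xs ys i j) ?P" if ij: "i < nx" "j < ny" for i j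
    using bilin_Q1[of "elem xs ys i j" "%x y. u (x, y)"] e[OF ij]
    by (simp add: Q1_on_def elem_def)
  have "\<Omega> \<noteq> {}" using ab by (simp add: box_Pair_real)
  then have fr: "frontier \<Omega> = cbox (a1, a2) (b1, b2) - \<Omega>" by (simp add: frontier_box)
  have 3: "?P p = 0" if p: "p \<in> cbox (a1, a2) (b1, b2) - \<Omega>" for p
  proof -
    obtain x y where xy: "p = (x, y)" "x \<in> {xs 0..xs nx}" "y \<in> {ys 0..ys ny}" "x = a1 \<or> x = b1 \<or> y = a2 \<or> y = b2"
      using p by (cases p) (auto simp: cbox_Pair_real box_Pair_real ends)
    have z: "u (s, t) = 0" if "s \<in> {a1..b1}" "t \<in> {a2..b2}" "s = a1 \<or> s = b1 \<or> t = a2 \<or> t = b2" for s t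
      by (rule u) (use that in \<open>auto simp: cbox_Pair_real box_Pair_real\<close>)
    obtain i where i: "i < nx" "x \<in> {xs i..xs (Suc i)}" by (rule interval_cover[OF n_pos(1) xy(2)])
    obtain j where j: "j < ny" "y \<in> {ys j..ys (Suc j)}" by (rule interval_cover[OF n_pos(2) xy(3)])
    have X: "xs i \<in> {a1..b1}" "xs (Suc i) \<in> {a1..b1}" "ys j \<in> {a2..b2}" "ys (Suc j) \<in> {a2..b2}"
      using xs_in[of i] xs_in[of "Suc i"] ys_in[of j] ys_in[of "Suc j"] i j by auto
    have S: "xs i < xs (Suc i)" "ys j < ys (Suc j)" using xs_step ys_step i j by auto
    have "bil u i j x y = 0"
      using xy(4)
    proof (elim disjE)
      assume "x = a1"
      then have "xs i = a1" "x = xs i" using i X by auto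
      then show ?thesis using z[OF X(1,3)] z[OF X(1,4)] by (simp add: bilin_def)
    next
      assume "x = b1"
      then have "xs (Suc i) = b1" "x = xs (Suc i)" using i X by auto
      then show ?thesis using z[OF X(2,3)] z[OF X(2,4)] by (simp add: bilin_def)
    next
      assume "y = a2"
      then have "ys j = a2" "y = ys j" using j X by auto
      then show ?thesis using z[OF X(1,3)] z[OF X(2,3)] by (simp add: bilin_def)
    next
      assume "y = b2"
      then have "ys (Suc j) = b2" "y = ys (Suc j)" using j X by auto
      then show ?thesis using z[OF X(1,4)] z[OF X(2,4)] by (simp add: bilin_def)
    qed
    then show ?thesis using Pih_cell[OF i(1) j(1) i(2) j(2)] xy(1) by simp
  qed
  show ?thesis unfolding Uh_def using 1 2 3 fr by auto
qed

lemma Pih_node: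
  assumes "i <= nx" "j <= ny"
  shows "Pih xs nx ys ny u (xs i, ys j) = u (xs i, ys j)"
proof -
  have c: "\<exists>k<n. s i \<in> {s k..s (Suc k)} \<and> (i = k \<or> i = Suc k)" if "i <= n" "0 < n" "!!k. k < n ==> s k < s (Suc k)" for s :: "nat => real" and i n
  proof (cases "i < n")
    case True
    then show ?thesis using that(3)[of i] by (intro exI[of _ i]) auto
  next
    case False
    then show ?thesis using that(3)[of "i - 1"] that(1,2) by (intro exI[of _ "i - 1"]) auto
  qed
  obtain k where k: "k < nx" "xs i \<in> {xs k..xs (Suc k)}" "i = k \<or> i = Suc k" using c[of i nx xs] assms n_pos xs_step by blast
  obtain l where l: "l < ny" "ys j \<in> {ys l..ys (Suc l)}" "j = l \<or> j = Suc l" using c[of j ny ys] assms n_pos ys_step by blast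
  have S: "xs (Suc k) - xs k \<noteq> 0" "ys (Suc l) - ys l \<noteq> 0" using xs_step[OF k(1)] ys_step[OF l(1)] by auto
  have d: "(p * m) / m = p" if "m \<noteq> 0" for p m :: real using that by simp
  show ?thesis
    unfolding Pih_cell[OF k(1) l(1) k(2) l(2)] using k(3) l(3) S by (elim disjE) (simp_all add: bilin_def)
qed

lemma Uh_diff:
  assumes "v \<in> UU" "w \<in> UU" shows "(%p. v p - w p) \<in> UU"
  using assms unfolding Uh_def by (auto intro!: continuous_intros Q1_on_diff)

end

subsection \<open>Consistency\<close>

text \<open>The orders that occur in the cell estimates, completed to be symmetric in x and y. The
  order (1, 1) is absent because bilinear functions include the product xy.\<close>

definition rest :: "(real => real => real => real => nat => nat => real) => (nat => real) => (nat => real) => nat => nat => real" where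
  "rest rm xs ys i j = (\<Sum>(k, l)\<leftarrow>[(2, 0), (0, 2), (3, 0), (0, 3), (2, 1), (1, 2)]. rm (xs i) (xs (Suc i)) (ys j) (ys (Suc j)) k l)"

lemma rest_flip: "rest (%k1 k2 l1 l2 i j. rm l1 l2 k1 k2 j i) ys xs j i = rest rm xs ys i j"
  by (simp add: rest_def)

lemma edges_flip: "edges (%j i. W i j) j i = edges W i j"
  by (simp add: edges_def)

lemma mesh_subcell:
  assumes "mesh a1 b1 a2 b2 xs nx ys ny \<gamma>" "approx a1 b1 a2 b2 u V B rm MU" "i < nx" "j < ny"
  shows "approx.subcell a1 b1 a2 b2 (xs i) (xs (Suc i)) (ys j) (ys (Suc j))"
    "0 <= rest rm xs ys i j"
    "rm (xs i) (xs (Suc i)) (ys j) (ys (Suc j)) 2 0 <= rest rm xs ys i j"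
    "rm (xs i) (xs (Suc i)) (ys j) (ys (Suc j)) 0 2 <= rest rm xs ys i j"
    "rm (xs i) (xs (Suc i)) (ys j) (ys (Suc j)) 3 0 <= rest rm xs ys i j"
    "rm (xs i) (xs (Suc i)) (ys j) (ys (Suc j)) 2 1 <= rest rm xs ys i j"
    "rm (xs i) (xs (Suc i)) (ys j) (ys (Suc j)) 1 2 <= rest rm xs ys i j"
    "rm (xs i) (xs (Suc i)) (ys j) (ys (Suc j)) 2 0 + rm (xs i) (xs (Suc i)) (ys j) (ys (Suc j)) 0 2 + rm (xs i) (xs (Suc i)) (ys j) (ys (Suc j)) 1 2 <= rest rm xs ys i j"
proof -
  interpret mesh a1 b1 a2 b2 xs nx ys ny \<gamma> by (rule assms)
  interpret P: approx a1 b1 a2 b2 u V B rm MU by (rule assms)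
  show s: "P.subcell (xs i) (xs (Suc i)) (ys j) (ys (Suc j))"
    using assms(3,4) xs_in[of i] xs_in[of "Suc i"] ys_in[of j] ys_in[of "Suc j"] xs_step[of i] ys_step[of j] by (simp add: P.subcell_def)
  note n = P.rm_nonneg[OF s]
  have n': "0 <= rm (xs i) (xs (Suc i)) (ys j) (ys (Suc j)) 2 0" "0 <= rm (xs i) (xs (Suc i)) (ys j) (ys (Suc j)) 0 2"
    "0 <= rm (xs i) (xs (Suc i)) (ys j) (ys (Suc j)) 3 0" "0 <= rm (xs i) (xs (Suc i)) (ys j) (ys (Suc j)) 0 3"
    "0 <= rm (xs i) (xs (Suc i)) (ys j) (ys (Suc j)) 2 1" "0 <= rm (xs i) (xs (Suc i)) (ys j) (ys (Suc j)) 1 2"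
    by (rule n; simp)+
  show "0 <= rest rm xs ys i j"
    "rm (xs i) (xs (Suc i)) (ys j) (ys (Suc j)) 2 0 <= rest rm xs ys i j"
    "rm (xs i) (xs (Suc i)) (ys j) (ys (Suc j)) 0 2 <= rest rm xs ys i j"
    "rm (xs i) (xs (Suc i)) (ys j) (ys (Suc j)) 3 0 <= rest rm xs ys i j"
    "rm (xs i) (xs (Suc i)) (ys j) (ys (Suc j)) 2 1 <= rest rm xs ys i j"
    "rm (xs i) (xs (Suc i)) (ys j) (ys (Suc j)) 1 2 <= rest rm xs ys i j"
    "rm (xs i) (xs (Suc i)) (ys j) (ys (Suc j)) 2 0 + rm (xs i) (xs (Suc i)) (ys j) (ys (Suc j)) 0 2 + rm (xs i) (xs (Suc i)) (ys j) (ys (Suc j)) 1 2 <= rest rm xs ys i j"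
    using n' by (simp_all add: rest_def)
qed

text \<open>Supplies \<open>vertical_flux_error\<close> with the estimates for the limit function,
  \<open>rest\<close> as the local quantity and K = 3\<gamma>: the error of \<open>cell_dy\<close>
  has three terms, each at most \<gamma> times \<open>rest\<close> because h <= 1 <= \<gamma>.
  Keeping \<open>a\<close>, \<open>b\<close> and \<open>q\<close> abstract lets the same lemma serve
  the horizontal edges.\<close>

lemma vertical_consistency:
  assumes mesh: "mesh a1 b1 a2 b2 xs nx ys ny \<gamma>" and ap: "approx a1 b1 a2 b2 u V B rm MU"
    and hx: "!!i. i < nx ==> xs (Suc i) - xs i <= h" and hy: "!!j. j < ny ==> ys (Suc j) - ys j <= h" and h1: "h <= 1" and L: "L >= 0"
    and a: "!!x. a1 < x ==> x < b1 ==> continuous_on {a2..b2} (a x)" and b: "!!x. a1 < x ==> x < b1 ==> continuous_on {a2..b2} (b x)"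
    and q: "!!x. a1 < x ==> x < b1 ==> continuous_on {a2..b2} (q x)"
    and qF: "!!x s t. a1 < x ==> x < b1 ==> a2 <= s ==> s <= t ==> t <= b2 ==> integral {s..t} (q x) = u x t - u x s"
    and qe: "!!x y. x \<in> {a1..b1} ==> y \<in> {a2..b2} ==> q x y = approx.q V x y"
    and bound: "!!x y. a1 < x ==> x < b1 ==> y \<in> {a2..b2} ==> \<bar>a x y\<bar> <= Mb \<and> \<bar>b x y\<bar> <= Mb"
    and bL: "!!x y y'. a1 < x ==> x < b1 ==> a2 <= y ==> y <= y' ==> y' <= b2 ==> \<bar>b x y' - b x y\<bar> <= L * (y' - y)"
    and bL': "!!x x' y. a1 <= x ==> x <= x' ==> x' <= b1 ==> a2 < y ==> y < b2 ==> \<bar>b x' y - b x y\<bar> <= L * (x' - x)"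
    and W0: "!!j. W 0 j = 0 \<and> W nx j = 0"
  shows "\<bar>flux_sum (%x y. a x y * approx.p V x y + b x y * q x y) xs nx ys ny W - vsum a b u xs nx ys ny W\<bar>
    <= (\<Sum>i<nx. \<Sum>j<ny. 3 * \<gamma> * h * (2 * Mb + L) * rest rm xs ys i j * edges W i j)"
proof -
  interpret mesh a1 b1 a2 b2 xs nx ys ny \<gamma> by (rule mesh)
  interpret P: approx a1 b1 a2 b2 u V B rm MU by (rule ap)
  interpret F: approx a2 b2 a1 b1 "%x y. u y x" "%n i j x y. V n j i y x" "%n k1 k2 l1 l2 i j. B n l1 l2 k1 k2 j i"
    "%k1 k2 l1 l2 i j. rm l1 l2 k1 k2 j i" MU by (rule approx_flip[OF ap])
  note sub = mesh_subcell[OF mesh ap] and subF = mesh_subcell(1)[OF flip_mesh F.approx_axioms]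
  have h0: "h > 0" using hx[of 0] xs_step[of 0] n_pos by simp
  have g: "\<gamma> >= 1" by (rule gamma_ge1)
  have ycell: "{ys j..ys (Suc j)} \<subseteq> {a2..b2}" if "j < ny" for j using ys_in[of j] ys_in[of "Suc j"] that by auto
  have pc: "continuous_on {ys j..ys (Suc j)} (P.p (mid xs i))" if "i < nx" "j < ny" for i j
    by (rule continuous_on_compose2[OF P.p_cont, of _ "%y. (mid xs i, y)", simplified])
      (use mid_in'(1)[OF that(1)] ycell[OF that(2)] in \<open>auto intro!: continuous_intros simp: cbox_Pair_real\<close>)
  have step_le: "c * r <= 3 * \<gamma> * h * rest rm xs ys i j" if "r <= rest rm xs ys i j" "0 <= c" "c <= 3 * \<gamma> * h" "i < nx" "j < ny" for c r i j
    using mult_mono[OF that(3,1)] sub(2)[OF that(4,5)] that(2) g h0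
    by (meson mult_left_mono mult_right_mono order_trans that)
  have hg: "h <= \<gamma> * h" "h <= \<gamma>" using g h0 h1 mult_right_mono[of 1 \<gamma> h] by auto
  have hr: "(xs (Suc i) - xs i) / (ys (Suc j) - ys j) <= \<gamma>" "(ys (Suc j) - ys j) / (xs (Suc i) - xs i) <= \<gamma>" if "i < nx" "j < ny" for i j
    using ratio[OF that] xs_step[OF that(1)] ys_step[OF that(2)] by (simp_all add: divide_le_eq)
  have E: "\<bar>flux_sum (%x y. a x y * P.p x y + b x y * q x y) xs nx ys ny W - vsum a b u xs nx ys ny W\<bar>
    <= (\<Sum>i<nx. \<Sum>j<ny. (3 * \<gamma>) * h * (2 * Mb + L) * rest rm xs ys i j * edges W i j)"
  proof (rule vertical_flux_error)
    show "W 0 j = 0 \<and> W nx j = 0" for j by (rule W0)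
    show "xs i < xs (Suc i)" if "i < nx" for i using xs_step[OF that] .
    show "ys j < ys (Suc j)" if "j < ny" for j using ys_step[OF that] .
    show "xs (Suc i) - xs i <= h" if "i < nx" for i using hx[OF that] .
    show "0 <= 3 * \<gamma>" "0 <= h" "0 <= L" using g h0 L by auto
    fix i j assume j: "j < ny"
    { assume i: "Suc i < nx"
      have "mid xs (Suc i) - mid xs i <= h" "mid xs i <= mid xs (Suc i)"
        unfolding mid_def using hx[of i] hx[OF i] xs_step[of i] xs_step[OF i] Suc_lessD[OF i] by argo+
      moreover have "\<bar>b (mid xs (Suc i)) (mid ys j) - b (mid xs i) (mid ys j)\<bar> <= L * (mid xs (Suc i) - mid xs i)"
        by (rule bL') (use mid_in'(1)[of i] mid_in'(1)[of "Suc i"] mid_in'(2)[OF j] i calculation in auto)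
      ultimately show "\<bar>b (mid xs i) (mid ys j) - b (mid xs (Suc i)) (mid ys j)\<bar> <= L * h"
        using mult_left_mono[of "mid xs (Suc i) - mid xs i" h L] L by (simp add: abs_minus_commute) }
    assume i: "i < nx"
    note mi = mid_in'(1)[OF i, THEN conjunct1] mid_in'(1)[OF i, THEN conjunct2]
    note yc = ycell[OF j] and s = sub(1)[OF i j] and sF = subF[OF j i] and S = sub[OF i j] and st = xs_step[OF i] ys_step[OF j]
    show "0 <= rest rm xs ys i j" by (rule sub(2)[OF i j])
    show "continuous_on {ys j..ys (Suc j)} (a (mid xs i)) \<and> continuous_on {ys j..ys (Suc j)} (b (mid xs i))
      \<and> continuous_on {ys j..ys (Suc j)} (P.p (mid xs i)) \<and> continuous_on {ys j..ys (Suc j)} (q (mid xs i))"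
      using pc[OF i j] a[OF mi] b[OF mi] q[OF mi] continuous_on_subset[OF _ yc] by blast
    have c1: "(ys (Suc j) - ys j)\<^sup>2 / (xs (Suc i) - xs i) <= \<gamma> * h"
    proof -
      have "(ys (Suc j) - ys j) / (xs (Suc i) - xs i) * (ys (Suc j) - ys j) <= \<gamma> * h"
        using hr(2)[OF i j] hy[OF j] st g by (intro mult_mono) auto
      then show ?thesis by (simp add: power2_eq_square)
    qed
    have "(xs (Suc i) - xs i) * rm (xs i) (xs (Suc i)) (ys j) (ys (Suc j)) 3 0 <= h * rest rm xs ys i j"
      using S(2,5) hx[OF i] st h0 by (meson less_imp_le diff_ge_0_iff_ge mult_left_mono mult_right_mono order_trans)
    moreover have "(ys (Suc j) - ys j)\<^sup>2 / (xs (Suc i) - xs i) * rm (xs i) (xs (Suc i)) (ys j) (ys (Suc j)) 1 2 <= \<gamma> * h * rest rm xs ys i j"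
    proof -
      have "(ys (Suc j) - ys j)\<^sup>2 / (xs (Suc i) - xs i) * rm (xs i) (xs (Suc i)) (ys j) (ys (Suc j)) 1 2
        <= (ys (Suc j) - ys j)\<^sup>2 / (xs (Suc i) - xs i) * rest rm xs ys i j"
        using S(7) st by (intro mult_left_mono) auto
      also have "\<dots> <= \<gamma> * h * rest rm xs ys i j" using c1 S(2) by (rule mult_right_mono)
      finally show ?thesis .
    qed
    moreover have hU: "h * rest rm xs ys i j <= \<gamma> * h * rest rm xs ys i j" "0 <= h * rest rm xs ys i j"
      "h * rest rm xs ys i j <= \<gamma> * rest rm xs ys i j"
      by (rule mult_right_mono[OF hg(1) S(2)] mult_nonneg_nonneg[OF less_imp_le[OF h0] S(2)] mult_right_mono[OF hg(2) S(2)])+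
    ultimately show "integral {ys j..ys (Suc j)} (%y. \<bar>P.p (mid xs i) y - cell_dx u (xs i) (xs (Suc i)) (ys j) (ys (Suc j)) y\<bar>) <= 3 * \<gamma> * h * rest rm xs ys i j"
      using P.u_cell_dx_error[OF s] unfolding mid_def by linarith
    have "integral {ys j..ys (Suc j)} (%y. \<bar>q (mid xs i) y - cell_dy u (xs i) (xs (Suc i)) (ys j) (ys (Suc j))\<bar>)
      = integral {ys j..ys (Suc j)} (%y. \<bar>P.q (mid xs i) y - cell_dy u (xs i) (xs (Suc i)) (ys j) (ys (Suc j))\<bar>)"
      by (rule Henstock_Kurzweil_Integration.integral_cong) (use qe[of "mid xs i"] mi yc in auto)
    moreover have "(ys (Suc j) - ys j) / (xs (Suc i) - xs i) * rm (xs i) (xs (Suc i)) (ys j) (ys (Suc j)) 0 2 <= \<gamma> * rest rm xs ys i j"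
    proof -
      have "(ys (Suc j) - ys j) / (xs (Suc i) - xs i) * rm (xs i) (xs (Suc i)) (ys j) (ys (Suc j)) 0 2
        <= (ys (Suc j) - ys j) / (xs (Suc i) - xs i) * rest rm xs ys i j"
        using S(4) st by (intro mult_left_mono) auto
      also have "\<dots> <= \<gamma> * rest rm xs ys i j" using hr(2)[OF i j] S(2) by (rule mult_right_mono)
      finally show ?thesis .
    qed
    moreover have "(ys (Suc j) - ys j) * rm (xs i) (xs (Suc i)) (ys j) (ys (Suc j)) 1 2 <= h * rest rm xs ys i j"
      using S(2,7) hy[OF j] st h0 by (meson less_imp_le diff_ge_0_iff_ge mult_left_mono mult_right_mono order_trans)
    moreover have x21: "(xs (Suc i) - xs i) * rm (xs i) (xs (Suc i)) (ys j) (ys (Suc j)) 2 1 <= h * rest rm xs ys i j"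
      using S(2,6) hx[OF i] st h0 by (meson less_imp_le diff_ge_0_iff_ge mult_left_mono mult_right_mono order_trans)
    ultimately show "integral {ys j..ys (Suc j)} (%y. \<bar>q (mid xs i) y - cell_dy u (xs i) (xs (Suc i)) (ys j) (ys (Suc j))\<bar>) <= 3 * \<gamma> * rest rm xs ys i j"
      using P.u_cell_dy_error[OF s] hU unfolding mid_def by linarith
    show "integral {s..t} (q (mid xs i)) = u (mid xs i) t - u (mid xs i) s" if "ys j <= s" "s <= t" "t <= ys (Suc j)" for s t
      by (rule qF[OF mi]) (use that yc in auto)
    fix y assume y: "y \<in> {ys j..ys (Suc j)}"
    show "\<bar>a (mid xs i) y\<bar> <= Mb \<and> \<bar>b (mid xs i) y\<bar> <= Mb" by (rule bound[OF mi]) (use y yc in auto)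
    have m: "ys j < mid ys j" "mid ys j < ys (Suc j)" using mid_in(2)[OF j] by auto
    have "\<bar>b (mid xs i) y - b (mid xs i) (mid ys j)\<bar> <= L * \<bar>y - mid ys j\<bar>"
      using bL[OF mi, of y "mid ys j"] bL[OF mi, of "mid ys j" y] y m yc by (cases "y <= mid ys j") (auto simp: abs_minus_commute)
    also have "\<dots> <= L * h" using y m hy[OF j] L by (intro mult_left_mono) auto
    finally show "\<bar>b (mid xs i) y - b (mid xs i) (mid ys j)\<bar> <= L * h" .
    show "\<bar>mid_defect u (xs i) (xs (Suc i)) y' - mid_defect u (xs i) (xs (Suc i)) y\<bar> <= 3 * \<gamma> * h * rest rm xs ys i j" if "y' \<in> {ys j..ys (Suc j)}" for y'
      using P.u_mid_defect_osc[OF s y that] x21 hU by linarith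
  next
    fix i j x assume i: "i < nx" and j: "j < ny" and x: "x \<in> {xs i..xs (Suc i)}"
    note sF = subF[OF j i] and S = sub[OF i j] and st = xs_step[OF i] ys_step[OF j]
    have hU: "h * rest rm xs ys i j <= \<gamma> * h * rest rm xs ys i j" "0 <= h * rest rm xs ys i j"
      "h * rest rm xs ys i j <= \<gamma> * rest rm xs ys i j"
      by (rule mult_right_mono[OF hg(1) S(2)] mult_nonneg_nonneg[OF less_imp_le[OF h0] S(2)] mult_right_mono[OF hg(2) S(2)])+
    have y12: "(ys (Suc j) - ys j) * rm (xs i) (xs (Suc i)) (ys j) (ys (Suc j)) 1 2 <= h * rest rm xs ys i j"
      using S(2,7) hy[OF j] st h0 by (meson less_imp_le diff_ge_0_iff_ge mult_left_mono mult_right_mono order_trans)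
    show "\<bar>mid_defect (%y x. u x y) (ys j) (ys (Suc j)) x' - mid_defect (%y x. u x y) (ys j) (ys (Suc j)) x\<bar> <= 3 * \<gamma> * h * rest rm xs ys i j"
      if "x' \<in> {xs i..xs (Suc i)}" for x'
      using F.u_mid_defect_osc[OF sF x that] y12 hU by linarith
    have "(ys (Suc j) - ys j) / (xs (Suc i) - xs i) * rm (xs i) (xs (Suc i)) (ys j) (ys (Suc j)) 0 2 <= \<gamma> * rest rm xs ys i j"
    proof -
      have "(ys (Suc j) - ys j) / (xs (Suc i) - xs i) * rm (xs i) (xs (Suc i)) (ys j) (ys (Suc j)) 0 2
        <= (ys (Suc j) - ys j) / (xs (Suc i) - xs i) * rest rm xs ys i j"
        using S(4) st by (intro mult_left_mono) auto
      also have "\<dots> <= \<gamma> * rest rm xs ys i j" using hr(2)[OF i j] S(2) by (rule mult_right_mono)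
      finally show ?thesis .
    qed
    then show "\<bar>mid_defect (%y x. u x y) (ys j) (ys (Suc j)) x\<bar> <= 3 * \<gamma> * rest rm xs ys i j"
      using F.u_mid_defect_le[OF sF x] y12 hU by linarith
  qed
  then show ?thesis .
qed

lemma double_sum_Cauchy_Schwarz:
  fixes f g :: "nat => nat => real"
  shows "(\<Sum>i<m. \<Sum>j<n. f i j * g i j) <= sqrt (\<Sum>i<m. \<Sum>j<n. (f i j)\<^sup>2) * sqrt (\<Sum>i<m. \<Sum>j<n. (g i j)\<^sup>2)"
proof -
  let ?S = "{..<m} \<times> {..<n}"
  have "(\<Sum>i<m. \<Sum>j<n. f i j * g i j) <= (\<Sum>(i, j)\<in>?S. \<bar>f i j\<bar> * \<bar>g i j\<bar>)"
    unfolding sum.cartesian_product by (intro sum_mono) (auto simp: abs_mult[symmetric])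
  also have "\<dots> <= L2_set (%(i, j). f i j) ?S * L2_set (%(i, j). g i j) ?S"
    using L2_set_mult_ineq[of "%(i, j). f i j" "%(i, j). g i j" ?S] by (simp add: split_def)
  finally show ?thesis by (simp add: L2_set_def sum.cartesian_product split_def)
qed

subsection \<open>The error estimate\<close>

lemma DERIV_of_integral:
  fixes F g :: "real => real"
  assumes g: "continuous_on {a..b} g" and F: "!!t. a <= t ==> t <= b ==> F t - F a = integral {a..t} g" and x: "a < x" "x < b"
  shows "(F has_real_derivative g x) (at x)"
proof -
  have "((%t. F a + integral {a..t} g) has_real_derivative g x) (at x within {a..b})"
    using DERIV_add[OF DERIV_const integral_has_real_derivative[OF g, of x], of "F a"] x by simp
  then have "((%t. F a + integral {a..t} g) has_real_derivative g x) (at x)"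
    using x by (simp add: at_within_Icc_at)
  note d = this
  have "F a + integral {a..t} g = F t" if "t \<in> {a<..<b}" for t using F[of t] that by simp
  then show ?thesis
    by (intro has_field_derivative_transform_within_open[OF d, where S = "{a<..<b}"]) (use x in auto)
qed

lemma cbox_slices:
  fixes F :: "real => real => real"
  assumes F: "continuous_on (cbox (a1, a2) (b1, b2)) (%z. F (fst z) (snd z))"
  shows "y \<in> {a2..b2} ==> continuous_on {a1..b1} (%x. F x y)" "x \<in> {a1..b1} ==> continuous_on {a2..b2} (%y. F x y)"
proof -
  assume y: "y \<in> {a2..b2}"
  have "continuous_on {a1..b1} (%x. F (fst (x, y)) (snd (x, y)))"
    by (rule continuous_on_compose2[OF F]) (use y in \<open>auto intro!: continuous_intros simp: cbox_Pair_real\<close>)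
  then show "continuous_on {a1..b1} (%x. F x y)" by simp
next
  assume x: "x \<in> {a1..b1}"
  have "continuous_on {a2..b2} (%y. F (fst (x, y)) (snd (x, y)))"
    by (rule continuous_on_compose2[OF F]) (use x in \<open>auto intro!: continuous_intros simp: cbox_Pair_real\<close>)
  then show "continuous_on {a2..b2} (%y. F x y)" by simp
qed

text \<open>Expand the nonnegative integral of (|g| - m/s)^2, where m/s is the mean of |g| over the
  cell.\<close>

lemma LINT_box_Cauchy_Schwarz:
  fixes g :: "real \<times> real => real"
  assumes x: "x0 < x1" "y0 < y1" and g: "set_integrable lborel (box (x0, y0) (x1, y1)) g"
    and g2: "set_integrable lborel (box (x0, y0) (x1, y1)) (%z. (g z)\<^sup>2)"
  shows "(LINT z:box (x0, y0) (x1, y1)|lborel. \<bar>g z\<bar>)\<^sup>2 <= (x1 - x0) * (y1 - y0) * (LINT z:box (x0, y0) (x1, y1)|lborel. (g z)\<^sup>2)"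
proof -
  let ?K = "box (x0, y0) (x1, y1)"
  define s where "s = (x1 - x0) * (y1 - y0)"
  define m where "m = (LINT z:?K|lborel. \<bar>g z\<bar>)"
  have s: "s > 0" using x by (simp add: s_def)
  have me: "measure lborel ?K = s"
  proof -
    have "measure lborel ?K = measure lborel (cbox (x0, y0) (x1, y1))"
      by (simp only: measure_lborel_box_eq measure_lborel_cbox_eq)
    also have "\<dots> = s" using x by (simp add: content_Pair s_def)
    finally show ?thesis .
  qed
  have ga: "set_integrable lborel ?K (%z. \<bar>g z\<bar>)" using g by (rule set_integrable_abs)
  have one: "set_integrable lborel ?K (%z. (m / s)\<^sup>2)" "(LINT z:?K|lborel. (m / s)\<^sup>2) = (m / s)\<^sup>2 * s"
    unfolding set_integrable_def set_lebesgue_integral_def using integrable_indicator_boxes(1)[of "(x0, y0)" "(x1, y1)"] me by auto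
  have "0 <= (LINT z:?K|lborel. (\<bar>g z\<bar> - m / s)\<^sup>2)"
    unfolding set_lebesgue_integral_def by (rule integral_nonneg_AE) auto
  also have "\<dots> = (LINT z:?K|lborel. ((g z)\<^sup>2 + (m / s)\<^sup>2) - (2 * m / s) * \<bar>g z\<bar>)"
    by (simp add: power2_diff mult_ac)
  also have "\<dots> = (LINT z:?K|lborel. (g z)\<^sup>2) + (m / s)\<^sup>2 * s - (2 * m / s) * m"
    using g2 one ga by (simp add: set_integral_diff set_integral_add m_def)
  finally have "m * m / s <= (LINT z:?K|lborel. (g z)\<^sup>2)" using s by (simp add: power2_eq_square)
  then show ?thesis using s unfolding m_def s_def by (simp add: power2_eq_square divide_le_eq mult_ac)
qed

locale solution = fvm +
  fixes u f :: "real \<times> real => real"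
  assumes u_H3: "H 3 (box (a1, a2) (b1, b2)) u" and u_cont: "continuous_on (cbox (a1, a2) (b1, b2)) u"
    and u_bdy: "!!p. p \<in> cbox (a1, a2) (b1, b2) - box (a1, a2) (b1, b2) ==> u p = 0"
    and f_L2: "L2 (box (a1, a2) (b1, b2)) f"
    and pde: "!!\<phi>. test_fun (box (a1, a2) (b1, b2)) \<phi> ==>
      (LINT x:box (a1, a2) (b1, b2)|lborel. (A x *v vector [wd (box (a1, a2) (b1, b2)) (1, 0) u x, wd (box (a1, a2) (b1, b2)) (0, 1) u x]) \<bullet> grad \<phi> x + c x * u x * \<phi> x)
      = (LINT x:box (a1, a2) (b1, b2)|lborel. f x * \<phi> x)"
begin

lemma wd_u:
  assumes "i + j <= 3"
  shows "weak_deriv \<Omega> (i, j) u (wd \<Omega> (i, j) u)" "L2 \<Omega> (wd \<Omega> (i, j) u)"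
proof -
  have "\<exists>g. weak_deriv \<Omega> (i, j) u g \<and> L2 \<Omega> g" using u_H3 assms by (auto simp: H_def)
  from someI_ex[OF this] show "weak_deriv \<Omega> (i, j) u (wd \<Omega> (i, j) u)" "L2 \<Omega> (wd \<Omega> (i, j) u)"
    unfolding wd_def by blast+
qed

sublocale W: weak_h3 a1 b1 a2 b2 u "%i j. wd (box (a1, a2) (b1, b2)) (i, j) u"
  by unfold_locales (use ab u_cont wd_u L2_integrable in auto)

text \<open>The bound from \<open>approx_exists\<close> is fixed by choice, so that
  \<open>approx\<close> can be instantiated as a sublocale.\<close>

definition MU where "MU = (SOME MU. approx a1 b1 a2 b2 (%x y. u (x, y)) W.V W.B W.rm MU)"

sublocale P: approx a1 b1 a2 b2 "%x y. u (x, y)" W.V W.B W.rm MU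
  unfolding MU_def by (rule someI_ex[OF W.approx_exists])

sublocale F: approx a2 b2 a1 b1 "%y x. u (x, y)" "%n i j x y. W.V n j i y x" "%n k1 k2 l1 l2 i j. W.B n l1 l2 k1 k2 j i"
    "%k1 k2 l1 l2 i j. W.rm l1 l2 k1 k2 j i" MU
  by (rule approx_flip[OF P.approx_axioms])

lemma F_p: "F.p y x = P.q x y" and F_q: "F.q y x = P.p x y"
  by (simp_all add: F.p_def P.q_def F.q_def P.p_def)

lemma q_cont: "continuous_on (cbox (a1, a2) (b1, b2)) (%z. P.q (fst z) (snd z))"
proof -
  have "continuous_on (cbox (a1, a2) (b1, b2)) (%z. F.p (fst (snd z, fst z)) (snd (snd z, fst z)))"
    by (rule continuous_on_compose2[OF F.p_cont]) (auto intro!: continuous_intros simp: cbox_Pair_real)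
  then show ?thesis by (simp add: F_p)
qed

lemma pq_slice:
  "y \<in> {a2..b2} ==> continuous_on {a1..b1} (%x. P.p x y)" "y \<in> {a2..b2} ==> continuous_on {a1..b1} (%x. P.q x y)"
  "x \<in> {a1..b1} ==> continuous_on {a2..b2} (%y. P.p x y)" "x \<in> {a1..b1} ==> continuous_on {a2..b2} (%y. P.q x y)"
  by (rule cbox_slices[OF P.p_cont] cbox_slices[OF q_cont]; assumption)+

text \<open>By \<open>p_FTC\<close> and continuity the limits \<open>P.p\<close> and
  \<open>P.q\<close> are classical derivatives of u, hence weak ones, and uniqueness identifies them
  with the choice \<open>wd\<close> in the weak equation.\<close>

lemma wd_AE:
  "AE z in lborel. z \<in> \<Omega> --> wd \<Omega> (1, 0) u z = P.p (fst z) (snd z)"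
  "AE z in lborel. z \<in> \<Omega> --> wd \<Omega> (0, 1) u z = P.q (fst z) (snd z)"
proof -
  note pi = set_integrable_box_of_continuous[OF P.p_cont] and qi = set_integrable_box_of_continuous[OF q_cont]
  have le: "a1 <= b1" "a2 <= b2" using ab by auto
  have "weak_deriv \<Omega> (1, 0) u (%z. P.p (fst z) (snd z))"
  proof (rule weak_deriv_of_piecewise(1)[OF le u_cont pi, of "{}" "{}"])
    fix x y assume "(x, y) \<in> \<Omega>"
    then have xy: "a1 < x" "x < b1" "y \<in> {a2..b2}" by (auto simp: box_Pair_real)
    show "((%t. u (t, y)) has_real_derivative P.p (fst (x, y)) (snd (x, y))) (at x)"
      using DERIV_of_integral[OF pq_slice(1)[OF xy(3)], of "%t. u (t, y)" x] P.p_FTC[of a1 _ y] xy by auto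
  qed auto
  then show "AE z in lborel. z \<in> \<Omega> --> wd \<Omega> (1, 0) u z = P.p (fst z) (snd z)"
    by (intro weak_deriv_unique[OF wd_u(1)] L2_integrable wd_u(2) pi) auto
  have "weak_deriv \<Omega> (0, 1) u (%z. P.q (fst z) (snd z))"
  proof (rule weak_deriv_of_piecewise(2)[OF le u_cont qi, of "{}" "{}"])
    fix x y assume "(x, y) \<in> \<Omega>"
    then have xy: "a2 < y" "y < b2" "x \<in> {a1..b1}" by (auto simp: box_Pair_real)
    show "((%t. u (x, t)) has_real_derivative P.q (fst (x, y)) (snd (x, y))) (at y)"
      using DERIV_of_integral[OF pq_slice(4)[OF xy(3)], of "%t. u (x, t)" y] F.p_FTC[of a2 _ x] xy by (auto simp: F_p)
  qed auto
  then show "AE z in lborel. z \<in> \<Omega> --> wd \<Omega> (0, 1) u z = P.q (fst z) (snd z)"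
    by (intro weak_deriv_unique[OF wd_u(1)] L2_integrable wd_u(2) qi) auto
qed

text \<open>The components of A grad u, formed with the continuous gradient. \<open>g2\<close> takes
  y first, as \<open>flux_sum\<close> with exchanged coordinates expects.\<close>

definition g1 where "g1 x y = A (x, y) $ 1 $ 1 * P.p x y + A (x, y) $ 1 $ 2 * P.q x y"
definition g2 where "g2 y x = A (x, y) $ 2 $ 2 * P.q x y + A (x, y) $ 2 $ 1 * P.p x y"

lemma g_cont:
  "continuous_on (cbox (a1, a2) (b1, b2)) (%z. g1 (fst z) (snd z))" "continuous_on (cbox (a1, a2) (b1, b2)) (%z. g2 (snd z) (fst z))"
  unfolding g1_def g2_def prod.collapse by (intro continuous_intros A_cont P.p_cont q_cont)+

text \<open>The weak equation tested with a tensor product, after replacing the weak gradient by the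
  continuous one: the continuous flux field has the weak divergence
  \<open>c * u - f\<close>.\<close>

lemma flux_weak:
  assumes s: "smooth1 \<phi>" "smooth1 \<psi>" and t: "test_fun \<Omega> (%p. \<phi> (fst p) * \<psi> (snd p))"
  shows "(LINT p:\<Omega>|lborel. g1 (fst p) (snd p) * (deriv \<phi> (fst p) * \<psi> (snd p)) + g2 (snd p) (fst p) * (\<phi> (fst p) * deriv \<psi> (snd p)))
    = - (LINT p:\<Omega>|lborel. (c p * u p - f p) * (\<phi> (fst p) * \<psi> (snd p)))"
proof -
  let ?d1 = "%p. deriv \<phi> (fst p) * \<psi> (snd p)" and ?d2 = "%p. \<phi> (fst p) * deriv \<psi> (snd p)" and ?t = "%p. \<phi> (fst p) * \<psi> (snd p)"
  let ?k1 = "%p. A p $ 1 $ 1 * ?d1 p + A p $ 2 $ 1 * ?d2 p" and ?k2 = "%p. A p $ 1 $ 2 * ?d1 p + A p $ 2 $ 2 * ?d2 p"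
  let ?w1 = "wd \<Omega> (1, 0) u" and ?w2 = "wd \<Omega> (0, 1) u" and ?p = "%z. P.p (fst z) (snd z)" and ?q = "%z. P.q (fst z) (snd z)"
  note tc = continuous_on_tensor[OF s, of "cbox (a1, a2) (b1, b2)"]
  have kc: "continuous_on (cbox (a1, a2) (b1, b2)) ?k1" "continuous_on (cbox (a1, a2) (b1, b2)) ?k2"
    by (intro continuous_on_add continuous_on_mult[OF A_cont] continuous_on_tensor smooth1_deriv s)+
  have wi: "set_integrable lborel \<Omega> ?w1" "set_integrable lborel \<Omega> ?w2" by (intro L2_integrable wd_u(2); simp)+
  have pq: "set_integrable lborel \<Omega> ?p" "set_integrable lborel \<Omega> ?q"
    by (intro set_integrable_box_of_continuous P.p_cont q_cont)+
  note iw = wi(1)[THEN set_integrable_mult_continuous, OF kc(1)] wi(2)[THEN set_integrable_mult_continuous, OF kc(2)]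
  note ip = pq(1)[THEN set_integrable_mult_continuous, OF kc(1)] pq(2)[THEN set_integrable_mult_continuous, OF kc(2)]
  have ic: "set_integrable lborel \<Omega> (%p. c p * u p * ?t p)" by (rule set_integrable_mult_continuous[OF c_mult_int[OF u_cont] tc])
  have it: "set_integrable lborel \<Omega> (%p. f p * ?t p)" by (rule set_integrable_mult_continuous[OF L2_integrable[OF f_L2] tc])
  have pd: "pdir True ?t = ?d1" "pdir False ?t = ?d2"
    using Dcl_tensor[OF s, of 1 0] Dcl_tensor[OF s, of 0 1] by (simp_all add: Dcl_def)
  have "(LINT x:\<Omega>|lborel. f x * ?t x) = (LINT x:\<Omega>|lborel. (A x *v vector [?w1 x, ?w2 x]) \<bullet> grad ?t x + c x * u x * ?t x)"
    by (rule pde[OF t, symmetric])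
  also have "\<dots> = (LINT x:\<Omega>|lborel. (?w1 x * ?k1 x + ?w2 x * ?k2 x) + c x * u x * ?t x)"
    unfolding grad_def pd by (simp add: inner_vec_def sum_2 mat2_mult algebra_simps)
  also have "\<dots> = (LINT x:\<Omega>|lborel. (?p x * ?k1 x + ?q x * ?k2 x) + c x * u x * ?t x)"
    unfolding set_lebesgue_integral_def
  proof (rule integral_cong_AE)
    show "(%x. indicator \<Omega> x *\<^sub>R ((?w1 x * ?k1 x + ?w2 x * ?k2 x) + c x * u x * ?t x)) \<in> borel_measurable lborel"
      using set_integral_add(1)[OF set_integral_add(1)[OF iw] ic] unfolding set_integrable_def by (rule borel_measurable_integrable)
    show "(%x. indicator \<Omega> x *\<^sub>R ((?p x * ?k1 x + ?q x * ?k2 x) + c x * u x * ?t x)) \<in> borel_measurable lborel"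
      using set_integral_add(1)[OF set_integral_add(1)[OF ip] ic] unfolding set_integrable_def by (rule borel_measurable_integrable)
    show "AE x in lborel. indicator \<Omega> x *\<^sub>R ((?w1 x * ?k1 x + ?w2 x * ?k2 x) + c x * u x * ?t x)
        = indicator \<Omega> x *\<^sub>R ((?p x * ?k1 x + ?q x * ?k2 x) + c x * u x * ?t x)"
      using wd_AE by eventually_elim (auto simp: indicator_def)
  qed
  also have "\<dots> = (LINT x:\<Omega>|lborel. ?p x * ?k1 x + ?q x * ?k2 x) + (LINT x:\<Omega>|lborel. c x * u x * ?t x)"
    by (rule set_integral_add(2)[OF set_integral_add(1)[OF ip] ic])
  also have "(%x. ?p x * ?k1 x + ?q x * ?k2 x) = (%p. g1 (fst p) (snd p) * ?d1 p + g2 (snd p) (fst p) * ?d2 p)"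
    by (simp add: g1_def g2_def fun_eq_iff algebra_simps)
  finally show ?thesis
    using set_integral_diff(2)[OF ic it] by (simp add: left_diff_distrib)
qed

text \<open>The exact solution satisfies the scheme, with \<open>g1\<close> and \<open>g2\<close> as
  fluxes: apply the divergence theorem on each control volume with a nonzero weight and regroup by
  dual edges.\<close>

lemma flux_identity:
  assumes v: "v \<in> UU"
  shows "(LINT x:\<Omega>|lborel. f x * Pistar xs nx ys ny v x)
    = flux_sum g1 xs nx ys ny (V\<^sub>N v) + flux_sum g2 ys ny xs nx (%j i. V\<^sub>N v i j) + (LINT x:\<Omega>|lborel. c x * u x * Pistar xs nx ys ny v x)"
proof -
  have fi: "set_integrable lborel \<Omega> f" by (rule L2_integrable[OF f_L2])
  have cu: "set_integrable lborel \<Omega> (%x. c x * u x)" by (rule c_mult_int[OF u_cont])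
  have gi: "set_integrable lborel \<Omega> (%x. c x * u x - f x)" by (rule set_integral_diff(1)[OF cu fi])
  note c1 = continuous_on_subset[OF g_cont(1) box_subset_cbox] and c2 = continuous_on_subset[OF g_cont(2) box_subset_cbox]
  have div: "integral {l2..r2} (g1 r1) - integral {l2..r2} (g1 l1) + integral {l1..r1} (g2 r2) - integral {l1..r1} (g2 l2)
      = (LINT p:cbox (l1, l2) (r1, r2)|lborel. c p * u p - f p)"
    if "a1 < l1" "l1 <= r1" "r1 < b1" "a2 < l2" "l2 <= r2" "r2 < b2" for l1 r1 l2 r2
    by (rule divergence_rect[where ?F1.0 = "%z. g1 (fst z) (snd z)" and ?F2.0 = "%z. g2 (snd z) (fst z)",
        OF c1 c2 gi flux_weak that, unfolded fst_conv snd_conv])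
  have g1s: "continuous_on {a2..b2} (g1 x)" if "x \<in> {a1..b1}" for x
    by (rule cbox_slices(2)[OF g_cont(1) that])
  have g2s: "continuous_on {a1..b1} (g2 y)" if "y \<in> {a2..b2}" for y
    by (rule cbox_slices(1)[OF g_cont(2) that])
  have "(LINT x:\<Omega>|lborel. (c x * u x - f x) * Pistar xs nx ys ny v x)
    = (\<Sum>i\<le>nx. \<Sum>j\<le>ny. V\<^sub>N v i j * (LINT x:ctrl_vol xs nx ys ny (i, j)|lborel. c x * u x - f x))"
    by (rule LINT_Pistar[OF v gi])
  also have "\<dots> = (\<Sum>i\<le>nx. \<Sum>j\<le>ny. (circulation g1 g2 i j) * V\<^sub>N v i j)"
  proof (intro sum.cong refl)
    fix i j assume "i \<in> {..nx}" "j \<in> {..ny}"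
    show "V\<^sub>N v i j * (LINT x:ctrl_vol xs nx ys ny (i, j)|lborel. c x * u x - f x)
      = (circulation g1 g2 i j) * V\<^sub>N v i j"
    proof (cases "V\<^sub>N v i j = 0")
      case False
      then have n: "0 < i" "i < nx" "0 < j" "j < ny" by (auto simp: nodal_def split: if_splits)
      have "ctrl_vol xs nx ys ny (i, j) = cbox (lo xs i, lo ys j) (hi xs nx i, hi ys ny j)" by (simp add: ctrl_vol_def cbox_Pair_real)
      then show ?thesis using div[OF ctrl_inner[OF n]] by (simp only: mult.commute)
    qed simp
  qed
  also have "\<dots> = - (flux_sum g1 xs nx ys ny (V\<^sub>N v) + flux_sum g2 ys ny xs nx (%j i. V\<^sub>N v i j))"
  proof -
    have I: "g1 (mid xs i) integrable_on {ys j..ys (Suc j)}" "g2 (mid ys j) integrable_on {xs i..xs (Suc i)}" if "i < nx" "j < ny" for i j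
      using mid_in'(1)[OF that(1)] mid_in'(2)[OF that(2)] xs_in[of i] xs_in[of "Suc i"] ys_in[of j] ys_in[of "Suc j"] that
      by (auto intro!: integrable_continuous_real continuous_on_subset[OF g1s] continuous_on_subset[OF g2s])
    have "flux_sum g1 xs nx ys ny (V\<^sub>N v) + flux_sum g2 ys ny xs nx (%j i. V\<^sub>N v i j)
      = (\<Sum>i\<le>nx. \<Sum>j\<le>ny. - (circulation g1 g2 i j) * V\<^sub>N v i j)"
      by (rule flux_sum_dual[symmetric]) (rule I; assumption)+
    then show ?thesis by (simp only: mult_minus_left sum_negf minus_minus)
  qed
  finally have "(LINT x:\<Omega>|lborel. (c x * u x - f x) * Pistar xs nx ys ny v x) = \<dots>" .
  moreover have "(LINT x:\<Omega>|lborel. (c x * u x - f x) * Pistar xs nx ys ny v x)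
    = (LINT x:\<Omega>|lborel. c x * u x * Pistar xs nx ys ny v x) - (LINT x:\<Omega>|lborel. f x * Pistar xs nx ys ny v x)"
    unfolding left_diff_distrib by (rule set_integral_diff(2)[OF int_Pistar[OF cu] int_Pistar[OF fi]])
  ultimately show ?thesis by linarith
qed

end

section \<open>From local masses to the H3 norm\<close>

context solution
begin

abbreviation "I6 \<equiv> {(2, 0), (0, 2), (3, 0), (0, 3), (2, 1), (1, 2 :: nat)} :: (nat \<times> nat) set"

definition S6 where "S6 i j = sqrt (6 * (\<Sum>\<alpha>\<in>I6. LINT z:elt0 i j|lborel. (wd \<Omega> \<alpha> u z)\<^sup>2))"

lemma I6: "\<alpha> \<in> I6 ==> fst \<alpha> + snd \<alpha> <= 3" by auto

lemma LINT_sq_nonneg: "0 <= (LINT z:K|lborel. (g z :: real)\<^sup>2)"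
  unfolding set_lebesgue_integral_def by (rule integral_nonneg_AE) auto

text \<open>Cauchy-Schwarz twice: on the cell it produces the square root of the area, over the six
  orders the factor 6 in \<open>S6\<close>. That square root, at most h, is the second power of h in
  the flux estimate.\<close>

lemma rest_le:
  assumes ij: "i < nx" "j < ny"
  shows "rest W.rm xs ys i j <= sqrt ((xs (Suc i) - xs i) * (ys (Suc j) - ys j)) * S6 i j"
proof -
  let ?K = "elt0 i j" and ?s = "(xs (Suc i) - xs i) * (ys (Suc j) - ys j)"
  have sub: "?K \<subseteq> \<Omega>"
    using xs_in[of i] xs_in[of "Suc i"] ys_in[of j] ys_in[of "Suc j"] ij by (auto simp: box_Pair_real)
  have one: "(W.rm (xs i) (xs (Suc i)) (ys j) (ys (Suc j)) (fst \<alpha>) (snd \<alpha>))\<^sup>2 <= ?s * (LINT z:?K|lborel. (wd \<Omega> \<alpha> u z)\<^sup>2)" if "\<alpha> \<in> I6" for \<alpha>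
  proof -
    have L: "L2 \<Omega> (wd \<Omega> \<alpha> u)" using wd_u(2)[OF I6[OF that]] by simp
    have "set_integrable lborel ?K (wd \<Omega> \<alpha> u)"
      by (rule set_integrable_subset[OF L2_integrable[OF L] _ sub]) simp
    moreover have "set_integrable lborel ?K (%z. (wd \<Omega> \<alpha> u z)\<^sup>2)"
      by (rule set_integrable_subset[OF _ _ sub]) (use L in \<open>auto simp: L2_def\<close>)
    ultimately show ?thesis
      using LINT_box_Cauchy_Schwarz[OF xs_step[OF ij(1)] ys_step[OF ij(2)]] by (simp add: W.rm_def)
  qed
  have "(rest W.rm xs ys i j)\<^sup>2 = (\<Sum>\<alpha>\<in>I6. W.rm (xs i) (xs (Suc i)) (ys j) (ys (Suc j)) (fst \<alpha>) (snd \<alpha>))\<^sup>2"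
    by (simp add: rest_def)
  also have "\<dots> <= (\<Sum>\<alpha>\<in>I6. (W.rm (xs i) (xs (Suc i)) (ys j) (ys (Suc j)) (fst \<alpha>) (snd \<alpha>))\<^sup>2) * card I6"
    by (rule sum_squared_le_sum_of_squares)
  also have "card I6 = 6" by simp
  also have "(\<Sum>\<alpha>\<in>I6. (W.rm (xs i) (xs (Suc i)) (ys j) (ys (Suc j)) (fst \<alpha>) (snd \<alpha>))\<^sup>2) <= (\<Sum>\<alpha>\<in>I6. ?s * (LINT z:?K|lborel. (wd \<Omega> \<alpha> u z)\<^sup>2))"
    by (rule sum_mono[OF one])
  also have "(\<Sum>\<alpha>\<in>I6. ?s * (LINT z:?K|lborel. (wd \<Omega> \<alpha> u z)\<^sup>2)) * real 6 = ?s * (6 * (\<Sum>\<alpha>\<in>I6. LINT z:?K|lborel. (wd \<Omega> \<alpha> u z)\<^sup>2))"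
    unfolding sum_distrib_left[symmetric] by (simp only: mult_ac of_nat_numeral)
  finally have "(rest W.rm xs ys i j)\<^sup>2 <= ?s * (6 * (\<Sum>\<alpha>\<in>I6. LINT z:?K|lborel. (wd \<Omega> \<alpha> u z)\<^sup>2))" by simp
  then have "\<bar>rest W.rm xs ys i j\<bar> <= sqrt (?s * (6 * (\<Sum>\<alpha>\<in>I6. LINT z:?K|lborel. (wd \<Omega> \<alpha> u z)\<^sup>2)))" by (rule real_le_rsqrt[of "\<bar>_\<bar>", unfolded power2_abs])
  then show ?thesis unfolding S6_def real_sqrt_mult by linarith
qed

lemma S6_nonneg: "0 <= S6 i j"
  unfolding S6_def by (intro real_sqrt_ge_zero mult_nonneg_nonneg sum_nonneg LINT_sq_nonneg) simp

lemma sum_S6: "(\<Sum>i<nx. \<Sum>j<ny. (S6 i j)\<^sup>2) <= 6 * (Hnorm 3 \<Omega> u)\<^sup>2"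
proof -
  have cells: "(\<Sum>i<nx. \<Sum>j<ny. LINT z:elt0 i j|lborel. (wd \<Omega> \<alpha> u z)\<^sup>2) <= (LINT z:\<Omega>|lborel. (wd \<Omega> \<alpha> u z)\<^sup>2)"
    if "\<alpha> \<in> I6" for \<alpha>
  proof -
    let ?f = "%z. indicator \<Omega> z *\<^sub>R (wd \<Omega> \<alpha> u z)\<^sup>2"
    have fi: "integrable lborel ?f" using wd_u(2)[OF I6[OF that]] by (simp add: L2_def set_integrable_def)
    have "(\<Sum>i<nx. \<Sum>j<ny. LINT z:elt0 i j|lborel. (wd \<Omega> \<alpha> u z)\<^sup>2)
      <= (\<Sum>i<nx. \<Sum>j<ny. LINT z:elt i j|lborel. ?f z)"
    proof (intro sum_mono)
      fix i j assume "i \<in> {..<nx}" "j \<in> {..<ny}"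
      then have ij: "i < nx" "j < ny" by auto
      let ?K = "elt0 i j" and ?C = "elt i j"
      have sub: "?K \<subseteq> \<Omega>"
        using xs_in[of i] xs_in[of "Suc i"] ys_in[of j] ys_in[of "Suc j"] ij by (auto simp: box_Pair_real)
      have eq: "indicator ?K z *\<^sub>R (wd \<Omega> \<alpha> u z)\<^sup>2 = indicator ?K z *\<^sub>R ?f z" for z using sub by (auto simp: indicator_def)
      show "(LINT z:?K|lborel. (wd \<Omega> \<alpha> u z)\<^sup>2) <= (LINT z:?C|lborel. ?f z)"
        unfolding set_lebesgue_integral_def eq
      proof (rule integral_mono)
        show "integrable lborel (%z. indicator ?K z *\<^sub>R ?f z)" "integrable lborel (%z. indicator ?C z *\<^sub>R ?f z)"
          by (rule integrable_mult_indicator[OF _ fi]; simp)+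
        show "indicator ?K z *\<^sub>R ?f z <= indicator ?C z *\<^sub>R ?f z" for z
          using box_subset_cbox[of "(xs i, ys j)" "(xs (Suc i), ys (Suc j))"] by (auto simp: indicator_def)
      qed
    qed
    also have "\<dots> = (LINT z:cbox (a1, a2) (b1, b2)|lborel. ?f z)" by (rule LINT_cells[OF fi])
    also have "\<dots> = (LINT z:\<Omega>|lborel. (wd \<Omega> \<alpha> u z)\<^sup>2)"
      by (rule LINT_box_cbox)
    finally show ?thesis .
  qed
  have "(\<Sum>i<nx. \<Sum>j<ny. (S6 i j)\<^sup>2) = 6 * (\<Sum>\<alpha>\<in>I6. \<Sum>i<nx. \<Sum>j<ny. LINT z:elt0 i j|lborel. (wd \<Omega> \<alpha> u z)\<^sup>2)"
  proof -
    have "(S6 i j)\<^sup>2 = 6 * (\<Sum>\<alpha>\<in>I6. LINT z:elt0 i j|lborel. (wd \<Omega> \<alpha> u z)\<^sup>2)" for i j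
      unfolding S6_def by (intro real_sqrt_pow2 mult_nonneg_nonneg sum_nonneg LINT_sq_nonneg) simp
    then show ?thesis
      \<comment> \<open>The sum over orders is moved outside, so that for each order the cell
        integrals add up to an integral over \<Omega>.\<close>
      unfolding sum.swap[of _ "{..<ny}" I6] sum.swap[of _ "{..<nx}" I6] by (simp only: sum_distrib_left[symmetric])
  qed
  also have "\<dots> <= 6 * (\<Sum>\<alpha>\<in>I6. LINT z:\<Omega>|lborel. (wd \<Omega> \<alpha> u z)\<^sup>2)"
    by (intro mult_left_mono sum_mono cells) auto
  also have "(\<Sum>\<alpha>\<in>I6. LINT z:\<Omega>|lborel. (wd \<Omega> \<alpha> u z)\<^sup>2) <= (\<Sum>(i, j)\<in>Sigma {..3} (%i. {..3 - i}). LINT z:\<Omega>|lborel. (wd \<Omega> (i, j) u z)\<^sup>2)"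
    unfolding split_def prod.collapse by (rule sum_mono2) (use LINT_sq_nonneg in auto)
  also have "\<dots> = (Hnorm 3 \<Omega> u)\<^sup>2"
    unfolding Hnorm_def by (subst real_sqrt_pow2) (auto intro!: sum_nonneg LINT_sq_nonneg simp: sum.Sigma)
  finally show ?thesis by simp
qed

lemma Hnorm_nonneg: "0 <= Hnorm m \<Omega> w"
  unfolding Hnorm_def by (intro real_sqrt_ge_zero sum_nonneg LINT_sq_nonneg)

lemma weighted_sum:
  assumes "(\<Sum>i<nx. \<Sum>j<ny. (t i j)\<^sup>2) <= T"
  shows "(\<Sum>i<nx. \<Sum>j<ny. S6 i j * t i j) <= sqrt 6 * Hnorm 3 \<Omega> u * sqrt T"
proof -
  have "(\<Sum>i<nx. \<Sum>j<ny. S6 i j * t i j) <= sqrt (\<Sum>i<nx. \<Sum>j<ny. (S6 i j)\<^sup>2) * sqrt (\<Sum>i<nx. \<Sum>j<ny. (t i j)\<^sup>2)"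
    by (rule double_sum_Cauchy_Schwarz)
  also have "\<dots> <= sqrt (6 * (Hnorm 3 \<Omega> u)\<^sup>2) * sqrt T"
    by (intro mult_mono real_sqrt_le_mono sum_S6 assms real_sqrt_ge_zero sum_nonneg zero_le_power2 mult_nonneg_nonneg) simp
  also have "sqrt (6 * (Hnorm 3 \<Omega> u)\<^sup>2) = sqrt 6 * Hnorm 3 \<Omega> u" by (simp add: real_sqrt_mult Hnorm_nonneg)
  finally show ?thesis .
qed

text \<open>Discrete Cauchy-Schwarz; the factor 2 is the square root of the 4 in
  \<open>edges_sq\<close>.\<close>

lemma edge_sum:
  "(\<Sum>i<nx. \<Sum>j<ny. rest W.rm xs ys i j * edges V i j) <= h * (2 * sqrt 6 * Hnorm 3 \<Omega> u * sqrt (energy V))"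
proof -
  have "(\<Sum>i<nx. \<Sum>j<ny. rest W.rm xs ys i j * edges V i j) <= (\<Sum>i<nx. \<Sum>j<ny. h * (S6 i j * edges V i j))"
  proof (intro sum_mono)
    fix i j assume "i \<in> {..<nx}" "j \<in> {..<ny}"
    then have ij: "i < nx" "j < ny" by auto
    have "sqrt ((xs (Suc i) - xs i) * (ys (Suc j) - ys j)) <= sqrt (h * h)"
      using hx_le[OF ij(1)] hy_le[OF ij(2)] xs_step[OF ij(1)] ys_step[OF ij(2)] h_pos by (intro real_sqrt_le_mono mult_mono) auto
    then have "sqrt ((xs (Suc i) - xs i) * (ys (Suc j) - ys j)) * S6 i j <= h * S6 i j"
      using h_pos S6_nonneg by (intro mult_right_mono) auto
    then have "rest W.rm xs ys i j <= h * S6 i j" using rest_le[OF ij] by linarith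
    then show "rest W.rm xs ys i j * edges V i j <= h * (S6 i j * edges V i j)"
      using mult_right_mono[OF _ edges_nonneg, of "rest W.rm xs ys i j" "h * S6 i j"] by (simp only: mult.assoc)
  qed
  also have "\<dots> = h * (\<Sum>i<nx. \<Sum>j<ny. S6 i j * edges V i j)" by (simp add: sum_distrib_left)
  also have "\<dots> <= h * (sqrt 6 * Hnorm 3 \<Omega> u * sqrt (4 * energy V))"
  proof (rule mult_left_mono[OF weighted_sum])
    show "(\<Sum>i<nx. \<Sum>j<ny. (edges V i j)\<^sup>2) <= 4 * energy V"
      unfolding energy_def sum_distrib_left by (intro sum_mono edges_sq)
  qed (use h_pos in simp)
  finally show ?thesis by (simp add: real_sqrt_mult mult_ac)
qed

lemma flux_error_x:
  assumes "h <= 1"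
  shows "\<bar>flux_sum g1 xs nx ys ny (V\<^sub>N v) - vsum1 (%x y. u (x, y)) xs nx ys ny (V\<^sub>N v)\<bar>
    <= (\<Sum>i<nx. \<Sum>j<ny. 3 * \<gamma> * h * (2 * Mb + L) * rest W.rm xs ys i j * edges (V\<^sub>N v) i j)"
proof -
  have "g1 = (%x y. A (x, y) $ 1 $ 1 * P.p x y + A (x, y) $ 1 $ 2 * P.q x y)" by (simp add: g1_def fun_eq_iff)
  moreover have "\<bar>flux_sum (%x y. A (x, y) $ 1 $ 1 * P.p x y + A (x, y) $ 1 $ 2 * P.q x y) xs nx ys ny (V\<^sub>N v)
      - vsum1 (%x y. u (x, y)) xs nx ys ny (V\<^sub>N v)\<bar>
    <= (\<Sum>i<nx. \<Sum>j<ny. 3 * \<gamma> * h * (2 * Mb + L) * rest W.rm xs ys i j * edges (V\<^sub>N v) i j)"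
  proof (rule vertical_consistency[OF mesh_axioms P.approx_axioms hx_le hy_le assms const_pos(2)])
    show "V\<^sub>N v 0 j = 0 \<and> V\<^sub>N v nx j = 0" for j using nodal_0 by blast
    show "\<bar>A (x', y) $ 1 $ 2 - A (x, y) $ 1 $ 2\<bar> <= L * (x' - x)" if "a1 <= x" "x <= x'" "x' <= b1" "a2 < y" "y < b2" for x x' y
      by (rule A_lipx[OF that])
    show "P.q x y = P.q x y" for x y by (rule refl)
    fix x assume x: "a1 < x" "x < b1"
    then have x': "x \<in> {a1..b1}" by simp
    show "continuous_on {a2..b2} (%y. A (x, y) $ 1 $ 1)" "continuous_on {a2..b2} (%y. A (x, y) $ 1 $ 2)" by (rule A_slice_y[OF x' order_refl])+
    show "continuous_on {a2..b2} (%y. P.q x y)" by (rule pq_slice(4)[OF x'])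
    show "integral {s..t} (%y. P.q x y) = u (x, t) - u (x, s)" if "a2 <= s" "s <= t" "t <= b2" for s t
      using F.p_FTC[OF that x'] by (simp add: F_p)
    show "\<bar>A (x, y) $ 1 $ 1\<bar> <= Mb \<and> \<bar>A (x, y) $ 1 $ 2\<bar> <= Mb" if "y \<in> {a2..b2}" for y
      using A_bd[of "(x, y)"] x' that by (simp add: cbox_Pair_real)
    show "\<bar>A (x, y') $ 1 $ 2 - A (x, y) $ 1 $ 2\<bar> <= L * (y' - y)" if "a2 <= y" "y <= y'" "y' <= b2" for y y'
      by (rule A_lipy[OF x that])
  qed
  ultimately show ?thesis by (simp only:)
qed

text \<open>\<open>vertical_consistency\<close> on the flipped mesh, with \<open>P.p\<close> and
  \<open>P.q\<close> in exchanged roles; \<open>rest\<close> and \<open>edges\<close> are invariant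
  under the exchange.\<close>

lemma flux_error_y:
  assumes "h <= 1"
  shows "\<bar>flux_sum g2 ys ny xs nx (%j i. V\<^sub>N v i j) - vsum2 (%y x. u (x, y)) ys ny xs nx (%j i. V\<^sub>N v i j)\<bar>
    <= (\<Sum>i<nx. \<Sum>j<ny. 3 * \<gamma> * h * (2 * Mb + L) * rest W.rm xs ys i j * edges (V\<^sub>N v) i j)"
proof -
  have e: "g2 = (%y x. A (x, y) $ 2 $ 2 * F.p y x + A (x, y) $ 2 $ 1 * P.p x y)" by (simp add: g2_def F_p fun_eq_iff)
  have "\<bar>flux_sum (%y x. A (x, y) $ 2 $ 2 * F.p y x + A (x, y) $ 2 $ 1 * P.p x y) ys ny xs nx (%j i. V\<^sub>N v i j) - vsum2 (%y x. u (x, y)) ys ny xs nx (%j i. V\<^sub>N v i j)\<bar>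
    <= (\<Sum>j<ny. \<Sum>i<nx. 3 * \<gamma> * h * (2 * Mb + L) * rest (%k1 k2 l1 l2 i j. W.rm l1 l2 k1 k2 j i) ys xs j i * edges (%j i. V\<^sub>N v i j) j i)"
  proof (rule vertical_consistency[OF flip_mesh F.approx_axioms hy_le hx_le assms const_pos(2)])
    show "V\<^sub>N v i 0 = 0 \<and> V\<^sub>N v i ny = 0" for i using nodal_0 by blast
    show "\<bar>A (x, y') $ 2 $ 1 - A (x, y) $ 2 $ 1\<bar> <= L * (y' - y)" if "a2 <= y" "y <= y'" "y' <= b2" "a1 < x" "x < b1" for y y' x
      by (rule A_lipy[OF that(4,5,1-3)])
    show "P.p x y = F.q y x" for x y by (rule F_q[symmetric])
    fix y assume y: "a2 < y" "y < b2"
    then have y': "y \<in> {a2..b2}" by simp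
    show "continuous_on {a1..b1} (%x. A (x, y) $ 2 $ 2)" "continuous_on {a1..b1} (%x. A (x, y) $ 2 $ 1)" by (rule A_slice_x[OF y' order_refl])+
    show "continuous_on {a1..b1} (%x. P.p x y)" by (rule pq_slice(1)[OF y'])
    show "integral {s..t} (%x. P.p x y) = u (t, y) - u (s, y)" if "a1 <= s" "s <= t" "t <= b1" for s t
      using P.p_FTC[OF that y'] by simp
    show "\<bar>A (x, y) $ 2 $ 2\<bar> <= Mb \<and> \<bar>A (x, y) $ 2 $ 1\<bar> <= Mb" if "x \<in> {a1..b1}" for x
      using A_bd[of "(x, y)"] y' that by (simp add: cbox_Pair_real)
    show "\<bar>A (x', y) $ 2 $ 1 - A (x, y) $ 2 $ 1\<bar> <= L * (x' - x)" if "a1 <= x" "x <= x'" "x' <= b1" for x x'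
      by (rule A_lipx[OF that y])
  qed
  also have "\<dots> = (\<Sum>i<nx. \<Sum>j<ny. 3 * \<gamma> * h * (2 * Mb + L) * rest W.rm xs ys i j * edges (V\<^sub>N v) i j)"
    unfolding rest_flip[of W.rm] edges_flip[of "V\<^sub>N v"] by (rule sum.swap)
  finally show ?thesis unfolding e .
qed

text \<open>Here both powers of h come from the interpolation error. The square root of the cell
  area stays with the corner values, where it matches the weights of the Poincare
  inequality.\<close>

lemma interpolation_reaction:
  assumes v: "v \<in> UU" and h1: "h <= 1"
  shows "\<bar>LINT x:\<Omega>|lborel. c x * (Pih xs nx ys ny u x - u x) * Pistar xs nx ys ny v x\<bar>
    <= Mc * h\<^sup>2 * (sqrt 6 * Hnorm 3 \<Omega> u * sqrt (8 * \<gamma> * (b1 - a1)\<^sup>2 * energy (V\<^sub>N v)))"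
proof -
  let ?P = "Pih xs nx ys ny u"
  let ?m = "%i j. corners (V\<^sub>N v) i j"
  let ?s = "%i j. (xs (Suc i) - xs i) * (ys (Suc j) - ys j)"
  have Pc: "continuous_on (cbox (a1, a2) (b1, b2)) (%x. ?P x - u x)"
    by (intro continuous_on_diff UhD(1)[OF Pih_in_Uh] u_bdy u_cont)
  have "\<bar>LINT x:\<Omega>|lborel. c x * (?P x - u x) * Pistar xs nx ys ny v x\<bar>
    <= (\<Sum>i<nx. \<Sum>j<ny. Mc * ?m i j * integral (elt i j) (%p. \<bar>?P p - u p\<bar>))"
    by (rule reaction_upper[OF v Pc])
  also have "\<dots> <= (\<Sum>i<nx. \<Sum>j<ny. Mc * h\<^sup>2 * (S6 i j * (sqrt (?s i j) * ?m i j)))"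
  proof (intro sum_mono)
    fix i j assume "i \<in> {..<nx}" "j \<in> {..<ny}"
    then have ij: "i < nx" "j < ny" by auto
    note s = mesh_subcell[OF mesh_axioms P.approx_axioms ij] and st = xs_step[OF ij(1)] ys_step[OF ij(2)] and hh = hx_le[OF ij(1)] hy_le[OF ij(2)]
    note nn = P.rm_nonneg[OF s(1), of 2 0] P.rm_nonneg[OF s(1), of 0 2] P.rm_nonneg[OF s(1), of 1 2]
    let ?r = "W.rm (xs i) (xs (Suc i)) (ys j) (ys (Suc j))"
    have "integral (elt i j) (%p. \<bar>?P p - u p\<bar>)
      = integral (elt i j) (%p. \<bar>u (fst p, snd p) - bil u i j (fst p) (snd p)\<bar>)"
    proof (rule Henstock_Kurzweil_Integration.integral_cong)
      fix p assume "p \<in> elt i j"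
      then have "fst p \<in> {xs i..xs (Suc i)}" "snd p \<in> {ys j..ys (Suc j)}" by (auto simp: cbox_Pair_real)
      from Pih_cell[OF ij this, of u] show "\<bar>?P p - u p\<bar> = \<bar>u (fst p, snd p) - bil u i j (fst p) (snd p)\<bar>"
        by (simp add: abs_minus_commute)
    qed
    also have "\<dots> <= (xs (Suc i) - xs i)\<^sup>2 * ?r 2 0 + (ys (Suc j) - ys j)\<^sup>2 * ?r 0 2 + (xs (Suc i) - xs i) * (ys (Suc j) - ys j)\<^sup>2 * ?r 1 2"
      by (rule P.u_bilin_error[OF s(1)])
    also have "\<dots> <= h\<^sup>2 * ?r 2 0 + h\<^sup>2 * ?r 0 2 + h\<^sup>2 * ?r 1 2"
    proof (intro add_mono mult_right_mono nn)
      show "(xs (Suc i) - xs i)\<^sup>2 <= h\<^sup>2" "(ys (Suc j) - ys j)\<^sup>2 <= h\<^sup>2" using st hh by (auto intro!: power_mono)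
      then have "(xs (Suc i) - xs i) * (ys (Suc j) - ys j)\<^sup>2 <= 1 * h\<^sup>2" using st hh h1 by (intro mult_mono) auto
      then show "(xs (Suc i) - xs i) * (ys (Suc j) - ys j)\<^sup>2 <= h\<^sup>2" by simp
    qed simp_all
    also have "\<dots> = h\<^sup>2 * (?r 2 0 + ?r 0 2 + ?r 1 2)" by (simp add: algebra_simps)
    also have "\<dots> <= h\<^sup>2 * (sqrt (?s i j) * S6 i j)"
      using s(8) rest_le[OF ij] by (intro mult_left_mono) auto
    finally have "Mc * ?m i j * integral (elt i j) (%p. \<bar>?P p - u p\<bar>) <= Mc * ?m i j * (h\<^sup>2 * (sqrt (?s i j) * S6 i j))"
      using const_pos by (intro mult_left_mono mult_nonneg_nonneg) auto
    then show "Mc * ?m i j * integral (elt i j) (%p. \<bar>?P p - u p\<bar>) <= Mc * h\<^sup>2 * (S6 i j * (sqrt (?s i j) * ?m i j))"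
      by (simp only: mult_ac)
  qed
  also have "\<dots> = Mc * h\<^sup>2 * (\<Sum>i<nx. \<Sum>j<ny. S6 i j * (sqrt (?s i j) * ?m i j))" by (simp only: sum_distrib_left)
  also have "\<dots> <= Mc * h\<^sup>2 * (sqrt 6 * Hnorm 3 \<Omega> u * sqrt (8 * \<gamma> * (b1 - a1)\<^sup>2 * energy (V\<^sub>N v)))"
  proof (rule mult_left_mono[OF weighted_sum])
    have "(sqrt (?s i j) * ?m i j)\<^sup>2 = ?s i j * (?m i j)\<^sup>2" if "i < nx" "j < ny" for i j
      using xs_step[OF that(1)] ys_step[OF that(2)] by (simp add: power_mult_distrib)
    then have "(\<Sum>i<nx. \<Sum>j<ny. (sqrt (?s i j) * ?m i j)\<^sup>2) = (\<Sum>i<nx. \<Sum>j<ny. ?s i j * (?m i j)\<^sup>2)" by simp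
    then show "(\<Sum>i<nx. \<Sum>j<ny. (sqrt (?s i j) * ?m i j)\<^sup>2) <= 8 * \<gamma> * (b1 - a1)\<^sup>2 * energy (V\<^sub>N v)" using poincare[of v] by simp
  qed (use const_pos in simp)
  finally show ?thesis .
qed

end

section \<open>Combination of coercivity and consistency\<close>

context solution
begin

text \<open>Half of the coercivity constant C1/(4\<gamma>) absorbs the terms in
  \<open>small\<close>; \<open>8 * \<gamma> / C1\<close> is the inverse of the other half. The 12 is
  3 from \<open>vertical_consistency\<close>, times 2 from \<open>edge_sum\<close>, times 2 for the
  two directions.\<close>

lemma error_estimate:
  assumes uh: "uh \<in> UU"
    and gal: "!!v. v \<in> UU ==> ah A c xs nx ys ny uh (Pistar xs nx ys ny v) = (LINT x:\<Omega>|lborel. f x * Pistar xs nx ys ny v x)"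
    and h1: "h <= 1" and small: "8 * L * h * \<gamma> + Mc * h\<^sup>2 <= C1 / (8 * \<gamma>)"
  shows "Hnorm 1 \<Omega> (%p. Pih xs nx ys ny u p - uh p)
    <= sqrt (4 * \<gamma> + 8 * \<gamma> * (b1 - a1)\<^sup>2) * (8 * \<gamma> / C1) * (sqrt 6 * (12 * \<gamma> * (2 * Mb + L) + Mc * sqrt (8 * \<gamma> * (b1 - a1)\<^sup>2))) * h\<^sup>2 * Hnorm 3 \<Omega> u"
proof -
  let ?P = "Pih xs nx ys ny u" and ?H = "Hnorm 3 \<Omega> u"
  define e where "e p = ?P p - uh p" for p
  let ?V = "V\<^sub>N e" and ?z = "Pistar xs nx ys ny e"
  define s where "s = sqrt (energy ?V)"
  define K where "K = 3 * \<gamma> * (2 * Mb + L)"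
  define D where "D = sqrt (8 * \<gamma> * (b1 - a1)\<^sup>2)"
  have g: "\<gamma> >= 1" by (rule gamma_ge1)
  have P: "?P \<in> UU" by (rule Pih_in_Uh[OF u_bdy])
  have e: "e \<in> UU" unfolding e_def by (rule Uh_diff[OF P uh])
  have en: "energy ?V >= 0" unfolding energy_def by (intro sum_nonneg esq_nonneg)
  then have s: "s >= 0" "s * s = energy ?V" by (auto simp: s_def)
  have Mb0: "Mb >= 0" using A_bd[of "(a1, a2)" 1 1] ab by (auto simp: cbox_Pair_real)
  have K0: "K >= 0" using g Mb0 const_pos by (simp add: K_def)
  have iP: "set_integrable lborel \<Omega> (%x. c x * ?P x * ?z x)" and iu: "set_integrable lborel \<Omega> (%x. c x * u x * ?z x)"
    and ih: "set_integrable lborel \<Omega> (%x. c x * uh x * ?z x)"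
    by (intro int_Pistar c_mult_int UhD(1) P uh u_cont)+
  let ?v1 = "vsum1 (%x y. u (x, y)) xs nx ys ny ?V"
  let ?v2 = "vsum2 (%y x. u (x, y)) ys ny xs nx (%j i. ?V i j)"
  let ?f1 = "flux_sum g1 xs nx ys ny ?V" and ?f2 = "flux_sum g2 ys ny xs nx (%j i. ?V i j)"
  let ?R = "LINT x:\<Omega>|lborel. c x * (?P x - u x) * ?z x"
  have "ah A c xs nx ys ny e ?z = dform (%x y. e (x, y)) ?V + (LINT x:\<Omega>|lborel. c x * e x * ?z x)"
    by (rule ah_eq[OF e e])
  also have "dform (%x y. e (x, y)) ?V = dform (%x y. ?P (x, y)) ?V - dform (%x y. uh (x, y)) ?V"
    unfolding e_def by (rule dform_diff)
  also have "dform (%x y. ?P (x, y)) ?V = dform (%x y. u (x, y)) ?V"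
    by (rule dform_cong) (rule Pih_node)
  also have "dform (%x y. u (x, y)) ?V = ?v1 + ?v2" by (simp only: dform_def)
  also have "(LINT x:\<Omega>|lborel. c x * e x * ?z x) = (LINT x:\<Omega>|lborel. c x * ?P x * ?z x) - (LINT x:\<Omega>|lborel. c x * uh x * ?z x)"
    using set_integral_diff(2)[OF iP ih] by (simp add: e_def algebra_simps)
  finally have 1: "ah A c xs nx ys ny e ?z = ?v1 + ?v2 - dform (%x y. uh (x, y)) ?V
     + ((LINT x:\<Omega>|lborel. c x * ?P x * ?z x) - (LINT x:\<Omega>|lborel. c x * uh x * ?z x))" .
  have 2: "dform (%x y. uh (x, y)) ?V + (LINT x:\<Omega>|lborel. c x * uh x * ?z x) = ?f1 + ?f2 + (LINT x:\<Omega>|lborel. c x * u x * ?z x)"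
    using gal[OF e] unfolding ah_eq[OF uh e] flux_identity[OF e] .
  have 3: "?R = (LINT x:\<Omega>|lborel. c x * ?P x * ?z x) - (LINT x:\<Omega>|lborel. c x * u x * ?z x)"
    using set_integral_diff(2)[OF iP iu] by (simp add: algebra_simps)
  have "(\<Sum>i<nx. \<Sum>j<ny. 3 * \<gamma> * h * (2 * Mb + L) * rest W.rm xs ys i j * edges ?V i j)
     = K * h * (\<Sum>i<nx. \<Sum>j<ny. rest W.rm xs ys i j * edges ?V i j)"
    unfolding K_def sum_distrib_left by (simp only: mult_ac)
  also have "\<dots> <= K * h * (h * (2 * sqrt 6 * ?H * s))"
    unfolding s_def using K0 h_pos by (intro mult_left_mono edge_sum) auto
  finally have E: "(\<Sum>i<nx. \<Sum>j<ny. 3 * \<gamma> * h * (2 * Mb + L) * rest W.rm xs ys i j * edges ?V i j) <= K * h * (h * (2 * sqrt 6 * ?H * s))" .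
  have R: "\<bar>?R\<bar> <= Mc * h\<^sup>2 * (sqrt 6 * ?H * (D * s))"
    using interpolation_reaction[OF e h1] by (simp only: s_def D_def real_sqrt_mult)
  \<comment> \<open>Subtracting the Galerkin identity \<open>2\<close> from \<open>1\<close> cancels
    \<open>uh\<close> and leaves the interpolant's flux error in both directions and the reaction
    term \<open>?R\<close>.\<close>
  have "ah A c xs nx ys ny e ?z <= 2 * (K * h * (h * (2 * sqrt 6 * ?H * s))) + Mc * h\<^sup>2 * (sqrt 6 * ?H * (D * s))"
    using flux_error_x[OF h1, of e] flux_error_y[OF h1, of e] 1 2 3 R E by linarith
  also have "\<dots> = (sqrt 6 * (12 * \<gamma> * (2 * Mb + L) + Mc * D)) * h\<^sup>2 * ?H * s"
    by (simp add: K_def power2_eq_square algebra_simps)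
  finally have up: "ah A c xs nx ys ny e ?z <= (sqrt 6 * (12 * \<gamma> * (2 * Mb + L) + Mc * D)) * h\<^sup>2 * ?H * s" (is "_ <= ?X * s") .
  have X0: "?X >= 0" using K0 const_pos g by (simp add: K_def D_def Hnorm_nonneg)
  have "C1 / (4 * \<gamma>) - C1 / (8 * \<gamma>) = C1 / (8 * \<gamma>)" using g by (simp add: field_simps)
  then have "C1 / (8 * \<gamma>) <= C1 / (4 * \<gamma>) - 8 * L * h * \<gamma> - Mc * h\<^sup>2" using small by linarith
  then have "C1 / (8 * \<gamma>) * (s * s) <= ah A c xs nx ys ny e ?z"
    using ah_coercive[OF e] mult_right_mono[OF _ en] unfolding s(2) by (meson order_trans)
  then have "C1 / (8 * \<gamma>) * s * s <= ?X * s" using up by simp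
  then have "C1 / (8 * \<gamma>) * s <= ?X" 
    using s(1) X0 mult_right_le_imp_le[of "C1 / (8 * \<gamma>) * s" s ?X] by (cases "s = 0") simp_all
  then have sX: "s <= 8 * \<gamma> / C1 * ?X" using const_pos g by (simp add: field_simps)
  have "Hnorm 1 \<Omega> e <= sqrt (4 * \<gamma> + 8 * \<gamma> * (b1 - a1)\<^sup>2) * s"
    using Hnorm1_le[OF e] by (simp only: s_def real_sqrt_mult)
  also have "\<dots> <= sqrt (4 * \<gamma> + 8 * \<gamma> * (b1 - a1)\<^sup>2) * (8 * \<gamma> / C1 * ?X)"
    using sX g by (intro mult_left_mono) auto
  finally show ?thesis unfolding e_def[abs_def] D_def by (simp only: mult.assoc)
qed

end

section \<open>Constants of the coefficients and the choice of the threshold\<close>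

lemma Lipschitz_closed:
  fixes g :: "real => real"
  assumes g: "continuous_on {a..b} g" and L: "L >= 0"
    and lip: "!!x x'. a < x ==> x <= x' ==> x' < b ==> \<bar>g x' - g x\<bar> <= L * (x' - x)" and x: "a <= x" "x <= x'" "x' <= b"
  shows "\<bar>g x' - g x\<bar> <= L * (x' - x)"
proof (cases "a < b")
  case ab: True
  define t where "t n = 1 / (real n + 2)" for n
  \<comment> \<open>A contraction towards the midpoint carries the closed interval into the open one
    and does not increase distances, so the bound passes to the limit with the same L.\<close>
  define \<phi> where "\<phi> n s = s + t n * ((a + b) / 2 - s)" for n s
  have t: "0 < t n" "t n < 1" for n by (simp_all add: t_def)
  have t0: "t \<longlonglongrightarrow> 0" unfolding t_def[abs_def] by real_asymp
  have \<phi>: "a < \<phi> n s" "\<phi> n s < b" if "s \<in> {a..b}" for n s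
  proof -
    have "\<phi> n s = (1 - t n) * s + t n * ((a + b) / 2)" by (simp add: \<phi>_def algebra_simps)
    moreover have "(1 - t n) * a <= (1 - t n) * s" "(1 - t n) * s <= (1 - t n) * b" using t[of n] that by (auto intro: mult_left_mono)
    moreover have "t n * a < t n * ((a + b) / 2)" "t n * ((a + b) / 2) < t n * b" using t[of n] ab by (auto intro: mult_strict_left_mono)
    moreover have "(1 - t n) * a + t n * a = a" "(1 - t n) * b + t n * b = b" by (simp_all add: algebra_simps)
    note c = calculation this
    show "a < \<phi> n s" using c by linarith
    show "\<phi> n s < b" using c by linarith
  qed
  have lim: "(%n. g (\<phi> n s)) \<longlonglongrightarrow> g s" if "s \<in> {a..b}" for s
  proof (rule continuous_on_tendsto_compose[OF g])
    have "(%n. \<phi> n s) \<longlonglongrightarrow> s + 0 * ((a + b) / 2 - s)" unfolding \<phi>_def by (intro tendsto_intros t0)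
    then show "(%n. \<phi> n s) \<longlonglongrightarrow> s" by simp
    show "\<forall>\<^sub>F n in sequentially. \<phi> n s \<in> {a..b}" using \<phi>[OF that] by (intro always_eventually) (auto simp: less_imp_le)
  qed (rule that)
  show ?thesis
  proof (rule LIMSEQ_le_const2)
    show "(%n. \<bar>g (\<phi> n x') - g (\<phi> n x)\<bar>) \<longlonglongrightarrow> \<bar>g x' - g x\<bar>" using x by (intro tendsto_intros lim) auto
    have "\<bar>g (\<phi> n x') - g (\<phi> n x)\<bar> <= L * (x' - x)" for n
    proof -
      have d: "\<phi> n x' - \<phi> n x = (1 - t n) * (x' - x)" by (simp add: \<phi>_def algebra_simps)
      have "0 <= (1 - t n) * (x' - x)" "(1 - t n) * (x' - x) <= 1 * (x' - x)"
        using t[of n] x mult_right_mono[of "1 - t n" 1 "x' - x"] by simp_all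
      then have "0 <= \<phi> n x' - \<phi> n x" "\<phi> n x' - \<phi> n x <= x' - x" by (simp_all add: d)
      then show ?thesis
        using lip[of "\<phi> n x" "\<phi> n x'"] \<phi>[of x n] \<phi>[of x' n] x mult_left_mono[OF _ L, of "\<phi> n x' - \<phi> n x" "x' - x"] by auto
    qed
    then show "\<exists>N. \<forall>n\<ge>N. \<bar>g (\<phi> n x') - g (\<phi> n x)\<bar> <= L * (x' - x)" by blast
  qed
next
  case False
  then have "x' = x" using x by linarith
  then show ?thesis by simp
qed

lemma uniform_bound_matrix:
  fixes P :: "2 => 2 => real => bool"
  assumes "!!k l. \<exists>M\<ge>0. P k l M" and "!!k l M M'. P k l M ==> M <= M' ==> P k l M'"
  shows "\<exists>M\<ge>0. \<forall>k l. P k l M"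
proof -
  obtain F where F: "!!k l. F k l >= 0" "!!k l. P k l (F k l)" using assms(1) by metis
  have "F k l <= (\<Sum>k\<in>UNIV. \<Sum>l\<in>UNIV. F k l)" for k l
  proof -
    have "F k l <= (\<Sum>l\<in>UNIV. F k l)" by (rule member_le_sum) (use F in auto)
    also have "\<dots> <= (\<Sum>k\<in>UNIV. \<Sum>l\<in>UNIV. F k l)"
      by (rule member_le_sum[of k UNIV "%k. \<Sum>l\<in>UNIV. F k l"]) (use F in \<open>auto intro: sum_nonneg\<close>)
    finally show ?thesis .
  qed
  then show ?thesis using assms(2) F by (intro exI[of _ "\<Sum>k\<in>UNIV. \<Sum>l\<in>UNIV. F k l"]) (blast intro: sum_nonneg)
qed

lemma matrix_entries_Lipschitz:
  fixes A :: "real \<times> real => real^2^2"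
  assumes cont: "!!k l. continuous_on (cbox (a1, a2) (b1, b2)) (%x. A x $ k $ l)"
    and W: "!!k l. W1inf (box (a1, a2) (b1, b2)) (%x. A x $ k $ l)"
  obtains L where "L >= 0"
    "!!k l x x' y. a1 <= x ==> x <= x' ==> x' <= b1 ==> a2 < y ==> y < b2 ==> \<bar>A (x', y) $ k $ l - A (x, y) $ k $ l\<bar> <= L * (x' - x)"
    "!!k l x y y'. a1 < x ==> x < b1 ==> a2 <= y ==> y <= y' ==> y' <= b2 ==> \<bar>A (x, y') $ k $ l - A (x, y) $ k $ l\<bar> <= L * (y' - y)"
proof -
  let ?X = "%k l L. \<forall>x x' y. a1 <= x --> x <= x' --> x' <= b1 --> a2 < y --> y < b2 --> \<bar>A (x', y) $ k $ l - A (x, y) $ k $ l\<bar> <= L * (x' - x)"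
  let ?Y = "%k l L. \<forall>x y y'. a1 < x --> x < b1 --> a2 <= y --> y <= y' --> y' <= b2 --> \<bar>A (x, y') $ k $ l - A (x, y) $ k $ l\<bar> <= L * (y' - y)"
  have "\<exists>L\<ge>0. \<forall>k l. ?X k l L \<and> ?Y k l L"
  proof (rule uniform_bound_matrix[of "%k l L. ?X k l L \<and> ?Y k l L"])
    fix k l
    have c: "continuous_on (cbox (a1, a2) (b1, b2)) (%z. A (fst z, snd z) $ k $ l)" using cont by simp
    obtain L where L: "L >= 0"
      "!!x x' y. a1 < x ==> x <= x' ==> x' < b1 ==> a2 < y ==> y < b2 ==> \<bar>A (x', y) $ k $ l - A (x, y) $ k $ l\<bar> <= L * (x' - x)"
      "!!x y y'. a1 < x ==> x < b1 ==> a2 < y ==> y <= y' ==> y' < b2 ==> \<bar>A (x, y') $ k $ l - A (x, y) $ k $ l\<bar> <= L * (y' - y)"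
      using W1inf_Lipschitz[OF continuous_on_subset[OF cont box_subset_cbox] W, of k l] by blast
    have "\<bar>A (x', y) $ k $ l - A (x, y) $ k $ l\<bar> <= L * (x' - x)" if "a1 <= x" "x <= x'" "x' <= b1" "a2 < y" "y < b2" for x x' y
      by (rule Lipschitz_closed[OF cbox_slices(1)[OF c] L(1) L(2) that(1-3)]) (use that in auto)
    moreover have "\<bar>A (x, y') $ k $ l - A (x, y) $ k $ l\<bar> <= L * (y' - y)" if "a1 < x" "x < b1" "a2 <= y" "y <= y'" "y' <= b2" for x y y'
      by (rule Lipschitz_closed[OF cbox_slices(2)[OF c] L(1) L(3) that(3-5)]) (use that in auto)
    ultimately show "\<exists>L\<ge>0. ?X k l L \<and> ?Y k l L" using L(1) by blast
  next
    fix k l M M' assume a: "?X k l M \<and> ?Y k l M" "M <= (M' :: real)"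
    have "M * d <= M' * d" if "d >= 0" for d using a(2) that by (rule mult_right_mono)
    then show "?X k l M' \<and> ?Y k l M'" using a(1) by (meson order_trans diff_ge_0_iff_ge)
  qed
  then obtain L where L: "L >= 0" "!!k l. ?X k l L \<and> ?Y k l L" by blast
  show ?thesis by (rule that[OF L(1)]) (use L(2) in blast)+
qed

theorem theorem3p2:
  fixes a1 b1 a2 b2 :: real
    and A :: "real \<times> real \<Rightarrow> real^2^2"
    and c :: "real \<times> real \<Rightarrow> real"
    and C1 C2 \<gamma> :: real
  defines "\<Omega> \<equiv> box (a1, a2) (b1, b2)"
  assumes "a1 < b1" and "a2 < b2"
    and A_W1inf: "\<forall>i j. W1inf \<Omega> (\<lambda>x. A x $ i $ j)"
    and A_cont: "\<forall>i j. continuous_on (closure \<Omega>) (\<lambda>x. A x $ i $ j)"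
    and "C1 > 0" and "C2 > 0"
    and ellip: "\<forall>x\<in>\<Omega>. \<forall>\<xi>::real^2. C1 * (\<xi> \<bullet> \<xi>) \<le> \<xi> \<bullet> (A x *v \<xi>) \<and> \<xi> \<bullet> (A x *v \<xi>) \<le> C2 * (\<xi> \<bullet> \<xi>)"
    and c_Linf: "Linf \<Omega> c"
    and c_nonneg: "\<forall>x\<in>\<Omega>. c x \<ge> 0"
  shows "\<exists>C h0. h0 > 0 \<and>
     (\<forall>xs nx ys ny. valid_mesh a1 b1 a2 b2 xs nx ys ny \<and> regular_mesh \<gamma> xs nx ys ny
        \<and> mesh_size xs nx ys ny < h0 \<longrightarrow>
      (\<forall>u f uh.
         H 3 \<Omega> u \<and> continuous_on (closure \<Omega>) u \<and> (\<forall>p\<in>frontier \<Omega>. u p = 0) \<and>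
         L2 \<Omega> f \<and>
         (\<forall>\<phi>. test_fun \<Omega> \<phi> \<longrightarrow>
            (LINT x:\<Omega>|lborel. (A x *v vector [wd \<Omega> (1, 0) u x, wd \<Omega> (0, 1) u x]) \<bullet> grad \<phi> x
                               + c x * u x * \<phi> x)
            = (LINT x:\<Omega>|lborel. f x * \<phi> x)) \<and>
         uh \<in> Uh a1 b1 a2 b2 xs nx ys ny \<and>
         (\<forall>vh\<in>Uh a1 b1 a2 b2 xs nx ys ny.
            ah A c xs nx ys ny uh (Pistar xs nx ys ny vh)
            = (LINT x:\<Omega>|lborel. f x * Pistar xs nx ys ny vh x))
       \<longrightarrow> Hnorm 1 \<Omega> (\<lambda>p. Pih xs nx ys ny u p - uh p)
           \<le> C * (mesh_size xs nx ys ny)\<^sup>2 * Hnorm 3 \<Omega> u))"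
proof -
  let ?R = "cbox (a1, a2) (b1, b2)"
  have ne: "\<Omega> \<noteq> {}" using \<open>a1 < b1\<close> \<open>a2 < b2\<close> by (simp add: \<Omega>_def box_Pair_real)
  have cl: "closure \<Omega> = ?R" "frontier \<Omega> = ?R - box (a1, a2) (b1, b2)"
    using ne by (simp_all add: \<Omega>_def closure_box frontier_box)
  have Ac: "continuous_on ?R (%x. A x $ k $ l)" for k l using A_cont cl by simp
  have AW: "W1inf (box (a1, a2) (b1, b2)) (%x. A x $ k $ l)" for k l using A_W1inf by (simp add: \<Omega>_def)
  obtain L where L: "L >= 0"
    "!!k l x x' y. a1 <= x ==> x <= x' ==> x' <= b1 ==> a2 < y ==> y < b2 ==> \<bar>A (x', y) $ k $ l - A (x, y) $ k $ l\<bar> <= L * (x' - x)"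
    "!!k l x y y'. a1 < x ==> x < b1 ==> a2 <= y ==> y <= y' ==> y' <= b2 ==> \<bar>A (x, y') $ k $ l - A (x, y) $ k $ l\<bar> <= L * (y' - y)"
    using matrix_entries_Lipschitz[OF Ac AW] by blast
  have "\<exists>M\<ge>0. \<forall>k l. \<forall>p\<in>?R. \<bar>A p $ k $ l\<bar> <= M"
  proof (rule uniform_bound_matrix[of "%k l M. \<forall>p\<in>?R. \<bar>A p $ k $ l\<bar> <= M"])
    fix k l
    have "bounded ((%x. A x $ k $ l) ` ?R)" by (intro compact_imp_bounded compact_continuous_image compact_cbox Ac)
    then obtain M where "\<forall>p\<in>?R. \<bar>A p $ k $ l\<bar> <= M" by (auto simp: bounded_iff)
    then show "\<exists>M\<ge>0. \<forall>p\<in>?R. \<bar>A p $ k $ l\<bar> <= M" 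
      by (intro exI[of _ "\<bar>M\<bar>"]) (auto intro: order_trans[OF _ abs_ge_self])
  qed (meson order_trans)
  then obtain Mb where Mb: "Mb >= 0" "!!k l. \<forall>p\<in>?R. \<bar>A p $ k $ l\<bar> <= Mb" by blast
  obtain M where M: "AE x in lborel. x \<in> \<Omega> --> \<bar>c x\<bar> <= M" using c_Linf by (auto simp: Linf_def)
  define Mc where "Mc = \<bar>M\<bar>"
  have Mc: "AE x in lborel. x \<in> box (a1, a2) (b1, b2) --> \<bar>c x\<bar> <= Mc"
    using M by eventually_elim (auto simp: Mc_def \<Omega>_def)
  \<comment> \<open>\<open>C\<close> and \<open>h0\<close> are fixed before any mesh is given, and
    h0 must be positive for every \<gamma>. Once a regular mesh exists, \<open>gamma_ge1\<close>
    gives \<open>G = \<gamma>\<close>.\<close>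
  define G where "G = max \<gamma> 1"
  \<comment> \<open>For h <= 1 the quantity \<open>8 * L * h * G + Mc * h^2\<close> is at most
    \<open>h * (8 * L * G + Mc)\<close>; the summand 1 keeps the denominator positive.\<close>
  define h0 where "h0 = min 1 (C1 / (8 * G * (8 * L * G + Mc + 1)))"
  define C where "C = sqrt (4 * \<gamma> + 8 * \<gamma> * (b1 - a1)\<^sup>2) * (8 * \<gamma> / C1) * (sqrt 6 * (12 * \<gamma> * (2 * Mb + L) + Mc * sqrt (8 * \<gamma> * (b1 - a1)\<^sup>2)))"
  have G: "G >= 1" by (simp add: G_def)
  have q: "8 * L * G + Mc + 1 > 0" using L(1) G by (simp add: Mc_def add_nonneg_pos)
  have h0: "h0 > 0" using G q \<open>C1 > 0\<close> by (simp add: h0_def)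
  have small: "8 * L * h * G + Mc * h\<^sup>2 <= C1 / (8 * G)" "h <= 1" if h: "0 < h" "h < h0" for h
  proof -
    show "h <= 1" using h by (simp add: h0_def)
    have "Mc * h\<^sup>2 <= Mc * h" using h by (intro mult_left_mono) (auto simp: h0_def Mc_def power2_eq_square mult_left_le)
    then have "8 * L * h * G + Mc * h\<^sup>2 <= h * (8 * L * G + Mc + 1)" using h by (simp add: algebra_simps)
    also have "\<dots> <= C1 / (8 * G * (8 * L * G + Mc + 1)) * (8 * L * G + Mc + 1)"
      using h q by (intro mult_right_mono) (auto simp: h0_def)
    also have "\<dots> = C1 / (8 * G)" using q G by simp
    finally show "8 * L * h * G + Mc * h\<^sup>2 <= C1 / (8 * G)" .
  qed
  show ?thesis
  proof (intro exI[of _ C] exI[of _ h0] conjI h0 allI impI, elim conjE)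
    fix xs nx ys ny u f uh
    assume vm: "valid_mesh a1 b1 a2 b2 xs nx ys ny" and rm: "regular_mesh \<gamma> xs nx ys ny" and h: "mesh_size xs nx ys ny < h0"
      and u: "H 3 \<Omega> u" "continuous_on (closure \<Omega>) u" "\<forall>p\<in>frontier \<Omega>. u p = 0" and f: "L2 \<Omega> f"
      and pde: "\<forall>\<phi>. test_fun \<Omega> \<phi> -->
            (LINT x:\<Omega>|lborel. (A x *v vector [wd \<Omega> (1, 0) u x, wd \<Omega> (0, 1) u x]) \<bullet> grad \<phi> x + c x * u x * \<phi> x)
            = (LINT x:\<Omega>|lborel. f x * \<phi> x)"
      and uh: "uh \<in> Uh a1 b1 a2 b2 xs nx ys ny"
      and gal: "\<forall>vh\<in>Uh a1 b1 a2 b2 xs nx ys ny. ah A c xs nx ys ny uh (Pistar xs nx ys ny vh) = (LINT x:\<Omega>|lborel. f x * Pistar xs nx ys ny vh x)"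
    interpret S: solution a1 b1 a2 b2 xs nx ys ny \<gamma> A c C1 L Mb Mc u f
    proof
      show "u p = 0" if "p \<in> ?R - box (a1, a2) (b1, b2)" for p using u(3) that cl by blast
      show "C1 * (\<xi> \<bullet> \<xi>) <= \<xi> \<bullet> (A p *v \<xi>)" if "p \<in> box (a1, a2) (b1, b2)" for p \<xi> using ellip that by (simp add: \<Omega>_def)
      show "0 <= Mc" by (simp add: Mc_def)
      show "\<bar>A p $ k $ l\<bar> <= Mb" if "p \<in> ?R" for k l p using Mb(2) that by blast
    qed (fact vm rm Ac L Mc \<open>C1 > 0\<close> c_Linf[unfolded \<Omega>_def] c_nonneg[unfolded \<Omega>_def, rule_format] u(1)[unfolded \<Omega>_def] u(2)[unfolded cl]
        f[unfolded \<Omega>_def] pde[unfolded \<Omega>_def, rule_format])+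
    have "G = \<gamma>" using S.gamma_ge1 by (simp add: G_def)
    then have "8 * L * S.h * \<gamma> + Mc * S.h\<^sup>2 <= C1 / (8 * \<gamma>)" "S.h <= 1"
      using small[of S.h] S.h_pos h by (simp_all add: S.h_def)
    then show "Hnorm 1 \<Omega> (%p. Pih xs nx ys ny u p - uh p) <= C * (mesh_size xs nx ys ny)\<^sup>2 * Hnorm 3 \<Omega> u"
      using S.error_estimate[OF uh] gal unfolding C_def \<Omega>_def S.h_def by blast
  qed
qed

end
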